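(* Let $\alpha\in\mathbb{R}\setminus\mathbb{Q}$, $\omega=(1,\alpha)$, let $\mathcal{A}\subset\mathbb{R}$ be open, let $g:\mathcal{A}\to\mathbb{R}$ be real analytic, and let $f:\mathbb{T}^2\to\mathbb{R}$ be real analytic, with an analytic extension to the strip $\Sigma_\xi$ for some $\xi>0$. Let $f_0$ be the average (zeroth Fourier coefficient) of $f$, and assume that there is $c\in\mathcal{A}$ which is a zero of odd order $\mathfrak{n}>1$ of the function $x\mapsto g(x)-f_0$. Consider the ordinary differential equation $$\varepsilon\ddot x+\dot x+\varepsilon g(x)=\varepsilon f(\omega t). \qquad ( * )$$ Let $p_n/q_n$ be the convergents of $\alpha$ and let $$C_0=\frac{\mathfrak{n}+1}{4(\mathfrak{n}^2+2\mathfrak{n}-1)}\,\xi .$$ Then for every constant $C_1>0$ there exists $N\in\mathbb{N}$, with $e^{-C_0q_n}\le (C_1q_n)^{-\mathfrak{n}-1}$ for all $n\ge N$, such that for all $\varepsilon\in J_N(C_1,C_0)$ there is at least one quasi-periodic solution $x(t,\varepsilon)=c+X(\omega t,\varepsilon)$ to $( * )$, such that the function $X(\psi,\varepsilon)$ is analytic in $\psi$ in the strip $\Sigma_{\xi'}$ for every $0<\xi'<\xi/4$, is continuous in $\varepsilon$ in the sense of Whitney on $J_N(C_1,C_0)$, and goes to zero as $\varepsilon\to0$.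
   Context: $\mathbb{T}=\mathbb{R}/2\pi\mathbb{Z}$. For $\xi>0$, $\Sigma_\xi=\{\psi=(\psi_1,\psi_2)\in\mathbb{C}^2:\ \mathrm{Re}\,\psi_i\in\mathbb{T},\ |\mathrm{Im}\,\psi_i|\le\xi,\ i=1,2\}$. A point $c$ is a zero of order $\mathfrak{n}$ of $g(x)-f_0$ if $g(c)=f_0$, $g^{(j)}(c)=0$ for $j=1,\dots,\mathfrak{n}-1$, and $g^{(\mathfrak{n})}(c)\ne0$. The convergents $p_n/q_n$ of $\alpha$ are those of its simple continued fraction $[a_0,a_1,a_2,\dots]$: $p_0=a_0$, $p_1=a_1a_0+1$, $p_k=a_kp_{k-1}+p_{k-2}$; $q_0=1$, $q_1=a_1$, $q_k=a_kq_{k-1}+q_{k-2}$ for $k\ge2$. Given $C,C'>0$ and $n\in\mathbb{N}$ such that $e^{-C'q_{n'}}\le(Cq_{n'})^{-\mathfrak{n}-1}$ for all $n'\ge n$, set $$I_n(C,C')=\big[e^{-C'q_n},(Cq_n)^{-\mathfrak{n}-1}\big],\qquad J_n(C,C')=\mathrm{Cl}\Big(\bigcup_{n'\ge n}I_{n'}(C,C')\Big),$$ where $\mathrm{Cl}$ denotes closure; note $0\in J_n(C,C')\subset[0,\infty)$. Continuity in the sense of Whitney on the closed set $J\subset\mathbb{R}$ means being defined and continuous on $J$ (so that the function admits a continuous extension to all of $\mathbb{R}$). *)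

theory Defs
  imports "HOL-Analysis.Analysis"
begin

definition real_analytic_on :: "(real \<Rightarrow> real) \<Rightarrow> real set \<Rightarrow> bool" where
  "real_analytic_on g A \<longleftrightarrow>
     (\<forall>a\<in>A. \<exists>r>0. \<exists>k. \<forall>x\<in>ball a r. (\<lambda>n. k n * (x - a) ^ n) sums g x)"

(* Joint analyticity in two variables, real or complex. As with the library's analytic_on,
   analyticity on a set S that is not open means analyticity on an open neighbourhood of S. *)
definition analytic2_on :: "('a::real_normed_field \<times> 'a \<Rightarrow> 'a) \<Rightarrow> ('a \<times> 'a) set \<Rightarrow> bool" where
  "analytic2_on F S \<longleftrightarrow>
     (\<forall>(a, b)\<in>S. \<exists>r>0. \<exists>k. \<forall>x\<in>ball a r. \<forall>y\<in>ball b r.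
        ((\<lambda>(i, j). k i j * (x - a) ^ i * (y - b) ^ j) has_sum F (x, y)) (UNIV :: (nat \<times> nat) set))"

(* Functions on the torus (or on a complex strip around it) are represented by functions that
   are 2 pi-periodic in each variable; S is meant to be invariant under real translations. *)
definition periodic2_on :: "('a::real_normed_field \<times> 'a \<Rightarrow> 'b) \<Rightarrow> ('a \<times> 'a) set \<Rightarrow> bool" where
  "periodic2_on F S \<longleftrightarrow>
     (\<forall>(x, y)\<in>S. F (x + of_real (2 * pi), y) = F (x, y) \<and> F (x, y + of_real (2 * pi)) = F (x, y))"

definition strip :: "real \<Rightarrow> (complex \<times> complex) set" where
  "strip \<xi> = {(z, w). \<bar>Im z\<bar> \<le> \<xi> \<and> \<bar>Im w\<bar> \<le> \<xi>}"

definition torus_average :: "(real \<times> real \<Rightarrow> real) \<Rightarrow> real" where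
  "torus_average f = integral (cbox (0, 0) (2 * pi, 2 * pi)) f / (2 * pi)\<^sup>2"

definition has_analytic_extension :: "(real \<times> real \<Rightarrow> real) \<Rightarrow> real \<Rightarrow> bool" where
  "has_analytic_extension f \<xi> \<longleftrightarrow>
     (\<exists>F. analytic2_on F (strip \<xi>) \<and> periodic2_on F (strip \<xi>) \<and>
          (\<forall>x y. F (complex_of_real x, complex_of_real y) = complex_of_real (f (x, y))))"

definition zero_of_order :: "(real \<Rightarrow> real) \<Rightarrow> real \<Rightarrow> real \<Rightarrow> nat \<Rightarrow> bool" where
  "zero_of_order g f\<^sub>0 c \<nn> \<longleftrightarrow>
     g c = f\<^sub>0 \<and> (\<forall>j\<in>{1..<\<nn>}. (deriv ^^ j) g c = 0) \<and> (deriv ^^ \<nn>) g c \<noteq> 0"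

(* Complete quotients of the simple continued fraction; intended for irrational \<alpha>, where
   the expansion does not terminate and the division below is never by zero. *)
primrec cf_tail :: "real \<Rightarrow> nat \<Rightarrow> real" where
  "cf_tail \<alpha> 0 = \<alpha>"
| "cf_tail \<alpha> (Suc k) = 1 / frac (cf_tail \<alpha> k)"

definition cf_coeff :: "real \<Rightarrow> nat \<Rightarrow> int" where
  "cf_coeff \<alpha> k = \<lfloor>cf_tail \<alpha> k\<rfloor>"

fun conv_num :: "real \<Rightarrow> nat \<Rightarrow> int" where
  "conv_num \<alpha> 0 = cf_coeff \<alpha> 0"
| "conv_num \<alpha> (Suc 0) = cf_coeff \<alpha> 1 * cf_coeff \<alpha> 0 + 1"
| "conv_num \<alpha> (Suc (Suc k)) =
     cf_coeff \<alpha> (Suc (Suc k)) * conv_num \<alpha> (Suc k) + conv_num \<alpha> k"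

fun conv_denom :: "real \<Rightarrow> nat \<Rightarrow> int" where
  "conv_denom \<alpha> 0 = 1"
| "conv_denom \<alpha> (Suc 0) = cf_coeff \<alpha> 1"
| "conv_denom \<alpha> (Suc (Suc k)) =
     cf_coeff \<alpha> (Suc (Suc k)) * conv_denom \<alpha> (Suc k) + conv_denom \<alpha> k"

definition I_lower :: "real \<Rightarrow> real \<Rightarrow> nat \<Rightarrow> real" where
  "I_lower \<alpha> C' n = exp (- C' * conv_denom \<alpha> n)"

definition I_upper :: "real \<Rightarrow> nat \<Rightarrow> real \<Rightarrow> nat \<Rightarrow> real" where
  "I_upper \<alpha> \<nn> C n = (C * conv_denom \<alpha> n) powi (- int \<nn> - 1)"

definition I_set :: "real \<Rightarrow> nat \<Rightarrow> nat \<Rightarrow> real \<Rightarrow> real \<Rightarrow> real set" where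
  "I_set \<alpha> \<nn> n C C' = {I_lower \<alpha> C' n .. I_upper \<alpha> \<nn> C n}"

definition J_set :: "real \<Rightarrow> nat \<Rightarrow> nat \<Rightarrow> real \<Rightarrow> real \<Rightarrow> real set" where
  "J_set \<alpha> \<nn> n C C' = closure (\<Union>n'\<in>{n..}. I_set \<alpha> \<nn> n' C C')"

(* x is a global solution of  \<epsilon> x'' + x' + \<epsilon> g(x) = \<epsilon> f(t, \<alpha> t).
   Since g is only meaningful on A, the solution has to stay in A. *)
definition solves_eq ::
  "real set \<Rightarrow> (real \<Rightarrow> real) \<Rightarrow> (real \<times> real \<Rightarrow> real) \<Rightarrow> real \<Rightarrow> real \<Rightarrow> (real \<Rightarrow> real) \<Rightarrow> bool" where
  "solves_eq A g f \<alpha> \<epsilon> x \<longleftrightarrow>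
     (\<exists>x' x''. \<forall>t. x t \<in> A \<and>
        (x has_real_derivative x' t) (at t) \<and>
        (x' has_real_derivative x'' t) (at t) \<and>
        \<epsilon> * x'' t + x' t + \<epsilon> * g (x t) = \<epsilon> * f (t, \<alpha> * t))"

end

theory Submission
  imports Defs "HOL-Probability.Probability" "HOL-Complex_Analysis.Complex_Analysis"
begin

text \<open>
  Let \<open>D\<close> be the derivative along \<open>(1, \<alpha>)\<close>, \<open>m\<close> the order of the zero, \<open>P x = g (c + x) - f0\<close> and \<open>F = f - f0\<close>,
  so that the equation for \<open>X\<close> on the torus is \<open>e D\<^sup>2 X + D X + e P X = e F\<close>. On functions of mean zero, \<open>D\<close> is inverted
  up to a small error by \<open>(D + l)\<^sup>-\<^sup>1 (1 + e D)\<^sup>-\<^sup>1\<close> with \<open>l = e ^ (m + 1)\<close>, which is given by an integral along the flow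
  and therefore preserves analyticity. For \<open>e\<close> in \<open>I_n\<close> the modes of size less than \<open>q_n\<close> have divisors at least
  \<open>1 / (2 q_n)\<close>, and the others carry a factor \<open>exp (- q_n \<xi> / 3) \<le> l\<close> on a strip narrower by \<open>3 \<xi> / 8\<close>; so \<open>e\<close> times this
  inverse has norm of order \<open>\<eta> = e powr (m / (m + 1))\<close>.

  The solution is sought as \<open>X = \<zeta> + u - p + exp (- e B) w\<close>. Here \<open>u\<close> is the response to \<open>F\<close>, the constant \<open>\<zeta>\<close> makes
  \<open>P (\<zeta> + u)\<close> have mean zero, \<open>p\<close> is the response to \<open>P (\<zeta> + u)\<close>, and \<open>B\<close> removes the oscillating part of
  \<open>h = P' (\<zeta> + u)\<close>. As \<open>m\<close> is odd, \<open>\<bar>P' x\<bar> \<ge> \<kappa> \<bar>x\<bar> ^ (m - 1)\<close> with a constant sign, and \<open>u\<close> has a Fourier coefficient of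
  order \<open>e\<close> unless \<open>f\<close> is constant; hence the mean \<open>h0\<close> of \<open>h\<close> is at least of order \<open>e ^ (m - 1)\<close>. The operator
  \<open>(1 + e D) (D + e h0)\<close> is then inverted with a loss \<open>e ^ (- m)\<close>, and what remains is a contraction for
  \<open>(1 + e D) (D + e h0) w\<close> on a ball of radius of order \<open>e ^ (m + 1) \<eta>\<close>. Its iterates depend continuously on \<open>e\<close> and
  converge uniformly.
\<close>

section \<open>Continued fractions\<close>

text \<open>The obstacle is that \<open>theta = e * h0\<close> is only known to be at least of order
  \<open>e ^ m\<close>, whereas the oscillating part of \<open>e * h\<close> is only bounded by
  order \<open>e * eta ^ (m - 1)\<close>, which is larger; it cannot be treated as a perturbation
  and is conjugated away. Likewise, whatever reaches the last equation should be of order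
  \<open>e ^ (m + 1) * eta\<close>, which dictates \<open>l\<close>: the defect \<open>l * u\<close>
  of the approximate inverse then leaves a \<open>w\<close> of order \<open>e * eta\<close>, far
  below \<open>u\<close>. The intervals fit this inverse. The right end of \<open>I_n\<close> makes
  \<open>e * q_n\<close> at most a constant times \<open>eta\<close>; the left end makes
  \<open>exp (- C\<^sub>0 * (m + 1) * q_n)\<close> at most \<open>e ^ (m + 1)\<close>, and
  \<open>C\<^sub>0 * (m + 1) \<le> \<xi> / 3\<close>. The inverse is applied twice in succession,
  first to \<open>F\<close> and then to functions of \<open>u\<close>, so the strips have widths
  \<open>\<xi>\<close>, \<open>5 * \<xi> / 8\<close> and \<open>\<xi> / 4\<close>; everything
  afterwards is free of loss. Sup norms on strips suffice throughout, since averages along the flow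
  do not increase them and products and compositions respect them. If \<open>f\<close> is constant,
  \<open>u\<close> has no lower bound, but then \<open>c\<close> itself is a solution.\<close>

lemma cf_tail_irrational:
  assumes "\<alpha> \<notin> \<rat>"
  shows "cf_tail \<alpha> k \<notin> \<rat>"
proof (induction k)
  case (Suc k)
  show ?case
  proof
    assume "cf_tail \<alpha> (Suc k) \<in> \<rat>"
    then have "inverse (1 / frac (cf_tail \<alpha> k)) \<in> \<rat>" by (intro Rats_inverse) simp
    then have "frac (cf_tail \<alpha> k) + of_int \<lfloor>cf_tail \<alpha> k\<rfloor> \<in> \<rat>"
      by (intro Rats_add) auto
    then show False using Suc by (simp add: frac_def)
  qed
qed (use assms in simp)

lemma frac_cf_tail:
  assumes "\<alpha> \<notin> \<rat>"
  shows "0 < frac (cf_tail \<alpha> k)" "frac (cf_tail \<alpha> k) < 1"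
proof -
  have "cf_tail \<alpha> k \<notin> \<int>" using cf_tail_irrational[OF assms, of k] Ints_subset_Rats by blast
  then show "0 < frac (cf_tail \<alpha> k)" by (simp add: frac_gt_0_iff)
qed (rule frac_lt_1)

lemma cf_tail_gt_1: "\<alpha> \<notin> \<rat> \<Longrightarrow> 1 < cf_tail \<alpha> (Suc k)"
  using frac_cf_tail[of \<alpha> k] by simp

lemma cf_coeff_ge_1: "\<alpha> \<notin> \<rat> \<Longrightarrow> 1 \<le> cf_coeff \<alpha> (Suc k)"
  using cf_tail_gt_1[of \<alpha> k] by (simp add: cf_coeff_def le_floor_iff del: cf_tail.simps)

lemma conv_denom_ge_1:
  assumes "\<alpha> \<notin> \<rat>"
  shows "1 \<le> conv_denom \<alpha> n"
proof (induction n rule: induct_nat_012)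
  case 1
  then show ?case using cf_coeff_ge_1[OF assms, of 0] by simp
next
  case (ge2 n)
  have "1 * 1 \<le> cf_coeff \<alpha> (Suc (Suc n)) * conv_denom \<alpha> (Suc n)"
    using cf_coeff_ge_1[OF assms, of "Suc n"] ge2 by (intro mult_mono) auto
  then show ?case using ge2 by simp
qed simp

lemma conv_denom_Suc_Suc_gt:
  assumes "\<alpha> \<notin> \<rat>"
  shows "conv_denom \<alpha> (Suc (Suc n)) \<ge> conv_denom \<alpha> (Suc n) + 1"
proof -
  have "1 * conv_denom \<alpha> (Suc n) \<le> cf_coeff \<alpha> (Suc (Suc n)) * conv_denom \<alpha> (Suc n)"
    using cf_coeff_ge_1[OF assms, of "Suc n"] conv_denom_ge_1[OF assms, of "Suc n"]
    by (intro mult_right_mono) auto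
  then show ?thesis using conv_denom_ge_1[OF assms, of n] by simp
qed

lemma conv_denom_mono_Suc:
  assumes "\<alpha> \<notin> \<rat>"
  shows "conv_denom \<alpha> n \<le> conv_denom \<alpha> (Suc n)"
  using conv_denom_Suc_Suc_gt[OF assms, of "n - 1"] cf_coeff_ge_1[OF assms, of 0]
  by (cases n) auto

lemma conv_denom_ge:
  assumes "\<alpha> \<notin> \<rat>"
  shows "int n \<le> conv_denom \<alpha> n"
proof (induction n rule: induct_nat_012)
  case 1
  then show ?case using conv_denom_ge_1[OF assms, of 1] by simp
next
  case (ge2 n)
  then show ?case using conv_denom_Suc_Suc_gt[OF assms, of n] by simp
qed simp

text \<open>Kept with its sign, because the alternation of signs drives
  \<open>small_divisor_lower\<close>.\<close>

definition conv_err :: "real \<Rightarrow> nat \<Rightarrow> real" where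
  "conv_err \<alpha> n = real_of_int (conv_denom \<alpha> n) * \<alpha> - real_of_int (conv_num \<alpha> n)"

text \<open>The errors obey the recurrence of the convergents, and a partial quotient is
  \<open>1 / frac - frac\<close> of consecutive complete quotients, so by the induction hypothesis
  the \<open>1 / frac\<close> term cancels. Hence the signs alternate and the moduli
  decrease.\<close>

lemma conv_err_Suc:
  assumes "\<alpha> \<notin> \<rat>"
  shows "conv_err \<alpha> (Suc n) = - conv_err \<alpha> n * frac (cf_tail \<alpha> (Suc n))"
proof (induction n rule: nat_induct)
  case 0
  have "frac \<alpha> > 0" using frac_cf_tail[OF assms, of 0] by simp
  then show ?case
    by (simp add: conv_err_def frac_def[of "1/_"] cf_coeff_def field_simps)
       (simp add: frac_def algebra_simps)
next
  case (Suc n)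
  let ?f = "\<lambda>k. frac (cf_tail \<alpha> k)"
  have *: "conv_err \<alpha> (Suc (Suc n)) =
      cf_coeff \<alpha> (Suc (Suc n)) * conv_err \<alpha> (Suc n) + conv_err \<alpha> n"
    by (simp add: conv_err_def algebra_simps)
  have pos: "?f (Suc n) > 0" using frac_cf_tail[OF assms] by blast
  have c: "real_of_int (cf_coeff \<alpha> (Suc (Suc n))) = 1 / ?f (Suc n) - ?f (Suc (Suc n))"
    by (simp add: cf_coeff_def frac_def)
  have d: "conv_err \<alpha> n = - conv_err \<alpha> (Suc n) / ?f (Suc n)"
    using Suc pos by simp
  show ?case unfolding * c d by (simp add: algebra_simps divide_inverse del: cf_tail.simps)
qed

lemma conv_det:
  "conv_denom \<alpha> (Suc n) * conv_num \<alpha> n - conv_denom \<alpha> n * conv_num \<alpha> (Suc n) = (-1) ^ Suc n"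
proof (induction n)
  case (Suc n)
  then show ?case by (simp add: algebra_simps)
qed simp

text \<open>Together, \<open>conv_det\<close> and \<open>conv_err_Suc\<close> say that the error
  times \<open>?q * ?f + ?q'\<close> has modulus one, and this bracket is at most
  \<open>2 * ?q'\<close>.\<close>

lemma conv_err_lower:
  assumes "\<alpha> \<notin> \<rat>"
  shows "1 / (2 * real_of_int (conv_denom \<alpha> (Suc n))) \<le> \<bar>conv_err \<alpha> n\<bar>"
proof -
  let ?q = "real_of_int (conv_denom \<alpha> n)" and ?q' = "real_of_int (conv_denom \<alpha> (Suc n))"
  let ?f = "frac (cf_tail \<alpha> (Suc n))"
  have f: "0 < ?f" "?f < 1" using frac_cf_tail[OF assms] by blast+
  have q: "1 \<le> ?q" "?q \<le> ?q'"
    using conv_denom_ge_1[OF assms, of n] conv_denom_mono_Suc[OF assms, of n] by linarith+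
  have "?q * conv_err \<alpha> (Suc n) - ?q' * conv_err \<alpha> n =
      of_int (conv_denom \<alpha> (Suc n) * conv_num \<alpha> n - conv_denom \<alpha> n * conv_num \<alpha> (Suc n))"
    by (simp add: conv_err_def algebra_simps)
  also have "\<bar>\<dots>\<bar> = 1" unfolding conv_det by simp
  finally have "1 = \<bar>- conv_err \<alpha> n * (?q * ?f + ?q')\<bar>"
    unfolding conv_err_Suc[OF assms] by (simp add: algebra_simps)
  also have "\<dots> = \<bar>conv_err \<alpha> n\<bar> * (?q * ?f + ?q')"
    using f q by (simp add: abs_mult)
  also have "\<dots> \<le> \<bar>conv_err \<alpha> n\<bar> * (2 * ?q')"
    using f q mult_mono[of ?q ?q' ?f 1] by (intro mult_left_mono) auto
  finally show ?thesis using q by (simp add: field_simps)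
qed

text \<open>Best approximation in quantitative form. Two consecutive convergents form a basis of the
  integer lattice; in the coordinates \<open>x\<close>, \<open>y\<close> the bound on
  \<open>b\<close> forces \<open>y \<noteq> 0\<close> and \<open>x * y \<le> 0\<close>. Since the
  two errors have opposite signs, both contributions then add up in modulus, and that of
  \<open>y\<close> alone is at least the error of index \<open>n\<close>.\<close>

lemma small_divisor_lower:
  fixes a b :: int
  assumes "\<alpha> \<notin> \<rat>" "\<bar>b\<bar> < conv_denom \<alpha> (Suc n)" "(a, b) \<noteq> (0, 0)"
  shows "1 / (2 * real_of_int (conv_denom \<alpha> (Suc n))) \<le> \<bar>real_of_int a + \<alpha> * real_of_int b\<bar>"
proof -
  let ?q = "conv_denom \<alpha> n" and ?q' = "conv_denom \<alpha> (Suc n)"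
  let ?p = "conv_num \<alpha> n" and ?p' = "conv_num \<alpha> (Suc n)"
  define s where "s = (-1 :: int) ^ Suc n"
  have ss: "s * s = 1" by (simp add: s_def flip: power_mult_distrib)
  have det: "?q' * ?p - ?q * ?p' = s" unfolding s_def by (rule conv_det)
  \<comment> \<open>Cramer's rule; the determinant \<open>s\<close> is its own inverse, so the
    coordinates are integers.\<close>
  define x where "x = s * (b * ?p + a * ?q)"
  define y where "y = - s * (a * ?q' + b * ?p')"
  have b: "b = x * ?q' + y * ?q"
  proof -
    have "x * ?q' + y * ?q = s * b * (?q' * ?p - ?q * ?p')"
      by (simp add: x_def y_def algebra_simps)
    then show ?thesis using det ss by (simp add: mult.assoc mult.left_commute)
  qed
  have a: "a = - (x * ?p' + y * ?p)"
  proof -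
    have "- (x * ?p' + y * ?p) = s * a * (?q' * ?p - ?q * ?p')"
      by (simp add: x_def y_def algebra_simps)
    then show ?thesis using det ss by (simp add: mult.assoc mult.left_commute)
  qed
  have q: "1 \<le> ?q" "1 \<le> ?q'" using conv_denom_ge_1[OF assms(1)] by blast+
  have y0: "y \<noteq> 0"
  proof
    assume "y = 0"
    with b a assms(3) have "x \<noteq> 0" by auto
    then have "1 * ?q' \<le> \<bar>x\<bar> * ?q'" using q by (intro mult_right_mono) auto
    then show False using b \<open>y = 0\<close> assms(2) q by (simp add: abs_mult)
  qed
  \<comment> \<open>With equal signs the two terms of \<open>b = x * ?q' + y * ?q\<close> would
    reinforce each other and reach \<open>?q'\<close>.\<close>
  have xy: "x * y \<le> 0"
  proof (rule ccontr)
    assume "\<not> x * y \<le> 0"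
    then consider "x \<ge> 1" "y \<ge> 1" | "x \<le> -1" "y \<le> -1"
      using zero_less_mult_iff[of x y] by linarith
    then show False
    proof cases
      case 1
      then have "1 * ?q' \<le> x * ?q'" "0 \<le> y * ?q" using q by (auto intro!: mult_right_mono simp del: mult_1)
      then show False using b assms(2) by linarith
    next
      case 2
      then have "1 * ?q' \<le> (-x) * ?q'" "0 \<le> (-y) * ?q" using q
        by (auto intro!: mult_right_mono mult_nonneg_nonneg simp del: mult_1 mult_minus_left)
      then show False using b assms(2) by simp
    qed
  qed
  let ?d = "conv_err \<alpha> n" and ?f = "frac (cf_tail \<alpha> (Suc n))"
  have f: "0 < ?f" "?f < 1" using frac_cf_tail[OF assms(1)] by blast+
  have "real_of_int a + \<alpha> * real_of_int b = real_of_int x * conv_err \<alpha> (Suc n) + real_of_int y * ?d"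
    by (subst a, subst b) (simp add: conv_err_def algebra_simps)
  also have "\<dots> = (real_of_int y - real_of_int x * ?f) * ?d" unfolding conv_err_Suc[OF assms(1)] by (simp add: algebra_simps)
  finally have "\<bar>real_of_int a + \<alpha> * real_of_int b\<bar> = \<bar>real_of_int y - real_of_int x * ?f\<bar> * \<bar>?d\<bar>" by (simp add: abs_mult)
  moreover have "1 \<le> \<bar>real_of_int y - real_of_int x * ?f\<bar>"
  proof (cases "y > 0")
    case True
    then have "x \<le> 0" using xy by (simp add: mult_le_0_iff)
    then have "real_of_int x * ?f \<le> 0" using f by (simp add: mult_nonpos_nonneg)
    then show ?thesis using True by linarith
  next
    case False
    then have "y \<le> -1" "x \<ge> 0" using xy y0 by (auto simp: mult_le_0_iff)
    then have "real_of_int x * ?f \<ge> 0" "real_of_int y \<le> -1" using f by auto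
    then show ?thesis by linarith
  qed
  then have "1 * \<bar>?d\<bar> \<le> \<bar>real_of_int y - real_of_int x * ?f\<bar> * \<bar>?d\<bar>" by (intro mult_right_mono) auto
  ultimately show ?thesis using conv_err_lower[OF assms(1), of n] by linarith
qed

section \<open>Integrals over the circle\<close>

text \<open>Cauchy's inequality on the circle of radius \<open>d / 2\<close> about \<open>w\<close>,
  which lies inside the larger ball.\<close>

lemma deriv_norm_bound:
  assumes "f holomorphic_on ball z (2 * d)" "0 < d" "w \<in> ball z d"
    and "\<And>x. x \<in> ball z (2 * d) \<Longrightarrow> norm (f x) \<le> C"
  shows "norm (deriv f w) \<le> 2 * C / d"
proof -
  have sub: "cball w (d / 2) \<subseteq> ball z (2 * d)"
  proof
    fix x assume "x \<in> cball w (d / 2)"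
    then show "x \<in> ball z (2 * d)"
      using assms(2,3) dist_triangle[of z x w] by auto
  qed
  have "norm ((deriv ^^ 1) f w) \<le> fact 1 * C / (d / 2) ^ 1"
  proof (rule Cauchy_inequality)
    show "f holomorphic_on ball w (d / 2)"
      by (rule holomorphic_on_subset[OF assms(1)]) (use sub ball_subset_cball in blast)
    show "continuous_on (cball w (d / 2)) f"
      using holomorphic_on_subset[OF assms(1) sub] by (rule holomorphic_on_imp_continuous_on)
    show "norm (f x) \<le> C" if "norm (w - x) = d / 2" for x
      using that sub by (intro assms(4)) (auto simp: subset_iff dist_norm)
  qed (use assms in auto)
  then show ?thesis by (simp add: mult.commute)
qed

text \<open>Dominated convergence for the difference quotients: by \<open>deriv_norm_bound\<close>
  all \<open>F \<tau>\<close> are Lipschitz near \<open>z\<close> with one constant, and this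
  constant dominates them. The limit is taken along sequences because the convergence theorem is one
  for sequences.\<close>

lemma has_field_derivative_integral:
  fixes F :: "'t \<Rightarrow> complex \<Rightarrow> complex"
  assumes M: "finite_measure M" and S: "open S" "z \<in> S"
    and hol: "\<And>\<tau>. \<tau> \<in> space M \<Longrightarrow> F \<tau> holomorphic_on S"
    and meas: "\<And>w. w \<in> S \<Longrightarrow> (\<lambda>\<tau>. F \<tau> w) \<in> borel_measurable M"
    and bd: "\<And>\<tau> w. \<tau> \<in> space M \<Longrightarrow> w \<in> S \<Longrightarrow> norm (F \<tau> w) \<le> C"
  shows "((\<lambda>w. \<integral>\<tau>. F \<tau> w \<partial>M) has_field_derivative (\<integral>\<tau>. deriv (F \<tau>) z \<partial>M)) (at z)"
proof -
  interpret finite_measure M by (rule M)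
  from S obtain e where e: "e > 0" "ball z e \<subseteq> S" by (meson openE)
  define d where "d = e / 2"
  have d: "d > 0" "ball z (2 * d) \<subseteq> S" "ball z d \<subseteq> S" using e by (auto simp: d_def)
  have int: "integrable M (\<lambda>\<tau>. F \<tau> w)" if "w \<in> S" for w
    by (rule integrable_const_bound[of _ C]) (use meas bd that in auto)
  have lip: "norm (F \<tau> x - F \<tau> y) \<le> (2 * C / d) * norm (x - y)"
    if "\<tau> \<in> space M" "x \<in> ball z d" "y \<in> ball z d" for \<tau> x y
  proof (rule field_differentiable_bound[of "ball z d" _ "deriv (F \<tau>)"])
    fix w assume w: "w \<in> ball z d"
    then have "w \<in> S" using d by blast
    then have "(F \<tau> has_field_derivative deriv (F \<tau>) w) (at w)"
      using hol[OF that(1)] S(1) holomorphic_derivI by blast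
    then show "(F \<tau> has_field_derivative deriv (F \<tau>) w) (at w within ball z d)"
      by (rule has_field_derivative_at_within)
    show "norm (deriv (F \<tau>) w) \<le> 2 * C / d"
      by (rule deriv_norm_bound[OF _ d(1) w]) (use hol[OF that(1)] d bd that(1) holomorphic_on_subset in \<open>auto simp: subset_iff\<close>)
  qed (use that in auto)
  have lim: "(\<lambda>n. (\<integral>\<tau>. (F \<tau> (X n) - F \<tau> z) / (X n - z) \<partial>M)) \<longlonglongrightarrow> (\<integral>\<tau>. deriv (F \<tau>) z \<partial>M)"
    if X: "\<And>n. X n \<in> ball z d - {z}" "X \<longlonglongrightarrow> z" for X
  proof (rule integral_dominated_convergence)
    have ptw: "(\<lambda>n. (F \<tau> (X n) - F \<tau> z) / (X n - z)) \<longlonglongrightarrow> deriv (F \<tau>) z" if "\<tau> \<in> space M" for \<tau>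
    proof -
      have "(F \<tau> has_field_derivative deriv (F \<tau>) z) (at z)"
        using hol[OF that] S holomorphic_derivI by blast
      then have "((\<lambda>y. (F \<tau> y - F \<tau> z) / (y - z)) \<longlongrightarrow> deriv (F \<tau>) z) (at z)"
        by (simp add: has_field_derivative_iff)
      then show ?thesis using X
        unfolding tendsto_at_iff_sequentially o_def by auto
    qed
    have m: "(\<lambda>\<tau>. (F \<tau> (X n) - F \<tau> z) / (X n - z)) \<in> borel_measurable M" for n
      using meas[of "X n"] meas[of z] X(1)[of n] d S by (intro borel_measurable_divide borel_measurable_diff) auto
    then show "(\<lambda>\<tau>. (F \<tau> (X n) - F \<tau> z) / (X n - z)) \<in> borel_measurable M" for n .
    \<comment> \<open>The derivative is measurable in \<open>\<tau>\<close> as a pointwise limit of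
      measurable quotients.\<close>
    show "(\<lambda>\<tau>. deriv (F \<tau>) z) \<in> borel_measurable M"
      by (rule borel_measurable_LIMSEQ_metric[OF m ptw])
    show "AE \<tau> in M. (\<lambda>n. (F \<tau> (X n) - F \<tau> z) / (X n - z)) \<longlonglongrightarrow> deriv (F \<tau>) z"
      using ptw by auto
    show "integrable M (\<lambda>\<tau>. 2 * C / d)" by simp
    show "AE \<tau> in M. norm ((F \<tau> (X n) - F \<tau> z) / (X n - z)) \<le> 2 * C / d" for n
    proof (rule AE_I2)
      fix \<tau> assume "\<tau> \<in> space M"
      then show "norm ((F \<tau> (X n) - F \<tau> z) / (X n - z)) \<le> 2 * C / d"
        using lip[of \<tau> "X n" z] X(1)[of n] d by (simp add: norm_divide divide_le_eq)
    qed
  qed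
  have eq: "(\<integral>\<tau>. (F \<tau> w - F \<tau> z) / (w - z) \<partial>M) = ((\<integral>\<tau>. F \<tau> w \<partial>M) - (\<integral>\<tau>. F \<tau> z \<partial>M)) / (w - z)"
    if "w \<in> ball z d" for w
  proof -
    have "w \<in> S" using that d by blast
    then show ?thesis using int[of w] int[of z] S by simp
  qed
  have "((\<lambda>y. ((\<integral>\<tau>. F \<tau> y \<partial>M) - (\<integral>\<tau>. F \<tau> z \<partial>M)) / (y - z)) \<longlongrightarrow> (\<integral>\<tau>. deriv (F \<tau>) z \<partial>M)) (at z within ball z d)"
    unfolding tendsto_at_iff_sequentially o_def
  proof (intro allI impI)
    fix X :: "nat \<Rightarrow> complex" assume X: "\<forall>n. X n \<in> ball z d - {z}" "X \<longlonglongrightarrow> z"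
    have "(\<lambda>n. (\<integral>\<tau>. (F \<tau> (X n) - F \<tau> z) / (X n - z) \<partial>M)) \<longlonglongrightarrow> (\<integral>\<tau>. deriv (F \<tau>) z \<partial>M)"
      by (rule lim) (use X in auto)
    moreover have "(\<integral>\<tau>. (F \<tau> (X n) - F \<tau> z) / (X n - z) \<partial>M) = ((\<integral>\<tau>. F \<tau> (X n) \<partial>M) - (\<integral>\<tau>. F \<tau> z \<partial>M)) / (X n - z)" for n
      by (rule eq) (use X in auto)
    ultimately show "(\<lambda>n. ((\<integral>\<tau>. F \<tau> (X n) \<partial>M) - (\<integral>\<tau>. F \<tau> z \<partial>M)) / (X n - z)) \<longlonglongrightarrow> (\<integral>\<tau>. deriv (F \<tau>) z \<partial>M)"
      by (simp only:)
  qed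
  moreover have "at z within ball z d = at z"
    using d by (intro at_within_open) auto
  ultimately show ?thesis by (simp add: has_field_derivative_iff)
qed

lemma holomorphic_on_integral:
  fixes F :: "'t \<Rightarrow> complex \<Rightarrow> complex"
  assumes "finite_measure M" "open S"
    and "\<And>\<tau>. \<tau> \<in> space M \<Longrightarrow> F \<tau> holomorphic_on S"
    and "\<And>w. w \<in> S \<Longrightarrow> (\<lambda>\<tau>. F \<tau> w) \<in> borel_measurable M"
    and "\<And>\<tau> w. \<tau> \<in> space M \<Longrightarrow> w \<in> S \<Longrightarrow> norm (F \<tau> w) \<le> C"
  shows "(\<lambda>w. \<integral>\<tau>. F \<tau> w \<partial>M) holomorphic_on S"
  unfolding holomorphic_on_open[OF assms(2)]
proof (intro ballI exI)
  fix z assume z: "z \<in> S"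
  show "((\<lambda>w. \<integral>\<tau>. F \<tau> w \<partial>M) has_field_derivative (\<integral>\<tau>. deriv (F \<tau>) z \<partial>M)) (at z)"
    by (rule has_field_derivative_integral[OF assms(1,2) z]) (use assms in auto)
qed

text \<open>Lebesgue measure on one period, normalised to mass one so that a sup bound passes to
  integrals without a constant.\<close>

definition circ :: "real measure" where
  "circ = density (restrict_space lborel {0..2*pi}) (\<lambda>_. ennreal (1 / (2 * pi)))"

lemma space_circ: "space circ = {0..2*pi}"
  by (simp add: circ_def space_restrict_space)

lemma sets_circ [measurable_cong]: "sets circ = sets (restrict_space borel {0..2*pi})"
  by (simp add: circ_def sets_restrict_space)

lemma prob_space_circ: "prob_space circ"
proof
  have m: "{0..2*pi} \<in> sets (restrict_space lborel {0..2*pi})"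
    by (subst sets_restrict_space_iff) auto
  have "emeasure circ (space circ) = (\<integral>\<^sup>+x. ennreal (1 / (2 * pi)) * indicator {0..2*pi} x \<partial>restrict_space lborel {0..2*pi})"
    unfolding space_circ unfolding circ_def by (rule emeasure_density[OF _ m]) simp
  also have "\<dots> = ennreal (1 / (2 * pi)) * emeasure (restrict_space lborel {0..2*pi}) {0..2*pi}"
    by (rule nn_integral_cmult_indicator[OF m])
  also have "emeasure (restrict_space lborel {0..2*pi}) {0..2*pi} = ennreal (2 * pi)"
    by (subst emeasure_restrict_space) auto
  also have "ennreal (1 / (2 * pi)) * ennreal (2 * pi) = ennreal (1 / (2 * pi) * (2 * pi))"
    by (rule ennreal_mult[symmetric]) auto
  also have "\<dots> = 1" by simp
  finally show "emeasure circ (space circ) = 1" .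
qed

interpretation circ: prob_space circ by (rule prob_space_circ)

lemma borel_measurable_circ:
  fixes f :: "real \<Rightarrow> 'a::topological_space"
  assumes "continuous_on {0..2*pi} f"
  shows "f \<in> borel_measurable circ"
proof -
  have "f \<in> borel_measurable (restrict_space borel {0..2*pi})"
    by (rule borel_measurable_continuous_on_restrict[OF assms])
  then show ?thesis by (simp add: measurable_cong_sets[OF sets_circ refl])
qed

lemma integrable_circ:
  fixes f :: "real \<Rightarrow> complex"
  assumes "continuous_on {0..2*pi} f"
  shows "integrable circ f"
proof -
  have "bounded (f ` {0..2*pi})"
    using compact_continuous_image[OF assms] compact_imp_bounded by blast
  then obtain B where "\<And>x. x \<in> {0..2*pi} \<Longrightarrow> norm (f x) \<le> B" unfolding bounded_iff by blast
  then show ?thesis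
    by (intro circ.integrable_const_bound[of _ B] borel_measurable_circ assms) (auto simp: space_circ)
qed

lemma integral_circ:
  fixes f :: "real \<Rightarrow> complex"
  assumes "continuous_on {0..2*pi} f"
  shows "(\<integral>x. f x \<partial>circ) = integral {0..2*pi} f / (2 * pi)"
proof -
  have "f \<in> borel_measurable (restrict_space lborel {0..2*pi})"
    using borel_measurable_continuous_on_restrict[OF assms] by (simp cong: measurable_cong_sets add: sets_restrict_space)
  then have "(\<integral>x. f x \<partial>circ) = (\<integral>x. (1 / (2 * pi)) *\<^sub>R f x \<partial>restrict_space lborel {0..2*pi})"
    unfolding circ_def by (subst integral_density) auto
  also have "\<dots> = (\<integral>x. indicator {0..2*pi} x *\<^sub>R f x \<partial>lborel) / (2 * pi)"
  proof (subst integral_restrict_space)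
    have "(\<integral>x. indicator {0..2*pi} x *\<^sub>R (1 / (2 * pi)) *\<^sub>R f x \<partial>lborel) =
        (\<integral>x. (1 / (2 * pi)) *\<^sub>R indicator {0..2*pi} x *\<^sub>R f x \<partial>lborel)"
      by (rule Bochner_Integration.integral_cong) (auto simp: indicator_def)
    also have "\<dots> = (1 / (2 * pi)) *\<^sub>R (\<integral>x. indicator {0..2*pi} x *\<^sub>R f x \<partial>lborel)"
      by (rule integral_scaleR_right)
    finally show "(\<integral>x. indicator {0..2*pi} x *\<^sub>R (1 / (2 * pi)) *\<^sub>R f x \<partial>lborel) =
        (\<integral>x. indicator {0..2*pi} x *\<^sub>R f x \<partial>lborel) / (2 * pi)"
      by (simp add: scaleR_conv_of_real)
  qed auto
  also have "(\<integral>x. indicator {0..2*pi} x *\<^sub>R f x \<partial>lborel) = integral {0..2*pi} f"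
    using borel_integrable_atLeastAtMost'[OF assms] set_borel_integral_eq_integral(2)[of "{0..2*pi}" f]
    by (simp add: set_lebesgue_integral_def)
  finally show ?thesis .
qed

text \<open>Moving the path of integration without Cauchy's theorem: the derivative in the shift
  \<open>y\<close> is the integral of \<open>deriv \<phi>\<close> over a period, which vanishes by
  periodicity. Only segments starting in \<open>Y\<close> have to lie in \<open>S\<close>, which
  later permits a kernel with poles elsewhere.\<close>

lemma integral_circ_shift_zero:
  fixes \<phi> :: "complex \<Rightarrow> complex"
  assumes S: "open S" "\<phi> holomorphic_on S" and Y: "open Y" "convex Y" "y \<in> Y" "y' \<in> Y"
    and in_S: "\<And>x y. x \<in> {0..2*pi} \<Longrightarrow> y \<in> Y \<Longrightarrow> of_real x + y \<in> S"
    and per: "\<And>y. y \<in> Y \<Longrightarrow> \<phi> (of_real (2 * pi) + y) = \<phi> y"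
  shows "(\<integral>x. \<phi> (of_real x + y) \<partial>circ) = (\<integral>x. \<phi> (of_real x + y') \<partial>circ)"
proof -
  define H where "H y = (\<integral>x. \<phi> (of_real x + y) \<partial>circ)" for y
  have c\<phi>: "continuous_on S \<phi>" using S holomorphic_on_imp_continuous_on by blast
  have cont: "continuous_on {0..2*pi} (\<lambda>x. f (of_real x + y))" if "y \<in> Y" "continuous_on S f"
    for y and f :: "complex \<Rightarrow> complex"
    by (rule continuous_on_compose2[OF that(2)]) (use in_S that in \<open>auto intro!: continuous_intros\<close>)
  have "(H has_field_derivative 0) (at y)" if y: "y \<in> Y" for y
  proof -
    obtain d where d: "d > 0" "cball y d \<subseteq> Y" using Y(1) y open_contains_cball by blast
    define K where "K = (\<lambda>(x, y). of_real x + y :: complex) ` ({0..2*pi} \<times> cball y d)"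
    have "compact K" unfolding K_def
      by (intro compact_continuous_image compact_Times) (auto intro!: continuous_intros simp: case_prod_unfold)
    moreover have "K \<subseteq> S" using d in_S by (auto simp: K_def)
    ultimately have "bounded (\<phi> ` K)"
      using compact_continuous_image[OF continuous_on_subset[OF c\<phi>]] compact_imp_bounded by blast
    then obtain B where B: "\<And>x. x \<in> K \<Longrightarrow> norm (\<phi> x) \<le> B" unfolding bounded_iff by blast
    have "(H has_field_derivative (\<integral>x. deriv (\<lambda>w. \<phi> (of_real x + w)) y \<partial>circ)) (at y)"
      unfolding H_def
    proof (rule has_field_derivative_integral[of _ "ball y d" _ _ B])
      fix x w assume x: "x \<in> space circ" and w: "w \<in> ball y d"
      show "norm (\<phi> (of_real x + w)) \<le> B" using x w by (intro B) (auto simp: K_def space_circ)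
    next
      fix x assume x: "x \<in> space circ"
      have "(\<phi> \<circ> (\<lambda>w. of_real x + w)) holomorphic_on ball y d"
        by (rule holomorphic_on_compose_gen[OF _ S(2)])
           (use x d(2) in \<open>auto intro!: holomorphic_intros in_S simp: space_circ subset_iff simp del: image_add_ball\<close>)
      then show "(\<lambda>w. \<phi> (of_real x + w)) holomorphic_on ball y d" by (simp add: o_def)
    next
      fix w assume "w \<in> ball y d"
      then show "(\<lambda>x. \<phi> (of_real x + w)) \<in> borel_measurable circ"
        using d by (intro borel_measurable_circ cont c\<phi>) auto
    qed (use d circ.finite_measure_axioms in auto)
    also have "(\<integral>x. deriv (\<lambda>w. \<phi> (of_real x + w)) y \<partial>circ) = (\<integral>x. deriv \<phi> (of_real x + y) \<partial>circ)"
    proof (rule Bochner_Integration.integral_cong[OF refl])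
      fix x assume "x \<in> space circ"
      then have "of_real x + y \<in> S" using in_S y by (simp add: space_circ)
      then have "(\<phi> has_field_derivative deriv \<phi> (of_real x + y)) (at (of_real x + y))"
        using S holomorphic_derivI by blast
      then have "((\<lambda>w. \<phi> (of_real x + w)) has_field_derivative deriv \<phi> (of_real x + y) * 1) (at y)"
        by (intro DERIV_chain2) (auto intro!: derivative_eq_intros)
      then show "deriv (\<lambda>w. \<phi> (of_real x + w)) y = deriv \<phi> (of_real x + y)"
        by (simp add: DERIV_imp_deriv)
    qed
    also have "\<dots> = integral {0..2*pi} (\<lambda>x. deriv \<phi> (of_real x + y)) / (2 * pi)"
      using S y by (intro integral_circ cont) (auto intro!: holomorphic_on_imp_continuous_on holomorphic_deriv)
    also have "integral {0..2*pi} (\<lambda>x. deriv \<phi> (of_real x + y)) = \<phi> (of_real (2*pi) + y) - \<phi> (of_real 0 + y)"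
    proof (rule integral_unique, rule fundamental_theorem_of_calculus)
      fix x assume "x \<in> {0..2*pi}"
      then have "of_real x + y \<in> S" using in_S y by (simp add: space_circ)
      then have "(\<phi> has_field_derivative deriv \<phi> (of_real x + y)) (at (of_real x + y))"
        using S holomorphic_derivI by blast
      then have "((\<phi> \<circ> (\<lambda>x. of_real x + y)) has_vector_derivative 1 * deriv \<phi> (of_real x + y)) (at x)"
        by (intro field_vector_diff_chain_at) (auto intro!: derivative_eq_intros)
      then show "((\<lambda>x. \<phi> (of_real x + y)) has_vector_derivative deriv \<phi> (of_real x + y)) (at x within {0..2*pi})"
        by (simp add: o_def has_vector_derivative_at_within)
    qed auto
    also have "\<dots> = 0" using per[OF y] by simp
    finally show ?thesis by simp
  qed
  then have "(H has_field_derivative 0) (at w within Y)" if "w \<in> Y" for w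
    using that has_field_derivative_at_within by blast
  then obtain c where "\<And>w. w \<in> Y \<Longrightarrow> H w = c"
    using has_field_derivative_zero_constant[OF Y(2)] by blast
  then show ?thesis using Y by (simp add: H_def)
qed

section \<open>Fourier series of periodic functions analytic in a strip\<close>

text \<open>If \<open>f\<close> is not integrable its integral is \<open>0\<close> by convention,
  and \<open>B \<ge> 0\<close> because a probability space is not empty.\<close>

lemma integral_norm_bound_prob:
  fixes f :: "'t \<Rightarrow> 'a::{banach, second_countable_topology}"
  assumes "prob_space M" "\<And>x. x \<in> space M \<Longrightarrow> norm (f x) \<le> B"
  shows "norm (\<integral>x. f x \<partial>M) \<le> B"
proof -
  interpret prob_space M by fact
  have B: "B \<ge> 0" using assms(2) not_empty norm_ge_zero order_trans by blast
  show ?thesis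
  proof (cases "integrable M f")
    case True
    have "norm (\<integral>x. f x \<partial>M) \<le> (\<integral>x. norm (f x) \<partial>M)" by (rule integral_norm_bound)
    also have "\<dots> \<le> (\<integral>x. B \<partial>M)"
      using True assms(2) by (intro integral_mono) auto
    finally show ?thesis by (simp add: prob_space)
  qed (simp add: not_integrable_integral_eq B)
qed

lemma exp_int_2pi: "exp (\<i> * of_int k * (of_real (2 * pi))) = (1 :: complex)"
proof -
  have "\<i> * of_int k * (of_real (2 * pi)) = \<i> * (of_int k * (of_real pi * 2))" by (simp add: mult_ac)
  then show ?thesis by (simp only: exp_2pi_1_int)
qed

lemma exp_add_int_2pi: "exp (a + \<i> * of_int k * (of_real (2 * pi))) = (exp a :: complex)"
  by (simp only: exp_add exp_int_2pi mult_1_right)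

lemma integral_circ_exp:
  "(\<integral>x. exp (\<i> * of_int k * of_real x) \<partial>circ) = (if k = 0 then 1 else 0 :: complex)"
proof (cases "k = 0")
  case True
  then show ?thesis by (simp add: circ.prob_space)
next
  case False
  have "(\<integral>x. exp (\<i> * of_int k * of_real x) \<partial>circ) =
      integral {0..2*pi} (\<lambda>x. exp (\<i> * of_int k * of_real x)) / (2 * pi)"
    by (rule integral_circ) (intro continuous_intros)
  also have "integral {0..2*pi} (\<lambda>x. exp (\<i> * of_int k * of_real x)) =
      exp (\<i> * of_int k * of_real (2*pi)) / (\<i> * of_int k) - exp (\<i> * of_int k * of_real 0) / (\<i> * of_int k)"
  proof (rule integral_unique, rule fundamental_theorem_of_calculus)
    fix x assume "x \<in> {0..2*pi}"
    have "((\<lambda>z. exp (\<i> * of_int k * z) / (\<i> * of_int k)) has_field_derivative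
        exp (\<i> * of_int k * of_real x)) (at (of_real x))"
      by (rule derivative_eq_intros refl | simp add: False)+
    then have "(((\<lambda>z. exp (\<i> * of_int k * z) / (\<i> * of_int k)) \<circ> of_real) has_vector_derivative
        1 * exp (\<i> * of_int k * of_real x)) (at x)"
      by (intro field_vector_diff_chain_at) (auto intro!: derivative_eq_intros)
    then show "((\<lambda>x. exp (\<i> * of_int k * of_real x) / (\<i> * of_int k)) has_vector_derivative
        exp (\<i> * of_int k * of_real x)) (at x within {0..2*pi})"
      by (simp add: o_def has_vector_derivative_at_within)
  qed auto
  also have "\<dots> = 0" using exp_int_2pi[of k] by simp
  finally show ?thesis using False by simp
qed

text \<open>Passes from two ordinary series to an unordered sum over the integers; the negative half
  starts at \<open>- 1\<close>, so that \<open>0\<close> is counted once.\<close>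

lemma has_sum_int_split:
  fixes f :: "int \<Rightarrow> 'a::{banach}"
  assumes "(\<lambda>n. f (int n)) sums a" "summable (\<lambda>n. norm (f (int n)))"
    and "(\<lambda>n. f (- int (Suc n))) sums b" "summable (\<lambda>n. norm (f (- int (Suc n))))"
  shows "(f has_sum (a + b)) UNIV"
proof -
  have "(f has_sum a) (range int)"
    by (subst has_sum_reindex) (use norm_summable_imp_has_sum[OF assms(2,1)] in \<open>auto simp: o_def\<close>)
  moreover have "(f has_sum b) (range (\<lambda>n. - int (Suc n)))"
    by (subst has_sum_reindex) (use norm_summable_imp_has_sum[OF assms(4,3)] in \<open>auto simp: o_def inj_on_def\<close>)
  moreover have "range int \<inter> range (\<lambda>n. - int (Suc n)) = {}" by auto
  ultimately have "(f has_sum (a + b)) (range int \<union> range (\<lambda>n. - int (Suc n)))"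
    by (rule has_sum_Un_disjoint)
  moreover have "range int \<union> range (\<lambda>n. - int (Suc n)) = UNIV"
  proof -
    have "k \<in> range int \<union> range (\<lambda>n. - int (Suc n))" for k
      by (cases k) auto
    then show ?thesis by blast
  qed
  ultimately show ?thesis by simp
qed

section \<open>Fourier series in one variable\<close>

locale periodic_strip =
  fixes \<phi> :: "complex \<Rightarrow> complex" and \<rho> :: real
  assumes \<rho>: "\<rho> > 0"
    and hol: "\<phi> holomorphic_on {z. \<bar>Im z\<bar> < \<rho>}"
    and per: "\<And>z. \<bar>Im z\<bar> < \<rho> \<Longrightarrow> \<phi> (z + of_real (2 * pi)) = \<phi> z"
begin

definition S where "S = {z. \<bar>Im z\<bar> < \<rho>}"

lemma open_S: "open S" and convex_S: "convex S"
proof -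
  have *: "S = {z. Im z < \<rho>} \<inter> {z. Im z > - \<rho>}" by (auto simp: S_def)
  show "open S" unfolding * by (intro open_Int open_halfspace_Im_lt open_halfspace_Im_gt)
  show "convex S" unfolding * by (intro convex_Int convex_halfspace_Im_lt convex_halfspace_Im_gt)
qed

lemma holS: "\<phi> holomorphic_on S" using hol by (simp add: S_def)

definition coef where "coef k = (\<integral>x. \<phi> (of_real x) * exp (- \<i> * of_int k * of_real x) \<partial>circ)"

lemma circ_shift:
  assumes "f holomorphic_on S" "\<And>z. z \<in> S \<Longrightarrow> f (z + of_real (2 * pi)) = f z" "y \<in> S"
  shows "(\<integral>x. f (of_real x) \<partial>circ) = (\<integral>x. f (of_real x + y) \<partial>circ)"
proof -
  have "(\<integral>x. f (of_real x + 0) \<partial>circ) = (\<integral>x. f (of_real x + y) \<partial>circ)"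
    by (rule integral_circ_shift_zero[OF open_S assms(1) open_S convex_S])
       (use assms(2,3) \<rho> in \<open>auto simp: S_def add.commute\<close>)
  then show ?thesis by simp
qed

text \<open>On the path of height \<open>s\<close> the factor
  \<open>exp (- \<i> * of_int k * z)\<close> has modulus \<open>exp (k * s)\<close>.\<close>

lemma coef_bound_aux:
  assumes "\<And>z. z \<in> S \<Longrightarrow> norm (\<phi> z) \<le> C" "\<bar>s\<bar> < \<rho>"
  shows "norm (coef k) \<le> C * exp (k * s)"
proof -
  have "coef k = (\<integral>x. \<phi> (of_real x + \<i> * s) * exp (- \<i> * of_int k * (of_real x + \<i> * s)) \<partial>circ)"
    unfolding coef_def
  proof (rule circ_shift[of "\<lambda>z. \<phi> z * exp (- \<i> * of_int k * z)"])
    show "(\<lambda>z. \<phi> z * exp (- \<i> * of_int k * z)) holomorphic_on S"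
      by (intro holomorphic_intros holS)
    fix z assume "z \<in> S"
    then have "\<phi> (z + of_real (2 * pi)) = \<phi> z" using per by (simp add: S_def)
    moreover have "exp (- \<i> * of_int k * (z + of_real (2 * pi))) = exp (- \<i> * of_int k * z)"
      using exp_add_int_2pi[of "- \<i> * of_int k * z" "-k"] by (simp add: ring_distribs)
    ultimately show "\<phi> (z + of_real (2 * pi)) * exp (- \<i> * of_int k * (z + of_real (2 * pi))) =
        \<phi> z * exp (- \<i> * of_int k * z)" by simp
  qed (use assms in \<open>simp add: S_def\<close>)
  also have "norm \<dots> \<le> C * exp (k * s)"
  proof (rule integral_norm_bound_prob[OF prob_space_circ])
    fix x
    have "norm (\<phi> (of_real x + \<i> * s)) \<le> C" using assms by (simp add: S_def)
    then show "norm (\<phi> (of_real x + \<i> * s) * exp (- \<i> * of_int k * (of_real x + \<i> * s))) \<le> C * exp (k * s)"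
      by (simp add: norm_mult mult_right_mono)
  qed
  finally show ?thesis .
qed

text \<open>The lines of height \<open>\<rho>\<close> lie outside the open strip, so the optimal
  exponent is reached only as a limit of heights below \<open>\<rho>\<close>.\<close>

lemma coef_bound:
  assumes "\<And>z. z \<in> S \<Longrightarrow> norm (\<phi> z) \<le> C"
  shows "norm (coef k) \<le> C * exp (- \<rho> * \<bar>of_int k\<bar>)"
proof -
  have "((\<lambda>s. C * exp (- s * \<bar>of_int k\<bar>)) \<longlongrightarrow> C * exp (- \<rho> * \<bar>of_int k\<bar>)) (at_left \<rho>)"
    by (intro tendsto_intros)
  moreover have "eventually (\<lambda>s. norm (coef k) \<le> C * exp (- s * \<bar>of_int k\<bar>)) (at_left \<rho>)"
    using eventually_at_left_real[OF \<rho>]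
  proof eventually_elim
    case (elim s)
    \<comment> \<open>The path is moved to the side on which the mode decays.\<close>
    then have "norm (coef k) \<le> C * exp (k * (if k \<ge> 0 then - s else s))"
      by (intro coef_bound_aux assms) auto
    also have "k * (if k \<ge> 0 then - s else s) = - s * \<bar>of_int k\<bar>" by simp
    finally show ?case .
  qed
  ultimately show ?thesis by (rule tendsto_lowerbound) simp
qed

context
  fixes z assumes z: "\<bar>Im z\<bar> < \<rho>"
begin

text \<open>Subtracting \<open>\<phi> z\<close> makes the singularity of the summed kernel at
  \<open>z\<close> removable. It affects only the term \<open>k = 0\<close> of the series, by
  \<open>d_eq\<close>, so the convergence of the Fourier series amounts to the \<open>d k\<close>
  having sum \<open>0\<close>.\<close>

definition "g k \<zeta> = (\<phi> \<zeta> - \<phi> z) * exp (\<i> * of_int k * (z - \<zeta>))"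
definition "d k = (\<integral>x. g k (of_real x) \<partial>circ)"

lemma g_hol: "g k holomorphic_on S"
  unfolding g_def by (intro holomorphic_intros holS)

lemma g_per: "\<zeta> \<in> S \<Longrightarrow> g k (\<zeta> + of_real (2 * pi)) = g k \<zeta>"
proof -
  assume "\<zeta> \<in> S"
  then have "\<phi> (\<zeta> + of_real (2 * pi)) = \<phi> \<zeta>" using per by (simp add: S_def)
  moreover have "exp (\<i> * of_int k * (z - (\<zeta> + of_real (2 * pi)))) = exp (\<i> * of_int k * (z - \<zeta>))"
    using exp_add_int_2pi[of "\<i> * of_int k * (z - \<zeta>)" "-k"] by (simp add: algebra_simps)
  ultimately show ?thesis by (simp add: g_def)
qed

lemma d_eq: "d k = coef k * exp (\<i> * of_int k * z) - \<phi> z * (if k = 0 then 1 else 0)"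
proof -
  let ?e = "\<lambda>x. exp (- \<i> * of_int k * of_real x) :: complex"
  have c: "continuous_on {0..2*pi} (\<lambda>x. \<phi> (of_real x) * ?e x)"
    by (intro continuous_intros continuous_on_compose2[OF holomorphic_on_imp_continuous_on[OF holS]])
       (use \<rho> in \<open>auto simp: S_def\<close>)
  have e: "?e x = exp (\<i> * of_int (- k) * of_real x)" for x by simp
  have c': "continuous_on {0..2*pi} ?e" by (intro continuous_intros)
  have "d k = (\<integral>x. exp (\<i> * of_int k * z) * (\<phi> (of_real x) * ?e x) -
      (\<phi> z * exp (\<i> * of_int k * z)) * ?e x \<partial>circ)"
    unfolding d_def g_def
    by (intro Bochner_Integration.integral_cong refl)
       (simp add: algebra_simps exp_diff exp_minus field_simps)
  also have "\<dots> = exp (\<i> * of_int k * z) * coef k - \<phi> z * exp (\<i> * of_int k * z) * (\<integral>x. ?e x \<partial>circ)"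
    using integrable_circ[OF c] integrable_circ[OF c']
    by (subst Bochner_Integration.integral_diff) (auto simp: coef_def)
  also have "(\<integral>x. ?e x \<partial>circ) = (if k = 0 then 1 else 0)"
    unfolding e by (subst integral_circ_exp) auto
  finally show ?thesis by (auto simp: mult.commute)
qed

text \<open>The shift by \<open>pi\<close> centres the period at \<open>z\<close>, so that the ends
  of the path stay away from the zeros \<open>z + 2 * pi * n\<close> of the denominator of the
  kernel.\<close>

definition "line t x = of_real x + (z - of_real pi + \<i> * of_real t)"

lemma d_line: "\<bar>Im z + t\<bar> < \<rho> \<Longrightarrow> d k = (\<integral>x. g k (line t x) \<partial>circ)"
  unfolding d_def line_def
  by (rule circ_shift[OF g_hol g_per]) (simp_all add: S_def)

lemma line_in_S: "\<bar>Im z + t\<bar> < \<rho> \<Longrightarrow> line t x \<in> S"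
  by (simp add: S_def line_def)

text \<open>The kernel expands into a geometric series below the line through z, and into minus the
  complementary one above it, while its integral is the same along both lines.\<close>

definition "ker \<zeta> = (\<phi> \<zeta> - \<phi> z) / (1 - exp (\<i> * (z - \<zeta>)))"

text \<open>Between the two lines the denominator vanishes only at \<open>z\<close>, where the
  numerator vanishes as well. Writing the kernel as a quotient \<open>a / b\<close> of divided
  differences, with \<open>b z = \<i>\<close>, exhibits it as holomorphic there, and the path can be
  moved across \<open>z\<close>.\<close>

lemma ker_line_const:
  assumes t: "\<bar>Im z + t\<bar> < \<rho>" "\<bar>Im z + t'\<bar> < \<rho>" "t \<noteq> 0" "t' \<noteq> 0"
  shows "(\<integral>x. ker (line t x) \<partial>circ) = (\<integral>x. ker (line t' x) \<partial>circ)"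
proof -
  define e where "e \<zeta> = 1 - exp (\<i> * (z - \<zeta>))" for \<zeta>
  define a where "a \<zeta> = (if \<zeta> = z then deriv \<phi> z else (\<phi> \<zeta> - \<phi> z) / (\<zeta> - z))" for \<zeta>
  define b where "b \<zeta> = (if \<zeta> = z then deriv e z else (e \<zeta> - e z) / (\<zeta> - z))" for \<zeta>
  \<comment> \<open>\<open>Y\<close> holds the starting points, with real part near
    \<open>Re z - pi\<close>; \<open>R\<close> contains all segments of length \<open>2 * pi\<close>
    from \<open>Y\<close> but no zero of \<open>e\<close> other than \<open>z\<close>.\<close>
  define R where "R = S \<inter> ({\<zeta>. Re \<zeta> < Re z + 2 * pi} \<inter> {\<zeta>. Re \<zeta> > Re z - 2 * pi})"
  define Y where "Y = S \<inter> ({\<zeta>. Re \<zeta> < Re z - pi + 1} \<inter> {\<zeta>. Re \<zeta> > Re z - pi - 1})"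
  have R: "open R" unfolding R_def
    by (intro open_Int open_S open_halfspace_Re_lt open_halfspace_Re_gt)
  have Y: "open Y" "convex Y" unfolding Y_def
    by (intro open_Int convex_Int open_S convex_S open_halfspace_Re_lt open_halfspace_Re_gt
        convex_halfspace_Re_lt convex_halfspace_Re_gt)+
  have e_hol: "e holomorphic_on UNIV" unfolding e_def by (intro holomorphic_intros)
  have "(e has_field_derivative \<i>) (at z)" unfolding e_def
    by (rule derivative_eq_intros refl | simp)+
  then have de: "deriv e z = \<i>" by (rule DERIV_imp_deriv)
  have e0: "e \<zeta> \<noteq> 0" if "\<zeta> \<in> R" "\<zeta> \<noteq> z" for \<zeta>
  proof
    assume "e \<zeta> = 0"
    then have "exp (\<i> * (z - \<zeta>)) = 1" by (simp add: e_def)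
    then obtain n :: int where n: "Re (\<i> * (z - \<zeta>)) = 0" "Im (\<i> * (z - \<zeta>)) = of_int (2 * n) * pi"
      unfolding exp_eq_1 by auto
    have "\<bar>Re z - Re \<zeta>\<bar> < 2 * pi" using that(1) unfolding R_def by auto
    then have "\<bar>2 * of_int n * pi\<bar> < 2 * pi" using n(2) by simp
    then have "\<bar>of_int n :: real\<bar> < 1" by (simp add: abs_mult)
    then have "n = 0" by linarith
    then show False using n that(2) by (simp add: complex_eq_iff)
  qed
  have b0: "b \<zeta> \<noteq> 0" if "\<zeta> \<in> R" for \<zeta>
    using e0[OF that] de by (auto simp: b_def e_def)
  have "a holomorphic_on S" unfolding a_def by (rule pole_lemma_open[OF holS open_S])
  moreover have "b holomorphic_on UNIV" unfolding b_def by (rule pole_lemma_open[OF e_hol]) auto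
  ultimately have ab: "(\<lambda>\<zeta>. a \<zeta> / b \<zeta>) holomorphic_on R"
    using b0 by (intro holomorphic_on_divide) (auto simp: R_def elim: holomorphic_on_subset)
  have ker: "a \<zeta> / b \<zeta> = ker \<zeta>" if "\<zeta> \<noteq> z" for \<zeta>
    using that by (simp add: a_def b_def ker_def e_def)
  have pi3: "pi > 1" using pi_gt3 by simp
  have "(\<integral>x. (\<lambda>\<zeta>. a \<zeta> / b \<zeta>) (line t x) \<partial>circ) = (\<integral>x. (\<lambda>\<zeta>. a \<zeta> / b \<zeta>) (line t' x) \<partial>circ)"
    unfolding line_def
  proof (rule integral_circ_shift_zero[OF R ab Y])
    fix x y assume "x \<in> {0..2*pi}" "y \<in> Y"
    then show "of_real x + y \<in> R" using pi3 unfolding R_def Y_def S_def by auto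
  next
    fix y assume y: "y \<in> Y"
    have "Re y \<noteq> Re z" "Re y + 2 * pi \<noteq> Re z" using y pi3 unfolding Y_def by auto
    then have "y \<noteq> z" "of_real (2*pi) + y \<noteq> z" by auto
    then have "a (of_real (2*pi) + y) / b (of_real (2*pi) + y) = ker (of_real (2*pi) + y)" "a y / b y = ker y"
      using ker by auto
    moreover have "ker (of_real (2*pi) + y) = ker y"
    proof -
      have "\<phi> (of_real (2 * pi) + y) = \<phi> y" using per[of y] y by (simp add: Y_def S_def add.commute)
      moreover have "exp (\<i> * (z - (of_real (2*pi) + y))) = exp (\<i> * (z - y))"
        using exp_add_int_2pi[of "\<i> * (z - y)" "-1"] by (simp add: algebra_simps)
      ultimately show ?thesis unfolding ker_def by simp
    qed
    ultimately show "a (of_real (2*pi) + y) / b (of_real (2*pi) + y) = a y / b y" by simp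
  qed (use t in \<open>auto simp: Y_def S_def\<close>)
  moreover have "line t x \<noteq> z" "line t' x \<noteq> z" for x
  proof -
    have "Im (line t x) \<noteq> Im z" "Im (line t' x) \<noteq> Im z" using t(3,4) by (simp_all add: line_def)
    then show "line t x \<noteq> z" "line t' x \<noteq> z" by auto
  qed
  ultimately show ?thesis using ker by simp
qed

text \<open>The hypothesis on \<open>h\<close> couples the half series with the side of the line:
  indices \<open>n \<ge> 0\<close> below \<open>z\<close>, negative ones above. In both cases the
  modes form a geometric series of ratio \<open>exp (- \<bar>t\<bar>)\<close> on the line, so sum
  and integral may be exchanged.\<close>

lemma d_series:
  assumes t: "\<bar>Im z + t\<bar> < \<rho>" and h: "\<And>n. h n = int n \<and> t < 0 \<or> h n = - int (Suc n) \<and> t > 0"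
  shows "(\<lambda>n. d (h n)) sums (- sgn t *\<^sub>R (\<integral>x. ker (line t x) \<partial>circ))"
    "summable (\<lambda>n. norm (d (h n)))"
proof -
  have lc: "continuous_on {0..2*pi} (line t)"
    unfolding line_def by (intro continuous_intros)
  have gc: "continuous_on {0..2*pi} (\<lambda>x. g k (line t x))" for k
    by (rule continuous_on_compose2[OF holomorphic_on_imp_continuous_on[OF g_hol] lc]) (use line_in_S[OF t] in auto)
  have "bounded ((\<lambda>x. g 0 (line t x)) ` {0..2*pi})"
    using compact_continuous_image[OF gc] compact_imp_bounded by blast
  then obtain B where B: "\<And>x. x \<in> {0..2*pi} \<Longrightarrow> norm (g 0 (line t x)) \<le> B"
    unfolding bounded_iff by blast
  have B0: "B \<ge> 0" using order_trans[OF norm_ge_zero B[of 0]] by simp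
  define r where "r = exp (- \<bar>t\<bar>)"
  have t0: "t \<noteq> 0" using h[of 0] by auto
  have r: "0 < r" "r < 1" using t0 by (auto simp: r_def)
  define q where "q x = exp (\<i> * (z - line t x))" for x
  have nq: "norm (q x) = exp t" for x by (simp add: q_def line_def)
  have g: "g k (line t x) = g 0 (line t x) * q x powi k" for k x
    by (simp add: g_def q_def exp_power_int mult_ac)
  have bd: "norm (g (h n) (line t x)) \<le> B * r ^ n" if "x \<in> {0..2*pi}" for n x
  proof -
    have "norm (q x powi (h n)) \<le> r ^ n"
    proof (cases "t < 0")
      case True
      then have "h n = int n" using h[of n] by auto
      then show ?thesis using True by (simp add: norm_power nq r_def)
    next
      case False
      then have hn: "h n = - int (Suc n)" using h[of n] t0 by auto
      have "norm (q x powi (h n)) = r ^ Suc n" using False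
        unfolding hn by (simp add: nq r_def power_int_minus exp_minus power_inverse norm_mult norm_inverse norm_power del: of_nat_Suc)
      also have "\<dots> \<le> r ^ n" using r by (simp add: mult_left_le_one_le)
      finally show ?thesis .
    qed
    then show ?thesis unfolding g[of "h n"] norm_mult
      using B[OF that] B0 by (intro mult_mono) auto
  qed
  have dn: "d (h n) = (\<integral>x. g (h n) (line t x) \<partial>circ)" for n by (rule d_line[OF t])
  have "norm (d (h n)) \<le> B * r ^ n" for n
    unfolding dn by (rule integral_norm_bound_prob[OF prob_space_circ]) (use bd in \<open>auto simp: space_circ\<close>)
  moreover have sumr: "summable (\<lambda>n. B * r ^ n)"
    using r by (intro summable_mult summable_geometric) auto
  ultimately show "summable (\<lambda>n. norm (d (h n)))"
    by (intro summable_comparison_test'[OF sumr, of 0]) auto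
  have suminf: "(\<Sum>n. g (h n) (line t x)) = - sgn t *\<^sub>R ker (line t x)" for x
  proof (cases "t < 0")
    case True
    then have "h n = int n" for n using h[of n] by auto
    moreover have "(\<lambda>n. q x ^ n) sums (1 / (1 - q x))" using True by (intro geometric_sums) (simp add: nq)
    then have "(\<lambda>n. g 0 (line t x) * q x ^ n) sums (g 0 (line t x) * (1 / (1 - q x)))" by (rule sums_mult)
    ultimately show ?thesis using True
      by (simp add: g[of "int _"] sums_iff) (simp add: g_def ker_def q_def)
  next
    case False
    then have t': "t > 0" using t0 by simp
    then have hn: "h n = - int (Suc n)" for n using h[of n] by auto
    have q0: "q x \<noteq> 0" "q x \<noteq> 1" using nq[of x] t' by auto
    have "(\<lambda>n. inverse (q x) ^ n) sums (1 / (1 - inverse (q x)))"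
      using t' by (intro geometric_sums) (simp add: nq norm_inverse flip: exp_minus)
    then have "(\<lambda>n. g 0 (line t x) * inverse (q x) * inverse (q x) ^ n) sums (g 0 (line t x) * inverse (q x) * (1 / (1 - inverse (q x))))"
      by (rule sums_mult)
    moreover have "g 0 (line t x) * inverse (q x) * inverse (q x) ^ n = g (h n) (line t x)" for n
      unfolding hn g[of "- int (Suc n)"] by (simp add: power_int_minus power_inverse field_simps del: of_nat_Suc)
    moreover have "g 0 (line t x) * inverse (q x) * (1 / (1 - inverse (q x))) = - ker (line t x)"
      using q0 by (simp add: g_def ker_def flip: q_def) (simp add: field_simps)
    ultimately show ?thesis using t' by (simp add: sums_iff)
  qed
  have "(\<lambda>n. \<integral>x. g (h n) (line t x) \<partial>circ) sums (\<integral>x. (\<Sum>n. g (h n) (line t x)) \<partial>circ)"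
  proof (rule sums_integral)
    show "integrable circ (\<lambda>x. g (h n) (line t x))" for n by (intro integrable_circ gc)
    show "AE x in circ. summable (\<lambda>n. norm (g (h n) (line t x)))"
    proof (rule AE_I2)
      fix x assume "x \<in> space circ"
      then show "summable (\<lambda>n. norm (g (h n) (line t x)))"
        using bd by (intro summable_comparison_test'[OF sumr, of 0]) (auto simp: space_circ)
    qed
    have "norm (\<integral>x. norm (g (h n) (line t x)) \<partial>circ) \<le> B * r ^ n" for n
      by (rule integral_norm_bound_prob[OF prob_space_circ]) (use bd in \<open>auto simp: space_circ\<close>)
    then show "summable (\<lambda>n. \<integral>x. norm (g (h n) (line t x)) \<partial>circ)"
      by (intro summable_comparison_test'[OF sumr, of 0]) auto
  qed
  then show "(\<lambda>n. d (h n)) sums (- sgn t *\<^sub>R (\<integral>x. ker (line t x) \<partial>circ))"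
    by (simp add: dn suminf)
qed

text \<open>The half series of \<open>d\<close> sum to the kernel integral below \<open>z\<close>
  and to minus the one above; these integrals agree, so the total is \<open>0\<close>, and putting
  \<open>\<phi> z\<close> back at \<open>k = 0\<close> gives the series.\<close>

lemma fourier_series: "((\<lambda>k. coef k * exp (\<i> * of_int k * z)) has_sum \<phi> z) UNIV"
proof -
  define s where "s = (\<bar>Im z\<bar> + \<rho>) / 2"
  have s: "\<bar>Im z\<bar> < s" "s < \<rho>" using z by (auto simp: s_def)
  define t t' where "t = - s - Im z" and "t' = s - Im z"
  have t: "\<bar>Im z + t\<bar> < \<rho>" "\<bar>Im z + t'\<bar> < \<rho>" "t < 0" "t' > 0"
    using s by (auto simp: t_def t'_def)
  let ?L = "\<integral>x. ker (line t x) \<partial>circ"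
  have L: "?L = (\<integral>x. ker (line t' x) \<partial>circ)" using t by (intro ker_line_const) auto
  have "(d has_sum (?L + (- ?L))) UNIV"
    using d_series[OF t(1), of int] d_series[OF t(2), of "\<lambda>n. - int (Suc n)"] t(3,4)
    by (intro has_sum_int_split) (auto simp flip: L)
  moreover have "((\<lambda>k::int. if k = 0 then \<phi> z else 0) has_sum \<phi> z) UNIV"
    by (rule has_sum_finite_neutralI[of "{0}"]) auto
  ultimately have "((\<lambda>k. d k + (if k = 0 then \<phi> z else 0)) has_sum (?L + (- ?L) + \<phi> z)) UNIV"
    by (rule has_sum_add)
  moreover have "d k + (if k = 0 then \<phi> z else 0) = coef k * exp (\<i> * of_int k * z)" for k
    by (simp add: d_eq)
  ultimately show ?thesis by simp
qed

end
end

text \<open>Holomorphy is asked only separately and only in the interior; joint continuity up to the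
  boundary supplies boundedness, and the class is closed under uniform limits. Reality on the real
  torus is built in, so that it never has to be traced separately.\<close>

definition strip_analytic :: "real \<Rightarrow> (complex \<times> complex \<Rightarrow> complex) \<Rightarrow> bool" where
  "strip_analytic \<rho> \<phi> \<longleftrightarrow> continuous_on (strip \<rho>) \<phi> \<and>
     (\<forall>w. \<bar>Im w\<bar> \<le> \<rho> \<longrightarrow> (\<lambda>z. \<phi> (z, w)) holomorphic_on {z. \<bar>Im z\<bar> < \<rho>}) \<and>
     (\<forall>z. \<bar>Im z\<bar> \<le> \<rho> \<longrightarrow> (\<lambda>w. \<phi> (z, w)) holomorphic_on {w. \<bar>Im w\<bar> < \<rho>}) \<and>
     periodic2_on \<phi> (strip \<rho>) \<and> (\<forall>x y. \<phi> (complex_of_real x, complex_of_real y) \<in> \<real>)"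

lemma strip_mono: "\<rho>' \<le> \<rho> \<Longrightarrow> strip \<rho>' \<subseteq> strip \<rho>"
  by (auto simp: strip_def)

lemma mem_strip: "\<psi> \<in> strip \<rho> \<longleftrightarrow> \<bar>Im (fst \<psi>)\<bar> \<le> \<rho> \<and> \<bar>Im (snd \<psi>)\<bar> \<le> \<rho>"
  by (cases \<psi>) (auto simp: strip_def)

lemma periodic2_onD:
  assumes "periodic2_on \<phi> (strip \<rho>)" "(z, w) \<in> strip \<rho>"
  shows "\<phi> (z + of_real (2 * pi), w) = \<phi> (z, w)" "\<phi> (z, w + of_real (2 * pi)) = \<phi> (z, w)"
  using bspec[OF assms(1)[unfolded periodic2_on_def] assms(2)] by auto

definition strip_cell :: "real \<Rightarrow> (complex \<times> complex) set" where
  "strip_cell \<rho> = cbox (Complex 0 (-\<rho>)) (Complex (2*pi) \<rho>) \<times> cbox (Complex 0 (-\<rho>)) (Complex (2*pi) \<rho>)"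

lemma compact_strip_cell: "compact (strip_cell \<rho>)"
  unfolding strip_cell_def by (intro compact_Times compact_cbox)

lemma strip_cell_subset: "strip_cell \<rho> \<subseteq> strip \<rho>"
  by (auto simp: strip_cell_def strip_def in_cbox_complex_iff)

lemma periodic_shift_int:
  assumes "\<And>z. P z \<Longrightarrow> f (z + of_real (2 * pi)) = f z" "\<And>z r. P z \<Longrightarrow> P (z + of_real r)" "P z"
  shows "f (z + of_real (of_int n * (2 * pi))) = f z"
proof -
  have nat: "f (z + of_real (of_nat n * (2 * pi))) = f z" if "P z" for n z
  proof (induction n)
    case (Suc n)
    have "f (z + of_real (of_nat (Suc n) * (2 * pi))) = f ((z + of_real (of_nat n * (2 * pi))) + of_real (2 * pi))"
      by (simp add: algebra_simps)
    also have "\<dots> = f (z + of_real (of_nat n * (2 * pi)))" by (rule assms(1)[OF assms(2)[OF that]])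
    also have "\<dots> = f z" by (rule Suc.IH)
    finally show ?case .
  qed simp
  show ?thesis
  proof (cases "n \<ge> 0")
    case True
    then show ?thesis using nat[OF assms(3), of "nat n"] by simp
  next
    case False
    have "f ((z + of_real (of_int n * (2 * pi))) + of_real (of_nat (nat (- n)) * (2 * pi))) = f (z + of_real (of_int n * (2 * pi)))"
      by (rule nat[OF assms(2)[OF assms(3)]])
    then show ?thesis using False by (simp add: algebra_simps)
  qed
qed

text \<open>The reduced point is obtained before \<open>\<phi>\<close> is chosen, so that one point
  serves several functions at once, as \<open>strip_family_uniform\<close> requires.\<close>

lemma periodic_reduce:
  assumes "(z, w) \<in> strip \<rho>"
  obtains z' w' where "(z', w') \<in> strip_cell \<rho>"
    "\<And>\<phi> :: complex \<times> complex \<Rightarrow> complex. periodic2_on \<phi> (strip \<rho>) \<Longrightarrow> \<phi> (z, w) = \<phi> (z', w')"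
proof -
  define m n where "m = - \<lfloor>Re z / (2 * pi)\<rfloor>" and "n = - \<lfloor>Re w / (2 * pi)\<rfloor>"
  define z' w' where "z' = z + of_real (of_int m * (2 * pi))" and "w' = w + of_real (of_int n * (2 * pi))"
  have red: "0 \<le> x - \<lfloor>x / (2 * pi)\<rfloor> * (2 * pi)" "x - \<lfloor>x / (2 * pi)\<rfloor> * (2 * pi) \<le> 2 * pi" for x :: real
  proof -
    have "of_int \<lfloor>x / (2 * pi)\<rfloor> \<le> x / (2 * pi)" "x / (2 * pi) \<le> of_int \<lfloor>x / (2 * pi)\<rfloor> + 1"
      by linarith+
    then have "of_int \<lfloor>x / (2 * pi)\<rfloor> * (2 * pi) \<le> x / (2 * pi) * (2 * pi)"
        "x / (2 * pi) * (2 * pi) \<le> (of_int \<lfloor>x / (2 * pi)\<rfloor> + 1) * (2 * pi)"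
      by (intro mult_right_mono; simp)+
    moreover have "x / (2 * pi) * (2 * pi) = x" by simp
    ultimately show "0 \<le> x - \<lfloor>x / (2 * pi)\<rfloor> * (2 * pi)" "x - \<lfloor>x / (2 * pi)\<rfloor> * (2 * pi) \<le> 2 * pi"
      unfolding distrib_right by linarith+
  qed
  have "(z', w') \<in> strip_cell \<rho>"
    using assms red[of "Re z"] red[of "Re w"]
    by (auto simp: strip_cell_def strip_def in_cbox_complex_iff z'_def w'_def m_def n_def)
  moreover have "\<phi> (z, w) = \<phi> (z', w')" if "periodic2_on \<phi> (strip \<rho>)" for \<phi> :: "complex \<times> complex \<Rightarrow> complex"
  proof -
    have st: "\<bar>Im z\<bar> \<le> \<rho>" "\<bar>Im w\<bar> \<le> \<rho>" using assms by (auto simp: strip_def)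
    have "\<phi> (z', w') = \<phi> (z, w')" unfolding z'_def
      by (rule periodic_shift_int[of "\<lambda>z. \<bar>Im z\<bar> \<le> \<rho>" "\<lambda>z. \<phi> (z, w')"])
         (use st periodic2_onD[OF that] in \<open>auto simp: strip_def w'_def\<close>)
    also have "\<dots> = \<phi> (z, w)" unfolding w'_def
      by (rule periodic_shift_int[of "\<lambda>w. \<bar>Im w\<bar> \<le> \<rho>" "\<lambda>w. \<phi> (z, w)"])
         (use st periodic2_onD[OF that] in \<open>auto simp: strip_def\<close>)
    finally show ?thesis by simp
  qed
  ultimately show ?thesis by (rule that)
qed

lemma strip_analytic_bounded:
  assumes "strip_analytic \<rho> \<phi>"
  obtains C where "\<And>\<psi>. \<psi> \<in> strip \<rho> \<Longrightarrow> norm (\<phi> \<psi>) \<le> C"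
proof -
  have p: "periodic2_on \<phi> (strip \<rho>)" and c: "continuous_on (strip \<rho>) \<phi>"
    using assms by (auto simp: strip_analytic_def)
  have "bounded (\<phi> ` strip_cell \<rho>)"
    using compact_continuous_image[OF continuous_on_subset[OF c strip_cell_subset] compact_strip_cell] compact_imp_bounded by blast
  then obtain C where C: "\<And>\<psi>. \<psi> \<in> strip_cell \<rho> \<Longrightarrow> norm (\<phi> \<psi>) \<le> C" unfolding bounded_iff by blast
  have "norm (\<phi> (z, w)) \<le> C" if "(z, w) \<in> strip \<rho>" for z w
    using periodic_reduce[OF that] C p by metis
  then show ?thesis using that by (metis prod.collapse)
qed

section \<open>Fourier modes and Fourier coefficients in two variables\<close>

definition nrm1 :: "int \<times> int \<Rightarrow> real" where
  "nrm1 \<nu> = \<bar>of_int (fst \<nu>)\<bar> + \<bar>of_int (snd \<nu>)\<bar>"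

definition emode :: "int \<times> int \<Rightarrow> complex \<times> complex \<Rightarrow> complex" where
  "emode \<nu> \<psi> = exp (\<i> * (of_int (fst \<nu>) * fst \<psi> + of_int (snd \<nu>) * snd \<psi>))"

lemma nrm1_nonneg: "nrm1 \<nu> \<ge> 0" by (simp add: nrm1_def)

lemma norm_emode_le:
  assumes "\<psi> \<in> strip \<rho>"
  shows "norm (emode \<nu> \<psi>) \<le> exp (\<rho> * nrm1 \<nu>)"
proof -
  have "- (of_int k * y) \<le> \<rho> * \<bar>of_int k\<bar>" if "\<bar>y\<bar> \<le> \<rho>" for k :: int and y :: real
  proof -
    have "- (of_int k * y) \<le> \<bar>of_int k * y\<bar>" by linarith
    also have "\<dots> = \<bar>y\<bar> * \<bar>of_int k\<bar>" by (simp add: abs_mult)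
    also have "\<dots> \<le> \<rho> * \<bar>of_int k\<bar>" using that by (intro mult_right_mono) auto
    finally show ?thesis .
  qed
  from this[of "Im (fst \<psi>)" "fst \<nu>"] this[of "Im (snd \<psi>)" "snd \<nu>"] assms
  show ?thesis by (simp add: emode_def nrm1_def mem_strip ring_distribs)
qed

lemma norm_emode_real: "norm (emode \<nu> (complex_of_real x, complex_of_real y)) = 1"
  by (simp add: emode_def)

lemma summable_on_exp_abs_int:
  assumes "a > 0"
  shows "(\<lambda>k::int. exp (- a * \<bar>of_int k\<bar> :: real)) summable_on UNIV"
proof -
  let ?f = "\<lambda>k::int. exp (- a * \<bar>of_int k\<bar> :: real)"
  have e: "exp (- a * real n) = exp (- a) ^ n" for n
    by (simp add: exp_of_nat_mult[symmetric] mult.commute)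
  have s: "summable (\<lambda>n. exp (- a) ^ n)" using assms by (intro summable_geometric) auto
  have 1: "(\<lambda>n. ?f (int n)) = (\<lambda>n. exp (- a) ^ n)" using e by auto
  have 2: "(\<lambda>n. ?f (- int (Suc n))) = (\<lambda>n. exp (- a) ^ Suc n)"
    using e[of "Suc n" for n] by (auto simp del: power_Suc of_nat_Suc)
  have s2: "summable (\<lambda>n. exp (- a) ^ Suc n)" using s summable_Suc_iff by blast
  have "(?f has_sum ((\<Sum>n. exp (- a) ^ n) + (\<Sum>n. exp (- a) ^ Suc n))) UNIV"
    by (rule has_sum_int_split; (simp only: real_norm_def abs_exp_cancel)?; (simp only: 1 2)?; (rule summable_sums)?; rule s s2)
  then show ?thesis by (rule has_sum_imp_summable)
qed

lemma summable_on_exp_nrm1: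
  assumes "a > 0"
  shows "(\<lambda>\<nu>. exp (- a * nrm1 \<nu>)) summable_on UNIV"
proof -
  let ?S = "\<Sum>\<^sub>\<infinity>k::int. exp (- a * \<bar>of_int k\<bar> :: real)"
  have h: "((\<lambda>k::int. exp (- a * \<bar>of_int k\<bar>)) has_sum ?S) UNIV"
    using summable_on_exp_abs_int[OF assms] by (rule has_sum_infsum)
  have "(\<lambda>\<nu>. exp (- a * nrm1 \<nu>)) summable_on (UNIV \<times> UNIV)"
  proof (rule summable_on_SigmaI)
    fix k :: int
    have "((\<lambda>l::int. exp (- a * \<bar>of_int k\<bar>) * exp (- a * \<bar>of_int l\<bar>)) has_sum (exp (- a * \<bar>of_int k\<bar>) * ?S)) UNIV"
      by (rule has_sum_cmult_right[OF h])
    then show "((\<lambda>l. exp (- a * nrm1 (k, l))) has_sum (exp (- a * \<bar>of_int k\<bar>) * ?S)) UNIV"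
      by (simp add: nrm1_def ring_distribs exp_add exp_diff exp_minus divide_inverse)
  next
    show "(\<lambda>k::int. exp (- a * \<bar>of_int k\<bar>) * ?S) summable_on UNIV"
      by (intro summable_on_cmult_left summable_on_exp_abs_int assms)
  qed auto
  then show ?thesis by simp
qed

text \<open>Written as an iterated integral, so that the one-dimensional theory applies twice;
  \<open>fcoef_eq_tavg\<close> gives the form as a torus average.\<close>

definition fcoef :: "(complex \<times> complex \<Rightarrow> complex) \<Rightarrow> int \<times> int \<Rightarrow> complex" where
  "fcoef \<phi> \<nu> = (\<integral>x. (\<integral>y. \<phi> (of_real x, of_real y) * exp (- \<i> * of_int (snd \<nu>) * of_real y) \<partial>circ)
      * exp (- \<i> * of_int (fst \<nu>) * of_real x) \<partial>circ)"

context
  fixes \<phi> :: "complex \<times> complex \<Rightarrow> complex" and \<rho> C :: real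
  assumes \<rho>: "\<rho> > 0" and an: "strip_analytic \<rho> \<phi>"
    and C: "\<And>\<psi>. \<psi> \<in> strip \<rho> \<Longrightarrow> norm (\<phi> \<psi>) \<le> C"
begin

lemma periodic_strip_snd: "\<bar>Im z\<bar> < \<rho> \<Longrightarrow> periodic_strip (\<lambda>w. \<phi> (z, w)) \<rho>"
proof
  assume z: "\<bar>Im z\<bar> < \<rho>"
  show "\<rho> > 0" by (rule \<rho>)
  show "(\<lambda>w. \<phi> (z, w)) holomorphic_on {z. \<bar>Im z\<bar> < \<rho>}"
    using an z by (simp add: strip_analytic_def)
  fix w assume "\<bar>Im w\<bar> < \<rho>"
  then show "\<phi> (z, w + of_real (2 * pi)) = \<phi> (z, w)"
    using an z by (intro periodic2_onD(2)) (auto simp: strip_analytic_def strip_def)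
qed

definition "partial_coef l z = (\<integral>y. \<phi> (z, of_real y) * exp (- \<i> * of_int l * of_real y) \<partial>circ)"

lemma periodic_strip_partial: "periodic_strip (partial_coef l) \<rho>"
proof
  show "partial_coef l holomorphic_on {z. \<bar>Im z\<bar> < \<rho>}"
    unfolding partial_coef_def
  proof (rule holomorphic_on_integral[of _ _ _ C])
    have *: "{z. \<bar>Im z\<bar> < \<rho>} = {z. Im z < \<rho>} \<inter> {z. Im z > - \<rho>}" by auto
    show "open {z. \<bar>Im z\<bar> < \<rho>}" unfolding *
      by (intro open_Int open_halfspace_Im_lt open_halfspace_Im_gt)
    show "(\<lambda>z. \<phi> (z, of_real y) * exp (- \<i> * of_int l * of_real y)) holomorphic_on {z. \<bar>Im z\<bar> < \<rho>}" for y
      using an \<rho> by (intro holomorphic_intros) (auto simp: strip_analytic_def)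
    show "(\<lambda>y. \<phi> (z, of_real y) * exp (- \<i> * of_int l * of_real y)) \<in> borel_measurable circ"
      if "z \<in> {z. \<bar>Im z\<bar> < \<rho>}" for z
    proof (rule borel_measurable_circ)
      have "continuous_on (strip \<rho>) \<phi>" using an by (simp add: strip_analytic_def)
      then have "continuous_on {0..2*pi} (\<lambda>y. \<phi> (z, of_real y))"
        by (rule continuous_on_compose2) (use that \<rho> in \<open>auto simp: strip_def intro!: continuous_intros\<close>)
      then show "continuous_on {0..2 * pi} (\<lambda>y. \<phi> (z, of_real y) * exp (- \<i> * of_int l * of_real y))"
        by (intro continuous_intros)
    qed
    show "norm (\<phi> (z, of_real y) * exp (- \<i> * of_int l * of_real y)) \<le> C" if "z \<in> {z. \<bar>Im z\<bar> < \<rho>}" for z y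
      using that C[of "(z, of_real y)"] by (simp add: norm_mult strip_def)
  qed (rule circ.finite_measure_axioms)
  fix z assume "\<bar>Im z\<bar> < \<rho>"
  then show "partial_coef l (z + of_real (2 * pi)) = partial_coef l z"
  proof -
    assume z: "\<bar>Im z\<bar> < \<rho>"
    have "\<phi> (z + of_real (2 * pi), of_real y) = \<phi> (z, of_real y)" for y
      using an z \<rho> by (intro periodic2_onD(1)) (auto simp: strip_analytic_def strip_def)
    then show ?thesis by (simp only: partial_coef_def)
  qed
qed (rule \<rho>)

lemma fcoef_eq: "fcoef \<phi> (k, l) = periodic_strip.coef (partial_coef l) k"
  unfolding fcoef_def periodic_strip.coef_def[OF periodic_strip_partial] partial_coef_def by simp

lemma partial_coef_eq: "\<bar>Im z\<bar> < \<rho> \<Longrightarrow> partial_coef l z = periodic_strip.coef (\<lambda>w. \<phi> (z, w)) l"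
  unfolding partial_coef_def by (subst periodic_strip.coef_def[OF periodic_strip_snd]) auto

lemma partial_coef_bound:
  assumes "\<bar>Im z\<bar> < \<rho>"
  shows "norm (partial_coef l z) \<le> C * exp (- \<rho> * \<bar>of_int l\<bar>)"
  unfolding partial_coef_eq[OF assms]
proof (rule periodic_strip.coef_bound[OF periodic_strip_snd[OF assms]])
  fix w assume "w \<in> periodic_strip.S \<rho>"
  then have "\<bar>Im w\<bar> < \<rho>" by (simp add: periodic_strip.S_def[OF periodic_strip_snd[OF assms]])
  then show "norm (\<phi> (z, w)) \<le> C" using assms by (intro C) (auto simp: strip_def)
qed

text \<open>One-dimensional decay in the second index, uniformly in \<open>z\<close>, is the sup
  bound to which decay in the first index is applied.\<close>

lemma fcoef_bound: "norm (fcoef \<phi> \<nu>) \<le> C * exp (- \<rho> * nrm1 \<nu>)"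
proof -
  obtain k l where \<nu>: "\<nu> = (k, l)" by (cases \<nu>)
  have "norm (fcoef \<phi> \<nu>) \<le> (C * exp (- \<rho> * \<bar>of_int l\<bar>)) * exp (- \<rho> * \<bar>of_int k\<bar>)"
    unfolding \<nu> fcoef_eq
  proof (rule periodic_strip.coef_bound[OF periodic_strip_partial])
    fix z assume "z \<in> periodic_strip.S \<rho>"
    then have "\<bar>Im z\<bar> < \<rho>" by (simp add: periodic_strip.S_def[OF periodic_strip_partial])
    then show "norm (partial_coef l z) \<le> C * exp (- \<rho> * \<bar>of_int l\<bar>)" by (rule partial_coef_bound)
  qed
  also have "\<dots> = C * exp (- \<rho> * nrm1 \<nu>)"
    by (simp add: \<nu> nrm1_def ring_distribs mult.assoc flip: exp_add)
  finally show ?thesis .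
qed

lemma C_nonneg: "C \<ge> 0"
  using order_trans[OF norm_ge_zero C[of "(0, 0)"]] \<rho> by (simp add: strip_def)

lemma fcoef_abs_summable:
  assumes "\<rho>' < \<rho>"
  shows "(\<lambda>\<nu>. norm (fcoef \<phi> \<nu>) * exp (\<rho>' * nrm1 \<nu>)) summable_on UNIV"
proof -
  have "(\<lambda>\<nu>. C * exp (- (\<rho> - \<rho>') * nrm1 \<nu>)) summable_on UNIV"
    using assms by (intro summable_on_cmult_right summable_on_exp_nrm1) auto
  then have "(\<lambda>\<nu>. norm (norm (fcoef \<phi> \<nu>) * exp (\<rho>' * nrm1 \<nu>))) summable_on UNIV"
  proof (rule Infinite_Sum.abs_summable_on_comparison_test')
    fix \<nu>
    have "norm (fcoef \<phi> \<nu>) * exp (\<rho>' * nrm1 \<nu>) \<le> C * exp (- \<rho> * nrm1 \<nu>) * exp (\<rho>' * nrm1 \<nu>)"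
      by (intro mult_right_mono fcoef_bound) auto
    then show "norm (norm (fcoef \<phi> \<nu>) * exp (\<rho>' * nrm1 \<nu>)) \<le> C * exp (- (\<rho> - \<rho>') * nrm1 \<nu>)"
      by (simp add: mult.assoc ring_distribs flip: exp_add)
  qed
  then show ?thesis by simp
qed

text \<open>The series in \<open>k\<close> sums to a partial coefficient, the series of these in
  \<open>l\<close> to \<open>\<phi>\<close>; absolute summability turns the iterated sum into an
  unordered one.\<close>

lemma fourier_series_2d:
  assumes z: "\<bar>Im z\<bar> < \<rho>" and w: "\<bar>Im w\<bar> < \<rho>"
  shows "((\<lambda>\<nu>. fcoef \<phi> \<nu> * emode \<nu> (z, w)) has_sum \<phi> (z, w)) UNIV"
proof -
  let ?f = "\<lambda>\<nu>. fcoef \<phi> \<nu> * emode \<nu> (z, w)"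
  define s where "s = max \<bar>Im z\<bar> \<bar>Im w\<bar>"
  have s: "s < \<rho>" "(z, w) \<in> strip s" using z w by (auto simp: s_def strip_def)
  have "(\<lambda>\<nu>. norm (?f \<nu>)) summable_on UNIV"
    using fcoef_abs_summable[OF s(1)]
    by (rule Infinite_Sum.abs_summable_on_comparison_test') (auto simp: norm_mult intro!: mult_left_mono norm_emode_le s)
  then have sm: "?f summable_on (UNIV \<times> UNIV)" by (simp add: abs_summable_summable)
  have inner: "((\<lambda>k. fcoef \<phi> (k, l) * emode (k, l) (z, w)) has_sum (partial_coef l z * exp (\<i> * of_int l * w))) UNIV" for l
  proof -
    have "((\<lambda>k. periodic_strip.coef (partial_coef l) k * exp (\<i> * of_int k * z)) has_sum partial_coef l z) UNIV"
      by (rule periodic_strip.fourier_series[OF periodic_strip_partial z])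
    then have "((\<lambda>k. fcoef \<phi> (k, l) * exp (\<i> * of_int k * z) * exp (\<i> * of_int l * w)) has_sum (partial_coef l z * exp (\<i> * of_int l * w))) UNIV"
      unfolding fcoef_eq by (rule has_sum_cmult_left)
    then show ?thesis by (simp add: emode_def ring_distribs exp_add mult.assoc)
  qed
  have outer: "((\<lambda>l. partial_coef l z * exp (\<i> * of_int l * w)) has_sum \<phi> (z, w)) UNIV"
    using periodic_strip.fourier_series[OF periodic_strip_snd[OF z] w]
    unfolding partial_coef_eq[OF z] .
  have sm': "(\<lambda>(l, k). ?f (k, l)) summable_on (UNIV \<times> UNIV)"
    using sm summable_on_swap[where f = ?f and A = UNIV and B = UNIV] by simp
  have "((\<lambda>(l, k). ?f (k, l)) has_sum \<phi> (z, w)) (UNIV \<times> UNIV)"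
    by (rule has_sum_SigmaI[OF _ outer sm']) (use inner in auto)
  then show ?thesis using has_sum_swap[where f = ?f and A = UNIV and B = UNIV] by simp
qed

text \<open>Separate holomorphy becomes a joint power series: every Fourier mode is expanded about
  \<open>(a, b)\<close> by the exponential series, and the sums over modes and over powers are
  exchanged.\<close>

lemma analytic2_on_strip:
  assumes "\<xi>' < \<rho>"
  shows "analytic2_on \<phi> (strip \<xi>')"
  unfolding analytic2_on_def
proof (intro ballI, clarify)
  fix a b assume ab: "(a, b) \<in> strip \<xi>'"
  \<comment> \<open>Within this radius the absolute values of an expanded mode sum to at most
    \<open>exp ((\<xi>' + r) * nrm1 \<nu>)\<close>, which the coefficients still beat as
    \<open>\<xi>' + r < \<rho>\<close>.\<close>
  define r where "r = (\<rho> - \<xi>') / 2"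
  have r: "r > 0" "\<xi>' + r < \<rho>" using assms by (auto simp: r_def field_simps)
  define k where "k i j = (\<Sum>\<^sub>\<infinity>\<nu>. fcoef \<phi> \<nu> * emode \<nu> (a, b) * ((\<i> * of_int (fst \<nu>)) ^ i / fact i) * ((\<i> * of_int (snd \<nu>)) ^ j / fact j))" for i j
  show "\<exists>r>0. \<exists>k. \<forall>x\<in>ball a r. \<forall>y\<in>ball b r.
        ((\<lambda>(i, j). k i j * (x - a) ^ i * (y - b) ^ j) has_sum \<phi> (x, y)) UNIV"
  proof (intro exI conjI ballI)
    show "r > 0" by (rule r)
    fix x y assume x: "x \<in> ball a r" and y: "y \<in> ball b r"
    have xy: "\<bar>Im x\<bar> < \<rho>" "\<bar>Im y\<bar> < \<rho>"
    proof -
      have "\<bar>Im (x - a)\<bar> \<le> norm (x - a)" "\<bar>Im (y - b)\<bar> \<le> norm (y - b)" by (rule abs_Im_le_cmod)+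
      then show "\<bar>Im x\<bar> < \<rho>" "\<bar>Im y\<bar> < \<rho>"
        using x y r ab by (auto simp: dist_norm norm_minus_commute strip_def)
    qed
    define E where "E u n = u ^ n / fact n" for u :: complex and n
    define f where "f \<nu> ij = fcoef \<phi> \<nu> * emode \<nu> (a, b) *
       (E (\<i> * of_int (fst \<nu>) * (x - a)) (fst ij) * E (\<i> * of_int (snd \<nu>) * (y - b)) (snd ij))" for \<nu> and ij :: "nat \<times> nat"
    have Esums: "(E u has_sum exp u) UNIV" "((\<lambda>n. norm (E u n)) has_sum exp (norm u)) UNIV" for u
    proof -
      have "(\<lambda>n. norm u ^ n / fact n) sums exp (norm u)"
        using exp_converges[of "norm u"] by (simp add: divide_inverse mult.commute scaleR_conv_of_real)
      then have n: "(\<lambda>n. norm (E u n)) sums exp (norm u)" by (simp add: E_def norm_divide norm_power)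
      moreover have "E u sums exp u"
        using exp_converges[of u] by (simp add: E_def[abs_def] divide_inverse mult.commute scaleR_conv_of_real)
      ultimately show "(E u has_sum exp u) UNIV" using sums_summable norm_summable_imp_has_sum by blast
      show "((\<lambda>n. norm (E u n)) has_sum exp (norm u)) UNIV"
        by (rule norm_summable_imp_has_sum) (use n sums_summable in auto)
    qed
    have prod: "((\<lambda>ij. F (fst ij) * G (snd ij)) has_sum (s * t)) UNIV"
      if "(F has_sum s) UNIV" "(G has_sum t) UNIV" "(\<lambda>ij. F (fst ij) * G (snd ij)) summable_on UNIV"
      for F G :: "nat \<Rightarrow> complex" and s t
    proof -
      have "((\<lambda>ij. F (fst ij) * G (snd ij)) has_sum (s * t)) (UNIV \<times> UNIV)"
        by (rule has_sum_SigmaI[where g = "\<lambda>i. F i * t"])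
           (use that in \<open>auto intro!: has_sum_cmult_left has_sum_cmult_right\<close>)
      then show ?thesis by simp
    qed
    have prodn: "((\<lambda>ij. F (fst ij) * G (snd ij)) has_sum (s * t)) UNIV"
      if "(F has_sum s) UNIV" "(G has_sum t) UNIV" "\<And>i. F i \<ge> 0" "\<And>i. G i \<ge> 0"
      for F G :: "nat \<Rightarrow> real" and s t
    proof -
      have i: "((\<lambda>j. F (fst (i, j)) * G (snd (i, j))) has_sum (F i * t)) UNIV" for i
        using has_sum_cmult_right[OF that(2)] by simp
      have o: "((\<lambda>i. F i * t) has_sum (s * t)) UNIV"
        using has_sum_cmult_left[OF that(1)] by simp
      have "(\<lambda>ij. F (fst ij) * G (snd ij)) summable_on (UNIV \<times> UNIV)"
        by (rule summable_on_SigmaI[OF i has_sum_imp_summable[OF o]]) (use that in auto)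
      from has_sum_SigmaI[OF i o this] show ?thesis by simp
    qed
    have fn: "((\<lambda>ij. norm (f \<nu> ij)) has_sum (norm (fcoef \<phi> \<nu> * emode \<nu> (a, b)) *
        (exp (norm (\<i> * of_int (fst \<nu>) * (x - a))) * exp (norm (\<i> * of_int (snd \<nu>) * (y - b)))))) UNIV" for \<nu>
      unfolding f_def norm_mult[of "fcoef \<phi> \<nu> * emode \<nu> (a, b)"] norm_mult[of "E _ _"]
      by (intro has_sum_cmult_right prodn Esums) auto
    have fs: "(f \<nu> has_sum (fcoef \<phi> \<nu> * emode \<nu> (x, y))) UNIV" for \<nu>
    proof -
      have "(\<lambda>ij. norm (E (\<i> * of_int (fst \<nu>) * (x - a)) (fst ij) * E (\<i> * of_int (snd \<nu>) * (y - b)) (snd ij))) summable_on UNIV"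
        unfolding norm_mult[of "E _ _"]
        by (rule has_sum_imp_summable, rule prodn[OF Esums(2) Esums(2)]) auto
      then have "(\<lambda>ij. E (\<i> * of_int (fst \<nu>) * (x - a)) (fst ij) * E (\<i> * of_int (snd \<nu>) * (y - b)) (snd ij)) summable_on UNIV"
        by (rule abs_summable_summable)
      from prod[OF Esums(1) Esums(1) this]
      have "(f \<nu> has_sum (fcoef \<phi> \<nu> * emode \<nu> (a, b) * (exp (\<i> * of_int (fst \<nu>) * (x - a)) * exp (\<i> * of_int (snd \<nu>) * (y - b))))) UNIV"
        unfolding f_def by (rule has_sum_cmult_right)
      moreover have "emode \<nu> (a, b) * (exp (\<i> * of_int (fst \<nu>) * (x - a)) * exp (\<i> * of_int (snd \<nu>) * (y - b))) = emode \<nu> (x, y)"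
        unfolding emode_def exp_add[symmetric] by (rule arg_cong[of _ _ exp]) (simp add: algebra_simps)
      ultimately show ?thesis by (simp add: mult.assoc)
    qed
    have "(\<lambda>(\<nu>, ij). norm (f \<nu> ij)) summable_on (UNIV \<times> UNIV)"
    proof (rule summable_on_SigmaI)
      show "((\<lambda>ij. case (\<nu>, ij) of (\<nu>, ij) \<Rightarrow> norm (f \<nu> ij)) has_sum (norm (fcoef \<phi> \<nu> * emode \<nu> (a, b)) *
        (exp (norm (\<i> * of_int (fst \<nu>) * (x - a))) * exp (norm (\<i> * of_int (snd \<nu>) * (y - b)))))) UNIV" for \<nu>
        using fn[of \<nu>] by simp
      have "(\<lambda>\<nu>. norm (norm (fcoef \<phi> \<nu> * emode \<nu> (a, b)) *
        (exp (norm (\<i> * of_int (fst \<nu>) * (x - a))) * exp (norm (\<i> * of_int (snd \<nu>) * (y - b)))))) summable_on UNIV"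
        using fcoef_abs_summable[OF r(2)]
      proof (rule Infinite_Sum.abs_summable_on_comparison_test')
        fix \<nu> :: "int \<times> int"
        have "exp (norm (\<i> * of_int (fst \<nu>) * (x - a))) * exp (norm (\<i> * of_int (snd \<nu>) * (y - b))) \<le> exp (r * nrm1 \<nu>)"
        proof -
          have "norm (\<i> * of_int (fst \<nu>) * (x - a)) \<le> \<bar>of_int (fst \<nu>)\<bar> * r" "norm (\<i> * of_int (snd \<nu>) * (y - b)) \<le> \<bar>of_int (snd \<nu>)\<bar> * r"
            unfolding norm_mult using x y by (simp_all add: mult_left_mono dist_norm norm_minus_commute)
          then show ?thesis unfolding exp_add[symmetric] nrm1_def by (simp add: ring_distribs mult.commute)
        qed
        moreover have "norm (emode \<nu> (a, b)) \<le> exp (\<xi>' * nrm1 \<nu>)" by (rule norm_emode_le[OF ab])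
        ultimately have "norm (emode \<nu> (a, b)) * (exp (norm (\<i> * of_int (fst \<nu>) * (x - a))) * exp (norm (\<i> * of_int (snd \<nu>) * (y - b))))
           \<le> exp (\<xi>' * nrm1 \<nu>) * exp (r * nrm1 \<nu>)"
          by (intro mult_mono) auto
        also have "\<dots> = exp ((\<xi>' + r) * nrm1 \<nu>)" by (simp add: ring_distribs exp_add)
        finally have "norm (fcoef \<phi> \<nu>) * (norm (emode \<nu> (a, b)) * (exp (norm (\<i> * of_int (fst \<nu>) * (x - a))) * exp (norm (\<i> * of_int (snd \<nu>) * (y - b)))))
           \<le> norm (fcoef \<phi> \<nu>) * exp ((\<xi>' + r) * nrm1 \<nu>)" by (rule mult_left_mono) simp
        then show "norm (norm (fcoef \<phi> \<nu> * emode \<nu> (a, b)) *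
        (exp (norm (\<i> * of_int (fst \<nu>) * (x - a))) * exp (norm (\<i> * of_int (snd \<nu>) * (y - b)))))
           \<le> norm (fcoef \<phi> \<nu>) * exp ((\<xi>' + r) * nrm1 \<nu>)"
          unfolding real_norm_def norm_mult[of "fcoef \<phi> \<nu>" "emode \<nu> (a, b)"]
          by (subst abs_of_nonneg) (auto simp: mult.assoc)
      qed
      then show "(\<lambda>\<nu>. norm (fcoef \<phi> \<nu> * emode \<nu> (a, b)) *
        (exp (norm (\<i> * of_int (fst \<nu>) * (x - a))) * exp (norm (\<i> * of_int (snd \<nu>) * (y - b))))) summable_on UNIV"
        by (rule abs_summable_summable)
    qed auto
    then have "(\<lambda>p. norm (case p of (\<nu>, ij) \<Rightarrow> f \<nu> ij)) summable_on (UNIV \<times> UNIV)"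
      by (simp add: case_prod_unfold)
    then have sm: "(\<lambda>(\<nu>, ij). f \<nu> ij) summable_on (UNIV \<times> UNIV)" by (rule abs_summable_summable)
    have "((\<lambda>(\<nu>, ij). f \<nu> ij) has_sum \<phi> (x, y)) (UNIV \<times> UNIV)"
      by (rule has_sum_SigmaI[OF _ fourier_series_2d[OF xy] sm]) (use fs in auto)
    then have hs: "((\<lambda>(ij, \<nu>). f \<nu> ij) has_sum \<phi> (x, y)) (UNIV \<times> UNIV)"
      by (subst (asm) has_sum_swap) simp
    have "((\<lambda>\<nu>. f \<nu> ij) has_sum (k (fst ij) (snd ij) * (x - a) ^ fst ij * (y - b) ^ snd ij)) UNIV" for ij
    proof -
      have "(\<lambda>\<nu>. f \<nu> ij) summable_on UNIV"
        by (rule summable_on_SigmaD1[OF has_sum_imp_summable[OF hs], of ij]) simp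
      then have "((\<lambda>\<nu>. f \<nu> ij) has_sum (\<Sum>\<^sub>\<infinity>\<nu>. f \<nu> ij)) UNIV" by (rule has_sum_infsum)
      moreover have "f \<nu> ij = fcoef \<phi> \<nu> * emode \<nu> (a, b) * ((\<i> * of_int (fst \<nu>)) ^ fst ij / fact (fst ij)) *
          ((\<i> * of_int (snd \<nu>)) ^ snd ij / fact (snd ij)) * ((x - a) ^ fst ij * (y - b) ^ snd ij)" for \<nu>
        by (simp add: f_def E_def power_mult_distrib)
      then have "(\<Sum>\<^sub>\<infinity>\<nu>. f \<nu> ij) = k (fst ij) (snd ij) * ((x - a) ^ fst ij * (y - b) ^ snd ij)"
        unfolding k_def by (simp only: infsum_cmult_left')
      ultimately show ?thesis by (simp add: mult.assoc)
    qed
    then have "((\<lambda>ij. k (fst ij) (snd ij) * (x - a) ^ fst ij * (y - b) ^ snd ij) has_sum \<phi> (x, y)) UNIV"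
      by (intro has_sum_SigmaD[OF hs]) auto
    then show "((\<lambda>(i, j). k i j * (x - a) ^ i * (y - b) ^ j) has_sum \<phi> (x, y)) UNIV"
      by (simp add: case_prod_unfold)
  qed
qed

end

section \<open>Families of analytic functions on the torus\<close>

text \<open>Abel's argument: absolute convergence at the single point \<open>(a + r, b + r)\<close>
  dominates the series on the closed polydisc, so it converges uniformly there and its limit
  inherits continuity and holomorphy. Enumerating the index pairs turns it into an ordinary series
  for the M-test.\<close>

lemma analytic2_on_local:
  fixes F :: "complex \<times> complex \<Rightarrow> complex"
  assumes "analytic2_on F S" "(a, b) \<in> S"
  shows "\<exists>r>0. continuous_on (cball a r \<times> cball b r) F \<and>
    (\<forall>w\<in>cball b r. (\<lambda>z. F (z, w)) holomorphic_on ball a r) \<and>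
    (\<forall>z\<in>cball a r. (\<lambda>w. F (z, w)) holomorphic_on ball b r)"
proof -
  from assms obtain R k where R: "R > 0" and
    hs: "\<And>x y. x \<in> ball a R \<Longrightarrow> y \<in> ball b R \<Longrightarrow>
        ((\<lambda>(i, j). k i j * (x - a) ^ i * (y - b) ^ j) has_sum F (x, y)) (UNIV :: (nat \<times> nat) set)"
    unfolding analytic2_on_def by blast
  define r where "r = R / 2"
  have r: "r > 0" "r < R" using R by (auto simp: r_def)
  define f where "f n p = (case prod_decode n of (i, j) \<Rightarrow> k i j * (fst p - a) ^ i * (snd p - b) ^ j)" for n p
  define M where "M n = norm (f n (a + of_real r, b + of_real r))" for n
  have bij: "bij_betw prod_decode UNIV UNIV" by (rule bij_prod_decode)
  have sums: "(\<lambda>n. f n p) sums F p" if p: "p \<in> cball a r \<times> cball b r" for p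
  proof -
    obtain x y where p': "p = (x, y)" by (cases p)
    then have "x \<in> ball a R" "y \<in> ball b R" using p r by auto
    from hs[OF this] have "((\<lambda>n. case prod_decode n of (i, j) \<Rightarrow> k i j * (x - a) ^ i * (y - b) ^ j) has_sum F (x, y)) UNIV"
      by (subst has_sum_reindex_bij_betw[OF bij])
    then show ?thesis unfolding f_def p' by (intro has_sum_imp_sums) simp
  qed
  have "M summable_on UNIV"
  proof -
    have "a + of_real r \<in> ball a R" "b + of_real r \<in> ball b R" using r by (auto simp: dist_norm)
    from has_sum_imp_summable[OF hs[OF this]]
    have "(\<lambda>ij. norm (case ij of (i, j) \<Rightarrow> k i j * ((a + of_real r) - a) ^ i * ((b + of_real r) - b) ^ j)) summable_on UNIV"
      by (simp only: summable_on_iff_abs_summable_on_complex)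
    then have "(\<lambda>n. norm (case prod_decode n of (i, j) \<Rightarrow> k i j * ((a + of_real r) - a) ^ i * ((b + of_real r) - b) ^ j)) summable_on UNIV"
      by (subst summable_on_reindex_bij_betw[OF bij])
    then show ?thesis unfolding M_def f_def by simp
  qed
  then have M: "summable M" by (rule summable_on_imp_summable)
  have bd: "norm (f n p) \<le> M n" if "p \<in> cball a r \<times> cball b r" for n p
  proof -
    obtain i j where ij: "prod_decode n = (i, j)" by fastforce
    have "norm (fst p - a) \<le> r" "norm (snd p - b) \<le> r"
      using that by (auto simp: dist_norm norm_minus_commute)
    then have "norm (fst p - a) ^ i \<le> r ^ i" "norm (snd p - b) ^ j \<le> r ^ j"
      by (auto intro: power_mono)
    then have "norm (k i j) * norm (fst p - a) ^ i * norm (snd p - b) ^ j \<le> norm (k i j) * r ^ i * r ^ j"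
      by (intro mult_mono) (use r in auto)
    then show ?thesis using r by (simp add: f_def M_def ij norm_mult norm_power)
  qed
  have "uniform_limit (cball a r \<times> cball b r) (\<lambda>n p. \<Sum>i<n. f i p) (\<lambda>p. \<Sum>i. f i p) sequentially"
    by (rule Weierstrass_m_test[OF bd M])
  moreover have "(\<Sum>i. f i p) = F p" if "p \<in> cball a r \<times> cball b r" for p
    using sums[OF that] by (simp add: sums_iff)
  ultimately have ul: "uniform_limit (cball a r \<times> cball b r) (\<lambda>n p. \<Sum>i<n. f i p) F sequentially"
    by (simp cong: uniform_limit_cong')
  have fc: "continuous_on UNIV (f n)" for n
    unfolding f_def by (cases "prod_decode n") (auto intro!: continuous_intros)
  have "continuous_on (cball a r \<times> cball b r) F"
    by (rule uniform_limit_theorem[OF always_eventually ul])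
       (auto intro!: continuous_on_sum continuous_on_subset[OF fc])
  moreover have "(\<lambda>z. F (z, w)) holomorphic_on ball a r" if w: "w \<in> cball b r" for w
  proof (rule holomorphic_uniform_limit[of a r "\<lambda>n z. \<Sum>i<n. f i (z, w)" sequentially])
    have "(\<lambda>z. \<Sum>i<n. f i (z, w)) holomorphic_on UNIV" for n
    proof (intro holomorphic_on_sum)
      fix i show "(\<lambda>z. f i (z, w)) holomorphic_on UNIV"
        unfolding f_def by (cases "prod_decode i") (auto intro!: holomorphic_intros)
    qed
    then show "\<forall>\<^sub>F n in sequentially. continuous_on (cball a r) (\<lambda>z. \<Sum>i<n. f i (z, w)) \<and> (\<lambda>z. \<Sum>i<n. f i (z, w)) holomorphic_on ball a r"
      using holomorphic_on_imp_continuous_on[OF holomorphic_on_subset[OF _ subset_UNIV]] holomorphic_on_subset[OF _ subset_UNIV]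
      by (intro always_eventually allI conjI) auto
    show "uniform_limit (cball a r) (\<lambda>n z. \<Sum>i<n. f i (z, w)) (\<lambda>z. F (z, w)) sequentially"
      by (rule uniform_limit_compose'[OF ul]) (use w in auto)
  qed auto
  moreover have "(\<lambda>w. F (z, w)) holomorphic_on ball b r" if z: "z \<in> cball a r" for z
  proof (rule holomorphic_uniform_limit[of b r "\<lambda>n w. \<Sum>i<n. f i (z, w)" sequentially])
    have "(\<lambda>w. \<Sum>i<n. f i (z, w)) holomorphic_on UNIV" for n
    proof (intro holomorphic_on_sum)
      fix i show "(\<lambda>w. f i (z, w)) holomorphic_on UNIV"
        unfolding f_def by (cases "prod_decode i") (auto intro!: holomorphic_intros)
    qed
    then show "\<forall>\<^sub>F n in sequentially. continuous_on (cball b r) (\<lambda>w. \<Sum>i<n. f i (z, w)) \<and> (\<lambda>w. \<Sum>i<n. f i (z, w)) holomorphic_on ball b r"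
      using holomorphic_on_imp_continuous_on[OF holomorphic_on_subset[OF _ subset_UNIV]] holomorphic_on_subset[OF _ subset_UNIV]
      by (intro always_eventually allI conjI) auto
    show "uniform_limit (cball b r) (\<lambda>n w. \<Sum>i<n. f i (z, w)) (\<lambda>w. F (z, w)) sequentially"
      by (rule uniform_limit_compose'[OF ul]) (use z in auto)
  qed auto
  ultimately show ?thesis using r by blast
qed

lemma open_Im_strip: "open {z. \<bar>Im z\<bar> < \<rho>}"
proof -
  have *: "{z. \<bar>Im z\<bar> < \<rho>} = {z. Im z < \<rho>} \<inter> {z. Im z > - \<rho>}" by auto
  show ?thesis unfolding * by (intro open_Int open_halfspace_Im_lt open_halfspace_Im_gt)
qed

lemma analytic2_on_imp_strip_analytic:
  assumes an: "analytic2_on F (strip \<xi>)" and "periodic2_on F (strip \<xi>)"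
    and "\<And>x y. F (complex_of_real x, complex_of_real y) \<in> \<real>"
  shows "strip_analytic \<xi> F"
  unfolding strip_analytic_def
proof (intro conjI allI impI)
  have "\<exists>f'. ((\<lambda>z. F (z, w)) has_field_derivative f') (at a)" if aw: "(a, w) \<in> strip \<xi>" for a w
  proof -
    obtain r where r: "r > 0" "\<forall>v\<in>cball w r. (\<lambda>z. F (z, v)) holomorphic_on ball a r"
      using analytic2_on_local[OF an aw] by blast
    have "w \<in> cball w r" using r(1) by simp
    with r have "r > 0" "(\<lambda>z. F (z, w)) holomorphic_on ball a r" by blast+
    then show ?thesis
      using holomorphic_on_imp_differentiable_at[OF _ open_ball] unfolding field_differentiable_def by fastforce
  qed
  then show "(\<lambda>z. F (z, w)) holomorphic_on {z. \<bar>Im z\<bar> < \<xi>}" if "\<bar>Im w\<bar> \<le> \<xi>" for w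
    using that unfolding holomorphic_on_open[OF open_Im_strip] by (auto simp: strip_def)
  have "\<exists>f'. ((\<lambda>w. F (z, w)) has_field_derivative f') (at b)" if aw: "(z, b) \<in> strip \<xi>" for z b
  proof -
    obtain r where r: "r > 0" "\<forall>v\<in>cball z r. (\<lambda>w. F (v, w)) holomorphic_on ball b r"
      using analytic2_on_local[OF an aw] by blast
    have "z \<in> cball z r" using r(1) by simp
    with r have "r > 0" "(\<lambda>w. F (z, w)) holomorphic_on ball b r" by blast+
    then show ?thesis
      using holomorphic_on_imp_differentiable_at[OF _ open_ball] unfolding field_differentiable_def by fastforce
  qed
  then show "(\<lambda>w. F (z, w)) holomorphic_on {w. \<bar>Im w\<bar> < \<xi>}" if "\<bar>Im z\<bar> \<le> \<xi>" for z
    using that unfolding holomorphic_on_open[OF open_Im_strip] by (auto simp: strip_def)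
  have "isCont F p" if ps: "p \<in> strip \<xi>" for p
  proof -
    obtain a b where p: "p = (a, b)" by (cases p)
    obtain r where r: "r > 0" "continuous_on (cball a r \<times> cball b r) F"
      using analytic2_on_local[OF an ps[unfolded p]] by blast
    have "continuous_on (ball a r \<times> ball b r) F"
      by (rule continuous_on_subset[OF r(2)]) (auto simp: less_imp_le)
    then show ?thesis unfolding p
      by (rule continuous_on_interior) (use r in \<open>auto simp: interior_Times\<close>)
  qed
  then show "continuous_on (strip \<xi>) F" by (simp add: continuous_at_imp_continuous_on)
qed (use assms in auto)

text \<open>Continuity is joint in parameter and point: over a compact period cell this yields
  continuity in the parameter uniformly in the point.\<close>

definition strip_family :: "real set \<Rightarrow> real \<Rightarrow> (real \<Rightarrow> complex \<times> complex \<Rightarrow> complex) \<Rightarrow> bool" where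
  "strip_family E \<rho> \<phi> \<longleftrightarrow> continuous_on (E \<times> strip \<rho>) (\<lambda>p. \<phi> (fst p) (snd p)) \<and> (\<forall>e\<in>E. strip_analytic \<rho> (\<phi> e))"

lemma strip_analytic_map2:
  assumes \<phi>: "strip_analytic \<rho> \<phi>" and \<phi>': "strip_analytic \<rho> \<phi>'"
    and cont: "\<And>T::(complex \<times> complex) set. \<And>f g. continuous_on T f \<Longrightarrow> continuous_on T g \<Longrightarrow> continuous_on T (\<lambda>x. H (f x) (g x))"
    and hol: "\<And>T f g. f holomorphic_on T \<Longrightarrow> g holomorphic_on T \<Longrightarrow> (\<lambda>x. H (f x) (g x)) holomorphic_on T"
    and real: "\<And>a b. a \<in> \<real> \<Longrightarrow> b \<in> \<real> \<Longrightarrow> H a b \<in> \<real>"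
  shows "strip_analytic \<rho> (\<lambda>\<psi>. H (\<phi> \<psi>) (\<phi>' \<psi>))"
  unfolding strip_analytic_def
proof (intro conjI allI impI)
  show "periodic2_on (\<lambda>\<psi>. H (\<phi> \<psi>) (\<phi>' \<psi>)) (strip \<rho>)"
    using periodic2_onD[of \<phi> \<rho>] periodic2_onD[of \<phi>' \<rho>] \<phi> \<phi>'
    by (simp only: strip_analytic_def periodic2_on_def[of "\<lambda>\<psi>. H (\<phi> \<psi>) (\<phi>' \<psi>)"]) fastforce
qed (use assms in \<open>auto simp: strip_analytic_def\<close>)

text \<open>Continuity of \<open>H\<close> is required in two instances, since one hypothesis cannot
  cover sets of two different types.\<close>

lemma strip_family_map2:
  assumes \<phi>: "strip_family E \<rho> \<phi>" and \<phi>': "strip_family E \<rho> \<phi>'"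
    and cont: "\<And>T::(complex \<times> complex) set. \<And>f g. continuous_on T f \<Longrightarrow> continuous_on T g \<Longrightarrow> continuous_on T (\<lambda>x. H (f x) (g x))"
    and cont': "\<And>T::(real \<times> complex \<times> complex) set. \<And>f g. continuous_on T f \<Longrightarrow> continuous_on T g \<Longrightarrow> continuous_on T (\<lambda>x. H (f x) (g x))"
    and hol: "\<And>T f g. f holomorphic_on T \<Longrightarrow> g holomorphic_on T \<Longrightarrow> (\<lambda>x. H (f x) (g x)) holomorphic_on T"
    and real: "\<And>a b. a \<in> \<real> \<Longrightarrow> b \<in> \<real> \<Longrightarrow> H a b \<in> \<real>"
  shows "strip_family E \<rho> (\<lambda>e \<psi>. H (\<phi> e \<psi>) (\<phi>' e \<psi>))"
  unfolding strip_family_def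
proof (intro conjI ballI)
  show "continuous_on (E \<times> strip \<rho>) (\<lambda>p. H (\<phi> (fst p) (snd p)) (\<phi>' (fst p) (snd p)))"
    by (rule cont') (use \<phi> \<phi>' in \<open>auto simp: strip_family_def\<close>)
  fix e assume "e \<in> E"
  then show "strip_analytic \<rho> (\<lambda>\<psi>. H (\<phi> e \<psi>) (\<phi>' e \<psi>))"
  proof (intro strip_analytic_map2[where H = H])
    assume "e \<in> E"
    then show "strip_analytic \<rho> (\<phi> e)" "strip_analytic \<rho> (\<phi>' e)"
      using \<phi> \<phi>' by (auto simp: strip_family_def)
  qed (rule cont hol real; assumption)+
qed

lemma strip_family_add: "strip_family E \<rho> \<phi> \<Longrightarrow> strip_family E \<rho> \<phi>' \<Longrightarrow> strip_family E \<rho> (\<lambda>e \<psi>. \<phi> e \<psi> + \<phi>' e \<psi>)"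
  by (rule strip_family_map2[of E \<rho> \<phi> \<phi>' "(+)"]) (rule continuous_on_add holomorphic_on_add Reals_add | assumption)+

lemma strip_family_diff: "strip_family E \<rho> \<phi> \<Longrightarrow> strip_family E \<rho> \<phi>' \<Longrightarrow> strip_family E \<rho> (\<lambda>e \<psi>. \<phi> e \<psi> - \<phi>' e \<psi>)"
  by (rule strip_family_map2[of E \<rho> \<phi> \<phi>' "(-)"]) (rule continuous_on_diff holomorphic_on_diff Reals_diff | assumption)+

lemma strip_family_mult: "strip_family E \<rho> \<phi> \<Longrightarrow> strip_family E \<rho> \<phi>' \<Longrightarrow> strip_family E \<rho> (\<lambda>e \<psi>. \<phi> e \<psi> * \<phi>' e \<psi>)"
  by (rule strip_family_map2[of E \<rho> \<phi> \<phi>' "(*)"]) (rule continuous_on_mult holomorphic_on_mult Reals_mult | assumption)+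

lemma strip_family_const:
  assumes "continuous_on E s"
  shows "strip_family E \<rho> (\<lambda>e \<psi>. complex_of_real (s e))"
  unfolding strip_family_def strip_analytic_def periodic2_on_def
  by (auto intro!: continuous_on_of_real continuous_on_compose2[OF assms] continuous_on_fst continuous_on_id)

lemma strip_family_fixed:
  assumes "strip_analytic \<rho> F"
  shows "strip_family E \<rho> (\<lambda>e. F)"
  using assms unfolding strip_family_def strip_analytic_def
  by (auto intro!: continuous_on_compose2[of "strip \<rho>" F] continuous_on_snd continuous_on_id)

lemma strip_analytic_mono:
  assumes "strip_analytic \<rho> \<phi>" "\<rho>' \<le> \<rho>"
  shows "strip_analytic \<rho>' \<phi>"
  unfolding strip_analytic_def
proof (intro conjI allI impI)
  show "continuous_on (strip \<rho>') \<phi>"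
    using assms continuous_on_subset strip_mono unfolding strip_analytic_def by blast
  show "periodic2_on \<phi> (strip \<rho>')"
    using assms strip_mono[OF assms(2)] unfolding strip_analytic_def periodic2_on_def by blast
  show "(\<lambda>z. \<phi> (z, w)) holomorphic_on {z. \<bar>Im z\<bar> < \<rho>'}" if "\<bar>Im w\<bar> \<le> \<rho>'" for w
    by (rule holomorphic_on_subset[of _ "{z. \<bar>Im z\<bar> < \<rho>}"]) (use assms that in \<open>auto simp: strip_analytic_def\<close>)
  show "(\<lambda>w. \<phi> (z, w)) holomorphic_on {z. \<bar>Im z\<bar> < \<rho>'}" if "\<bar>Im z\<bar> \<le> \<rho>'" for z
    by (rule holomorphic_on_subset[of _ "{z. \<bar>Im z\<bar> < \<rho>}"]) (use assms that in \<open>auto simp: strip_analytic_def\<close>)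
qed (use assms in \<open>auto simp: strip_analytic_def\<close>)

lemma strip_family_mono:
  assumes "strip_family E \<rho> \<phi>" "\<rho>' \<le> \<rho>" "E' \<subseteq> E"
  shows "strip_family E' \<rho>' \<phi>"
proof -
  have "E' \<times> strip \<rho>' \<subseteq> E \<times> strip \<rho>" using assms strip_mono by blast
  then show ?thesis using assms strip_analytic_mono[OF _ assms(2)] continuous_on_subset
    unfolding strip_family_def by blast
qed

lemma strip_family_cong:
  assumes "strip_family E \<rho> \<phi>" "\<And>e \<psi>. e \<in> E \<Longrightarrow> \<psi> \<in> strip \<rho> \<Longrightarrow> \<phi> e \<psi> = \<phi>' e \<psi>" "\<rho> \<ge> 0"
  shows "strip_family E \<rho> \<phi>'"
proof -
  have c: "continuous_on (E \<times> strip \<rho>) (\<lambda>p. \<phi>' (fst p) (snd p))"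
    by (rule continuous_on_eq[of _ "\<lambda>p. \<phi> (fst p) (snd p)"]) (use assms(1,2) in \<open>auto simp: strip_family_def\<close>)
  have "strip_analytic \<rho> (\<phi>' e)" if e: "e \<in> E" for e
  proof -
    have eq: "\<phi>' e \<psi> = \<phi> e \<psi>" if "\<psi> \<in> strip \<rho>" for \<psi> using assms(2)[OF e that] by simp
    have an: "strip_analytic \<rho> (\<phi> e)" using assms(1) e by (simp add: strip_family_def)
    show ?thesis unfolding strip_analytic_def
    proof (intro conjI allI impI)
      show "continuous_on (strip \<rho>) (\<phi>' e)"
        using an by (simp add: strip_analytic_def eq cong: continuous_on_cong)
      show "(\<lambda>z. \<phi>' e (z, w)) holomorphic_on {z. \<bar>Im z\<bar> < \<rho>}" if "\<bar>Im w\<bar> \<le> \<rho>" for w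
        by (rule holomorphic_transform[of "\<lambda>z. \<phi> e (z, w)"]) (use an that in \<open>auto simp: strip_analytic_def eq strip_def\<close>)
      show "(\<lambda>w. \<phi>' e (z, w)) holomorphic_on {z. \<bar>Im z\<bar> < \<rho>}" if "\<bar>Im z\<bar> \<le> \<rho>" for z
        by (rule holomorphic_transform[of "\<lambda>w. \<phi> e (z, w)"]) (use an that in \<open>auto simp: strip_analytic_def eq strip_def\<close>)
      show "\<phi>' e (of_real x, of_real y) \<in> \<real>" for x y
        using an assms(3) by (subst eq) (auto simp: strip_analytic_def strip_def)
      have p: "periodic2_on (\<phi> e) (strip \<rho>)" using an by (simp add: strip_analytic_def)
      show "periodic2_on (\<phi>' e) (strip \<rho>)" unfolding periodic2_on_def
      proof (clarify, intro conjI)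
        fix z w assume zw: "(z, w) \<in> strip \<rho>"
        then have "(z + of_real (2 * pi), w) \<in> strip \<rho>" "(z, w + of_real (2 * pi)) \<in> strip \<rho>" by (auto simp: strip_def)
        then show "\<phi>' e (z + of_real (2 * pi), w) = \<phi>' e (z, w)" "\<phi>' e (z, w + of_real (2 * pi)) = \<phi>' e (z, w)"
          by (simp_all only: eq zw periodic2_onD[OF p zw])
      qed
    qed
  qed
  with c show ?thesis by (simp add: strip_family_def)
qed

lemma strip_family_compose:
  assumes \<phi>: "strip_family E \<rho> \<phi>" and U: "open U" "H holomorphic_on U"
    and sub: "\<And>e \<psi>. e \<in> E \<Longrightarrow> \<psi> \<in> strip \<rho> \<Longrightarrow> \<phi> e \<psi> \<in> U"
    and real: "\<And>x. x \<in> U \<Longrightarrow> x \<in> \<real> \<Longrightarrow> H x \<in> \<real>" and "\<rho> \<ge> 0"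
  shows "strip_family E \<rho> (\<lambda>e \<psi>. H (\<phi> e \<psi>))"
  unfolding strip_family_def
proof (intro conjI ballI)
  have cH: "continuous_on U H" using U holomorphic_on_imp_continuous_on by blast
  show "continuous_on (E \<times> strip \<rho>) (\<lambda>p. H (\<phi> (fst p) (snd p)))"
    by (rule continuous_on_compose2[OF cH]) (use \<phi> sub in \<open>auto simp: strip_family_def\<close>)
  fix e assume e: "e \<in> E"
  then have an: "strip_analytic \<rho> (\<phi> e)" using \<phi> by (simp add: strip_family_def)
  show "strip_analytic \<rho> (\<lambda>\<psi>. H (\<phi> e \<psi>))" unfolding strip_analytic_def
  proof (intro conjI allI impI)
    show "continuous_on (strip \<rho>) (\<lambda>\<psi>. H (\<phi> e \<psi>))"
      by (rule continuous_on_compose2[OF cH]) (use an sub e in \<open>auto simp: strip_analytic_def\<close>)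
    show "(\<lambda>z. H (\<phi> e (z, w))) holomorphic_on {z. \<bar>Im z\<bar> < \<rho>}" if "\<bar>Im w\<bar> \<le> \<rho>" for w
    proof -
      have "(H \<circ> (\<lambda>z. \<phi> e (z, w))) holomorphic_on {z. \<bar>Im z\<bar> < \<rho>}"
        by (rule holomorphic_on_compose_gen[OF _ U(2)])
           (use an that in \<open>auto simp: strip_analytic_def strip_def intro!: sub[OF e]\<close>)
      then show ?thesis by (simp add: o_def)
    qed
    show "(\<lambda>w. H (\<phi> e (z, w))) holomorphic_on {z. \<bar>Im z\<bar> < \<rho>}" if "\<bar>Im z\<bar> \<le> \<rho>" for z
    proof -
      have "(H \<circ> (\<lambda>w. \<phi> e (z, w))) holomorphic_on {z. \<bar>Im z\<bar> < \<rho>}"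
        by (rule holomorphic_on_compose_gen[OF _ U(2)])
           (use an that in \<open>auto simp: strip_analytic_def strip_def intro!: sub[OF e]\<close>)
      then show ?thesis by (simp add: o_def)
    qed
    show "H (\<phi> e (of_real x, of_real y)) \<in> \<real>" for x y
      using an sub[OF e] assms(6) by (intro real) (auto simp: strip_analytic_def strip_def)
    have p: "periodic2_on (\<phi> e) (strip \<rho>)" using an by (simp add: strip_analytic_def)
    show "periodic2_on (\<lambda>\<psi>. H (\<phi> e \<psi>)) (strip \<rho>)"
      unfolding periodic2_on_def[of "\<lambda>\<psi>. H (\<phi> e \<psi>)"]
      by (clarify, intro conjI) (simp_all only: periodic2_onD[OF p])
  qed
qed

text \<open>Weierstrass's theorem in each variable separately, on small closed discs; this carries
  the iteration to its limit.\<close>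

lemma strip_family_uniform_limit:
  assumes f: "\<And>n::nat. strip_family E \<rho> (f n)"
    and ul: "uniform_limit (E \<times> strip \<rho>) (\<lambda>n p. f n (fst p) (snd p)) (\<lambda>p. g (fst p) (snd p)) sequentially"
    and \<rho>: "\<rho> \<ge> 0"
  shows "strip_family E \<rho> g"
  unfolding strip_family_def
proof (intro conjI ballI)
  show "continuous_on (E \<times> strip \<rho>) (\<lambda>p. g (fst p) (snd p))"
    by (rule uniform_limit_theorem[OF always_eventually ul]) (use f in \<open>auto simp: strip_family_def\<close>)
  fix e assume e: "e \<in> E"
  have an: "strip_analytic \<rho> (f n e)" for n using f e by (simp add: strip_family_def)
  have ul': "uniform_limit (strip \<rho>) (\<lambda>n. f n e) (g e) sequentially"
    using uniform_limit_compose'[OF ul, of "\<lambda>\<psi>. (e, \<psi>)" "strip \<rho>"] e by auto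
  have lim: "(\<lambda>n. f n e \<psi>) \<longlonglongrightarrow> g e \<psi>" if "\<psi> \<in> strip \<rho>" for \<psi>
    by (rule tendsto_uniform_limitI[OF ul' that])
  show "strip_analytic \<rho> (g e)" unfolding strip_analytic_def
  proof (intro conjI allI impI)
    show "continuous_on (strip \<rho>) (g e)"
      by (rule uniform_limit_theorem[OF always_eventually ul']) (use an in \<open>auto simp: strip_analytic_def\<close>)
    have nb: "\<exists>d>0. cball z d \<subseteq> {z. \<bar>Im z\<bar> < \<rho>}" if "\<bar>Im z\<bar> < \<rho>" for z
      using open_Im_strip that by (simp add: open_contains_cball)
    show "(\<lambda>z. g e (z, w)) holomorphic_on {z. \<bar>Im z\<bar> < \<rho>}" if w: "\<bar>Im w\<bar> \<le> \<rho>" for w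
    proof (rule holomorphic_uniform_sequence[OF open_Im_strip])
      show "(\<lambda>z. f n e (z, w)) holomorphic_on {z. \<bar>Im z\<bar> < \<rho>}" for n
        using an w by (simp add: strip_analytic_def)
      fix z assume "z \<in> {z. \<bar>Im z\<bar> < \<rho>}"
      then obtain d where d: "d > 0" "cball z d \<subseteq> {z. \<bar>Im z\<bar> < \<rho>}" using nb by blast
      then have "uniform_limit (cball z d) (\<lambda>n z. f n e (z, w)) (\<lambda>z. g e (z, w)) sequentially"
        by (intro uniform_limit_compose'[OF ul']) (use w in \<open>auto simp: strip_def less_imp_le\<close>)
      then show "\<exists>d>0. cball z d \<subseteq> {z. \<bar>Im z\<bar> < \<rho>} \<and> uniform_limit (cball z d) (\<lambda>n z. f n e (z, w)) (\<lambda>z. g e (z, w)) sequentially"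
        using d by blast
    qed
    show "(\<lambda>w. g e (z, w)) holomorphic_on {z. \<bar>Im z\<bar> < \<rho>}" if z: "\<bar>Im z\<bar> \<le> \<rho>" for z
    proof (rule holomorphic_uniform_sequence[OF open_Im_strip])
      show "(\<lambda>w. f n e (z, w)) holomorphic_on {z. \<bar>Im z\<bar> < \<rho>}" for n
        using an z by (simp add: strip_analytic_def)
      fix w assume "w \<in> {z. \<bar>Im z\<bar> < \<rho>}"
      then obtain d where d: "d > 0" "cball w d \<subseteq> {z. \<bar>Im z\<bar> < \<rho>}" using nb by blast
      then have "uniform_limit (cball w d) (\<lambda>n w. f n e (z, w)) (\<lambda>w. g e (z, w)) sequentially"
        by (intro uniform_limit_compose'[OF ul']) (use z in \<open>auto simp: strip_def less_imp_le\<close>)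
      then show "\<exists>d>0. cball w d \<subseteq> {z. \<bar>Im z\<bar> < \<rho>} \<and> uniform_limit (cball w d) (\<lambda>n w. f n e (z, w)) (\<lambda>w. g e (z, w)) sequentially"
        using d by blast
    qed
    show "periodic2_on (g e) (strip \<rho>)" unfolding periodic2_on_def
    proof (clarify, intro conjI)
      fix z w assume zw: "(z, w) \<in> strip \<rho>"
      have p: "periodic2_on (f n e) (strip \<rho>)" for n using an by (simp add: strip_analytic_def)
      have "(z + of_real (2 * pi), w) \<in> strip \<rho>" "(z, w + of_real (2 * pi)) \<in> strip \<rho>" using zw by (auto simp: strip_def)
      from lim[OF this(1)] lim[OF this(2)]
      have "(\<lambda>n. f n e (z, w)) \<longlonglongrightarrow> g e (z + of_real (2 * pi), w)" "(\<lambda>n. f n e (z, w)) \<longlonglongrightarrow> g e (z, w + of_real (2 * pi))"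
        unfolding periodic2_onD[OF p zw] .
      then show "g e (z + of_real (2 * pi), w) = g e (z, w)" "g e (z, w + of_real (2 * pi)) = g e (z, w)"
        using lim[OF zw] LIMSEQ_unique by blast+
    qed
    fix x y :: real
    have "(of_real x, of_real y) \<in> strip \<rho>" using \<rho> by (simp add: strip_def)
    moreover have "f n e (of_real x, of_real y) \<in> \<real>" for n using an by (simp add: strip_analytic_def)
    ultimately show "g e (of_real x, of_real y) \<in> \<real>"
      using Lim_in_closed_set[OF closed_complex_Reals, of "\<lambda>n. f n e (of_real x, of_real y)" sequentially] lim by auto
  qed
qed

section \<open>Inverting the derivative along the flow\<close>

text \<open>A resolvent of the flow is an average over exponentially distributed times; as a
  probability measure this gives sup bounds with constant one.\<close>

definition expM :: "real measure" where "expM = density lborel (exponential_density 1)"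

lemma prob_space_expM: "prob_space expM"
  unfolding expM_def by (rule prob_space_exponential_density) simp

interpretation expM: prob_space expM by (rule prob_space_expM)

lemma sets_expM [measurable_cong]: "sets expM = sets borel"
  by (simp add: expM_def)

lemma borel_measurable_expM:
  fixes f :: "real \<Rightarrow> 'a::topological_space"
  assumes "continuous_on UNIV f"
  shows "f \<in> borel_measurable expM"
  using borel_measurable_continuous_onI[OF assms] by (simp add: measurable_cong_sets[OF sets_expM refl])

lemma integrable_expM:
  fixes f :: "real \<Rightarrow> complex"
  assumes "continuous_on UNIV f" "\<And>x. norm (f x) \<le> B"
  shows "integrable expM f"
  by (rule expM.integrable_const_bound[of _ B]) (use assms borel_measurable_expM in auto)

text \<open>After substitution the integral is \<open>exp (- t)\<close> times the integral of
  \<open>exp \<sigma> * Y \<sigma>\<close> over \<open>\<sigma> \<le> t\<close>, the bounded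
  solution of \<open>V' = Y - V\<close>.\<close>

lemma integral_expM_deriv:
  fixes Y :: "real \<Rightarrow> complex"
  assumes Y: "continuous_on UNIV Y" and B: "\<And>x. norm (Y x) \<le> B"
  shows "((\<lambda>t. \<integral>\<tau>. Y (t - \<tau>) \<partial>expM) has_vector_derivative (Y t - (\<integral>\<tau>. Y (t - \<tau>) \<partial>expM))) (at t)"
proof -
  define g where "g \<sigma> = exp \<sigma> *\<^sub>R Y \<sigma>" for \<sigma> :: real
  have gc: "continuous_on S g" for S
    unfolding g_def by (intro continuous_intros continuous_on_subset[OF Y]) auto
  have shift: "continuous_on UNIV (\<lambda>\<tau>. Y (t - \<tau>))" for t
    by (rule continuous_on_compose2[OF Y]) (auto intro!: continuous_intros)
  have Ym: "(\<lambda>\<tau>. Y (t - \<tau>)) \<in> borel_measurable lborel" for t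
    using borel_measurable_continuous_onI[OF shift] by simp
  define d where "d = (\<lambda>x::real. exponential_density 1 x)"
  have d: "d \<in> borel_measurable lborel" "AE x in lborel. 0 \<le> d x"
    by (auto simp: d_def exponential_density_def)
  have eq: "d (t - \<sigma>) *\<^sub>R Y (t - (t - \<sigma>)) = exp (- t) *\<^sub>R indicator {..t} \<sigma> *\<^sub>R g \<sigma>" for t \<sigma>
    by (auto simp: d_def exponential_density_def g_def indicator_def exp_diff exp_minus field_simps)
  have V: "(\<integral>\<tau>. Y (t - \<tau>) \<partial>expM) = exp (- t) *\<^sub>R (\<integral>\<sigma>. indicator {..t} \<sigma> *\<^sub>R g \<sigma> \<partial>lborel)" for t
  proof -
    have "(\<integral>\<tau>. Y (t - \<tau>) \<partial>expM) = (\<integral>\<tau>. d \<tau> *\<^sub>R Y (t - \<tau>) \<partial>lborel)"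
      unfolding expM_def using d Ym by (subst integral_density) (auto simp: d_def)
    also have "\<dots> = (\<integral>\<sigma>. d (t + (-1) * \<sigma>) *\<^sub>R Y (t - (t + (-1) * \<sigma>)) \<partial>lborel)"
      by (subst lborel_integral_real_affine[of "-1" _ t]) auto
    also have "\<dots> = (\<integral>\<sigma>. exp (- t) *\<^sub>R indicator {..t} \<sigma> *\<^sub>R g \<sigma> \<partial>lborel)"
      using eq[of t] by simp
    finally show ?thesis by (simp only: integral_scaleR_right)
  qed
  have int: "set_integrable lborel {..t} g" for t
  proof -
    have "integrable expM (\<lambda>\<tau>. Y (t - \<tau>))" by (rule integrable_expM[OF shift B])
    then have "integrable lborel (\<lambda>\<tau>. d \<tau> *\<^sub>R Y (t - \<tau>))"
      unfolding expM_def using d Ym by (subst (asm) integrable_density) (auto simp: d_def)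
    then have "integrable lborel (\<lambda>\<sigma>. d (t + (-1) * \<sigma>) *\<^sub>R Y (t - (t + (-1) * \<sigma>)))"
      by (rule lborel_integrable_real_affine[where f = "\<lambda>\<tau>. d \<tau> *\<^sub>R Y (t - \<tau>)"]) simp
    then have "integrable lborel (\<lambda>\<sigma>. exp (- t) *\<^sub>R indicator {..t} \<sigma> *\<^sub>R g \<sigma>)"
      using eq[of t] by simp
    then have "integrable lborel (\<lambda>\<sigma>. exp t *\<^sub>R exp (- t) *\<^sub>R indicator {..t} \<sigma> *\<^sub>R g \<sigma>)"
      by (rule integrable_scaleR_right)
    moreover have "exp t *\<^sub>R exp (- t) *\<^sub>R v = v" for v :: complex by (simp add: exp_minus)
    ultimately show ?thesis unfolding set_integrable_def by (simp only:)
  qed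
  define W where "W t = (\<integral>\<sigma>. indicator {..t} \<sigma> *\<^sub>R g \<sigma> \<partial>lborel)" for t
  \<comment> \<open>Splitting off the half-line at \<open>t - 1\<close> leaves a compact interval
    near \<open>t\<close>, to which the fundamental theorem applies.\<close>
  have W: "W u = W (t - 1) + integral {t - 1..u} g" if "u \<ge> t - 1" for u
  proof -
    have i: "set_integrable lborel {t - 1..u} g"
      using borel_integrable_atLeastAtMost'[OF gc] .
    have "W u = (\<integral>\<sigma>. indicator {..t - 1} \<sigma> *\<^sub>R g \<sigma> + indicator {t - 1..u} \<sigma> *\<^sub>R g \<sigma> \<partial>lborel)"
      unfolding W_def
    proof (rule integral_cong_AE)
      show "AE x in lborel. indicat_real {..u} x *\<^sub>R g x = indicat_real {..t - 1} x *\<^sub>R g x + indicat_real {t - 1..u} x *\<^sub>R g x"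
        using AE_lborel_singleton[of "t - 1"]
      proof eventually_elim
        case (elim x)
        then show ?case using that by (cases "x < t - 1"; cases "x \<le> u") (simp_all add: indicator_def)
      qed
      have m: "(\<lambda>x. indicat_real {..v} x *\<^sub>R g x) \<in> borel_measurable lborel" for v
        using int[of v] unfolding set_integrable_def by (rule borel_measurable_integrable)
      have m': "(\<lambda>x. indicat_real {t - 1..u} x *\<^sub>R g x) \<in> borel_measurable lborel"
        using i unfolding set_integrable_def by (rule borel_measurable_integrable)
      show "(\<lambda>x. indicat_real {..u} x *\<^sub>R g x) \<in> borel_measurable lborel" by (rule m)
      show "(\<lambda>x. indicat_real {..t - 1} x *\<^sub>R g x + indicat_real {t - 1..u} x *\<^sub>R g x) \<in> borel_measurable lborel"
        by (rule borel_measurable_add[OF m m'])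
    qed
    also have "\<dots> = W (t - 1) + (\<integral>\<sigma>. indicator {t - 1..u} \<sigma> *\<^sub>R g \<sigma> \<partial>lborel)"
      unfolding W_def using int[of "t - 1"] i by (intro Bochner_Integration.integral_add) (auto simp: set_integrable_def)
    also have "(\<integral>\<sigma>. indicator {t - 1..u} \<sigma> *\<^sub>R g \<sigma> \<partial>lborel) = integral {t - 1..u} g"
      using set_borel_integral_eq_integral(2)[OF i] by (simp add: set_lebesgue_integral_def)
    finally show ?thesis .
  qed
  have "((\<lambda>u. integral {t - 1..u} g) has_vector_derivative g t) (at t within {t - 1..t + 1})"
    by (rule integral_has_vector_derivative[OF gc]) auto
  from has_vector_derivative_add[OF has_vector_derivative_const this]
  have "((\<lambda>u. W (t - 1) + integral {t - 1..u} g) has_vector_derivative g t) (at t within {t - 1..t + 1})"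
    by simp
  then have "((\<lambda>u. W (t - 1) + integral {t - 1..u} g) has_vector_derivative g t) (at t within {t - 1<..<t + 1})"
    by (rule has_vector_derivative_within_subset) auto
  then have "((\<lambda>u. W (t - 1) + integral {t - 1..u} g) has_vector_derivative g t) (at t)"
    by (subst (asm) at_within_open) auto
  then have "(W has_vector_derivative g t) (at t)"
  proof (rule has_vector_derivative_transform_within_open[of _ _ _ "{t-1<..}"])
    fix u assume "u \<in> {t - 1<..}"
    then show "W (t - 1) + integral {t - 1..u} g = W u" by (intro W[symmetric]) simp
  qed auto
  then have "((\<lambda>t. exp (- t) *\<^sub>R W t) has_vector_derivative (exp (- t) *\<^sub>R g t + (- exp (- t)) *\<^sub>R W t)) (at t)"
  proof (intro has_vector_derivative_scaleR)
    show "((\<lambda>t. exp (- t)) has_field_derivative (- exp (- t))) (at t)"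
      by (rule derivative_eq_intros refl | simp)+
  qed
  moreover have "exp (- t) *\<^sub>R g t + (- exp (- t)) *\<^sub>R W t = Y t - (\<integral>\<tau>. Y (t - \<tau>) \<partial>expM)"
    unfolding V[of t] by (simp add: g_def W_def flip: exp_add)
  ultimately show ?thesis unfolding V W_def[symmetric] by simp
qed

text \<open>For either sign of \<open>s\<close>, this inverts \<open>D + s\<close> on bounded functions, where \<open>D\<close> is the
  derivative along the flow with frequency vector \<open>(1, \<alpha>)\<close>.\<close>

definition resolv :: "real \<Rightarrow> real \<Rightarrow> (complex \<times> complex \<Rightarrow> complex) \<Rightarrow> complex \<times> complex \<Rightarrow> complex" where
  "resolv \<alpha> s \<phi> \<psi> = (\<integral>\<tau>. \<phi> (fst \<psi> - of_real (\<tau> / s), snd \<psi> - of_real (\<alpha> * \<tau> / s)) \<partial>expM) / of_real s"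

lemma strip_shift: "\<psi> \<in> strip \<rho> \<Longrightarrow> (fst \<psi> - of_real a, snd \<psi> - of_real b) \<in> strip \<rho>"
  by (simp add: mem_strip)

lemma resolv_cont:
  assumes "continuous_on (strip \<rho>) \<phi>" "\<psi> \<in> strip \<rho>"
  shows "continuous_on UNIV (\<lambda>\<tau>. \<phi> (fst \<psi> - of_real (\<tau> / s), snd \<psi> - of_real (\<alpha> * \<tau> / s)))"
proof -
  have c: "continuous_on UNIV (\<lambda>\<tau>. (fst \<psi> - complex_of_real (\<tau> / s), snd \<psi> - complex_of_real (\<alpha> * \<tau> / s)))"
    unfolding divide_inverse by (intro continuous_intros)
  show ?thesis
    by (rule continuous_on_compose2[OF assms(1) c]) (use strip_shift[OF assms(2)] in blast)
qed

text \<open>The values averaged are taken at real translates of \<open>\<psi>\<close>, so no width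
  of the strip is lost; the price is \<open>1 / \<bar>s\<bar>\<close>.\<close>

lemma resolv_bound:
  assumes "s \<noteq> 0" "\<And>\<psi>. \<psi> \<in> strip \<rho> \<Longrightarrow> norm (\<phi> \<psi>) \<le> C" "\<psi> \<in> strip \<rho>"
  shows "norm (resolv \<alpha> s \<phi> \<psi>) \<le> C / \<bar>s\<bar>"
proof -
  have "norm (\<integral>\<tau>. \<phi> (fst \<psi> - of_real (\<tau> / s), snd \<psi> - of_real (\<alpha> * \<tau> / s)) \<partial>expM) \<le> C"
    by (rule integral_norm_bound_prob[OF prob_space_expM]) (rule assms(2)[OF strip_shift[OF assms(3)]])
  then show ?thesis using assms(1) by (simp add: resolv_def norm_divide divide_right_mono)
qed

lemma resolv_diff:
  assumes "continuous_on (strip \<rho>) \<phi>" "\<And>\<psi>. \<psi> \<in> strip \<rho> \<Longrightarrow> norm (\<phi> \<psi>) \<le> C"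
    "continuous_on (strip \<rho>) \<phi>'" "\<And>\<psi>. \<psi> \<in> strip \<rho> \<Longrightarrow> norm (\<phi>' \<psi>) \<le> C'" "\<psi> \<in> strip \<rho>"
  shows "resolv \<alpha> s (\<lambda>\<psi>. \<phi> \<psi> - \<phi>' \<psi>) \<psi> = resolv \<alpha> s \<phi> \<psi> - resolv \<alpha> s \<phi>' \<psi>"
proof -
  have "integrable expM (\<lambda>\<tau>. \<phi> (fst \<psi> - of_real (\<tau> / s), snd \<psi> - of_real (\<alpha> * \<tau> / s)))"
    by (rule integrable_expM[OF resolv_cont[OF assms(1,5)] assms(2)[OF strip_shift[OF assms(5)]]])
  moreover have "integrable expM (\<lambda>\<tau>. \<phi>' (fst \<psi> - of_real (\<tau> / s), snd \<psi> - of_real (\<alpha> * \<tau> / s)))"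
    by (rule integrable_expM[OF resolv_cont[OF assms(3,5)] assms(4)[OF strip_shift[OF assms(5)]]])
  ultimately show ?thesis unfolding resolv_def by (simp add: diff_divide_distrib)
qed

lemma strip_family_locally_bounded:
  assumes "strip_family E \<rho> \<phi>" "compact K" "K \<subseteq> E"
  obtains C where "\<And>e \<psi>. e \<in> K \<Longrightarrow> \<psi> \<in> strip \<rho> \<Longrightarrow> norm (\<phi> e \<psi>) \<le> C"
proof -
  have "continuous_on (E \<times> strip \<rho>) (\<lambda>p. \<phi> (fst p) (snd p))" using assms(1) by (simp add: strip_family_def)
  then have "continuous_on (K \<times> strip_cell \<rho>) (\<lambda>p. \<phi> (fst p) (snd p))"
    by (rule continuous_on_subset) (use assms(3) strip_cell_subset in auto)
  then have "compact ((\<lambda>p. \<phi> (fst p) (snd p)) ` (K \<times> strip_cell \<rho>))"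
    by (rule compact_continuous_image) (intro compact_Times assms compact_strip_cell)
  then have "bounded ((\<lambda>p. \<phi> (fst p) (snd p)) ` (K \<times> strip_cell \<rho>))" by (rule compact_imp_bounded)
  then obtain C where C: "\<And>e \<psi>. e \<in> K \<Longrightarrow> \<psi> \<in> strip_cell \<rho> \<Longrightarrow> norm (\<phi> e \<psi>) \<le> C"
    unfolding bounded_iff by fastforce
  have "norm (\<phi> e (z, w)) \<le> C" if e: "e \<in> K" and zw: "(z, w) \<in> strip \<rho>" for e z w
  proof -
    have p: "periodic2_on (\<phi> e) (strip \<rho>)"
      using assms(1,3) e by (auto simp: strip_family_def strip_analytic_def)
    show ?thesis using periodic_reduce[OF zw] C[OF e] p by metis
  qed
  then show ?thesis using that by (metis prod.collapse)
qed

text \<open>Dominated convergence along a sequence of parameters and points. The parameters together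
  with their limit form a compact set, on which the family has a common bound.\<close>

lemma resolv_continuous:
  assumes \<phi>: "strip_family E \<rho> \<phi>" and s: "continuous_on E s" "\<And>e. e \<in> E \<Longrightarrow> s e \<noteq> 0"
  shows "continuous_on (E \<times> strip \<rho>) (\<lambda>p. resolv \<alpha> (s (fst p)) (\<phi> (fst p)) (snd p))"
proof (rule continuous_on_sequentiallyI)
  fix u :: "nat \<Rightarrow> real \<times> complex \<times> complex" and a
  assume u: "\<forall>n. u n \<in> E \<times> strip \<rho>" and a: "a \<in> E \<times> strip \<rho>" and lim: "u \<longlonglongrightarrow> a"
  define e \<psi> where "e n = fst (u n)" and "\<psi> n = snd (u n)" for n
  define e0 \<psi>0 where "e0 = fst a" and "\<psi>0 = snd a"
  have mem: "e n \<in> E" "\<psi> n \<in> strip \<rho>" "e0 \<in> E" "\<psi>0 \<in> strip \<rho>" for n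
    using u a by (auto simp: e_def \<psi>_def e0_def \<psi>0_def mem_Times_iff)
  have le: "e \<longlonglongrightarrow> e0" and l\<psi>: "\<psi> \<longlonglongrightarrow> \<psi>0"
    using tendsto_fst[OF lim] tendsto_snd[OF lim] by (simp_all add: e_def[abs_def] \<psi>_def[abs_def] e0_def \<psi>0_def)
  have ls: "(\<lambda>n. s (e n)) \<longlonglongrightarrow> s e0"
    by (rule continuous_on_tendsto_compose[OF s(1) le]) (use mem in auto)
  have s0: "s e0 \<noteq> 0" using s(2) mem by blast
  have cp: "continuous_on (E \<times> strip \<rho>) (\<lambda>p. \<phi> (fst p) (snd p))" using \<phi> by (simp add: strip_family_def)
  have "compact (insert e0 (range e))" by (rule compact_sequence_with_limit[OF le])
  then obtain C where C: "\<And>x \<psi>. x \<in> insert e0 (range e) \<Longrightarrow> \<psi> \<in> strip \<rho> \<Longrightarrow> norm (\<phi> x \<psi>) \<le> C"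
    using strip_family_locally_bounded[OF \<phi>, of "insert e0 (range e)"] mem by blast
  define f where "f x \<psi> \<tau> = \<phi> x (fst \<psi> - of_real (\<tau> / s x), snd \<psi> - of_real (\<alpha> * \<tau> / s x))" for x \<psi> \<tau>
  have meas: "f x \<psi> \<in> borel_measurable expM" if "x \<in> E" "\<psi> \<in> strip \<rho>" for x \<psi>
    unfolding f_def by (rule borel_measurable_expM[OF resolv_cont])
      (use \<phi> that in \<open>auto simp: strip_family_def strip_analytic_def\<close>)
  have "(\<lambda>n. \<integral>\<tau>. f (e n) (\<psi> n) \<tau> \<partial>expM) \<longlonglongrightarrow> (\<integral>\<tau>. f e0 \<psi>0 \<tau> \<partial>expM)"
  proof (rule integral_dominated_convergence[where w = "\<lambda>_. C"])
    show "AE \<tau> in expM. (\<lambda>n. f (e n) (\<psi> n) \<tau>) \<longlonglongrightarrow> f e0 \<psi>0 \<tau>"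
    proof (rule AE_I2)
      fix \<tau>
      have "(\<lambda>n. (\<lambda>p. \<phi> (fst p) (snd p)) (e n, fst (\<psi> n) - of_real (\<tau> / s (e n)), snd (\<psi> n) - of_real (\<alpha> * \<tau> / s (e n))))
          \<longlonglongrightarrow> (\<lambda>p. \<phi> (fst p) (snd p)) (e0, fst \<psi>0 - of_real (\<tau> / s e0), snd \<psi>0 - of_real (\<alpha> * \<tau> / s e0))"
      proof (rule continuous_on_tendsto_compose[OF cp])
        show "(\<lambda>n. (e n, fst (\<psi> n) - complex_of_real (\<tau> / s (e n)), snd (\<psi> n) - complex_of_real (\<alpha> * \<tau> / s (e n))))
           \<longlonglongrightarrow> (e0, fst \<psi>0 - of_real (\<tau> / s e0), snd \<psi>0 - of_real (\<alpha> * \<tau> / s e0))"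
          using s0 by (intro tendsto_intros le ls l\<psi>)
      qed (intro always_eventually allI SigmaI mem strip_shift)+
      then show "(\<lambda>n. f (e n) (\<psi> n) \<tau>) \<longlonglongrightarrow> f e0 \<psi>0 \<tau>" by (simp add: f_def)
    qed
    show "AE \<tau> in expM. norm (f (e n) (\<psi> n) \<tau>) \<le> C" for n
      unfolding f_def by (intro AE_I2 C strip_shift mem) auto
  qed (use meas mem in auto)
  then have "(\<lambda>n. (\<integral>\<tau>. f (e n) (\<psi> n) \<tau> \<partial>expM) / of_real (s (e n))) \<longlonglongrightarrow> (\<integral>\<tau>. f e0 \<psi>0 \<tau> \<partial>expM) / of_real (s e0)"
    using s0 by (intro tendsto_intros ls) auto
  then show "(\<lambda>n. resolv \<alpha> (s (fst (u n))) (\<phi> (fst (u n))) (snd (u n))) \<longlonglongrightarrow> resolv \<alpha> (s (fst a)) (\<phi> (fst a)) (snd a)"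
    unfolding resolv_def f_def e_def \<psi>_def e0_def \<psi>0_def .
qed

lemma strip_analytic_resolv:
  assumes an: "strip_analytic \<rho> \<phi>" and s: "s \<noteq> 0" and \<rho>: "\<rho> \<ge> 0"
  shows "strip_analytic \<rho> (resolv \<alpha> s \<phi>)"
proof -
  obtain C where C: "\<And>\<psi>. \<psi> \<in> strip \<rho> \<Longrightarrow> norm (\<phi> \<psi>) \<le> C" using strip_analytic_bounded[OF an] by blast
  have c: "continuous_on (strip \<rho>) \<phi>" using an by (simp add: strip_analytic_def)
  have p: "periodic2_on \<phi> (strip \<rho>)" using an by (simp add: strip_analytic_def)
  have meas: "(\<lambda>\<tau>. \<phi> (z - of_real (\<tau> / s), w - of_real (\<alpha> * \<tau> / s))) \<in> borel_measurable expM"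
    if "(z, w) \<in> strip \<rho>" for z w
    using borel_measurable_expM[OF resolv_cont[OF c that]] by simp
  show ?thesis unfolding strip_analytic_def
  proof (intro conjI allI impI)
    have "continuous_on ({0::real} \<times> strip \<rho>) (\<lambda>p. resolv \<alpha> s \<phi> (snd p))"
      using resolv_continuous[of "{0}" \<rho> "\<lambda>_. \<phi>" "\<lambda>_. s" \<alpha>] strip_family_fixed[OF an] s by simp
    moreover have "continuous_on (strip \<rho>) (\<lambda>\<psi>. (0::real, \<psi>))" by (intro continuous_intros)
    ultimately have "continuous_on (strip \<rho>) (\<lambda>\<psi>. (\<lambda>p. resolv \<alpha> s \<phi> (snd p)) (0::real, \<psi>))"
      by (rule continuous_on_compose2) auto
    then show "continuous_on (strip \<rho>) (resolv \<alpha> s \<phi>)" by simp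
    show "(\<lambda>z. resolv \<alpha> s \<phi> (z, w)) holomorphic_on {z. \<bar>Im z\<bar> < \<rho>}" if w: "\<bar>Im w\<bar> \<le> \<rho>" for w
      unfolding resolv_def fst_conv snd_conv
    proof (intro holomorphic_on_divide holomorphic_on_const holomorphic_on_integral[of _ _ _ C] expM.finite_measure_axioms open_Im_strip)
      fix \<tau>
      have "((\<lambda>z. \<phi> (z, w - of_real (\<alpha> * \<tau> / s))) \<circ> (\<lambda>z. z - of_real (\<tau> / s))) holomorphic_on {z. \<bar>Im z\<bar> < \<rho>}"
        by (rule holomorphic_on_compose_gen[of _ _ _ "{z. \<bar>Im z\<bar> < \<rho>}"])
           (use an w in \<open>auto intro!: holomorphic_intros simp: strip_analytic_def\<close>)
      then show "(\<lambda>z. \<phi> (z - of_real (\<tau> / s), w - of_real (\<alpha> * \<tau> / s))) holomorphic_on {z. \<bar>Im z\<bar> < \<rho>}"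
        by (simp add: o_def)
    qed (use s w C meas in \<open>auto simp: strip_def\<close>)
    show "(\<lambda>w. resolv \<alpha> s \<phi> (z, w)) holomorphic_on {z. \<bar>Im z\<bar> < \<rho>}" if z: "\<bar>Im z\<bar> \<le> \<rho>" for z
      unfolding resolv_def fst_conv snd_conv
    proof (intro holomorphic_on_divide holomorphic_on_const holomorphic_on_integral[of _ _ _ C] expM.finite_measure_axioms open_Im_strip)
      fix \<tau>
      have "((\<lambda>w. \<phi> (z - of_real (\<tau> / s), w)) \<circ> (\<lambda>w. w - of_real (\<alpha> * \<tau> / s))) holomorphic_on {z. \<bar>Im z\<bar> < \<rho>}"
        by (rule holomorphic_on_compose_gen[of _ _ _ "{z. \<bar>Im z\<bar> < \<rho>}"])
           (use an z in \<open>auto intro!: holomorphic_intros simp: strip_analytic_def\<close>)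
      then show "(\<lambda>w. \<phi> (z - of_real (\<tau> / s), w - of_real (\<alpha> * \<tau> / s))) holomorphic_on {z. \<bar>Im z\<bar> < \<rho>}"
        by (simp add: o_def)
    qed (use s z C meas in \<open>auto simp: strip_def\<close>)
    show "periodic2_on (resolv \<alpha> s \<phi>) (strip \<rho>)" unfolding periodic2_on_def
    proof (clarify, intro conjI)
      fix z w assume zw: "(z, w) \<in> strip \<rho>"
      have 1: "\<phi> (z + of_real (2 * pi) - of_real a, w - of_real b) = \<phi> (z - of_real a, w - of_real b)"
        "\<phi> (z - of_real a, w + of_real (2 * pi) - of_real b) = \<phi> (z - of_real a, w - of_real b)" for a b
        using periodic2_onD[OF p, of "z - of_real a" "w - of_real b"] strip_shift[OF zw, of a b]
        by (simp_all add: algebra_simps)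
      show "resolv \<alpha> s \<phi> (z + of_real (2 * pi), w) = resolv \<alpha> s \<phi> (z, w)"
        "resolv \<alpha> s \<phi> (z, w + of_real (2 * pi)) = resolv \<alpha> s \<phi> (z, w)"
        unfolding resolv_def fst_conv snd_conv 1 by simp_all
    qed
    fix x y :: real
    have r: "\<phi> (of_real x - of_real a, of_real y - of_real b) = of_real (Re (\<phi> (of_real x - of_real a, of_real y - of_real b)))" for a b
    proof -
      have "\<phi> (of_real (x - a), of_real (y - b)) \<in> \<real>" using an unfolding strip_analytic_def by blast
      then show ?thesis by (simp add: of_real_Re)
    qed
    have "(\<integral>\<tau>. \<phi> (of_real x - of_real (\<tau> / s), of_real y - of_real (\<alpha> * \<tau> / s)) \<partial>expM) =
        of_real (\<integral>\<tau>. Re (\<phi> (of_real x - of_real (\<tau> / s), of_real y - of_real (\<alpha> * \<tau> / s))) \<partial>expM)"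
      by (subst r) (rule integral_complex_of_real)
    then show "resolv \<alpha> s \<phi> (of_real x, of_real y) \<in> \<real>"
      unfolding resolv_def fst_conv snd_conv by (simp only: Reals_divide Reals_of_real)
  qed
qed

lemma strip_family_resolv:
  assumes "strip_family E \<rho> \<phi>" "continuous_on E s" "\<And>e. e \<in> E \<Longrightarrow> s e \<noteq> 0" "\<rho> \<ge> 0"
  shows "strip_family E \<rho> (\<lambda>e. resolv \<alpha> (s e) (\<phi> e))"
  unfolding strip_family_def
proof (intro conjI ballI)
  show "continuous_on (E \<times> strip \<rho>) (\<lambda>p. resolv \<alpha> (s (fst p)) (\<phi> (fst p)) (snd p))"
    by (rule resolv_continuous[OF assms(1-3)])
  fix e assume "e \<in> E"
  then show "strip_analytic \<rho> (resolv \<alpha> (s e) (\<phi> e))"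
    using assms by (intro strip_analytic_resolv) (auto simp: strip_family_def)
qed

text \<open>Along an orbit the average is the convolution of \<open>integral_expM_deriv\<close> with
  time rescaled by \<open>s\<close>; a negative \<open>s\<close> just reverses time. So
  \<open>(D + s)\<close> applied to the resolvent returns \<open>\<phi>\<close>.\<close>

lemma resolv_ode:
  assumes an: "strip_analytic \<rho> \<phi>" and s: "s \<noteq> 0" and \<rho>: "\<rho> \<ge> 0"
  shows "((\<lambda>t. resolv \<alpha> s \<phi> (of_real t, of_real (\<alpha> * t))) has_vector_derivative
    (\<phi> (of_real t, of_real (\<alpha> * t)) - of_real s * resolv \<alpha> s \<phi> (of_real t, of_real (\<alpha> * t)))) (at t)"
proof -
  obtain C where C: "\<And>\<psi>. \<psi> \<in> strip \<rho> \<Longrightarrow> norm (\<phi> \<psi>) \<le> C" using strip_analytic_bounded[OF an] by blast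
  define Y where "Y t = \<phi> (of_real (t / s), of_real (\<alpha> * t / s))" for t
  have Yc: "continuous_on UNIV Y" unfolding Y_def
    by (rule continuous_on_compose2[of "strip \<rho>" \<phi>])
       (use an s \<rho> in \<open>auto simp: strip_analytic_def strip_def intro!: continuous_intros\<close>)
  have YC: "norm (Y t) \<le> C" for t unfolding Y_def using \<rho> by (intro C) (simp add: strip_def)
  define V where "V t = (\<integral>\<tau>. Y (t - \<tau>) \<partial>expM)" for t
  have R: "resolv \<alpha> s \<phi> (of_real t, of_real (\<alpha> * t)) = V (s * t) / of_real s" for t
  proof -
    have "\<phi> (of_real t - of_real (\<tau> / s), of_real (\<alpha> * t) - of_real (\<alpha> * \<tau> / s)) = Y (s * t - \<tau>)" for \<tau>
    proof -
      have "t - \<tau> / s = (s * t - \<tau>) / s" "\<alpha> * t - \<alpha> * \<tau> / s = \<alpha> * (s * t - \<tau>) / s"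
        using s by (simp_all add: field_simps)
      then show ?thesis unfolding Y_def of_real_diff[symmetric] by simp
    qed
    then show ?thesis unfolding resolv_def V_def by simp
  qed
  have "(V has_vector_derivative (Y (s * t) - V (s * t))) (at (s * t))"
    unfolding V_def by (rule integral_expM_deriv[OF Yc YC])
  then have "((V \<circ> (\<lambda>t. s * t)) has_vector_derivative (s *\<^sub>R (Y (s * t) - V (s * t)))) (at t)"
    by (intro vector_diff_chain_at) (auto intro!: derivative_eq_intros)
  then have "((\<lambda>t. (1 / s) *\<^sub>R V (s * t)) has_vector_derivative ((1 / s) *\<^sub>R (s *\<^sub>R (Y (s * t) - V (s * t))))) (at t)"
    unfolding o_def by (rule bounded_linear.has_vector_derivative[OF bounded_linear_scaleR_right])
  moreover have "(\<lambda>t. (1 / s) *\<^sub>R V (s * t)) = (\<lambda>t. resolv \<alpha> s \<phi> (of_real t, of_real (\<alpha> * t)))"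
    by (rule ext) (simp only: R, simp add: scaleR_conv_of_real)
  moreover have "(1 / s) *\<^sub>R (s *\<^sub>R (Y (s * t) - V (s * t))) = \<phi> (of_real t, of_real (\<alpha> * t)) - of_real s * resolv \<alpha> s \<phi> (of_real t, of_real (\<alpha> * t))"
  proof -
    have y: "Y (s * t) = \<phi> (of_real t, of_real (\<alpha> * t))" using s by (simp add: Y_def)
    show ?thesis unfolding R y[symmetric] using s by simp
  qed
  ultimately show ?thesis by simp
qed

definition freq :: "real \<Rightarrow> int \<times> int \<Rightarrow> real" where
  "freq \<alpha> \<nu> = of_int (fst \<nu>) + \<alpha> * of_int (snd \<nu>)"

text \<open>The Laplace integral \<open>I\<close> is not computed: differentiating
  \<open>Y t * I\<close> at \<open>0\<close> directly and through \<open>integral_expM_deriv\<close>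
  gives \<open>1 - I = \<i> * b * I\<close>.\<close>

lemma resolv_emode:
  assumes s: "s \<noteq> 0"
  shows "resolv \<alpha> s (emode \<nu>) \<psi> = emode \<nu> \<psi> / (of_real s + \<i> * of_real (freq \<alpha> \<nu>))"
proof -
  define b where "b = freq \<alpha> \<nu> / s"
  define Y where "Y t = exp (\<i> * of_real (b * t))" for t
  define I where "I = (\<integral>\<tau>. Y (- \<tau>) \<partial>expM)"
  have V: "(\<integral>\<tau>. Y (t - \<tau>) \<partial>expM) = Y t * I" for t
  proof -
    have "Y (t - \<tau>) = Y t * Y (- \<tau>)" for \<tau> by (simp add: Y_def ring_distribs exp_diff exp_minus divide_inverse)
    then show ?thesis by (simp add: I_def)
  qed
  have "((\<lambda>t. \<integral>\<tau>. Y (t - \<tau>) \<partial>expM) has_vector_derivative (Y 0 - (\<integral>\<tau>. Y (0 - \<tau>) \<partial>expM))) (at 0)"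
    by (rule integral_expM_deriv[of _ 1]) (auto simp: Y_def intro!: continuous_intros)
  then have 1: "((\<lambda>t. Y t * I) has_vector_derivative (1 - I)) (at 0)"
    unfolding V by (simp add: Y_def)
  have "(Y has_vector_derivative (\<i> * of_real b)) (at 0)"
  proof -
    have "((\<lambda>z. exp (\<i> * of_real b * z)) has_field_derivative \<i> * of_real b) (at (of_real 0))"
      by (rule derivative_eq_intros refl | simp)+
    then have "(((\<lambda>z. exp (\<i> * of_real b * z)) \<circ> of_real) has_vector_derivative 1 * (\<i> * of_real b)) (at 0)"
      by (intro field_vector_diff_chain_at) (auto intro!: derivative_eq_intros)
    then show ?thesis by (simp add: o_def Y_def[abs_def] mult.assoc)
  qed
  then have 2: "((\<lambda>t. Y t * I) has_vector_derivative (\<i> * of_real b * I)) (at 0)"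
    by (rule has_vector_derivative_mult_left)
  have h: "1 - I = \<i> * of_real b * I" using vector_derivative_unique_at[OF 1 2] .
  have "(1 + \<i> * of_real b) * I = I + \<i> * of_real b * I" by (simp add: ring_distribs)
  also have "\<dots> = 1" unfolding h[symmetric] by simp
  finally have I: "(of_real s + \<i> * of_real (freq \<alpha> \<nu>)) * I = of_real s"
    using s by (simp add: b_def field_simps)
  then have nz: "of_real s + \<i> * of_real (freq \<alpha> \<nu>) \<noteq> 0" using s by auto
  have "emode \<nu> (fst \<psi> - of_real (\<tau> / s), snd \<psi> - of_real (\<alpha> * \<tau> / s)) = emode \<nu> \<psi> * Y (- \<tau>)" for \<tau>
  proof -
    have "\<i> * (of_int (fst \<nu>) * (fst \<psi> - of_real (\<tau> / s)) + of_int (snd \<nu>) * (snd \<psi> - of_real (\<alpha> * \<tau> / s)))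
      = \<i> * (of_int (fst \<nu>) * fst \<psi> + of_int (snd \<nu>) * snd \<psi>) + \<i> * of_real (b * (- \<tau>))"
      using s by (simp add: b_def freq_def field_simps)
    then show ?thesis by (simp only: emode_def Y_def fst_conv snd_conv exp_add)
  qed
  then have "resolv \<alpha> s (emode \<nu>) \<psi> = emode \<nu> \<psi> * I / of_real s" by (simp add: resolv_def I_def)
  also have "I = of_real s / (of_real s + \<i> * of_real (freq \<alpha> \<nu>))"
    using I nz by (simp add: field_simps)
  finally show ?thesis using s by simp
qed

text \<open>For finite partial sums this is \<open>resolv_emode\<close>; the sup bound of the
  resolvent transports the uniform tail estimate \<open>G - sum g F\<close>, so the transformed
  partial sums converge too.\<close>

lemma resolv_fourier:
  assumes an: "strip_analytic \<rho> \<phi>" and s: "s \<noteq> 0" and \<rho>': "\<rho>' < \<rho>" "0 \<le> \<rho>'"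
    and c: "\<And>\<psi>. \<psi> \<in> strip \<rho>' \<Longrightarrow> ((\<lambda>\<nu>. c \<nu> * emode \<nu> \<psi>) has_sum \<phi> \<psi>) UNIV"
    and sm: "(\<lambda>\<nu>. norm (c \<nu>) * exp (\<rho>' * nrm1 \<nu>)) summable_on UNIV" and \<psi>: "\<psi> \<in> strip \<rho>'"
  shows "((\<lambda>\<nu>. c \<nu> / (of_real s + \<i> * of_real (freq \<alpha> \<nu>)) * emode \<nu> \<psi>) has_sum resolv \<alpha> s \<phi> \<psi>) UNIV"
proof -
  define g where "g \<nu> = norm (c \<nu>) * exp (\<rho>' * nrm1 \<nu>)" for \<nu>
  define G where "G = infsum g UNIV"
  have gs: "(g has_sum G) UNIV" using sm unfolding g_def[abs_def] G_def by (rule has_sum_infsum)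
  have an': "strip_analytic \<rho>' \<phi>" using strip_analytic_mono[OF an] \<rho>' by auto
  then obtain C where C: "\<And>\<psi>. \<psi> \<in> strip \<rho>' \<Longrightarrow> norm (\<phi> \<psi>) \<le> C" using strip_analytic_bounded by blast
  have cont: "continuous_on (strip \<rho>') \<phi>" using an' by (simp add: strip_analytic_def)
  have fin: "norm ((\<Sum>\<nu>\<in>F. c \<nu> / (of_real s + \<i> * of_real (freq \<alpha> \<nu>)) * emode \<nu> \<psi>) - resolv \<alpha> s \<phi> \<psi>) \<le> (G - sum g F) / \<bar>s\<bar>"
    if F: "finite F" for F
  proof -
    define P where "P \<psi> = (\<Sum>\<nu>\<in>F. c \<nu> * emode \<nu> \<psi>)" for \<psi>
    have diff: "norm (P \<psi>' - \<phi> \<psi>') \<le> G - sum g F" if "\<psi>' \<in> strip \<rho>'" for \<psi>'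
    proof -
      have f: "((\<lambda>\<nu>. c \<nu> * emode \<nu> \<psi>') has_sum (\<phi> \<psi>' - P \<psi>')) (UNIV - F)"
        unfolding P_def using F by (intro has_sum_Diff c[OF that] has_sum_finite) auto
      have g: "(g has_sum (G - sum g F)) (UNIV - F)"
        using F by (intro has_sum_Diff gs has_sum_finite) auto
      have le: "norm (c \<nu> * emode \<nu> \<psi>') \<le> g \<nu>" for \<nu>
        unfolding g_def norm_mult by (intro mult_left_mono norm_emode_le that) auto
      have "(\<lambda>\<nu>. norm (c \<nu> * emode \<nu> \<psi>')) summable_on (UNIV - F)"
        by (rule Infinite_Sum.abs_summable_on_comparison_test'[OF has_sum_imp_summable[OF g] le])
      then have n: "((\<lambda>\<nu>. norm (c \<nu> * emode \<nu> \<psi>')) has_sum (\<Sum>\<^sub>\<infinity>\<nu>\<in>UNIV - F. norm (c \<nu> * emode \<nu> \<psi>'))) (UNIV - F)"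
        by (rule has_sum_infsum)
      have "norm (\<phi> \<psi>' - P \<psi>') \<le> G - sum g F"
        using norm_has_sum_bound[OF n f] has_sum_mono[OF n g le] by linarith
      then show ?thesis by (simp add: norm_minus_commute)
    qed
    have em_c: "continuous_on S (emode \<nu>)" for \<nu> S unfolding emode_def by (intro continuous_intros)
    have Pc: "continuous_on (strip \<rho>') P"
      unfolding P_def by (intro continuous_intros em_c)
    have Pb: "norm (P \<psi>') \<le> sum g F" if "\<psi>' \<in> strip \<rho>'" for \<psi>'
      unfolding P_def g_def by (rule sum_norm_le) (unfold norm_mult, intro mult_left_mono norm_emode_le that, auto)
    have "resolv \<alpha> s P \<psi> = (\<Sum>\<nu>\<in>F. c \<nu> * resolv \<alpha> s (emode \<nu>) \<psi>)"
    proof -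
      have "integrable expM (\<lambda>\<tau>. emode \<nu> (fst \<psi> - of_real (\<tau> / s), snd \<psi> - of_real (\<alpha> * \<tau> / s)))" for \<nu>
        by (rule integrable_expM[OF resolv_cont[OF em_c \<psi>] norm_emode_le[OF strip_shift[OF \<psi>]]])
      then show ?thesis unfolding resolv_def P_def by (simp add: sum_divide_distrib)
    qed
    also have "\<dots> = (\<Sum>\<nu>\<in>F. c \<nu> / (of_real s + \<i> * of_real (freq \<alpha> \<nu>)) * emode \<nu> \<psi>)"
      by (simp add: resolv_emode[OF s])
    finally have "(\<Sum>\<nu>\<in>F. c \<nu> / (of_real s + \<i> * of_real (freq \<alpha> \<nu>)) * emode \<nu> \<psi>) - resolv \<alpha> s \<phi> \<psi>
        = resolv \<alpha> s (\<lambda>\<psi>. P \<psi> - \<phi> \<psi>) \<psi>"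
      using resolv_diff[OF Pc Pb cont C \<psi>] by simp
    then show ?thesis using resolv_bound[OF s diff \<psi>] by simp
  qed
  have "((\<lambda>F. (G - sum g F) / \<bar>s\<bar>) \<longlongrightarrow> (G - G) / \<bar>s\<bar>) (finite_subsets_at_top UNIV)"
    using gs s unfolding has_sum_def by (intro tendsto_intros) auto
  then have lim0: "((\<lambda>F. (G - sum g F) / \<bar>s\<bar>) \<longlongrightarrow> 0) (finite_subsets_at_top UNIV)" by simp
  have "((\<lambda>F. (\<Sum>\<nu>\<in>F. c \<nu> / (of_real s + \<i> * of_real (freq \<alpha> \<nu>)) * emode \<nu> \<psi>) - resolv \<alpha> s \<phi> \<psi>) \<longlongrightarrow> 0) (finite_subsets_at_top UNIV)"
  proof (rule Lim_null_comparison[OF _ lim0])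
    show "\<forall>\<^sub>F F in finite_subsets_at_top UNIV. norm ((\<Sum>\<nu>\<in>F. c \<nu> / (of_real s + \<i> * of_real (freq \<alpha> \<nu>)) * emode \<nu> \<psi>) - resolv \<alpha> s \<phi> \<psi>) \<le> (G - sum g F) / \<bar>s\<bar>"
      by (rule eventually_finite_subsets_at_top_weakI) (rule fin)
  qed
  then show ?thesis unfolding has_sum_def by (rule LIM_zero_cancel)
qed

section \<open>Averages over the torus\<close>

definition torus :: "(real \<times> real) measure" where "torus = circ \<Otimes>\<^sub>M circ"

interpretation circ2: pair_prob_space circ circ ..

lemma prob_space_torus: "prob_space torus"
  unfolding torus_def by (rule circ2.prob_space_axioms)

interpretation torus: prob_space torus by (rule prob_space_torus)

lemma borel_measurable_torus:
  fixes f :: "real \<times> real \<Rightarrow> 'a::topological_space"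
  assumes "continuous_on UNIV f"
  shows "f \<in> borel_measurable torus"
proof -
  have id: "(\<lambda>x. x) \<in> measurable circ borel"
    unfolding measurable_cong_sets[OF sets_circ refl] by (rule measurable_restrict_space1) simp
  have "fst \<in> measurable torus borel"
    unfolding torus_def using measurable_compose[OF measurable_fst[of circ circ] id] by simp
  moreover have "snd \<in> measurable torus borel"
    unfolding torus_def using measurable_compose[OF measurable_snd[of circ circ] id] by simp
  ultimately have "(\<lambda>p. (fst p, snd p)) \<in> measurable torus borel"
    by (intro borel_measurable_Pair)
  then have "(\<lambda>p. p) \<in> measurable torus borel" by simp
  from measurable_compose[OF this borel_measurable_continuous_onI[OF assms]] show ?thesis .
qed

lemma integrable_torus:
  fixes f :: "real \<times> real \<Rightarrow> 'a::{banach, second_countable_topology}"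
  assumes "continuous_on UNIV f" "\<And>p. norm (f p) \<le> B"
  shows "integrable torus f"
  by (rule torus.integrable_const_bound[of _ B]) (use assms borel_measurable_torus in auto)

definition tpt :: "real \<times> real \<Rightarrow> complex \<times> complex" where
  "tpt p = (of_real (fst p), of_real (snd p))"

lemma tpt_strip: "\<rho> \<ge> 0 \<Longrightarrow> tpt p \<in> strip \<rho>"
  by (simp add: tpt_def strip_def)

lemma continuous_on_tpt: "continuous_on (strip \<rho>) \<phi> \<Longrightarrow> \<rho> \<ge> 0 \<Longrightarrow> continuous_on UNIV (\<lambda>p. \<phi> (tpt p))"
  by (rule continuous_on_compose2[of "strip \<rho>" \<phi>]) (auto simp: tpt_def strip_def intro!: continuous_intros)

definition tavg :: "(complex \<times> complex \<Rightarrow> complex) \<Rightarrow> complex" where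
  "tavg \<phi> = (\<integral>p. \<phi> (tpt p) \<partial>torus)"

lemma norm_tavg_le: "(\<And>p. norm (\<phi> (tpt p)) \<le> C) \<Longrightarrow> norm (tavg \<phi>) \<le> C"
  unfolding tavg_def by (rule integral_norm_bound_prob[OF prob_space_torus]) auto

lemma tavg_iterated:
  assumes "continuous_on UNIV (\<lambda>p. \<phi> (tpt p))" "\<And>p. norm (\<phi> (tpt p)) \<le> C"
  shows "tavg \<phi> = (\<integral>x. (\<integral>y. \<phi> (of_real x, of_real y) \<partial>circ) \<partial>circ)"
proof -
  have "integrable (circ \<Otimes>\<^sub>M circ) (\<lambda>p. \<phi> (tpt p))"
    using integrable_torus[OF assms] by (simp add: torus_def)
  from circ2.integral_fst'[OF this] show ?thesis by (simp add: tavg_def torus_def tpt_def)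
qed

lemma strip_analytic_tpt:
  assumes "strip_analytic \<rho> \<phi>" "\<rho> \<ge> 0"
  shows "continuous_on UNIV (\<lambda>p. \<phi> (tpt p))"
    "\<exists>C. \<forall>p. norm (\<phi> (tpt p)) \<le> C"
proof -
  show "continuous_on UNIV (\<lambda>p. \<phi> (tpt p))"
    by (rule continuous_on_tpt) (use assms in \<open>auto simp: strip_analytic_def\<close>)
  obtain C where "\<And>\<psi>. \<psi> \<in> strip \<rho> \<Longrightarrow> norm (\<phi> \<psi>) \<le> C" using strip_analytic_bounded[OF assms(1)] by blast
  then show "\<exists>C. \<forall>p. norm (\<phi> (tpt p)) \<le> C" using tpt_strip[OF assms(2)] by blast
qed

lemma integrable_strip_analytic:
  assumes "strip_analytic \<rho> \<phi>" "\<rho> \<ge> 0"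
  shows "integrable torus (\<lambda>p. \<phi> (tpt p))"
  using strip_analytic_tpt[OF assms] integrable_torus by blast

lemma emode_tpt_cont: "continuous_on UNIV (\<lambda>p. emode \<nu> (tpt p))"
  unfolding emode_def tpt_def by (intro continuous_intros)

lemma norm_emode_tpt: "norm (emode \<nu> (tpt p)) = 1"
  by (simp add: tpt_def norm_emode_real)

lemma tavg_emode: "tavg (emode \<nu>) = (if \<nu> = (0, 0) then 1 else 0)"
proof -
  have "tavg (emode \<nu>) = (\<integral>x. (\<integral>y. emode \<nu> (of_real x, of_real y) \<partial>circ) \<partial>circ)"
    by (rule tavg_iterated[OF emode_tpt_cont, of _ 1]) (simp add: norm_emode_tpt)
  also have "\<dots> = (\<integral>x. exp (\<i> * of_int (fst \<nu>) * of_real x) * (\<integral>y. exp (\<i> * of_int (snd \<nu>) * of_real y) \<partial>circ) \<partial>circ)"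
  proof -
    have "emode \<nu> (of_real x, of_real y) = exp (\<i> * of_int (fst \<nu>) * of_real x) * exp (\<i> * of_int (snd \<nu>) * of_real y)" for x y
      by (simp add: emode_def ring_distribs exp_add mult.assoc)
    then show ?thesis by simp
  qed
  also have "\<dots> = (if \<nu> = (0, 0) then 1 else 0)"
    by (simp add: integral_circ_exp prod_eq_iff)
  finally show ?thesis .
qed

lemma emode_mult: "emode \<nu> \<psi> * emode \<mu> \<psi> = emode (\<nu> + \<mu>) \<psi>"
  unfolding emode_def exp_add[symmetric] by (rule arg_cong[of _ _ exp]) (simp add: algebra_simps)

lemma fcoef_eq_tavg:
  assumes "strip_analytic \<rho> \<phi>" "\<rho> \<ge> 0"
  shows "fcoef \<phi> \<nu> = tavg (\<lambda>\<psi>. \<phi> \<psi> * emode (- \<nu>) \<psi>)"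
proof -
  obtain C where C: "\<And>p. norm (\<phi> (tpt p)) \<le> C" using strip_analytic_tpt[OF assms] by blast
  have "tavg (\<lambda>\<psi>. \<phi> \<psi> * emode (- \<nu>) \<psi>) = (\<integral>x. (\<integral>y. \<phi> (of_real x, of_real y) * emode (- \<nu>) (of_real x, of_real y) \<partial>circ) \<partial>circ)"
    by (rule tavg_iterated[of _ C]) (auto intro!: continuous_intros strip_analytic_tpt[OF assms] emode_tpt_cont simp: norm_mult norm_emode_tpt C)
  also have "\<dots> = fcoef \<phi> \<nu>"
  proof -
    have e: "\<phi> (of_real x, of_real y) * emode (- \<nu>) (of_real x, of_real y) =
      (\<phi> (of_real x, of_real y) * exp (- \<i> * of_int (snd \<nu>) * of_real y)) * exp (- \<i> * of_int (fst \<nu>) * of_real x)" for x y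
      by (simp add: emode_def ring_distribs exp_diff exp_minus field_simps)
    show ?thesis unfolding fcoef_def e by (simp only: integral_mult_left_zero)
  qed
  finally show ?thesis by simp
qed

lemma fcoef_0: "strip_analytic \<rho> \<phi> \<Longrightarrow> \<rho> \<ge> 0 \<Longrightarrow> fcoef \<phi> (0, 0) = tavg \<phi>"
  by (subst fcoef_eq_tavg) (auto simp: emode_def tavg_def)

text \<open>Testing a finite partial sum against a mode isolates \<open>c \<nu>\<close>, and the
  tail is uniformly small. It serves to read off the coefficients of \<open>u\<close> from its
  series.\<close>

lemma fcoef_unique:
  assumes an: "strip_analytic \<rho> \<phi>" "\<rho> \<ge> 0"
    and c: "\<And>p. ((\<lambda>\<nu>. c \<nu> * emode \<nu> (tpt p)) has_sum \<phi> (tpt p)) UNIV"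
    and sm: "(\<lambda>\<nu>. norm (c \<nu>)) summable_on UNIV"
  shows "fcoef \<phi> \<nu> = c \<nu>"
proof -
  define g where "g \<nu> = norm (c \<nu>)" for \<nu>
  define G where "G = infsum g UNIV"
  have gs: "(g has_sum G) UNIV" using sm unfolding g_def[abs_def] G_def by (rule has_sum_infsum)
  obtain C where C: "\<And>p. norm (\<phi> (tpt p)) \<le> C" using strip_analytic_tpt[OF an] by blast
  have bd: "norm (fcoef \<phi> \<nu> - c \<nu>) \<le> G - sum g F" if F: "finite F" "\<nu> \<in> F" for F
  proof -
    define P where "P p = (\<Sum>\<mu>\<in>F. c \<mu> * emode \<mu> (tpt p))" for p
    have diff: "norm (\<phi> (tpt p) - P p) \<le> G - sum g F" for p
    proof -
      have f: "((\<lambda>\<nu>. c \<nu> * emode \<nu> (tpt p)) has_sum (\<phi> (tpt p) - P p)) (UNIV - F)"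
        unfolding P_def using F by (intro has_sum_Diff c has_sum_finite) auto
      have "(g has_sum (G - sum g F)) (UNIV - F)"
        using F by (intro has_sum_Diff gs has_sum_finite) auto
      then have n: "((\<lambda>\<nu>. norm (c \<nu> * emode \<nu> (tpt p))) has_sum (G - sum g F)) (UNIV - F)"
        by (simp add: norm_mult norm_emode_tpt g_def[abs_def])
      show ?thesis by (rule norm_has_sum_bound[OF n f])
    qed
    have ie: "integrable torus (\<lambda>p. c \<mu> * emode \<mu> (tpt p) * emode (- \<nu>) (tpt p))" for \<mu>
      by (rule integrable_torus[of _ "norm (c \<mu>)"]) (auto intro!: continuous_intros emode_tpt_cont simp: norm_mult norm_emode_tpt)
    have i1: "integrable torus (\<lambda>p. \<phi> (tpt p) * emode (- \<nu>) (tpt p))"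
      by (rule integrable_torus[of _ C]) (auto intro!: continuous_intros emode_tpt_cont strip_analytic_tpt[OF an] simp: norm_mult norm_emode_tpt C)
    have i2: "integrable torus (\<lambda>p. P p * emode (- \<nu>) (tpt p))"
      unfolding P_def sum_distrib_right by (intro Bochner_Integration.integrable_sum ie)
    have "(\<integral>p. P p * emode (- \<nu>) (tpt p) \<partial>torus) = (\<Sum>\<mu>\<in>F. \<integral>p. c \<mu> * emode \<mu> (tpt p) * emode (- \<nu>) (tpt p) \<partial>torus)"
      unfolding P_def sum_distrib_right by (intro Bochner_Integration.integral_sum ie)
    also have "\<dots> = (\<Sum>\<mu>\<in>F. c \<mu> * tavg (emode (\<mu> - \<nu>)))"
      by (simp add: tavg_def mult.assoc emode_mult)
    also have "\<dots> = (\<Sum>\<mu>\<in>F. if \<mu> = \<nu> then c \<nu> else 0)"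
      by (rule sum.cong) (auto simp: tavg_emode prod_eq_iff)
    also have "\<dots> = c \<nu>" using F by simp
    finally have "fcoef \<phi> \<nu> - c \<nu> = (\<integral>p. \<phi> (tpt p) * emode (- \<nu>) (tpt p) - P p * emode (- \<nu>) (tpt p) \<partial>torus)"
      using i1 i2 by (simp add: fcoef_eq_tavg[OF an] tavg_def)
    also have "norm \<dots> \<le> G - sum g F"
      by (rule integral_norm_bound_prob[OF prob_space_torus])
         (use diff in \<open>simp add: norm_mult norm_emode_tpt flip: left_diff_distrib\<close>)
    finally show ?thesis .
  qed
  have "((\<lambda>F. G - sum g F) \<longlongrightarrow> G - G) (finite_subsets_at_top UNIV)"
    using gs unfolding has_sum_def by (intro tendsto_intros) auto
  moreover have "\<forall>\<^sub>F F in finite_subsets_at_top UNIV. norm (fcoef \<phi> \<nu> - c \<nu>) \<le> G - sum g F"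
    unfolding eventually_finite_subsets_at_top by (rule exI[of _ "{\<nu>}"]) (auto intro: bd)
  ultimately have "norm (fcoef \<phi> \<nu> - c \<nu>) \<le> G - G"
    by (rule tendsto_lowerbound) (rule finite_subsets_at_top_neq_bot)
  then show ?thesis by simp
qed

lemma tavg_continuous:
  assumes \<phi>: "strip_family E \<rho> \<phi>" and \<rho>: "\<rho> \<ge> 0"
  shows "continuous_on E (\<lambda>e. tavg (\<phi> e))"
proof (rule continuous_on_sequentiallyI)
  fix e :: "nat \<Rightarrow> real" and e0 assume e: "\<forall>n. e n \<in> E" "e0 \<in> E" and le: "e \<longlonglongrightarrow> e0"
  have cp: "continuous_on (E \<times> strip \<rho>) (\<lambda>p. \<phi> (fst p) (snd p))" using \<phi> by (simp add: strip_family_def)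
  have "compact (insert e0 (range e))" by (rule compact_sequence_with_limit[OF le])
  then obtain C where C: "\<And>x \<psi>. x \<in> insert e0 (range e) \<Longrightarrow> \<psi> \<in> strip \<rho> \<Longrightarrow> norm (\<phi> x \<psi>) \<le> C"
    using strip_family_locally_bounded[OF \<phi>, of "insert e0 (range e)"] e by blast
  have meas: "(\<lambda>p. \<phi> x (tpt p)) \<in> borel_measurable torus" if "x \<in> E" for x
    by (rule borel_measurable_torus, rule strip_analytic_tpt[OF _ \<rho>]) (use \<phi> that in \<open>auto simp: strip_family_def\<close>)
  show "(\<lambda>n. tavg (\<phi> (e n))) \<longlonglongrightarrow> tavg (\<phi> e0)"
    unfolding tavg_def
  proof (rule integral_dominated_convergence[where w = "\<lambda>_. C"])
    show "AE p in torus. (\<lambda>n. \<phi> (e n) (tpt p)) \<longlonglongrightarrow> \<phi> e0 (tpt p)"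
    proof (rule AE_I2)
      fix p
      have "(\<lambda>n. (\<lambda>p. \<phi> (fst p) (snd p)) (e n, tpt p)) \<longlonglongrightarrow> (\<lambda>p. \<phi> (fst p) (snd p)) (e0, tpt p)"
        by (rule continuous_on_tendsto_compose[OF cp]) (use e tpt_strip[OF \<rho>] le in \<open>auto intro!: tendsto_intros\<close>)
      then show "(\<lambda>n. \<phi> (e n) (tpt p)) \<longlonglongrightarrow> \<phi> e0 (tpt p)" by simp
    qed
    show "AE p in torus. norm (\<phi> (e n) (tpt p)) \<le> C" for n
      by (intro AE_I2 C tpt_strip \<rho>) auto
  qed (use meas e in auto)
qed

text \<open>Both averages are reduced to the same iterated integral; this links the normalisation in
  the hypothesis on \<open>c\<close> to the mean value used for the analysis.\<close>

lemma tavg_torus_average: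
  assumes an: "strip_analytic \<rho> F" "\<rho> \<ge> 0"
    and F: "\<And>x y. F (complex_of_real x, complex_of_real y) = complex_of_real (f (x, y))"
  shows "tavg F = of_real (torus_average f)"
proof -
  have Fc: "continuous_on UNIV (\<lambda>p. F (tpt p))" by (rule strip_analytic_tpt[OF an])
  then have "continuous_on UNIV (\<lambda>p. Re (F (tpt p)))" by (intro continuous_intros)
  then have fc: "continuous_on UNIV f" by (simp add: tpt_def F)
  have ic: "continuous_on A (\<lambda>y. f (x, y))" for x A
    by (rule continuous_on_compose2[OF fc]) (auto intro!: continuous_intros)
  have fx: "(\<integral>y. F (of_real x, of_real y) \<partial>circ) = of_real (integral {0..2*pi} (\<lambda>y. f (x, y)) / (2 * pi))" for x
  proof -
    have "(\<integral>y. F (of_real x, of_real y) \<partial>circ) = integral {0..2*pi} (\<lambda>y. complex_of_real (f (x, y))) / (2 * pi)"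
      unfolding F by (rule integral_circ) (intro continuous_intros ic)
    also have "integral {0..2*pi} (\<lambda>y. complex_of_real (f (x, y))) = of_real (integral {0..2*pi} (\<lambda>y. f (x, y)))"
      by (rule integral_unique, rule has_integral_of_real, rule integrable_integral, rule integrable_continuous_real, rule ic)
    finally show ?thesis by simp
  qed
  have c2: "continuous_on {0..2*pi} (\<lambda>x. integral {0..2*pi} (\<lambda>y. f (x, y)))"
  proof -
    have "continuous_on {0..2*pi} (\<lambda>x. integral (cbox 0 (2*pi)) (\<lambda>y. f (x, y)))"
      by (rule integral_continuous_on_param) (use fc continuous_on_subset in \<open>auto simp: case_prod_unfold\<close>)
    then show ?thesis by simp
  qed
  obtain C where C: "\<And>p. norm (F (tpt p)) \<le> C" using strip_analytic_tpt[OF an] by blast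
  have "tavg F = (\<integral>x. (\<integral>y. F (of_real x, of_real y) \<partial>circ) \<partial>circ)"
    by (rule tavg_iterated[OF Fc C])
  also have "\<dots> = integral {0..2*pi} (\<lambda>x. complex_of_real (integral {0..2*pi} (\<lambda>y. f (x, y)) / (2 * pi))) / (2 * pi)"
    unfolding fx by (rule integral_circ) (intro continuous_intros c2, simp)
  also have "integral {0..2*pi} (\<lambda>x. complex_of_real (integral {0..2*pi} (\<lambda>y. f (x, y)) / (2 * pi))) =
      of_real (integral {0..2*pi} (\<lambda>x. integral {0..2*pi} (\<lambda>y. f (x, y)) / (2 * pi)))"
    by (rule integral_unique, rule has_integral_of_real, rule integrable_integral, rule integrable_continuous_real)
       (intro continuous_intros c2, simp)
  also have "integral {0..2*pi} (\<lambda>x. integral {0..2*pi} (\<lambda>y. f (x, y)) / (2 * pi)) =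
      integral {0..2*pi} (\<lambda>x. integral {0..2*pi} (\<lambda>y. f (x, y))) / (2 * pi)"
    by (rule integral_divide)
  also have "integral {0..2*pi} (\<lambda>x. integral {0..2*pi} (\<lambda>y. f (x, y))) = integral (cbox (0, 0) (2*pi, 2*pi)) f"
    by (subst integral_prod_continuous) (use fc continuous_on_subset in auto)
  finally show ?thesis by (simp add: torus_average_def power2_eq_square)
qed

text \<open>\<open>Jop\<close> inverts \<open>1 + e D\<close>, and \<open>Top\<close> inverts \<open>(D + l) (1 + e D)\<close>.\<close>

definition Jop :: "real \<Rightarrow> real \<Rightarrow> (complex \<times> complex \<Rightarrow> complex) \<Rightarrow> complex \<times> complex \<Rightarrow> complex" where
  "Jop \<alpha> e \<phi> \<psi> = resolv \<alpha> (1 / e) \<phi> \<psi> * of_real (1 / e)"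

definition Top :: "real \<Rightarrow> real \<Rightarrow> real \<Rightarrow> (complex \<times> complex \<Rightarrow> complex) \<Rightarrow> complex \<times> complex \<Rightarrow> complex" where
  "Top \<alpha> l e \<phi> = resolv \<alpha> l (Jop \<alpha> e \<phi>)"

lemma Jop_bound:
  assumes "e > 0" "\<And>\<psi>. \<psi> \<in> strip \<rho> \<Longrightarrow> norm (\<phi> \<psi>) \<le> C" "\<psi> \<in> strip \<rho>"
  shows "norm (Jop \<alpha> e \<phi> \<psi>) \<le> C"
  using resolv_bound[of "1 / e" \<rho> \<phi> C \<psi> \<alpha>] assms
  by (simp add: Jop_def norm_divide divide_le_eq)

lemma strip_family_Jop:
  assumes "strip_family E \<rho> \<phi>" "\<And>e. e \<in> E \<Longrightarrow> e > 0" "\<rho> \<ge> 0"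
  shows "strip_family E \<rho> (\<lambda>e. Jop \<alpha> e (\<phi> e))"
proof -
  have c: "continuous_on E (\<lambda>e. 1 / e)"
    by (intro continuous_intros) (use assms(2) in force)
  have 1: "strip_family E \<rho> (\<lambda>e. resolv \<alpha> (1 / e) (\<phi> e))"
    by (rule strip_family_resolv[OF assms(1) c]) (use assms in force)+
  have 2: "strip_family E \<rho> (\<lambda>e \<psi>. complex_of_real (1 / e))" by (rule strip_family_const[OF c])
  show ?thesis unfolding Jop_def[abs_def] using strip_family_mult[OF 1 2] by simp
qed

lemma strip_family_Top:
  assumes "strip_family E \<rho> \<phi>" "\<And>e. e \<in> E \<Longrightarrow> e > 0" "\<rho> \<ge> 0" "continuous_on E l" "\<And>e. e \<in> E \<Longrightarrow> l e \<noteq> 0"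
  shows "strip_family E \<rho> (\<lambda>e. Top \<alpha> (l e) e (\<phi> e))"
  unfolding Top_def by (rule strip_family_resolv) (use assms strip_family_Jop in auto)

lemma strip_analytic_Jop:
  assumes "strip_analytic \<rho> \<phi>" "e > 0" "\<rho> \<ge> 0"
  shows "strip_analytic \<rho> (Jop \<alpha> e \<phi>)"
  using strip_family_Jop[OF strip_family_fixed[OF assms(1)], of "{e}" \<alpha>] assms by (simp add: strip_family_def)

text \<open>The factor \<open>1 + \<i> * e * freq\<close> has real part one, so \<open>Jop\<close>
  does not enlarge coefficients, and the series can be fed to \<open>resolv_fourier\<close> a second
  time.\<close>

lemma Top_fourier:
  assumes an: "strip_analytic \<rho>' \<phi>" and C: "\<And>\<psi>. \<psi> \<in> strip \<rho>' \<Longrightarrow> norm (\<phi> \<psi>) \<le> C"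
    and \<rho>: "0 \<le> \<rho>" "\<rho> < \<rho>'" and e: "e > 0" and l: "l > 0" and \<psi>: "\<psi> \<in> strip \<rho>"
  shows "((\<lambda>\<nu>. fcoef \<phi> \<nu> / (1 + \<i> * of_real (e * freq \<alpha> \<nu>)) / (of_real l + \<i> * of_real (freq \<alpha> \<nu>)) * emode \<nu> \<psi>)
    has_sum Top \<alpha> l e \<phi> \<psi>) UNIV"
    and "\<And>\<nu>. norm (fcoef \<phi> \<nu> / (1 + \<i> * of_real (e * freq \<alpha> \<nu>))) \<le> norm (fcoef \<phi> \<nu>)"
    and "(\<lambda>\<nu>. norm (fcoef \<phi> \<nu> / (1 + \<i> * of_real (e * freq \<alpha> \<nu>))) * exp (\<rho> * nrm1 \<nu>)) summable_on UNIV"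
proof -
  have \<rho>': "\<rho>' > 0" using \<rho> by simp
  have four: "((\<lambda>\<nu>. fcoef \<phi> \<nu> * emode \<nu> \<psi>) has_sum \<phi> \<psi>) UNIV" if "\<psi> \<in> strip \<rho>" for \<psi>
    using fourier_series_2d[OF \<rho>' an C, of "fst \<psi>" "snd \<psi>"] that \<rho> by (auto simp: mem_strip)
  have sm: "(\<lambda>\<nu>. norm (fcoef \<phi> \<nu>) * exp (\<rho> * nrm1 \<nu>)) summable_on UNIV"
    by (rule fcoef_abs_summable[OF \<rho>' an C \<rho>(2)])
  have eq: "fcoef \<phi> \<nu> / (of_real (1 / e) + \<i> * of_real (freq \<alpha> \<nu>)) * of_real (1 / e) = fcoef \<phi> \<nu> / (1 + \<i> * of_real (e * freq \<alpha> \<nu>))" for \<nu>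
  proof -
    have "1 + \<i> * of_real (e * freq \<alpha> \<nu>) = of_real e * (of_real (1 / e) + \<i> * of_real (freq \<alpha> \<nu>))"
      using e by (simp add: algebra_simps)
    then show ?thesis using e by simp
  qed
  have J: "((\<lambda>\<nu>. fcoef \<phi> \<nu> / (1 + \<i> * of_real (e * freq \<alpha> \<nu>)) * emode \<nu> \<psi>) has_sum Jop \<alpha> e \<phi> \<psi>) UNIV" if "\<psi> \<in> strip \<rho>" for \<psi>
  proof -
    have "((\<lambda>\<nu>. fcoef \<phi> \<nu> / (of_real (1 / e) + \<i> * of_real (freq \<alpha> \<nu>)) * emode \<nu> \<psi> * of_real (1 / e)) has_sum Jop \<alpha> e \<phi> \<psi>) UNIV"
      unfolding Jop_def by (intro has_sum_cmult_left resolv_fourier[OF an _ \<rho>(2,1) four sm that]) (use e in auto)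
    moreover have "fcoef \<phi> \<nu> / (of_real (1 / e) + \<i> * of_real (freq \<alpha> \<nu>)) * emode \<nu> \<psi> * of_real (1 / e) =
        fcoef \<phi> \<nu> / (1 + \<i> * of_real (e * freq \<alpha> \<nu>)) * emode \<nu> \<psi>" for \<nu>
      unfolding eq[symmetric] by (simp only: mult_ac)
    ultimately show ?thesis by (simp only:)
  qed
  show le: "norm (fcoef \<phi> \<nu> / (1 + \<i> * of_real (e * freq \<alpha> \<nu>))) \<le> norm (fcoef \<phi> \<nu>)" for \<nu>
  proof -
    have "1 \<le> norm (1 + \<i> * of_real (e * freq \<alpha> \<nu>))"
      using abs_Re_le_cmod[of "1 + \<i> * of_real (e * freq \<alpha> \<nu>)"] by simp
    then have "norm (fcoef \<phi> \<nu>) / norm (1 + \<i> * of_real (e * freq \<alpha> \<nu>)) \<le> norm (fcoef \<phi> \<nu>) / 1"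
      by (intro frac_le) auto
    then show ?thesis by (simp only: norm_divide div_by_1)
  qed
  have "(\<lambda>\<nu>. norm (norm (fcoef \<phi> \<nu> / (1 + \<i> * of_real (e * freq \<alpha> \<nu>))) * exp (\<rho> * nrm1 \<nu>))) summable_on UNIV"
    by (rule Infinite_Sum.abs_summable_on_comparison_test'[OF sm]) (use le in \<open>simp add: norm_mult mult_right_mono\<close>)
  then show sm': "(\<lambda>\<nu>. norm (fcoef \<phi> \<nu> / (1 + \<i> * of_real (e * freq \<alpha> \<nu>))) * exp (\<rho> * nrm1 \<nu>)) summable_on UNIV"
    by simp
  show "((\<lambda>\<nu>. fcoef \<phi> \<nu> / (1 + \<i> * of_real (e * freq \<alpha> \<nu>)) / (of_real l + \<i> * of_real (freq \<alpha> \<nu>)) * emode \<nu> \<psi>)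
    has_sum Top \<alpha> l e \<phi> \<psi>) UNIV"
    unfolding Top_def
    by (rule resolv_fourier[OF strip_analytic_Jop[OF an e] _ \<rho>(2,1) J sm' \<psi>]) (use \<rho>' l in auto)
qed

text \<open>For modes below \<open>q\<close> the arithmetic of \<open>\<alpha>\<close> bounds the
  divisor. For the others only \<open>l\<close> does, but the decay
  \<open>exp (- s * q) \<le> l\<close> gained from the narrower strip cancels this loss. The
  remaining width \<open>\<eta>\<close> makes the sum over all modes converge, and zero mean removes
  the mode whose divisor is \<open>l\<close> alone.\<close>

lemma Top_bound:
  assumes an: "strip_analytic \<rho>' \<phi>" and C: "\<And>\<psi>. \<psi> \<in> strip \<rho>' \<Longrightarrow> norm (\<phi> \<psi>) \<le> C"
    and \<rho>: "0 \<le> \<rho>" "\<rho> + s + \<eta> \<le> \<rho>'" "s > 0" "\<eta> > 0" and e: "e > 0" and l: "l > 0"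
    and q: "q \<ge> 1" "\<And>\<nu>. \<nu> \<noteq> (0, 0) \<Longrightarrow> nrm1 \<nu> < q \<Longrightarrow> 1 / (2 * q) \<le> \<bar>freq \<alpha> \<nu>\<bar>"
    and lq: "exp (- s * q) \<le> l" and zero: "tavg \<phi> = 0" and \<psi>: "\<psi> \<in> strip \<rho>"
  shows "norm (Top \<alpha> l e \<phi> \<psi>) \<le> 2 * q * C * (\<Sum>\<^sub>\<infinity>\<nu>. exp (- \<eta> * nrm1 \<nu>))"
proof -
  have lt: "\<rho> < \<rho>'" "\<rho>' > 0" using \<rho> by auto
  define f where "f \<nu> = fcoef \<phi> \<nu> / (1 + \<i> * of_real (e * freq \<alpha> \<nu>)) / (of_real l + \<i> * of_real (freq \<alpha> \<nu>)) * emode \<nu> \<psi>" for \<nu>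
  have hs: "(f has_sum Top \<alpha> l e \<phi> \<psi>) UNIV"
    unfolding f_def by (rule Top_fourier(1)[OF an C \<rho>(1) lt(1) e l \<psi>])
  have C0: "C \<ge> 0" by (rule C_nonneg[OF lt(2) an C])
  have f0: "fcoef \<phi> (0, 0) = 0" using fcoef_0[OF an] lt zero by simp
  have le: "norm (f \<nu>) \<le> 2 * q * C * exp (- \<eta> * nrm1 \<nu>)" for \<nu>
  proof (cases "\<nu> = (0, 0)")
    case True
    then show ?thesis using f0 q C0 by (simp add: f_def)
  next
    case False
    let ?n = "norm (of_real l + \<i> * of_real (freq \<alpha> \<nu>))"
    have n: "l \<le> ?n" "\<bar>freq \<alpha> \<nu>\<bar> \<le> ?n"
      using abs_Re_le_cmod[of "of_real l + \<i> * of_real (freq \<alpha> \<nu>)"] abs_Im_le_cmod[of "of_real l + \<i> * of_real (freq \<alpha> \<nu>)"] l by auto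
    have "norm (f \<nu>) \<le> norm (fcoef \<phi> \<nu>) / ?n * exp (\<rho> * nrm1 \<nu>)"
      unfolding f_def norm_mult norm_divide[of _ "of_real l + \<i> * of_real (freq \<alpha> \<nu>)"]
      using Top_fourier(2)[OF an C \<rho>(1) lt(1) e l \<psi>, of \<nu> \<alpha>] norm_emode_le[OF \<psi>, of \<nu>]
      by (intro mult_mono divide_right_mono) auto
    also have "\<dots> \<le> C * exp (- \<rho>' * nrm1 \<nu>) / ?n * exp (\<rho> * nrm1 \<nu>)"
      using fcoef_bound[OF lt(2) an C, of \<nu>] by (intro mult_right_mono divide_right_mono) auto
    also have "\<dots> = C * exp (- (\<rho>' - \<rho>) * nrm1 \<nu>) / ?n"
      by (simp add: mult.assoc ring_distribs exp_diff exp_minus field_simps)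
    also have "\<dots> \<le> C * (2 * q * exp (- \<eta> * nrm1 \<nu>))"
    proof -
      have "exp (- (\<rho>' - \<rho>) * nrm1 \<nu>) / ?n \<le> 2 * q * exp (- \<eta> * nrm1 \<nu>)"
      proof (cases "nrm1 \<nu> < q")
        case True
        then have fr: "1 / (2 * q) \<le> ?n" using q(2)[OF False True] n by linarith
        have "\<eta> * nrm1 \<nu> \<le> (\<rho>' - \<rho>) * nrm1 \<nu>" using \<rho> nrm1_nonneg by (intro mult_right_mono) auto
        then have "exp (- (\<rho>' - \<rho>) * nrm1 \<nu>) / ?n \<le> exp (- \<eta> * nrm1 \<nu>) / (1 / (2 * q))"
          using fr q by (intro frac_le) (auto simp: algebra_simps)
        then show ?thesis by (simp add: mult.commute)
      next
        case False
        have "s * q + \<eta> * nrm1 \<nu> \<le> s * nrm1 \<nu> + \<eta> * nrm1 \<nu>" using False \<rho> by simp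
        also have "\<dots> \<le> (\<rho>' - \<rho>) * nrm1 \<nu>" unfolding distrib_right[symmetric]
          using \<rho> nrm1_nonneg by (intro mult_right_mono) auto
        finally have "exp (- (\<rho>' - \<rho>) * nrm1 \<nu>) \<le> exp (- s * q) * exp (- \<eta> * nrm1 \<nu>)"
          unfolding exp_add[symmetric] exp_le_cancel_iff by (simp add: algebra_simps)
        also have "\<dots> \<le> l * exp (- \<eta> * nrm1 \<nu>)" using lq by (intro mult_right_mono) auto
        finally have "exp (- (\<rho>' - \<rho>) * nrm1 \<nu>) / ?n \<le> l * exp (- \<eta> * nrm1 \<nu>) / l"
          using n l by (intro frac_le) auto
        also have "\<dots> = 1 * exp (- \<eta> * nrm1 \<nu>)" using l by simp
        also have "\<dots> \<le> 2 * q * exp (- \<eta> * nrm1 \<nu>)" using q by (intro mult_right_mono) auto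
        finally show ?thesis .
      qed
      from mult_left_mono[OF this C0] show ?thesis by simp
    qed
    finally show ?thesis by (simp add: mult_ac)
  qed
  have sS: "((\<lambda>\<nu>. 2 * q * C * exp (- \<eta> * nrm1 \<nu>)) has_sum (2 * q * C * (\<Sum>\<^sub>\<infinity>\<nu>. exp (- \<eta> * nrm1 \<nu>)))) UNIV"
    by (intro has_sum_cmult_right has_sum_infsum summable_on_exp_nrm1 \<rho>)
  have "(\<lambda>\<nu>. norm (f \<nu>)) summable_on UNIV"
    by (rule Infinite_Sum.abs_summable_on_comparison_test'[OF has_sum_imp_summable[OF sS] le])
  then have n: "((\<lambda>\<nu>. norm (f \<nu>)) has_sum (\<Sum>\<^sub>\<infinity>\<nu>. norm (f \<nu>))) UNIV" by (rule has_sum_infsum)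
  show ?thesis using norm_has_sum_bound[OF n hs] has_sum_mono[OF n sS le] by linarith
qed

text \<open>A nonzero mode is orthogonal to constants, so adding \<open>z\<close> leaves the
  coefficient unchanged. This bounds the oscillation of \<open>u\<close> from below whatever the
  constant added to it.\<close>

lemma tavg_abs_lower:
  assumes an: "strip_analytic \<rho> \<phi>" "\<rho> \<ge> 0" and \<nu>: "\<nu> \<noteq> (0, 0)"
  shows "norm (fcoef \<phi> \<nu>) \<le> (\<integral>p. norm (z + \<phi> (tpt p)) \<partial>torus)"
proof -
  obtain C where C: "\<And>p. norm (\<phi> (tpt p)) \<le> C" using strip_analytic_tpt[OF an] by blast
  have i1: "integrable torus (\<lambda>p. \<phi> (tpt p) * emode (- \<nu>) (tpt p))"
    by (rule integrable_torus[of _ C]) (auto intro!: continuous_intros emode_tpt_cont strip_analytic_tpt[OF an] simp: norm_mult norm_emode_tpt C)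
  have i2: "integrable torus (\<lambda>p. z * emode (- \<nu>) (tpt p))"
    by (rule integrable_torus[of _ "norm z"]) (auto intro!: continuous_intros emode_tpt_cont simp: norm_mult norm_emode_tpt)
  have "- \<nu> \<noteq> (0, 0)" using \<nu> by (auto simp: prod_eq_iff)
  then have "tavg (emode (- \<nu>)) = 0" by (simp add: tavg_emode)
  then have "(\<integral>p. z * emode (- \<nu>) (tpt p) \<partial>torus) = 0" by (simp add: tavg_def)
  then have "fcoef \<phi> \<nu> = (\<integral>p. z * emode (- \<nu>) (tpt p) + \<phi> (tpt p) * emode (- \<nu>) (tpt p) \<partial>torus)"
    using i1 i2 by (simp add: fcoef_eq_tavg[OF an] tavg_def)
  also have "norm \<dots> \<le> (\<integral>p. norm (z * emode (- \<nu>) (tpt p) + \<phi> (tpt p) * emode (- \<nu>) (tpt p)) \<partial>torus)"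
    by (rule integral_norm_bound)
  also have "\<dots> = (\<integral>p. norm (z + \<phi> (tpt p)) \<partial>torus)"
    by (simp add: norm_mult norm_emode_tpt flip: distrib_right)
  finally show ?thesis .
qed

section \<open>The nonlinearity near its zero\<close>

lemma power_series_higher_deriv:
  fixes g :: "real \<Rightarrow> real"
  assumes "r > 0" "\<And>x. x \<in> ball c r \<Longrightarrow> (\<lambda>n. k n * (x - c) ^ n) sums g x"
  shows "(deriv ^^ j) g c = fact j * k j"
  using assms(2)
proof (induction j arbitrary: g k)
  case 0
  have "k 0 = g c" using 0[of c] assms(1) by simp
  then show ?case by simp
next
  case (Suc j)
  have d: "(\<lambda>n. diffs k n * (x - c) ^ n) sums deriv g x" if x: "x \<in> ball c r" for x
  proof -
    define s where "s = (\<bar>x - c\<bar> + r) / 2"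
    have s: "\<bar>x - c\<bar> < s" "s < r" using x by (auto simp: s_def dist_real_def abs_minus_commute)
    have s0: "s > 0" using s by linarith
    have sm: "summable (\<lambda>n. k n * s ^ n)"
      using Suc.prems[of "c + s"] s s0 by (auto simp: dist_real_def sums_iff)
    have sm': "summable (\<lambda>n. diffs k n * (x - c) ^ n)"
    proof (rule termdiff_converges[of "x - c" s])
      fix y :: real assume "norm y < s"
      then show "summable (\<lambda>n. k n * y ^ n)"
        using Suc.prems[of "c + y"] s by (auto simp: dist_real_def sums_iff)
    qed (use s in simp)
    have "((\<lambda>y. \<Sum>n. k n * y ^ n) has_field_derivative (\<Sum>n. diffs k n * (x - c) ^ n)) (at (x - c))"
      by (rule termdiffs_strong[OF sm]) (use s s0 in auto)
    then have "((\<lambda>x. \<Sum>n. k n * (x - c) ^ n) has_field_derivative (\<Sum>n. diffs k n * (x - c) ^ n) * 1) (at x)"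
      by (intro DERIV_chain2[of "\<lambda>y. \<Sum>n. k n * y ^ n"]) (auto intro!: derivative_eq_intros)
    then have "((\<lambda>x. \<Sum>n. k n * (x - c) ^ n) has_field_derivative (\<Sum>n. diffs k n * (x - c) ^ n)) (at x)"
      by simp
    then have "(g has_field_derivative (\<Sum>n. diffs k n * (x - c) ^ n)) (at x)"
      by (rule has_field_derivative_transform_within_open[of _ _ _ "ball c r"])
         (use x Suc.prems in \<open>auto simp: sums_iff\<close>)
    then have "deriv g x = (\<Sum>n. diffs k n * (x - c) ^ n)" by (rule DERIV_imp_deriv)
    then show ?thesis using sm' by (simp add: summable_sums)
  qed
  have "(deriv ^^ Suc j) g c = (deriv ^^ j) (deriv g) c" by (simp add: funpow_swap1)
  also have "\<dots> = fact j * diffs k j" by (rule Suc.IH[OF d])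
  also have "\<dots> = fact (Suc j) * k (Suc j)" by (simp add: diffs_def)
  finally show ?case .
qed

text \<open>On the real axis the imaginary part vanishes identically, hence so does its
  derivative.\<close>

lemma real_derivative_Reals:
  assumes "(f has_field_derivative D) (at (complex_of_real x))"
    and "r > 0" "\<And>y. \<bar>y - x\<bar> < r \<Longrightarrow> f (complex_of_real y) \<in> \<real>"
  shows "D \<in> \<real>"
proof -
  have "((f \<circ> of_real) has_vector_derivative 1 * D) (at x)"
    using assms(1) by (intro field_vector_diff_chain_at) (auto intro!: derivative_eq_intros)
  then have "((\<lambda>t. Im (f (of_real t))) has_vector_derivative Im D) (at x)"
    using bounded_linear.has_vector_derivative[OF bounded_linear_Im] by (fastforce simp: o_def)
  then have "((\<lambda>t. 0 :: real) has_vector_derivative Im D) (at x)"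
    by (rule has_vector_derivative_transform_within_open[of _ _ _ "ball x r"])
       (use assms in \<open>auto simp: complex_is_Real_iff dist_real_def abs_minus_commute\<close>)
  then have "Im D = 0"
    using vector_derivative_unique_at[OF _ has_vector_derivative_const] by blast
  then show ?thesis by (simp add: complex_is_Real_iff)
qed

text \<open>The Taylor coefficients of index strictly between \<open>0\<close> and \<open>m\<close>
  vanish and the zeroth is \<open>f\<^sub>0\<close>, so \<open>x ^ m\<close> divides the series; the
  remaining real coefficients define \<open>G\<close> on a complex disc.\<close>

lemma zero_of_order_factor:
  assumes A: "open A" "real_analytic_on g A" "c \<in> A" and z: "zero_of_order g f\<^sub>0 c m" and m: "m > 0"
  obtains r G where "r > 0" "G holomorphic_on ball 0 r" "G 0 \<noteq> 0"
    "\<And>x. \<bar>x\<bar> < r \<Longrightarrow> c + x \<in> A" "\<And>x. \<bar>x\<bar> < r \<Longrightarrow> G (of_real x) \<in> \<real>"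
    "\<And>x. \<bar>x\<bar> < r \<Longrightarrow> of_real x ^ m * G (of_real x) = complex_of_real (g (c + x) - f\<^sub>0)"
proof -
  obtain r1 k where r1: "r1 > 0" and k: "\<And>x. x \<in> ball c r1 \<Longrightarrow> (\<lambda>n. k n * (x - c) ^ n) sums g x"
    using A unfolding real_analytic_on_def by blast
  obtain r2 where r2: "r2 > 0" "ball c r2 \<subseteq> A" using A openE by blast
  define r where "r = min r1 r2"
  have r: "r > 0" "r \<le> r1" "r \<le> r2" using r1 r2 by (auto simp: r_def)
  have hd: "(deriv ^^ j) g c = fact j * k j" for j by (rule power_series_higher_deriv[OF r1 k])
  have k0: "k 0 = f\<^sub>0" using hd[of 0] z by (simp add: zero_of_order_def)
  have kj: "k j = 0" if "0 < j" "j < m" for j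
    using hd[of j] z that by (auto simp: zero_of_order_def)
  have km: "k m \<noteq> 0" using hd[of m] z m by (auto simp: zero_of_order_def)
  define G where "G z = (\<Sum>n. complex_of_real (k (n + m)) * z ^ n)" for z
  have real_sums: "(\<lambda>n. k n * x ^ n) sums g (c + x)" if "\<bar>x\<bar> < r" for x
    using k[of "c + x"] that r by (simp add: dist_real_def)
  have shift: "(\<lambda>n. k (n + m) * x ^ n * x ^ m) sums (g (c + x) - f\<^sub>0)" if "\<bar>x\<bar> < r" for x
  proof -
    have "(\<Sum>n<m. k n * x ^ n) = (\<Sum>n\<in>{0}. k n * x ^ n)"
      by (rule sum.mono_neutral_right) (use m kj in auto)
    then have "(\<Sum>n<m. k n * x ^ n) = f\<^sub>0" using k0 by simp
    then have "(\<lambda>n. k (n + m) * x ^ (n + m)) sums (g (c + x) - f\<^sub>0)"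
      using sums_split_initial_segment[OF real_sums[OF that], of m] by simp
    then show ?thesis by (simp add: power_add mult.assoc)
  qed
  have smr: "summable (\<lambda>n. k (n + m) * x ^ n)" if "\<bar>x\<bar> < r" for x
  proof (cases "x = 0")
    case False
    from summable_mult2[OF sums_summable[OF shift[OF that]], of "1 / x ^ m"] show ?thesis using False by simp
  qed (simp add: powser_sums_zero[THEN sums_summable])
  have smc: "summable (\<lambda>n. complex_of_real (k (n + m)) * z ^ n)" if "norm z < r" for z
  proof -
    define s where "s = (norm z + r) / 2"
    have s: "norm z < s" "s < r" using that by (auto simp: s_def)
    have s0: "s > 0" using s norm_ge_zero[of z] by linarith
    have "summable (\<lambda>n. complex_of_real (k (n + m) * s ^ n))"
      using smr[of s] s s0 by (intro summable_of_real) auto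
    then have "summable (\<lambda>n. complex_of_real (k (n + m)) * (of_real s) ^ n)" by simp
    then show ?thesis by (rule powser_inside) (use s s0 in simp)
  qed
  have Gd: "\<exists>D. (G has_field_derivative D) (at z)" if "norm z < r" for z
  proof -
    define s where "s = (norm z + r) / 2"
    have s: "norm z < s" "s < r" using that by (auto simp: s_def)
    have s0: "s > 0" using s norm_ge_zero[of z] by linarith
    have sm: "summable (\<lambda>n. complex_of_real (k (n + m)) * of_real s ^ n)" using smc[of "of_real s"] s s0 by simp
    have "norm z < norm (complex_of_real s)" using s s0 by simp
    from termdiffs_strong[OF sm this] show ?thesis unfolding G_def[abs_def] by blast
  qed
  have Greal: "G (of_real x) = of_real (\<Sum>n. k (n + m) * x ^ n)" if "\<bar>x\<bar> < r" for x
  proof -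
    have "(\<lambda>n. complex_of_real (k (n + m) * x ^ n)) sums of_real (\<Sum>n. k (n + m) * x ^ n)"
      using smr[OF that] by (intro sums_of_real summable_sums)
    then show ?thesis by (simp add: G_def sums_iff)
  qed
  show ?thesis
  proof
    show "r > 0" by (rule r)
    show "G holomorphic_on ball 0 r" using Gd by (subst holomorphic_on_open) auto
    show "G 0 \<noteq> 0" using powser_zero[of "\<lambda>n. complex_of_real (k (n + m))"] km by (simp add: G_def)
    show "c + x \<in> A" if "\<bar>x\<bar> < r" for x using r2 r that by (auto simp: dist_real_def subset_iff)
    show "G (of_real x) \<in> \<real>" if "\<bar>x\<bar> < r" for x using Greal[OF that] by simp
    show "of_real x ^ m * G (of_real x) = complex_of_real (g (c + x) - f\<^sub>0)" if "\<bar>x\<bar> < r" for x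
    proof -
      have "(\<Sum>n. k (n + m) * x ^ n) * x ^ m = g (c + x) - f\<^sub>0"
        using suminf_mult2[OF smr[OF that], of "x ^ m"] shift[OF that] by (simp add: sums_iff)
      then show ?thesis unfolding Greal[OF that] by (simp flip: of_real_power of_real_mult add: mult.commute)
    qed
  qed
qed

lemma deriv_power_mult:
  assumes "H holomorphic_on ball 0 r" "z \<in> ball 0 r" "k > 0"
  shows "((\<lambda>z. z ^ k * H z) has_field_derivative z ^ (k - 1) * (of_nat k * H z + z * deriv H z)) (at z)"
proof -
  have "(H has_field_derivative deriv H z) (at z)"
    using assms holomorphic_derivI[OF assms(1) open_ball assms(2)] by simp
  then have "((\<lambda>z. z ^ k * H z) has_field_derivative (of_nat k * z ^ (k - 1) * 1 * H z + deriv H z * z ^ k)) (at z)"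
    by (auto intro!: derivative_eq_intros)
  moreover have "z ^ k = z * z ^ (k - 1)" using assms(3) by (cases k) auto
  ultimately show ?thesis by (simp add: algebra_simps)
qed

text \<open>Differentiating \<open>z ^ m * G z\<close> twice lowers the power by one each time and
  keeps a holomorphic cofactor. With \<open>\<sigma>\<close> the sign of the leading coefficient,
  odd \<open>m\<close> makes \<open>m - 1\<close> and \<open>m + 1\<close> even, so that
  \<open>\<sigma> * P1\<close> and \<open>\<sigma> * x * P\<close> are nonnegative on the real
  axis.\<close>

lemma nonlinearity_bounds:
  assumes A: "open A" "real_analytic_on g A" "c \<in> A" and z: "zero_of_order g f\<^sub>0 c m" and m: "odd m" "m > 1"
  obtains r K \<kappa> \<sigma> P P1 P2 where "r > 0" "K > 0" "\<kappa> > 0" "\<sigma> = 1 \<or> \<sigma> = -1"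
    "\<And>x. \<bar>x\<bar> < r \<Longrightarrow> c + x \<in> A"
    "\<And>x. \<bar>x\<bar> < r \<Longrightarrow> P (of_real x) = complex_of_real (g (c + x) - f\<^sub>0)"
    "\<And>z. norm z < r \<Longrightarrow> (P has_field_derivative P1 z) (at z)"
    "\<And>z. norm z < r \<Longrightarrow> (P1 has_field_derivative P2 z) (at z)"
    "\<And>z. norm z < r \<Longrightarrow> norm (P z) \<le> K * norm z ^ m"
    "\<And>z. norm z < r \<Longrightarrow> norm (P1 z) \<le> K * norm z ^ (m - 1)"
    "\<And>z. norm z < r \<Longrightarrow> norm (P2 z) \<le> K * norm z ^ (m - 2)"
    "\<And>x. \<bar>x\<bar> < r \<Longrightarrow> P1 (of_real x) \<in> \<real>"
    "\<And>x. \<bar>x\<bar> < r \<Longrightarrow> \<kappa> * \<bar>x\<bar> ^ (m - 1) \<le> \<sigma> * Re (P1 (of_real x))"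
    "\<And>x. \<bar>x\<bar> < r \<Longrightarrow> 0 \<le> \<sigma> * x * Re (P (of_real x))"
proof -
  obtain r G where r: "r > 0" and G: "G holomorphic_on ball 0 r" "G 0 \<noteq> 0"
    and cA: "\<And>x. \<bar>x\<bar> < r \<Longrightarrow> c + x \<in> A" and GR: "\<And>x. \<bar>x\<bar> < r \<Longrightarrow> G (of_real x) \<in> \<real>"
    and Gg: "\<And>x. \<bar>x\<bar> < r \<Longrightarrow> of_real x ^ m * G (of_real x) = complex_of_real (g (c + x) - f\<^sub>0)"
    using zero_of_order_factor[OF A z] m by auto
  define G1 where "G1 z = of_nat m * G z + z * deriv G z" for z
  define G2 where "G2 z = of_nat (m - 1) * G1 z + z * deriv G1 z" for z
  have G1: "G1 holomorphic_on ball 0 r" unfolding G1_def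
    by (intro holomorphic_intros G holomorphic_deriv) auto
  have G2: "G2 holomorphic_on ball 0 r" unfolding G2_def
    by (intro holomorphic_intros G1 holomorphic_deriv) auto
  define P where "P z = z ^ m * G z" for z
  define P1 where "P1 z = z ^ (m - 1) * G1 z" for z
  define P2 where "P2 z = z ^ (m - 2) * G2 z" for z
  have P: "(P has_field_derivative P1 z) (at z)" if "norm z < r" for z
    unfolding P_def[abs_def] P1_def G1_def using deriv_power_mult[OF G(1), of z m] that m by simp
  have P1: "(P1 has_field_derivative P2 z) (at z)" if "norm z < r" for z
    unfolding P1_def[abs_def] P2_def G2_def using deriv_power_mult[OF G1, of z "m - 1"] that m by (simp add: numeral_2_eq_2)
  define a where "a = Re (G 0)"
  have a: "G 0 = of_real a" "a \<noteq> 0" using GR[of 0] r G(2) by (auto simp: a_def of_real_Re complex_is_Real_iff complex_eq_iff)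
  have G10: "G1 0 = of_real (m * a)" by (simp add: G1_def a)
  define \<sigma> where "\<sigma> = sgn a"
  have \<sigma>: "\<sigma> = 1 \<or> \<sigma> = -1" "\<sigma> * a = \<bar>a\<bar>" using a by (auto simp: \<sigma>_def sgn_if)
  have "isCont G 0" "isCont G1 0"
    using r G G1 by (auto intro!: continuous_on_interior[of "ball 0 r"] holomorphic_on_imp_continuous_on)
  then have "isCont (\<lambda>z. \<sigma> * Re (G z)) 0" "isCont (\<lambda>z. \<sigma> * Re (G1 z)) 0"
    by (auto intro!: continuous_intros)
  then have t: "((\<lambda>z. \<sigma> * Re (G z)) \<longlongrightarrow> \<bar>a\<bar>) (at 0)" "((\<lambda>z. \<sigma> * Re (G1 z)) \<longlongrightarrow> real m * \<bar>a\<bar>) (at 0)"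
  proof -
    have "\<sigma> * (real m * a) = real m * \<bar>a\<bar>" using \<sigma>(2) by (simp add: mult.left_commute)
    then show "((\<lambda>z. \<sigma> * Re (G z)) \<longlongrightarrow> \<bar>a\<bar>) (at 0)" "((\<lambda>z. \<sigma> * Re (G1 z)) \<longlongrightarrow> real m * \<bar>a\<bar>) (at 0)"
      using \<open>isCont (\<lambda>z. \<sigma> * Re (G z)) 0\<close> \<open>isCont (\<lambda>z. \<sigma> * Re (G1 z)) 0\<close> \<sigma>(2) unfolding isCont_def a(1) G10
      by (simp_all only: Re_complex_of_real)
  qed
  have "\<forall>\<^sub>F z in at 0. 0 < \<sigma> * Re (G z)" using order_tendstoD(1)[OF t(1)] a by simp
  then obtain d1 where d1: "d1 > 0" "\<And>z. z \<noteq> 0 \<Longrightarrow> norm z < d1 \<Longrightarrow> 0 < \<sigma> * Re (G z)"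
    by (auto simp: eventually_at)
  have am: "real m * \<bar>a\<bar> / 2 < real m * \<bar>a\<bar>" using a m by simp
  have "\<forall>\<^sub>F z in at 0. real m * \<bar>a\<bar> / 2 < \<sigma> * Re (G1 z)" using order_tendstoD(1)[OF t(2) am] by simp
  then obtain d2 where d2: "d2 > 0" "\<And>z. z \<noteq> 0 \<Longrightarrow> norm z < d2 \<Longrightarrow> real m * \<bar>a\<bar> / 2 < \<sigma> * Re (G1 z)"
    by (auto simp: eventually_at)
  define s where "s = Min {r / 2, d1, d2}"
  have s: "s > 0" "s \<le> r / 2" "s \<le> d1" "s \<le> d2" using r d1 d2 by (auto simp: s_def)
  have sr: "s < r" using s r by simp
  have bd: "\<exists>B. \<forall>z\<in>cball 0 s. norm (H z) \<le> B" if "H holomorphic_on ball 0 r" for H :: "complex \<Rightarrow> complex"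
  proof -
    have "continuous_on (cball 0 s) H"
      by (rule continuous_on_subset[OF holomorphic_on_imp_continuous_on[OF that]]) (use sr in auto)
    then show ?thesis using compact_continuous_image[of "cball 0 s" H] compact_imp_bounded bounded_iff
      by (metis (no_types, lifting) compact_cball imageI)
  qed
  obtain B0 B1 B2 where B: "\<And>z. z \<in> cball 0 s \<Longrightarrow> norm (G z) \<le> B0"
    "\<And>z. z \<in> cball 0 s \<Longrightarrow> norm (G1 z) \<le> B1" "\<And>z. z \<in> cball 0 s \<Longrightarrow> norm (G2 z) \<le> B2"
    using bd[OF G(1)] bd[OF G1] bd[OF G2] by blast
  define K where "K = Max {1, B0, B1, B2}"
  have K: "K > 0" "B0 \<le> K" "B1 \<le> K" "B2 \<le> K" by (auto simp: K_def less_max_iff_disj)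
  have Pb: "norm (z ^ j * w) \<le> K * norm (z :: complex) ^ j" if "norm w \<le> b" "b \<le> K" for w z j b
    unfolding norm_mult norm_power using that by (subst mult.commute) (intro mult_right_mono, auto)
  show ?thesis
  proof (rule that[of s K "real m * \<bar>a\<bar> / 2" \<sigma> P P1 P2])
    show "real m * \<bar>a\<bar> / 2 > 0" using a m by simp
    show "c + x \<in> A" if "\<bar>x\<bar> < s" for x using cA that sr by simp
    show "P (of_real x) = complex_of_real (g (c + x) - f\<^sub>0)" if "\<bar>x\<bar> < s" for x
      using Gg that sr by (simp add: P_def)
    show "norm (P z) \<le> K * norm z ^ m" if "norm z < s" for z
      unfolding P_def by (rule Pb[OF B(1) K(2)]) (use that in auto)
    show "norm (P1 z) \<le> K * norm z ^ (m - 1)" if "norm z < s" for z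
      unfolding P1_def by (rule Pb[OF B(2) K(3)]) (use that in auto)
    show "norm (P2 z) \<le> K * norm z ^ (m - 2)" if "norm z < s" for z
      unfolding P2_def by (rule Pb[OF B(3) K(4)]) (use that in auto)
    have PR: "P (of_real x) \<in> \<real>" if "\<bar>x\<bar> < r" for x using Gg[OF that] by (simp add: P_def)
    show P1R: "P1 (of_real x) \<in> \<real>" if "\<bar>x\<bar> < s" for x
      by (rule real_derivative_Reals[OF P, of x "r - \<bar>x\<bar>"]) (use that sr PR in auto)
    show "real m * \<bar>a\<bar> / 2 * \<bar>x\<bar> ^ (m - 1) \<le> \<sigma> * Re (P1 (of_real x))" if "\<bar>x\<bar> < s" for x
    proof (cases "x = 0")
      case False
      have "even (m - 1)" using m by simp
      then have e: "x ^ (m - 1) = \<bar>x\<bar> ^ (m - 1)" by (simp add: power_even_abs)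
      have h1: "\<sigma> * Re (P1 (of_real x)) = x ^ (m - 1) * (\<sigma> * Re (G1 (of_real x)))"
        by (simp add: P1_def flip: of_real_power)
      have "real m * \<bar>a\<bar> / 2 \<le> \<sigma> * Re (G1 (of_real x))"
        using d2(2)[of "of_real x"] False that s by simp
      then have h2: "\<bar>x\<bar> ^ (m - 1) * (real m * \<bar>a\<bar> / 2) \<le> \<bar>x\<bar> ^ (m - 1) * (\<sigma> * Re (G1 (of_real x)))"
        by (intro mult_left_mono) auto
      show ?thesis unfolding h1 e by (subst mult.commute) (rule h2)
    qed (use m in \<open>simp add: P1_def power_0_left\<close>)
    show "0 \<le> \<sigma> * x * Re (P (of_real x))" if "\<bar>x\<bar> < s" for x
    proof (cases "x = 0")
      case False
      have "even (Suc m)" using m by simp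
      then have "0 \<le> x ^ Suc m" by (rule zero_le_even_power)
      moreover have "0 \<le> \<sigma> * Re (G (of_real x))" using d1(2)[of "of_real x"] False that s by simp
      ultimately have "0 \<le> x ^ Suc m * (\<sigma> * Re (G (of_real x)))" by (rule mult_nonneg_nonneg)
      then show ?thesis by (simp add: P_def mult_ac flip: of_real_power)
    qed simp
  qed (use s K \<sigma> P P1 sr in auto)
qed

section \<open>The averaged equation\<close>

text \<open>The set \<open>E\<close> and the threshold \<open>\<tau>0\<close> are parameters, but
  the constants defined below do not depend on them; this lets \<open>response_solution\<close> fix
  the constants first and shrink \<open>\<tau>0\<close> afterwards. The mode \<open>\<nu>0\<close>
  witnesses that \<open>F\<close> is not zero.\<close>

locale response =
  fixes \<alpha> \<xi> :: real and m :: nat and P P1 P2 :: "complex \<Rightarrow> complex" and r K \<kappa> \<sigma> :: real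
    and F :: "complex \<times> complex \<Rightarrow> complex" and Fb Cq \<tau>0 :: real and E :: "real set" and \<nu>0 :: "int \<times> int"
  assumes \<xi>: "\<xi> > 0" and m: "odd m" "m > 1"
    and r: "r > 0" and K: "K > 0" and \<kappa>: "\<kappa> > 0" and \<sigma>: "\<sigma> = 1 \<or> \<sigma> = -1"
    and P_deriv: "\<And>z. norm z < r \<Longrightarrow> (P has_field_derivative P1 z) (at z)"
    and P1_deriv: "\<And>z. norm z < r \<Longrightarrow> (P1 has_field_derivative P2 z) (at z)"
    and P_bound: "\<And>z. norm z < r \<Longrightarrow> norm (P z) \<le> K * norm z ^ m"
    and P1_bound: "\<And>z. norm z < r \<Longrightarrow> norm (P1 z) \<le> K * norm z ^ (m - 1)"
    and P2_bound: "\<And>z. norm z < r \<Longrightarrow> norm (P2 z) \<le> K * norm z ^ (m - 2)"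
    and P_real: "\<And>x. \<bar>x\<bar> < r \<Longrightarrow> P (of_real x) \<in> \<real>"
    and P1_real: "\<And>x. \<bar>x\<bar> < r \<Longrightarrow> P1 (of_real x) \<in> \<real>"
    and P1_lower: "\<And>x. \<bar>x\<bar> < r \<Longrightarrow> \<kappa> * \<bar>x\<bar> ^ (m - 1) \<le> \<sigma> * Re (P1 (of_real x))"
    and P_sign: "\<And>x. \<bar>x\<bar> < r \<Longrightarrow> 0 \<le> \<sigma> * x * Re (P (of_real x))"
    and F: "strip_analytic \<xi> F" and F_avg: "tavg F = 0"
    and F_bound: "\<And>\<psi>. \<psi> \<in> strip \<xi> \<Longrightarrow> norm (F \<psi>) \<le> Fb"
    and \<nu>0: "fcoef F \<nu>0 \<noteq> 0" "\<nu>0 \<noteq> (0, 0)"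
    and Cq: "Cq > 0" and \<tau>0: "0 < \<tau>0" "\<tau>0 \<le> 1"
    and E: "\<And>e. e \<in> E \<Longrightarrow> 0 < e" "\<And>e. e \<in> E \<Longrightarrow> root (m + 1) e \<le> \<tau>0"
    and E_div: "\<And>e. e \<in> E \<Longrightarrow> \<exists>q\<ge>1. e * q \<le> Cq * root (m + 1) e ^ m \<and> exp (- (\<xi> / 3) * q) \<le> e ^ (m + 1) \<and>
        (\<forall>\<nu>. \<nu> \<noteq> (0, 0) \<longrightarrow> nrm1 \<nu> < q \<longrightarrow> 1 / (2 * q) \<le> \<bar>freq \<alpha> \<nu>\<bar>)"
begin

definition "tau e = root (m + 1) e"
definition "eta e = tau e ^ m"
definition "lam e = (e :: real) ^ (m + 1)"
text \<open>The loss \<open>3 * \<xi> / 8\<close> splits as \<open>\<xi> / 3 + \<xi> / 24\<close>: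
  the first part beats \<open>lam\<close>, the second sums the modes.\<close>

definition "S = (\<Sum>\<^sub>\<infinity>\<nu>. exp (- (\<xi> / 24) * nrm1 \<nu>))"
definition "CT = 2 * Cq * S"
definition "Cu = CT * Fb"

lemma tau:
  assumes "e \<in> E"
  shows "0 < tau e" "tau e \<le> \<tau>0" "tau e \<le> 1" "tau e ^ (m + 1) = e" "e \<le> 1"
proof -
  show 1: "0 < tau e" "tau e \<le> \<tau>0" using E[OF assms] by (auto simp: tau_def)
  then show 2: "tau e \<le> 1" using \<tau>0 by simp
  show 3: "tau e ^ (m + 1) = e" unfolding tau_def using E[OF assms] by (intro real_root_pow_pos2) auto
  have "tau e ^ (m + 1) \<le> 1" using 1 2 by (intro power_le_one) auto
  then show "e \<le> 1" using 3 by simp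
qed

lemma eta:
  assumes "e \<in> E"
  shows "0 < eta e" "eta e \<le> tau e" "eta e \<le> \<tau>0" "eta e \<le> 1" "e \<le> eta e"
proof -
  note t = tau[OF assms]
  show "0 < eta e" using t by (simp add: eta_def)
  show le: "eta e \<le> tau e" unfolding eta_def using t m power_decreasing[of 1 m "tau e"] by simp
  then show "eta e \<le> \<tau>0" "eta e \<le> 1" using t by auto
  have "tau e ^ (m + 1) \<le> tau e ^ m" using t by (intro power_decreasing) auto
  then show "e \<le> eta e" unfolding t(4) eta_def .
qed

lemma lam: "e \<in> E \<Longrightarrow> 0 < lam e" "e \<in> E \<Longrightarrow> lam e \<le> e" "e \<in> E \<Longrightarrow> lam e \<le> 1"
proof -
  assume e: "e \<in> E"
  note e0 = E(1)[OF e]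
  show "0 < lam e" using e0 by (simp add: lam_def)
  show l: "lam e \<le> e" unfolding lam_def using power_decreasing[of 1 "m + 1" e] e0 tau[OF e] by simp
  then show "lam e \<le> 1" using tau[OF e] by simp
qed

lemma S_pos: "S > 0"
proof -
  have h: "((\<lambda>\<nu>. exp (- (\<xi> / 24) * nrm1 \<nu>)) has_sum S) UNIV"
    unfolding S_def using \<xi> by (intro has_sum_infsum summable_on_exp_nrm1) auto
  have "((\<lambda>\<nu>. exp (- (\<xi> / 24) * nrm1 \<nu>)) has_sum exp (- (\<xi> / 24) * nrm1 (0, 0))) {(0, 0)}"
    by (rule has_sum_finiteI) auto
  from has_sum_mono2[OF this h] have "exp (- (\<xi> / 24) * nrm1 (0, 0)) \<le> S" by auto
  then show ?thesis by (simp add: nrm1_def)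
qed

lemma CT_pos: "CT > 0" using S_pos Cq by (simp add: CT_def)

lemma Fb_pos: "Fb > 0"
proof -
  have "norm (fcoef F \<nu>0) \<le> Fb * exp (- \<xi> * nrm1 \<nu>0)" by (rule fcoef_bound[OF \<xi> F F_bound])
  then have "0 < Fb * exp (- \<xi> * nrm1 \<nu>0)" using \<nu>0 by (meson less_le_trans zero_less_norm_iff)
  then show ?thesis by (simp add: zero_less_mult_iff)
qed

lemma Cu_pos: "Cu > 0" using CT_pos Fb_pos by (simp add: Cu_def)

text \<open>The factor \<open>q\<close> of \<open>Top_bound\<close> is absorbed by
  \<open>e * q \<le> Cq * eta e\<close>; this is where the gain \<open>eta\<close> comes
  from.\<close>

lemma Top_est:
  assumes e: "e \<in> E" and \<phi>: "strip_analytic \<rho>' \<phi>" "tavg \<phi> = 0" "\<And>\<psi>. \<psi> \<in> strip \<rho>' \<Longrightarrow> norm (\<phi> \<psi>) \<le> C"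
    and \<rho>: "0 \<le> \<rho>" "\<rho> + 3 * \<xi> / 8 \<le> \<rho>'" and \<psi>: "\<psi> \<in> strip \<rho>"
  shows "e * norm (Top \<alpha> (lam e) e \<phi> \<psi>) \<le> CT * eta e * C"
proof -
  obtain q where q: "q \<ge> 1" "e * q \<le> Cq * eta e" "exp (- (\<xi> / 3) * q) \<le> lam e"
    "\<And>\<nu>. \<nu> \<noteq> (0, 0) \<Longrightarrow> nrm1 \<nu> < q \<Longrightarrow> 1 / (2 * q) \<le> \<bar>freq \<alpha> \<nu>\<bar>"
    using E_div[OF e] unfolding eta_def tau_def lam_def by blast
  have C: "C \<ge> 0" by (rule C_nonneg[OF _ \<phi>(1,3)]) (use \<rho> \<xi> in auto)
  have "norm (Top \<alpha> (lam e) e \<phi> \<psi>) \<le> 2 * q * C * S"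
    unfolding S_def
    by (rule Top_bound[OF \<phi>(1,3) \<rho>(1) _ _ _ E(1)[OF e] lam(1)[OF e] q(1,4,3) \<phi>(2) \<psi>]) (use \<rho> \<xi> in auto)
  then have "e * norm (Top \<alpha> (lam e) e \<phi> \<psi>) \<le> e * (2 * q * C * S)"
    using E(1)[OF e] by (intro mult_left_mono) auto
  also have "\<dots> = (e * q) * (2 * C * S)" by simp
  also have "\<dots> \<le> (Cq * eta e) * (2 * C * S)"
    using q(2) C S_pos by (intro mult_right_mono) auto
  finally show ?thesis by (simp add: CT_def mult_ac)
qed

definition "u e \<psi> = of_real e * Top \<alpha> (lam e) e F \<psi>"

lemma continuous_lam: "continuous_on E lam" unfolding lam_def[abs_def] by (intro continuous_intros)

lemma strip_family_scale: "strip_family E \<rho> \<phi> \<Longrightarrow> continuous_on E s \<Longrightarrow> strip_family E \<rho> (\<lambda>e \<psi>. of_real (s e) * \<phi> e \<psi>)"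
  by (intro strip_family_mult strip_family_const)

lemma lam_nz: "e \<in> E \<Longrightarrow> lam e \<noteq> 0" using lam(1) by force

lemma u_family: "strip_family E \<xi> u"
  unfolding u_def[abs_def]
  by (intro strip_family_scale[where s = "\<lambda>e. e"] strip_family_Top strip_family_fixed F E continuous_lam lam_nz continuous_on_id)
     (use \<xi> in auto)

lemma u_an: "e \<in> E \<Longrightarrow> strip_analytic \<xi> (u e)" using u_family by (simp add: strip_family_def)

lemma u_bound: "e \<in> E \<Longrightarrow> \<psi> \<in> strip (5 * \<xi> / 8) \<Longrightarrow> norm (u e \<psi>) \<le> Cu * eta e"
  using Top_est[OF _ F F_avg F_bound, of e "5 * \<xi> / 8" \<psi>] \<xi> E(1)[of e]
  by (simp add: u_def norm_mult Cu_def mult_ac)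

lemma u_tpt: "e \<in> E \<Longrightarrow> norm (u e (tpt p)) \<le> Cu * eta e"
  using \<xi> by (intro u_bound tpt_strip) auto

lemma u_real: "e \<in> E \<Longrightarrow> u e (tpt p) = of_real (Re (u e (tpt p)))"
  using u_an[of e] by (simp add: strip_analytic_def tpt_def of_real_Re)

text \<open>Both divisors at \<open>\<nu>0\<close> have modulus at most
  \<open>1 + \<bar>freq \<alpha> \<nu>0\<bar>\<close>, because \<open>e\<close> and
  \<open>lam e\<close> do not exceed one.\<close>

definition "K1 = norm (fcoef F \<nu>0) / (1 + \<bar>freq \<alpha> \<nu>0\<bar>)\<^sup>2"

lemma K1_pos: "K1 > 0" using \<nu>0 by (simp add: K1_def)

lemma u_coef_lower:
  assumes e: "e \<in> E"
  shows "K1 * e \<le> norm (fcoef (u e) \<nu>0)"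
proof -
  note e0 = E(1)[OF e] and l0 = lam(1)[OF e]
  let ?d = "\<lambda>\<nu>. 1 + \<i> * of_real (e * freq \<alpha> \<nu>) :: complex" and ?l = "\<lambda>\<nu>. of_real (lam e) + \<i> * of_real (freq \<alpha> \<nu>) :: complex"
  define c where "c \<nu> = of_real e * (fcoef F \<nu> / ?d \<nu> / ?l \<nu>)" for \<nu>
  have pos: "0 \<le> (0::real)" "0 < \<xi>" using \<xi> by auto
  have 1: "((\<lambda>\<nu>. c \<nu> * emode \<nu> (tpt p)) has_sum u e (tpt p)) UNIV" for p
  proof -
    have "((\<lambda>\<nu>. of_real e * (fcoef F \<nu> / ?d \<nu> / ?l \<nu> * emode \<nu> (tpt p))) has_sum u e (tpt p)) UNIV"
      unfolding u_def by (rule has_sum_cmult_right, rule Top_fourier(1)[OF F F_bound pos e0 l0 tpt_strip]) auto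
    then show ?thesis by (simp add: c_def mult.assoc)
  qed
  have 2: "(\<lambda>\<nu>. norm (c \<nu>)) summable_on UNIV"
  proof -
    have "(\<lambda>\<nu>. norm (fcoef F \<nu> / ?d \<nu>) * exp (0 * nrm1 \<nu>)) summable_on UNIV"
      by (rule Top_fourier(3)[OF F F_bound pos e0 l0 tpt_strip[of 0 "(0,0)"]]) auto
    then have s: "(\<lambda>\<nu>. (e / lam e) * norm (fcoef F \<nu> / ?d \<nu>)) summable_on UNIV"
      by (intro summable_on_cmult_right) simp
    have "(\<lambda>\<nu>. norm (c \<nu>)) summable_on UNIV"
    proof (rule Infinite_Sum.abs_summable_on_comparison_test'[OF s])
      fix \<nu>
      have "lam e \<le> norm (?l \<nu>)" using abs_Re_le_cmod[of "?l \<nu>"] l0 by simp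
      then have "norm (fcoef F \<nu> / ?d \<nu>) / norm (?l \<nu>) \<le> norm (fcoef F \<nu> / ?d \<nu>) / lam e"
        using l0 by (intro divide_left_mono mult_pos_pos) auto
      from mult_left_mono[OF this, of e] show "norm (c \<nu>) \<le> (e / lam e) * norm (fcoef F \<nu> / ?d \<nu>)"
        using e0 unfolding c_def norm_mult norm_divide[of _ "?l \<nu>"] by simp
    qed
    then show ?thesis .
  qed
  have fc: "fcoef (u e) \<nu>0 = c \<nu>0"
    by (rule fcoef_unique[OF u_an[OF e] _ 1 2]) (use \<xi> in simp)
  let ?w = "\<bar>freq \<alpha> \<nu>0\<bar>"
  have n1: "norm (?d \<nu>0) \<le> 1 + ?w"
  proof -
    have "norm (?d \<nu>0) \<le> 1 + \<bar>e * freq \<alpha> \<nu>0\<bar>"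
      using norm_triangle_ineq[of 1 "\<i> * of_real (e * freq \<alpha> \<nu>0)"] by (simp only: norm_one norm_mult norm_ii norm_of_real mult_1_left)
    also have "\<bar>e * freq \<alpha> \<nu>0\<bar> \<le> 1 * ?w" unfolding abs_mult using e0 tau(5)[OF e] by (intro mult_right_mono) auto
    finally show ?thesis by simp
  qed
  have n2: "norm (?l \<nu>0) \<le> 1 + ?w"
    using norm_triangle_ineq[of "of_real (lam e)" "\<i> * of_real (freq \<alpha> \<nu>0)"] lam[OF e]
    by (simp add: norm_mult)
  have p1: "1 \<le> norm (?d \<nu>0)" using abs_Re_le_cmod[of "?d \<nu>0"] by simp
  have "lam e \<le> norm (?l \<nu>0)" using abs_Re_le_cmod[of "?l \<nu>0"] l0 by simp
  then have p2: "0 < norm (?l \<nu>0)" using l0 by linarith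
  have "norm (?d \<nu>0) * norm (?l \<nu>0) \<le> (1 + ?w)\<^sup>2"
    unfolding power2_eq_square using n1 n2 p1 by (intro mult_mono) auto
  then have "norm (fcoef F \<nu>0) / (1 + ?w)\<^sup>2 \<le> norm (fcoef F \<nu>0) / (norm (?d \<nu>0) * norm (?l \<nu>0))"
    using p1 p2 by (intro divide_left_mono mult_pos_pos) auto
  then have "K1 * e \<le> norm (fcoef F \<nu>0) / (norm (?d \<nu>0) * norm (?l \<nu>0)) * e"
    using e0 unfolding K1_def by (intro mult_right_mono) auto
  also have "\<dots> = norm (c \<nu>0)" using e0 unfolding c_def norm_mult norm_divide by simp
  finally show ?thesis by (simp add: fc)
qed

end

text \<open>This smallness keeps \<open>u\<close> below \<open>r / 4\<close>, so that
  \<open>P\<close> may be evaluated at \<open>x + u\<close> for every \<open>x\<close> below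
  \<open>r / 4\<close>.\<close>

locale response1 = response +
  assumes small1: "4 * Cu * \<tau>0 < r"
begin

lemma Cu_eta: "e \<in> E \<Longrightarrow> Cu * eta e < r / 4"
proof -
  assume e: "e \<in> E"
  have "Cu * eta e \<le> Cu * \<tau>0" using eta[OF e] Cu_pos by (intro mult_left_mono) auto
  then show ?thesis using small1 by simp
qed

definition "Phi e x = Re (tavg (\<lambda>\<psi>. P (of_real x + u e \<psi>)))"
definition "K2 = \<kappa> * K1 ^ (m - 1)"

lemma K2_pos: "K2 > 0" using \<kappa> K1_pos by (simp add: K2_def)

lemma P_hol: "P holomorphic_on ball 0 r" "P1 holomorphic_on ball 0 r"
  unfolding holomorphic_on_open[OF open_ball]
  by (intro ballI exI, rule P_deriv P1_deriv, simp)+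

lemma P_cont: "continuous_on (ball 0 r) P" "continuous_on (ball 0 r) P1"
  using P_hol holomorphic_on_imp_continuous_on by blast+

lemma norm_shift_u:
  assumes "e \<in> E" "norm z < r / 4"
  shows "norm (z + u e (tpt p)) < r / 2"
  using norm_triangle_ineq[of z "u e (tpt p)"] u_tpt[OF assms(1), of p] Cu_eta[OF assms(1)] assms(2) by linarith

lemma shift_cont:
  assumes "e \<in> E" "norm z < r / 4" "continuous_on (ball 0 r) H"
  shows "continuous_on UNIV (\<lambda>p. H (z + u e (tpt p)))"
proof (rule continuous_on_compose2[OF assms(3)])
  show "continuous_on UNIV (\<lambda>p. z + u e (tpt p))"
    by (intro continuous_intros strip_analytic_tpt[OF u_an[OF assms(1)]]) (use \<xi> in auto)
  show "range (\<lambda>p. z + u e (tpt p)) \<subseteq> ball 0 r"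
  proof safe
    fix p show "z + u e (tpt p) \<in> ball 0 r" using norm_shift_u[OF assms(1,2), of p] r by simp
  qed
qed

lemma pow_le: "norm z < r \<Longrightarrow> K * norm z ^ k \<le> K * r ^ k"
  using K by (intro mult_left_mono power_mono) auto

lemma P_le: "norm z < r \<Longrightarrow> norm (P z) \<le> K * r ^ m" "norm z < r \<Longrightarrow> norm (P1 z) \<le> K * r ^ (m - 1)"
  using P_bound P1_bound pow_le order_trans by blast+

text \<open>The average is differentiated as a holomorphic function of the shift, where uniform
  bounds suffice, and only then restricted to real shifts.\<close>

lemma Phi_deriv:
  assumes e: "e \<in> E" and x: "\<bar>x\<bar> < r / 4"
  shows "(Phi e has_real_derivative Re (tavg (\<lambda>\<psi>. P1 (of_real x + u e \<psi>)))) (at x)"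
proof -
  have lt: "norm (z + u e (tpt p)) < r" if "norm z < r / 4" for z p
    using norm_shift_u[OF e that, of p] r by simp
  have "((\<lambda>z. \<integral>p. P (z + u e (tpt p)) \<partial>torus) has_field_derivative
      (\<integral>p. deriv (\<lambda>z. P (z + u e (tpt p))) (of_real x) \<partial>torus)) (at (of_real x))"
  proof (rule has_field_derivative_integral[of _ "ball 0 (r / 4)" _ _ "K * r ^ m"])
    show "(\<lambda>z. P (z + u e (tpt p))) holomorphic_on ball 0 (r / 4)" for p
    proof -
      have "(P \<circ> (\<lambda>z. z + u e (tpt p))) holomorphic_on ball 0 (r / 4)"
        by (rule holomorphic_on_compose_gen[OF _ P_hol(1)])
           (use lt[of _ p] in \<open>auto intro!: holomorphic_intros simp del: image_add_ball\<close>)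
      then show ?thesis by (simp add: o_def)
    qed
    show "(\<lambda>p. P (z + u e (tpt p))) \<in> borel_measurable torus" if "z \<in> ball 0 (r / 4)" for z
      by (rule borel_measurable_torus, rule shift_cont[OF e _ P_cont(1)]) (use that in auto)
    show "norm (P (z + u e (tpt p))) \<le> K * r ^ m" if "z \<in> ball 0 (r / 4)" for z p
      by (rule P_le, rule lt) (use that in auto)
  qed (use x torus.finite_measure_axioms in auto)
  also have "(\<integral>p. deriv (\<lambda>z. P (z + u e (tpt p))) (of_real x) \<partial>torus) = tavg (\<lambda>\<psi>. P1 (of_real x + u e \<psi>))"
  proof -
    have "deriv (\<lambda>z. P (z + u e (tpt p))) (of_real x) = P1 (of_real x + u e (tpt p))" for p
    proof (rule DERIV_imp_deriv)
      have "(P has_field_derivative P1 (of_real x + u e (tpt p))) (at (of_real x + u e (tpt p)))"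
        by (rule P_deriv, rule lt) (use x in auto)
      then have "((\<lambda>z. P (z + u e (tpt p))) has_field_derivative P1 (of_real x + u e (tpt p)) * 1) (at (of_real x))"
        by (intro DERIV_chain2[of P]) (auto intro!: derivative_eq_intros)
      then show "((\<lambda>z. P (z + u e (tpt p))) has_field_derivative P1 (of_real x + u e (tpt p))) (at (of_real x))" by simp
    qed
    then show ?thesis by (simp add: tavg_def)
  qed
  finally have "((\<lambda>z. tavg (\<lambda>\<psi>. P (z + u e \<psi>))) has_field_derivative tavg (\<lambda>\<psi>. P1 (of_real x + u e \<psi>))) (at (of_real x))"
    by (simp add: tavg_def)
  then have "(((\<lambda>z. tavg (\<lambda>\<psi>. P (z + u e \<psi>))) \<circ> of_real) has_vector_derivative 1 * tavg (\<lambda>\<psi>. P1 (of_real x + u e \<psi>))) (at x)"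
    by (intro field_vector_diff_chain_at) (auto intro!: derivative_eq_intros)
  from bounded_linear.has_vector_derivative[OF bounded_linear_Re this]
  show ?thesis by (simp add: o_def Phi_def[abs_def] has_real_derivative_iff_has_vector_derivative)
qed

text \<open>The mean of \<open>\<bar>Y\<bar>\<close> is at least \<open>K1 * e\<close> by
  orthogonality, Jensen's inequality passes to the power \<open>m - 1\<close>, and
  \<open>P1_lower\<close> turns this into a bound for the mean of \<open>\<sigma> * P1\<close>. It
  does not depend on \<open>x\<close>, so \<open>\<sigma> * Phi e\<close> is strictly
  increasing.\<close>

lemma Phi_deriv_lower:
  assumes e: "e \<in> E" and x: "\<bar>x\<bar> < r / 4"
  shows "K2 * e ^ (m - 1) \<le> \<sigma> * Re (tavg (\<lambda>\<psi>. P1 (of_real x + u e \<psi>)))"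
proof -
  define Y where "Y p = x + Re (u e (tpt p))" for p
  have Yc: "of_real x + u e (tpt p) = of_real (Y p)" for p using u_real[OF e, of p] by (simp add: Y_def)
  have Yr: "\<bar>Y p\<bar> < r" for p
    using norm_shift_u[OF e, of "of_real x" p] x r unfolding Yc by simp
  have Ycont: "continuous_on UNIV Y" unfolding Y_def
    by (intro continuous_intros strip_analytic_tpt[OF u_an[OF e]]) (use \<xi> in auto)
  have i1: "integrable torus (\<lambda>p. \<bar>Y p\<bar>)"
    by (rule integrable_torus[of _ r]) (use Yr Ycont in \<open>auto intro!: continuous_intros simp: less_imp_le\<close>)
  have i2: "integrable torus (\<lambda>p. \<bar>Y p\<bar> ^ (m - 1))"
    by (rule integrable_torus[of _ "r ^ (m - 1)"]) (use Yr Ycont in \<open>auto intro!: continuous_intros power_mono simp: less_imp_le power_abs\<close>)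
  have i3: "integrable torus (\<lambda>p. P1 (of_real x + u e (tpt p)))"
    by (rule integrable_torus[of _ "K * r ^ (m - 1)"], rule shift_cont[OF e _ P_cont(2)], use x in simp, rule P_le(2))
       (unfold Yc, use Yr in simp)
  have "K1 * e \<le> norm (fcoef (u e) \<nu>0)" by (rule u_coef_lower[OF e])
  also have "\<dots> \<le> (\<integral>p. norm (of_real x + u e (tpt p)) \<partial>torus)"
    by (rule tavg_abs_lower[OF u_an[OF e] _ \<nu>0(2)]) (use \<xi> in simp)
  also have "\<dots> = (\<integral>p. \<bar>Y p\<bar> \<partial>torus)" unfolding Yc by simp
  finally have "(K1 * e) ^ (m - 1) \<le> (\<integral>p. \<bar>Y p\<bar> \<partial>torus) ^ (m - 1)"
    using K1_pos E(1)[OF e] by (intro power_mono) auto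
  also have "\<dots> \<le> (\<integral>p. \<bar>Y p\<bar> ^ (m - 1) \<partial>torus)"
  proof (rule torus.jensens_inequality[where I = UNIV and q = "\<lambda>t. t ^ (m - 1)"])
    show "convex_on UNIV (\<lambda>t::real. t ^ (m - 1))" by (rule convex_power_even) (use m in simp)
  qed (use i1 i2 in auto)
  finally have "\<kappa> * (K1 * e) ^ (m - 1) \<le> \<kappa> * (\<integral>p. \<bar>Y p\<bar> ^ (m - 1) \<partial>torus)"
    using \<kappa> by (intro mult_left_mono) auto
  also have "\<dots> = (\<integral>p. \<kappa> * \<bar>Y p\<bar> ^ (m - 1) \<partial>torus)" by simp
  also have "\<dots> \<le> (\<integral>p. \<sigma> * Re (P1 (of_real x + u e (tpt p))) \<partial>torus)"
    by (rule integral_mono) (use i2 i3 P1_lower[OF Yr] in \<open>auto simp: Yc\<close>)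
  also have "\<dots> = \<sigma> * Re (tavg (\<lambda>\<psi>. P1 (of_real x + u e \<psi>)))"
    using i3 by (simp add: tavg_def)
  finally show ?thesis by (simp add: K2_def power_mult_distrib mult.assoc)
qed

lemma Phi_mono:
  assumes e: "e \<in> E" and x: "\<bar>x\<bar> < r / 4" "\<bar>y\<bar> < r / 4" "x \<le> y"
  shows "K2 * e ^ (m - 1) * (y - x) \<le> \<sigma> * (Phi e y - Phi e x)"
proof (cases "x = y")
  case False
  then have "x < y" using x by simp
  have "\<exists>z>x. z < y \<and> Phi e y - Phi e x = (y - x) * Re (tavg (\<lambda>\<psi>. P1 (of_real z + u e \<psi>)))"
    by (rule MVT2[OF \<open>x < y\<close>]) (use x in \<open>auto intro!: Phi_deriv[OF e]\<close>)
  then obtain z where z: "x < z" "z < y" "Phi e y - Phi e x = (y - x) * Re (tavg (\<lambda>\<psi>. P1 (of_real z + u e \<psi>)))" by blast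
  have "K2 * e ^ (m - 1) * (y - x) \<le> (\<sigma> * Re (tavg (\<lambda>\<psi>. P1 (of_real z + u e \<psi>)))) * (y - x)"
    by (intro mult_right_mono Phi_deriv_lower[OF e]) (use z x in auto)
  then show ?thesis unfolding z(3) by (simp add: mult_ac)
qed simp

lemma Phi_abs:
  assumes e: "e \<in> E" and x: "\<bar>x\<bar> < r / 4" "\<bar>y\<bar> < r / 4"
  shows "K2 * e ^ (m - 1) * \<bar>y - x\<bar> \<le> \<bar>Phi e y - Phi e x\<bar>"
proof -
  have "\<bar>\<sigma> * t\<bar> = \<bar>t\<bar>" for t using \<sigma> by auto
  then show ?thesis
    using Phi_mono[OF e, of x y] Phi_mono[OF e, of y x] x by (cases "x \<le> y") (smt (verit))+
qed

text \<open>At \<open>x = s\<close> or \<open>x = - s\<close> the bound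
  \<open>\<bar>u\<bar> \<le> s\<close> gives \<open>x + u\<close> the sign of \<open>x\<close> or
  makes it zero; the sign condition on \<open>P\<close> then fixes the sign of \<open>Phi\<close> at
  both ends and the intermediate value theorem applies.\<close>

lemma zeta_ex:
  assumes e: "e \<in> E"
  shows "\<exists>x. \<bar>x\<bar> \<le> Cu * eta e \<and> Phi e x = 0"
proof -
  define s where "s = Cu * eta e"
  have s: "s > 0" "s < r / 4" using Cu_pos eta[OF e] Cu_eta[OF e] by (auto simp: s_def)
  have sgn: "0 \<le> \<sigma> * x * Phi e x" if x: "\<bar>x\<bar> = s" for x
  proof -
    have i: "integrable torus (\<lambda>p. P (of_real x + u e (tpt p)))"
      by (rule integrable_torus[of _ "K * r ^ m"], rule shift_cont[OF e _ P_cont(1)], use x s in simp, rule P_le(1))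
         (use norm_shift_u[OF e, of "of_real x"] x s r in \<open>simp add: order.strict_trans\<close>, smt (verit) norm_shift_u[OF e] norm_of_real s(2) x r)
    have pt: "0 \<le> \<sigma> * x * Re (P (of_real x + u e (tpt p)))" for p
    proof -
      define y where "y = x + Re (u e (tpt p))"
      have yc: "of_real x + u e (tpt p) = of_real y" using u_real[OF e, of p] by (simp add: y_def)
      have yr: "\<bar>y\<bar> < r" using norm_shift_u[OF e, of "of_real x" p] x s r unfolding yc by simp
      have ub: "\<bar>Re (u e (tpt p))\<bar> \<le> s" using abs_Re_le_cmod[of "u e (tpt p)"] u_tpt[OF e, of p] by (simp add: s_def)
      have xy: "0 \<le> x * y"
        using x ub unfolding y_def by (cases "x \<ge> 0") (auto simp: mult_nonneg_nonneg mult_nonpos_nonpos)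
      have P0: "P 0 = 0" using P_bound[of 0] r m by (simp add: power_0_left)
      show ?thesis
      proof (cases "y = 0")
        case False
        then have "0 < y * y" using not_real_square_gt_zero by blast
        have "0 \<le> (\<sigma> * y * Re (P (of_real y))) * (x * y)" using P_sign[OF yr] xy by (rule mult_nonneg_nonneg)
        also have "\<dots> = (\<sigma> * x * Re (P (of_real y))) * (y * y)" by (simp add: mult_ac)
        finally show ?thesis unfolding yc using \<open>0 < y * y\<close> by (simp add: zero_le_mult_iff)
      qed (use yc P0 in simp)
    qed
    have "0 \<le> (\<integral>p. \<sigma> * x * Re (P (of_real x + u e (tpt p))) \<partial>torus)"
      by (rule integral_nonneg_AE) (use pt in simp)
    also have "\<dots> = \<sigma> * x * Phi e x" using i by (simp add: Phi_def tavg_def)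
    finally show ?thesis .
  qed
  have c: "continuous_on {-s..s} (\<lambda>x. \<sigma> * Phi e x)"
  proof (intro continuous_intros, rule DERIV_continuous_on)
    fix x assume "x \<in> {-s..s}"
    then show "(Phi e has_real_derivative Re (tavg (\<lambda>\<psi>. P1 (of_real x + u e \<psi>)))) (at x within {-s..s})"
      using Phi_deriv[OF e, of x] s has_field_derivative_at_within by force
  qed
  have "\<exists>x. - s \<le> x \<and> x \<le> s \<and> \<sigma> * Phi e x = 0"
  proof (rule IVT'[OF _ _ _ c])
    show "\<sigma> * Phi e (- s) \<le> 0" using sgn[of "-s"] s by (simp add: zero_le_mult_iff mult_le_0_iff)
    show "0 \<le> \<sigma> * Phi e s" using sgn[of s] s by (simp add: zero_le_mult_iff mult_le_0_iff)
  qed (use s in simp)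
  then obtain x where "- s \<le> x" "x \<le> s" "\<sigma> * Phi e x = 0" by blast
  then have "\<bar>x\<bar> \<le> Cu * eta e \<and> Phi e x = 0" using \<sigma> unfolding s_def by auto
  then show ?thesis by blast
qed

text \<open>By \<open>Phi_abs\<close> there is only one such zero, so the choice cannot destroy
  continuity in \<open>e\<close>.\<close>

definition "zeta e = (SOME x. \<bar>x\<bar> \<le> Cu * eta e \<and> Phi e x = 0)"

lemma zeta: "e \<in> E \<Longrightarrow> \<bar>zeta e\<bar> \<le> Cu * eta e" "e \<in> E \<Longrightarrow> Phi e (zeta e) = 0"
  using someI_ex[OF zeta_ex] unfolding zeta_def by blast+

lemma zeta_r: "e \<in> E \<Longrightarrow> \<bar>zeta e\<bar> < r / 4" using zeta(1) Cu_eta by fastforce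

lemma shift_family:
  assumes "\<And>e. e \<in> E \<Longrightarrow> \<bar>s e\<bar> < r / 4" "continuous_on E s" "H = P \<or> H = P1"
  shows "strip_family E (5 * \<xi> / 8) (\<lambda>e \<psi>. H (of_real (s e) + u e \<psi>))"
proof (rule strip_family_compose[where U = "ball 0 r" and H = H and \<phi> = "\<lambda>e \<psi>. of_real (s e) + u e \<psi>"])
  show "strip_family E (5 * \<xi> / 8) (\<lambda>e \<psi>. of_real (s e) + u e \<psi>)"
    by (intro strip_family_add strip_family_const assms strip_family_mono[OF u_family]) (use \<xi> in auto)
  fix e \<psi> assume "e \<in> E" "\<psi> \<in> strip (5 * \<xi> / 8)"
  then show "of_real (s e) + u e \<psi> \<in> ball 0 r"
    using norm_triangle_ineq[of "of_real (s e)" "u e \<psi>"] u_bound[of e \<psi>] Cu_eta[of e] assms(1)[of e] r by simp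
next
  fix x :: complex assume "x \<in> ball 0 r" "x \<in> \<real>"
  then show "H x \<in> \<real>" using P_real P1_real assms(3) by (auto elim!: Reals_cases)
qed (use \<xi> P_hol assms(3) in auto)

text \<open>\<open>Phi_abs\<close> bounds the distance of \<open>zeta e\<close> to
  \<open>zeta a\<close> by \<open>Phi e (zeta a)\<close> over its slope; the numerator tends to zero
  and the slope stays away from zero near \<open>a > 0\<close>.\<close>

lemma continuous_zeta: "continuous_on E zeta"
  unfolding continuous_on_def
proof
  fix a assume a: "a \<in> E"
  have fam: "strip_family E (5 * \<xi> / 8) (\<lambda>e \<psi>. P (of_real (zeta a) + u e \<psi>))"
    by (rule shift_family[of "\<lambda>_. zeta a"]) (use zeta_r[OF a] in auto)
  have "continuous_on E (\<lambda>e. Phi e (zeta a))"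
    unfolding Phi_def by (intro continuous_intros tavg_continuous[OF fam]) (use \<xi> in simp)
  then have "((\<lambda>e. Phi e (zeta a)) \<longlongrightarrow> Phi a (zeta a)) (at a within E)" using a by (simp add: continuous_on_def)
  then have "((\<lambda>e. \<bar>Phi e (zeta a)\<bar> / (K2 * e ^ (m - 1))) \<longlongrightarrow> \<bar>0\<bar> / (K2 * a ^ (m - 1))) (at a within E)"
    using K2_pos E(1)[OF a] by (intro tendsto_intros) (auto simp: zeta(2)[OF a])
  then have lim: "((\<lambda>e. \<bar>Phi e (zeta a)\<bar> / (K2 * e ^ (m - 1))) \<longlongrightarrow> 0) (at a within E)" by simp
  have "((\<lambda>e. zeta e - zeta a) \<longlongrightarrow> 0) (at a within E)"
  proof (rule Lim_null_comparison[OF _ lim])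
    have "norm (zeta e - zeta a) \<le> \<bar>Phi e (zeta a)\<bar> / (K2 * e ^ (m - 1))" if e: "e \<in> E" for e
      using Phi_abs[OF e zeta_r[OF a] zeta_r[OF e]] zeta(2)[OF e] K2_pos E(1)[OF e]
      by (simp add: field_simps)
    then show "\<forall>\<^sub>F e in at a within E. norm (zeta e - zeta a) \<le> \<bar>Phi e (zeta a)\<bar> / (K2 * e ^ (m - 1))"
      by (simp add: eventually_at_filter)
  qed
  then show "(zeta \<longlongrightarrow> zeta a) (at a within E)" by (rule LIM_zero_cancel)
qed

end

section \<open>The fixed-point equation\<close>

lemma tavg_real:
  assumes "strip_analytic \<rho> \<phi>" "\<rho> \<ge> 0"
  shows "tavg \<phi> = of_real (Re (tavg \<phi>))"
proof -
  have "\<phi> (tpt p) = of_real (Re (\<phi> (tpt p)))" for p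
    using assms by (simp add: strip_analytic_def tpt_def of_real_Re)
  then have "tavg \<phi> = (\<integral>p. complex_of_real (Re (\<phi> (tpt p))) \<partial>torus)" unfolding tavg_def by metis
  also have "\<dots> = of_real (\<integral>p. Re (\<phi> (tpt p)) \<partial>torus)" by (rule integral_complex_of_real)
  finally show ?thesis by simp
qed

lemma norm_exp_le_3: "norm z \<le> 1 \<Longrightarrow> norm (exp z) \<le> (3 :: real)" for z :: complex
  using norm_exp[of z] exp_le exp_le_cancel_iff[of "norm z" 1] by linarith

context response1
begin

text \<open>Each constant is the prefactor of one estimate: \<open>A\<close> for \<open>y\<close>,
  \<open>C0\<close> for \<open>P0\<close>, \<open>Ch\<close> for \<open>h\<close>, \<open>Cp\<close>
  for \<open>pp\<close>, \<open>CB\<close> for \<open>e * B\<close>, \<open>CD\<close> for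
  \<open>DB\<close>, \<open>Cs\<close> for \<open>src\<close>, \<open>CV\<close> for the argument of
  \<open>Q\<close>, \<open>CQ\<close> for \<open>P2\<close> along that argument. \<open>C0\<close>
  is unrelated to the constant of the theorem.\<close>

definition "A = 2 * Cu"
definition "C0 = K * A ^ m"
definition "Ch = K * A ^ (m - 1)"
definition "Cp = CT * C0"
definition "CB = CT * (2 * Ch)"
definition "CD = 2 * Ch + CB"
definition "Cs = (2 * Cu + Fb) + (2 * Cp + C0) + Ch * Cp"
text \<open>\<open>3\<close> bounds \<open>EBi\<close>, the summand \<open>1\<close> covers the
  quadratic term, and the factor \<open>2\<close> leaves half of the radius to the Lipschitz
  estimate.\<close>

definition "CR = 6 * (Cs + 1)"
definition "CV = 3 * CR / K2 + Cp"
definition "CQ = K * (A + 1) ^ (m - 2)"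
text \<open>\<open>CL * tau e\<close> will be the Lipschitz constant. The first summand collects the
  terms in \<open>d\<close>, bounded by \<open>2 * D\<close>; the second those in \<open>w\<close>,
  whose bound carries \<open>1 / K2\<close>. The \<open>9\<close> comes from \<open>EB\<close> and
  \<open>EBi\<close>.\<close>

definition "CL = 2 * (Ch + 2 * CD) + (CB + CD + CD\<^sup>2 + 9 * CQ * CV) / K2"

lemma consts_pos: "A > 0" "C0 > 0" "Ch > 0" "Cp > 0" "CB > 0" "CD > 0" "Cs > 0" "CR > 0" "CV > 0" "CQ > 0" "CL > 0"
proof -
  show A: "A > 0" using Cu_pos by (simp add: A_def)
  show C0: "C0 > 0" and Ch: "Ch > 0" using A K by (simp_all add: C0_def Ch_def)
  show Cp: "Cp > 0" and CB: "CB > 0" using CT_pos C0 Ch by (simp_all add: Cp_def CB_def)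
  show CD: "CD > 0" using Ch CB by (simp add: CD_def)
  show Cs: "Cs > 0" using Ch Cp C0 Cu_pos Fb_pos by (simp add: Cs_def add_pos_pos)
  show CR: "CR > 0" using Cs by (simp add: CR_def)
  show CV: "CV > 0" using CR K2_pos Cp by (simp add: CV_def add_pos_pos)
  show CQ: "CQ > 0" using A K by (simp add: CQ_def)
  show "CL > 0" unfolding CL_def
    using Ch CD CB CV CQ K2_pos by (intro add_pos_pos mult_pos_pos divide_pos_pos zero_less_power) auto
qed

definition "y e \<psi> = of_real (zeta e) + u e \<psi>"
definition "P0 e \<psi> = P (y e \<psi>)"
definition "h e \<psi> = P1 (y e \<psi>)"
definition "h0 e = Re (tavg (h e))"
definition "ht e \<psi> = h e \<psi> - of_real (h0 e)"
definition "pp e \<psi> = of_real e * Top \<alpha> (lam e) e (P0 e) \<psi>"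
definition "B e \<psi> = Top \<alpha> (lam e) e (ht e) \<psi>"
text \<open>This and the next two definitions are flow derivatives, written through the equation of
  the resolvent: \<open>D\<close> of \<open>Top\<close> is \<open>Jop\<close> minus
  \<open>lam\<close> times \<open>Top\<close>. Thus they are strip families with sup bounds, without
  any differentiation.\<close>

definition "DB e \<psi> = Jop \<alpha> e (ht e) \<psi> - of_real (lam e) * B e \<psi>"
definition "Du e \<psi> = of_real e * Jop \<alpha> e F \<psi> - of_real (lam e) * u e \<psi>"
definition "Dp e \<psi> = of_real e * Jop \<alpha> e (P0 e) \<psi> - of_real (lam e) * pp e \<psi>"
definition "theta e = e * h0 e"
definition "EB e \<psi> = exp (- (of_real e * B e \<psi>))"
definition "EBi e \<psi> = exp (of_real e * B e \<psi>)"
text \<open>The residual of \<open>y - pp\<close>: the defects of the approximate inverse on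
  \<open>F\<close> and on \<open>P0\<close>, and the linear term \<open>h * pp\<close> that the
  correction by \<open>pp\<close> creates.\<close>

definition "src e \<psi> = of_real (lam e) * (u e \<psi> + of_real e * Du e \<psi>) - of_real (lam e) * (pp e \<psi> + of_real e * Dp e \<psi>) + of_real e * (h e \<psi> * pp e \<psi>)"
definition "Q e \<psi> v = P (y e \<psi> + v) - P0 e \<psi> - h e \<psi> * v"
text \<open>The equation \<open>(1 + e D) (D + theta) w = Npt e \<psi> w (D w)\<close> is what is left for \<open>w\<close> after substituting \<open>y - pp + EB w\<close>.\<close>

definition "Npt e \<psi> w d = of_real (e * theta e) * d - of_real (e * lam e) * ((B e \<psi> + of_real e * DB e \<psi>) * w)
   + of_real (2 * e\<^sup>2) * (DB e \<psi> * d) - of_real (e ^ 3) * (DB e \<psi> * DB e \<psi> * w)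
   + EBi e \<psi> * (src e \<psi> - of_real e * Q e \<psi> (EB e \<psi> * w - pp e \<psi>))"

abbreviation "\<rho>1 \<equiv> 5 * \<xi> / 8"
abbreviation "\<rho>2 \<equiv> \<xi> / 4"

lemma rho: "0 \<le> \<rho>1" "0 \<le> \<rho>2" "0 < \<rho>2" "\<rho>2 + 3 * \<xi> / 8 \<le> \<rho>1" "\<rho>2 \<le> \<rho>1" "\<rho>1 \<le> \<xi>" "\<rho>2 \<le> \<xi>"
  using \<xi> by auto

lemma cont_id: "continuous_on E (\<lambda>e. e)" by (rule continuous_on_id)

lemma y_family: "strip_family E \<rho>1 y"
  unfolding y_def[abs_def]
  by (intro strip_family_add strip_family_const continuous_zeta strip_family_mono[OF u_family]) (use rho in auto)

lemma P0_family: "strip_family E \<rho>1 P0" and h_family: "strip_family E \<rho>1 h"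
  unfolding P0_def[abs_def] h_def[abs_def] y_def
  by (intro shift_family zeta_r continuous_zeta; simp)+

lemma continuous_h0: "continuous_on E h0"
  unfolding h0_def[abs_def] by (intro continuous_intros tavg_continuous[OF h_family] rho)

lemma ht_family: "strip_family E \<rho>1 ht"
  unfolding ht_def[abs_def] by (intro strip_family_diff h_family strip_family_const continuous_h0)

lemma fam_an: "strip_family E \<rho> \<phi> \<Longrightarrow> e \<in> E \<Longrightarrow> strip_analytic \<rho> (\<phi> e)"
  by (simp add: strip_family_def)

lemma Top_family: "strip_family E \<rho> \<phi> \<Longrightarrow> \<rho> \<ge> 0 \<Longrightarrow> strip_family E \<rho> (\<lambda>e \<psi>. Top \<alpha> (lam e) e (\<phi> e) \<psi>)"
  by (intro strip_family_Top E continuous_lam lam_nz)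

lemma J_family: "strip_family E \<rho> \<phi> \<Longrightarrow> \<rho> \<ge> 0 \<Longrightarrow> strip_family E \<rho> (\<lambda>e \<psi>. Jop \<alpha> e (\<phi> e) \<psi>)"
  by (intro strip_family_Jop E)

lemma pp_family: "strip_family E \<rho>1 pp"
  unfolding pp_def[abs_def] by (intro strip_family_scale[where s = "\<lambda>e. e"] Top_family P0_family cont_id rho)

lemma B_family: "strip_family E \<rho>1 B"
  unfolding B_def[abs_def] by (intro Top_family ht_family rho)

lemma DB_family: "strip_family E \<rho>1 DB"
  unfolding DB_def[abs_def] by (intro strip_family_diff strip_family_scale[where s = lam] J_family ht_family B_family continuous_lam rho)

lemma Du_family: "strip_family E \<xi> Du"
  unfolding Du_def[abs_def]
  by (intro strip_family_diff strip_family_scale[where s = lam] strip_family_scale[where s = "\<lambda>e. e"] J_family strip_family_fixed F u_family continuous_lam cont_id)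
     (use \<xi> in simp)

lemma Dp_family: "strip_family E \<rho>1 Dp"
  unfolding Dp_def[abs_def]
  by (intro strip_family_diff strip_family_scale[where s = lam] strip_family_scale[where s = "\<lambda>e. e"] J_family P0_family pp_family continuous_lam cont_id rho)

lemma down: "strip_family E \<rho>1 \<phi> \<Longrightarrow> strip_family E \<rho>2 \<phi>" "strip_family E \<xi> \<phi> \<Longrightarrow> strip_family E \<rho>2 \<phi>"
  by (auto intro: strip_family_mono rho)

lemma EB_family: "strip_family E \<rho>2 EB" "strip_family E \<rho>2 EBi"
proof -
  have b: "strip_family E \<rho>2 (\<lambda>e \<psi>. of_real e * B e \<psi>)"
    by (intro strip_family_scale[where s = "\<lambda>e. e"] down B_family cont_id)
  have R: "exp x \<in> \<real>" "exp (- x) \<in> \<real>" if "x \<in> \<real>" for x :: complex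
    using that by (auto elim!: Reals_cases simp flip: exp_of_real of_real_minus)
  show "strip_family E \<rho>2 EBi"
    unfolding EBi_def[abs_def]
    by (rule strip_family_compose[where H = exp and U = UNIV, OF b]) (use rho R in \<open>auto intro!: holomorphic_intros\<close>)
  show "strip_family E \<rho>2 EB"
    unfolding EB_def[abs_def]
    by (rule strip_family_compose[where H = "\<lambda>x. exp (- x)" and U = UNIV, OF b]) (use rho R in \<open>auto intro!: holomorphic_intros\<close>)
qed

lemma src_family: "strip_family E \<rho>2 src"
  unfolding src_def[abs_def]
  by (intro strip_family_add strip_family_diff strip_family_mult strip_family_scale[where s = lam] strip_family_scale[where s = "\<lambda>e. e"]
      continuous_lam cont_id down(1)[OF pp_family] down(1)[OF Dp_family] down(1)[OF h_family] down(2)[OF u_family] down(2)[OF Du_family])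

text \<open>Everything is a comparison of powers of \<open>tau e \<le> 1\<close>, with
  \<open>eta = tau ^ m\<close> and \<open>e = tau ^ (m + 1)\<close>. The first identity equates the
  gain of \<open>Top\<close> on a term of size \<open>eta ^ m\<close> with the order of the lower
  bound for \<open>theta\<close>.\<close>

lemma pows:
  assumes e: "e \<in> E"
  shows "eta e ^ (m + 1) = e ^ m" "e\<^sup>2 * eta e ^ (m - 1) = e ^ m * (tau e)\<^sup>2" "(eta e)\<^sup>2 \<le> e"
    "e ^ (m - 1) \<le> eta e" "eta e ^ (m - 1) \<le> eta e" "e \<le> tau e" "e ^ m \<le> e * eta e"
    "eta e * eta e ^ (m - 1) = eta e ^ m" "eta e ^ m \<le> eta e ^ (m - 1)" "e * e ^ m = e ^ (m + 1)" "e ^ m \<le> 1" "eta e ^ m \<le> tau e"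
proof -
  note t = tau[OF e] and n = eta[OF e] and e0 = E(1)[OF e]
  obtain k where k: "m = Suc k" "k \<ge> 1" using m by (cases m) auto
  have et: "e = tau e ^ (m + 1)" using t by simp
  have "eta e ^ (m + 1) = tau e ^ (m * (m + 1))" by (simp only: eta_def power_mult)
  also have "\<dots> = (tau e ^ (m + 1)) ^ m" by (simp only: power_mult[symmetric] mult.commute)
  finally show 1: "eta e ^ (m + 1) = e ^ m" unfolding t(4) .
  have "(tau e ^ (m + 1))\<^sup>2 * eta e ^ (m - 1) = tau e ^ ((m + 1) * 2 + m * (m - 1))"
    by (simp only: eta_def power_mult power_add)
  also have "(m + 1) * 2 + m * (m - 1) = (m + 1) * m + 2" using k by (simp add: algebra_simps)
  also have "tau e ^ ((m + 1) * m + 2) = (tau e ^ (m + 1)) ^ m * (tau e)\<^sup>2" by (simp only: power_mult power_add)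
  finally show "e\<^sup>2 * eta e ^ (m - 1) = e ^ m * (tau e)\<^sup>2" unfolding t(4) .
  have "(eta e)\<^sup>2 = tau e ^ (m * 2)" by (simp only: eta_def power_mult)
  also have "\<dots> \<le> tau e ^ (m + 1)" using t m by (intro power_decreasing) auto
  finally show "(eta e)\<^sup>2 \<le> e" unfolding t(4) .
  have le: "e ^ (m - 1) \<le> e" using power_decreasing[of 1 "m - 1" e] e0 t k by simp
  then show 2: "e ^ (m - 1) \<le> eta e" using n by linarith
  show "eta e ^ (m - 1) \<le> eta e" using power_decreasing[of 1 "m - 1" "eta e"] n k by simp
  show "e \<le> tau e" using n by linarith
  have "e * e ^ (m - 1) \<le> e * eta e" using 2 e0 by (intro mult_left_mono) auto
  then show "e ^ m \<le> e * eta e" using k by simp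
  show "eta e * eta e ^ (m - 1) = eta e ^ m" using k by simp
  show "eta e ^ m \<le> eta e ^ (m - 1)" using n by (intro power_decreasing) auto
  show "e * e ^ m = e ^ (m + 1)" by simp
  show "e ^ m \<le> 1" using e0 t by (intro power_le_one) auto
  have "eta e ^ m \<le> eta e" using power_decreasing[of 1 m "eta e"] n k by simp
  then show "eta e ^ m \<le> tau e" using n by linarith
qed

lemma y_bound: "e \<in> E \<Longrightarrow> \<psi> \<in> strip \<rho>1 \<Longrightarrow> norm (y e \<psi>) \<le> A * eta e"
  using norm_triangle_ineq[of "of_real (zeta e)" "u e \<psi>"] zeta(1)[of e] u_bound[of e \<psi>]
  by (simp add: y_def A_def)

lemma y_r: "e \<in> E \<Longrightarrow> \<psi> \<in> strip \<rho>1 \<Longrightarrow> norm (y e \<psi>) < r"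
  using y_bound[of e \<psi>] Cu_eta[of e] r by (simp add: A_def)

lemma P0_bound: "e \<in> E \<Longrightarrow> \<psi> \<in> strip \<rho>1 \<Longrightarrow> norm (P0 e \<psi>) \<le> C0 * eta e ^ m"
proof -
  assume a: "e \<in> E" "\<psi> \<in> strip \<rho>1"
  have "norm (P0 e \<psi>) \<le> K * norm (y e \<psi>) ^ m" unfolding P0_def by (rule P_bound[OF y_r[OF a]])
  also have "\<dots> \<le> K * (A * eta e) ^ m" using y_bound[OF a] K by (intro mult_left_mono power_mono) auto
  finally show ?thesis by (simp add: C0_def power_mult_distrib mult.assoc)
qed

lemma h_bound: "e \<in> E \<Longrightarrow> \<psi> \<in> strip \<rho>1 \<Longrightarrow> norm (h e \<psi>) \<le> Ch * eta e ^ (m - 1)"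
proof -
  assume a: "e \<in> E" "\<psi> \<in> strip \<rho>1"
  have "norm (h e \<psi>) \<le> K * norm (y e \<psi>) ^ (m - 1)" unfolding h_def by (rule P1_bound[OF y_r[OF a]])
  also have "\<dots> \<le> K * (A * eta e) ^ (m - 1)" using y_bound[OF a] K by (intro mult_left_mono power_mono) auto
  finally show ?thesis by (simp add: Ch_def power_mult_distrib mult.assoc)
qed

lemma h0_bound: "e \<in> E \<Longrightarrow> \<bar>h0 e\<bar> \<le> Ch * eta e ^ (m - 1)"
proof -
  assume e: "e \<in> E"
  have "norm (tavg (h e)) \<le> Ch * eta e ^ (m - 1)"
    by (rule norm_tavg_le, rule h_bound[OF e tpt_strip[OF rho(1)]])
  then show ?thesis unfolding h0_def using abs_Re_le_cmod order_trans by blast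
qed

lemma ht_bound: "e \<in> E \<Longrightarrow> \<psi> \<in> strip \<rho>1 \<Longrightarrow> norm (ht e \<psi>) \<le> 2 * Ch * eta e ^ (m - 1)"
  using norm_triangle_ineq4[of "h e \<psi>" "of_real (h0 e)"] h_bound[of e \<psi>] h0_bound[of e]
  by (simp add: ht_def)

lemma tavg_P0: "e \<in> E \<Longrightarrow> tavg (P0 e) = 0"
proof -
  assume e: "e \<in> E"
  have "Re (tavg (P0 e)) = Phi e (zeta e)" by (simp add: Phi_def P0_def[abs_def] y_def)
  then show ?thesis using tavg_real[OF fam_an[OF P0_family e] rho(1)] zeta(2)[OF e] by simp
qed

lemma tavg_ht: "e \<in> E \<Longrightarrow> tavg (ht e) = 0"
proof -
  assume e: "e \<in> E"
  note an = fam_an[OF h_family e]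
  have "tavg (ht e) = tavg (h e) - of_real (h0 e)"
    using integrable_strip_analytic[OF an rho(1)] by (simp add: tavg_def ht_def torus.prob_space)
  also have "\<dots> = 0" using tavg_real[OF an rho(1)] by (simp add: h0_def)
  finally show ?thesis .
qed

lemma h0_lower: "e \<in> E \<Longrightarrow> K2 * e ^ (m - 1) \<le> \<bar>h0 e\<bar>"
proof -
  assume e: "e \<in> E"
  have "K2 * e ^ (m - 1) \<le> \<sigma> * h0 e"
    using Phi_deriv_lower[OF e zeta_r[OF e]] by (simp add: h0_def h_def[abs_def] y_def)
  then show ?thesis using \<sigma> by auto
qed

lemma theta_lower: "e \<in> E \<Longrightarrow> K2 * e ^ m \<le> \<bar>theta e\<bar>"
proof -
  assume e: "e \<in> E"
  have "e * (K2 * e ^ (m - 1)) \<le> e * \<bar>h0 e\<bar>" using h0_lower[OF e] E(1)[OF e] by (intro mult_left_mono) auto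
  then have "K2 * (e * e ^ (m - 1)) \<le> e * \<bar>h0 e\<bar>" by (metis mult.left_commute)
  moreover have eq: "e * e ^ (m - 1) = e ^ m" using m by (cases m) auto
  ultimately have "K2 * e ^ m \<le> e * \<bar>h0 e\<bar>" by (simp only: eq)
  then show ?thesis using E(1)[OF e] by (simp add: theta_def abs_mult)
qed

lemma theta_nz: "e \<in> E \<Longrightarrow> theta e \<noteq> 0"
proof -
  assume e: "e \<in> E"
  have "0 < K2 * e ^ m" using K2_pos E(1)[OF e] by simp
  then show ?thesis using theta_lower[OF e] by auto
qed

lemma continuous_theta: "continuous_on E theta"
  unfolding theta_def[abs_def] by (intro continuous_intros continuous_h0)

text \<open>\<open>Top\<close> adds one factor \<open>eta\<close> to the size \<open>eta ^ m\<close>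
  of \<open>P0\<close>, and \<open>eta ^ (m + 1) = e ^ m\<close>.\<close>

lemma pp_bound: "e \<in> E \<Longrightarrow> \<psi> \<in> strip \<rho>2 \<Longrightarrow> norm (pp e \<psi>) \<le> Cp * e ^ m"
proof -
  assume a: "e \<in> E" "\<psi> \<in> strip \<rho>2"
  have "e * norm (Top \<alpha> (lam e) e (P0 e) \<psi>) \<le> CT * eta e * (C0 * eta e ^ m)"
    by (rule Top_est[OF a(1) fam_an[OF P0_family a(1)] tavg_P0[OF a(1)] P0_bound[OF a(1)] rho(2,4) a(2)])
  also have "\<dots> = Cp * eta e ^ (m + 1)" by (simp add: Cp_def)
  finally show ?thesis unfolding pows(1)[OF a(1)] using E(1)[OF a(1)] by (simp add: pp_def norm_mult)
qed

lemma B_bound: "e \<in> E \<Longrightarrow> \<psi> \<in> strip \<rho>2 \<Longrightarrow> e * norm (B e \<psi>) \<le> CB * eta e ^ m"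
proof -
  assume a: "e \<in> E" "\<psi> \<in> strip \<rho>2"
  have "e * norm (Top \<alpha> (lam e) e (ht e) \<psi>) \<le> CT * eta e * (2 * Ch * eta e ^ (m - 1))"
    by (rule Top_est[OF a(1) fam_an[OF ht_family a(1)] tavg_ht[OF a(1)] ht_bound[OF a(1)] rho(2,4) a(2)])
  also have "\<dots> = CB * (eta e * eta e ^ (m - 1))" by (simp add: CB_def mult_ac)
  finally show ?thesis unfolding pows(8)[OF a(1)] by (simp add: B_def)
qed

lemma strip21: "\<psi> \<in> strip \<rho>2 \<Longrightarrow> \<psi> \<in> strip \<rho>1" "\<psi> \<in> strip \<rho>2 \<Longrightarrow> \<psi> \<in> strip \<xi>"
  using strip_mono[OF rho(5)] strip_mono[OF rho(7)] by blast+

text \<open>Differentiation undoes the small divisors: \<open>Jop\<close> costs nothing, and the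
  defect \<open>lam * B\<close> is dominated using \<open>lam e = e ^ m * e\<close>.\<close>

lemma DB_bound: "e \<in> E \<Longrightarrow> \<psi> \<in> strip \<rho>2 \<Longrightarrow> norm (DB e \<psi>) \<le> CD * eta e ^ (m - 1)"
proof -
  assume a: "e \<in> E" "\<psi> \<in> strip \<rho>2"
  have "norm (Jop \<alpha> e (ht e) \<psi>) \<le> 2 * Ch * eta e ^ (m - 1)"
    by (rule Jop_bound[OF E(1)[OF a(1)] ht_bound[OF a(1)] strip21(1)[OF a(2)]])
  moreover have "norm (of_real (lam e) * B e \<psi>) \<le> CB * eta e ^ (m - 1)"
  proof -
    have "norm (of_real (lam e) * B e \<psi>) = e ^ m * (e * norm (B e \<psi>))"
      using E(1)[OF a(1)] by (simp add: norm_mult lam_def norm_power)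
    also have "\<dots> \<le> 1 * (CB * eta e ^ m)"
      by (rule mult_mono[OF pows(11)[OF a(1)] B_bound[OF a]]) (use E(1)[OF a(1)] in auto)
    also have "\<dots> \<le> CB * eta e ^ (m - 1)" using pows(9)[OF a(1)] consts_pos by simp
    finally show ?thesis .
  qed
  ultimately show ?thesis
    using norm_triangle_ineq4[of "Jop \<alpha> e (ht e) \<psi>" "of_real (lam e) * B e \<psi>"] by (simp add: DB_def CD_def ring_distribs)
qed

text \<open>The two defects carry \<open>lam e = e ^ (m + 1)\<close> and functions of order
  \<open>eta\<close>; in the last term \<open>pp\<close> supplies \<open>e ^ m\<close> and
  \<open>h\<close> at least one factor \<open>eta\<close>.\<close>

lemma src_bound: "e \<in> E \<Longrightarrow> \<psi> \<in> strip \<rho>2 \<Longrightarrow> norm (src e \<psi>) \<le> Cs * (e ^ (m + 1) * eta e)"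
proof -
  assume a: "e \<in> E" "\<psi> \<in> strip \<rho>2"
  note e0 = E(1)[OF a(1)] and s1 = strip21(1)[OF a(2)] and s = strip21(2)[OF a(2)] and n = eta[OF a(1)] and l = lam[OF a(1)] and t = tau[OF a(1)] and c = consts_pos
  have em: "e ^ m \<le> eta e" using pows(7)[OF a(1)] n t(5) mult_right_mono[of e 1 "eta e"] by linarith
  have u: "norm (u e \<psi>) \<le> Cu * eta e" by (rule u_bound[OF a(1) s1])
  have p: "norm (pp e \<psi>) \<le> Cp * e ^ m" by (rule pp_bound[OF a])
  have p': "norm (pp e \<psi>) \<le> Cp * eta e" using p mult_left_mono[OF em, of Cp] c by linarith
  have lu: "lam e * norm (u e \<psi>) \<le> 1 * (Cu * eta e)" using u l n Cu_pos by (intro mult_mono) auto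
  have "norm (Jop \<alpha> e F \<psi>) \<le> Fb" by (rule Jop_bound[OF e0 F_bound s])
  then have ef: "e * norm (Jop \<alpha> e F \<psi>) \<le> e * Fb" using e0 by (intro mult_left_mono) auto
  have "norm (Du e \<psi>) \<le> e * norm (Jop \<alpha> e F \<psi>) + lam e * norm (u e \<psi>)"
    unfolding Du_def using norm_triangle_ineq4[of "of_real e * Jop \<alpha> e F \<psi>" "of_real (lam e) * u e \<psi>"] e0 l by (simp add: norm_mult)
  also have "\<dots> \<le> 1 * Fb + Cu * 1"
    using lu ef mult_right_mono[of e 1 Fb] mult_left_mono[of "eta e" 1 Cu] t(5) n Fb_pos Cu_pos by linarith
  finally have Du: "norm (Du e \<psi>) \<le> Fb + Cu" by simp
  have U: "norm (u e \<psi> + of_real e * Du e \<psi>) \<le> (2 * Cu + Fb) * eta e"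
  proof -
    have "e * norm (Du e \<psi>) \<le> eta e * (Fb + Cu)" using Du n e0 by (intro mult_mono) auto
    then show ?thesis using u norm_triangle_ineq[of "u e \<psi>" "of_real e * Du e \<psi>"] e0 by (simp add: norm_mult ring_distribs mult.commute)
  qed
  have lp: "lam e * norm (pp e \<psi>) \<le> 1 * (Cp * eta e)" using p' l n c by (intro mult_mono) auto
  have e1: "e * norm (Jop \<alpha> e (P0 e) \<psi>) \<le> 1 * C0"
  proof (intro mult_mono)
    have "norm (Jop \<alpha> e (P0 e) \<psi>) \<le> C0 * eta e ^ m" by (rule Jop_bound[OF e0 P0_bound[OF a(1)] s1])
    also have "\<dots> \<le> C0 * 1" using n c by (intro mult_left_mono power_le_one) auto
    finally show "norm (Jop \<alpha> e (P0 e) \<psi>) \<le> C0" by simp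
  qed (use t c in auto)
  have "norm (Dp e \<psi>) \<le> e * norm (Jop \<alpha> e (P0 e) \<psi>) + lam e * norm (pp e \<psi>)"
    unfolding Dp_def using norm_triangle_ineq4[of "of_real e * Jop \<alpha> e (P0 e) \<psi>" "of_real (lam e) * pp e \<psi>"] e0 l by (simp add: norm_mult)
  also have "\<dots> \<le> C0 + Cp * 1"
    using lp e1 mult_left_mono[of "eta e" 1 Cp] n c by linarith
  finally have Dp: "norm (Dp e \<psi>) \<le> C0 + Cp" by simp
  have PP: "norm (pp e \<psi> + of_real e * Dp e \<psi>) \<le> (2 * Cp + C0) * eta e"
  proof -
    have "e * norm (Dp e \<psi>) \<le> eta e * (C0 + Cp)" using Dp n e0 by (intro mult_mono) auto
    then show ?thesis using p' norm_triangle_ineq[of "pp e \<psi>" "of_real e * Dp e \<psi>"] e0 by (simp add: norm_mult ring_distribs mult.commute)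
  qed
  have H: "norm (of_real e * (h e \<psi> * pp e \<psi>)) \<le> Ch * Cp * (e ^ (m + 1) * eta e)"
  proof -
    have "norm (h e \<psi>) * norm (pp e \<psi>) \<le> (Ch * eta e) * (Cp * e ^ m)"
    proof (rule mult_mono)
      show "norm (h e \<psi>) \<le> Ch * eta e" using h_bound[OF a(1) s1] mult_left_mono[OF pows(5)[OF a(1)], of Ch] c by linarith
    qed (use p c n in auto)
    then have "e * (norm (h e \<psi>) * norm (pp e \<psi>)) \<le> e * ((Ch * eta e) * (Cp * e ^ m))" using e0 by (intro mult_left_mono) auto
    then show ?thesis using e0 by (simp add: norm_mult mult_ac)
  qed
  have "norm (src e \<psi>) \<le> norm (of_real (lam e) * (u e \<psi> + of_real e * Du e \<psi>)) + norm (of_real (lam e) * (pp e \<psi> + of_real e * Dp e \<psi>))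
      + norm (of_real e * (h e \<psi> * pp e \<psi>))"
    unfolding src_def by (intro order_trans[OF norm_triangle_ineq] add_mono norm_triangle_ineq4 order_refl)
  also have "\<dots> \<le> lam e * ((2 * Cu + Fb) * eta e) + lam e * ((2 * Cp + C0) * eta e) + Ch * Cp * (e ^ (m + 1) * eta e)"
    using U PP H l by (intro add_mono) (auto simp: norm_mult intro!: mult_left_mono)
  also have "\<dots> = Cs * (e ^ (m + 1) * eta e)" unfolding Cs_def lam_def by (simp add: ring_distribs mult_ac)
  finally show ?thesis .
qed

end

text \<open>In order: \<open>e * B\<close> is at most one, so that the exponentials are at most
  three; \<open>V\<close> is at most \<open>eta\<close>; arguments of \<open>P\<close> stay in its
  disc; the map contracts by one half; the quadratic term at \<open>- pp\<close> fits into the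
  radius.\<close>

locale response2 = response1 +
  assumes small2: "CB * \<tau>0 \<le> 1" "CV * \<tau>0 \<le> 1" "(A + 1) * \<tau>0 < r" "CL * \<tau>0 \<le> 1 / 2" "CQ * CV * Cp * \<tau>0 \<le> 1"
begin

lemma EB_bound: "e \<in> E \<Longrightarrow> \<psi> \<in> strip \<rho>2 \<Longrightarrow> norm (EB e \<psi>) \<le> 3" "e \<in> E \<Longrightarrow> \<psi> \<in> strip \<rho>2 \<Longrightarrow> norm (EBi e \<psi>) \<le> 3"
proof -
  assume a: "e \<in> E" "\<psi> \<in> strip \<rho>2"
  have "CB * eta e ^ m \<le> CB * \<tau>0" using pows(12)[OF a(1)] tau[OF a(1)] consts_pos by (intro mult_left_mono) auto
  then have "norm (of_real e * B e \<psi>) \<le> 1" using B_bound[OF a] E(1)[OF a(1)] small2(1) by (simp add: norm_mult)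
  then show "norm (EBi e \<psi>) \<le> 3" "norm (EB e \<psi>) \<le> 3"
    unfolding EB_def EBi_def by (simp_all only: norm_exp_le_3 norm_minus_cancel)
qed

text \<open>Radius of the ball for the unknown right-hand side. Dividing by
  \<open>K2 * e ^ m\<close> gives a \<open>w\<close> of order \<open>e * eta\<close>, hence the
  bound \<open>V\<close> for the argument of \<open>Q\<close>, and \<open>LQ\<close> is the
  Lipschitz constant of \<open>Q\<close> on that range.\<close>

definition "R e = CR * (e ^ (m + 1) * eta e)"
definition "V e = CV * (e * eta e)"
definition "LQ e = CQ * eta e ^ (m - 2) * V e"

lemma V: "e \<in> E \<Longrightarrow> 0 < V e" "e \<in> E \<Longrightarrow> V e \<le> eta e" "e \<in> E \<Longrightarrow> A * eta e + V e < r"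
proof -
  assume e: "e \<in> E"
  note e0 = E(1)[OF e] and n = eta[OF e] and c = consts_pos
  show "0 < V e" using e0 n c by (simp add: V_def)
  have "CV * e \<le> CV * \<tau>0" using pows(6)[OF e] tau[OF e] c by (intro mult_left_mono) auto
  then have "CV * e \<le> 1" using small2 by linarith
  then have "(CV * e) * eta e \<le> 1 * eta e" using n by (intro mult_right_mono) auto
  then show v: "V e \<le> eta e" by (simp add: V_def mult.assoc)
  have "(A + 1) * eta e \<le> (A + 1) * \<tau>0" using n c by (intro mult_left_mono) auto
  then show "A * eta e + V e < r" using v small2(3) by (simp add: ring_distribs)
qed

text \<open>The derivative of \<open>Q\<close> in \<open>v\<close> vanishes at \<open>v = 0\<close>.
  The mean value inequality is used twice: with \<open>P2\<close> to bound this derivative on the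
  disc of radius \<open>V e\<close>, then with that bound for \<open>Q\<close> itself.\<close>

lemma Q_lipschitz:
  assumes e: "e \<in> E" and \<psi>: "\<psi> \<in> strip \<rho>2" and v: "norm v \<le> V e" "norm v' \<le> V e"
  shows "norm (Q e \<psi> v - Q e \<psi> v') \<le> LQ e * norm (v - v')"
proof -
  note V = V[OF e] and yb = y_bound[OF e strip21(1)[OF \<psi>]] and c = consts_pos and n = eta[OF e]
  have lt: "norm (y e \<psi> + w) < r" "norm (y e \<psi> + w) \<le> (A + 1) * eta e" if "norm w \<le> V e" for w
    using norm_triangle_ineq[of "y e \<psi>" w] yb V that by (simp_all add: ring_distribs)
  have P1d: "norm (P1 (y e \<psi> + w) - h e \<psi>) \<le> LQ e" if w: "norm w \<le> V e" for w
  proof -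
    have "norm (P1 (y e \<psi> + w) - P1 (y e \<psi> + 0)) \<le> (CQ * eta e ^ (m - 2)) * norm (w - 0)"
    proof (rule field_differentiable_bound[of "cball 0 (V e)" "\<lambda>w. P1 (y e \<psi> + w)" "\<lambda>w. P2 (y e \<psi> + w)"])
      fix w :: complex assume "w \<in> cball 0 (V e)"
      then have w: "norm w \<le> V e" by simp
      have "((\<lambda>w. P1 (y e \<psi> + w)) has_field_derivative P2 (y e \<psi> + w) * 1) (at w)"
        by (intro DERIV_chain2[of P1] P1_deriv lt w) (auto intro!: derivative_eq_intros)
      then show "((\<lambda>w. P1 (y e \<psi> + w)) has_field_derivative P2 (y e \<psi> + w)) (at w within cball 0 (V e))"
        by (simp add: has_field_derivative_at_within)
      have "norm (P2 (y e \<psi> + w)) \<le> K * norm (y e \<psi> + w) ^ (m - 2)" by (rule P2_bound[OF lt(1)[OF w]])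
      also have "\<dots> \<le> K * ((A + 1) * eta e) ^ (m - 2)" using lt(2)[OF w] K by (intro mult_left_mono power_mono) auto
      finally show "norm (P2 (y e \<psi> + w)) \<le> CQ * eta e ^ (m - 2)" by (simp add: CQ_def power_mult_distrib mult.assoc)
    qed (use w V in auto)
    also have "\<dots> \<le> CQ * eta e ^ (m - 2) * V e" using w c n by (intro mult_left_mono) auto
    finally show ?thesis by (simp add: LQ_def h_def)
  qed
  show ?thesis
  proof (rule field_differentiable_bound[of "cball 0 (V e)" _ "\<lambda>w. P1 (y e \<psi> + w) - h e \<psi>"])
    fix w :: complex assume "w \<in> cball 0 (V e)"
    then have w: "norm w \<le> V e" by simp
    show "norm (P1 (y e \<psi> + w) - h e \<psi>) \<le> LQ e" by (rule P1d[OF w])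
    have "((\<lambda>w. P (y e \<psi> + w)) has_field_derivative P1 (y e \<psi> + w) * 1) (at w)"
      by (intro DERIV_chain2[of P] P_deriv lt w) (auto intro!: derivative_eq_intros)
    then have "(Q e \<psi> has_field_derivative P1 (y e \<psi> + w) - h e \<psi>) (at w)"
      unfolding Q_def[abs_def] by (auto intro!: derivative_eq_intros)
    then show "(Q e \<psi> has_field_derivative P1 (y e \<psi> + w) - h e \<psi>) (at w within cball 0 (V e))"
      by (rule has_field_derivative_at_within)
  qed (use v in auto)
qed

text \<open>The factor \<open>e ^ m\<close> pays for inverting \<open>theta\<close>, and a factor
  \<open>(tau e)\<^sup>2\<close> is left as smallness.\<close>

lemma eLQ: "e \<in> E \<Longrightarrow> e * LQ e = CQ * CV * (e ^ m * (tau e)\<^sup>2)"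
proof -
  assume e: "e \<in> E"
  have "eta e ^ (m - 2) * eta e = eta e ^ (m - 1)" using m by (metis Suc_diff_Suc Suc_1 power_Suc2)
  then have "e * LQ e = CQ * CV * (e\<^sup>2 * eta e ^ (m - 1))"
    by (simp add: LQ_def V_def power2_eq_square mult_ac)
  then show ?thesis using pows(2)[OF e] by simp
qed

lemma w_small:
  assumes e: "e \<in> E" and \<psi>: "\<psi> \<in> strip \<rho>2" and w: "norm w \<le> R e / (K2 * e ^ m)"
  shows "norm (EB e \<psi> * w - pp e \<psi>) \<le> V e"
proof -
  note e0 = E(1)[OF e] and c = consts_pos
  have "R e / (K2 * e ^ m) = (CR / K2) * (e * eta e)"
    using e0 K2_pos by (simp add: R_def field_simps)
  then have w': "norm w \<le> (CR / K2) * (e * eta e)" using w by simp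
  have "norm (EB e \<psi> * w) \<le> 3 * ((CR / K2) * (e * eta e))"
    unfolding norm_mult using EB_bound(1)[OF e \<psi>] w' by (intro mult_mono) auto
  moreover have "norm (pp e \<psi>) \<le> Cp * (e * eta e)"
    using pp_bound[OF e \<psi>] mult_left_mono[OF pows(7)[OF e], of Cp] c by linarith
  ultimately have "norm (EB e \<psi> * w - pp e \<psi>) \<le> 3 * ((CR / K2) * (e * eta e)) + Cp * (e * eta e)"
    using norm_triangle_ineq4[of "EB e \<psi> * w" "pp e \<psi>"] by linarith
  also have "\<dots> = V e" by (simp add: V_def CV_def ring_distribs)
  finally show ?thesis .
qed

text \<open>The hypotheses on the differences are exactly the output of \<open>sol_bounds\<close>.
  Terms in \<open>d\<close> lose nothing and need one factor \<open>tau\<close>; terms in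
  \<open>w\<close> have to bring \<open>e ^ m * tau\<close> to make up for the inversion of
  \<open>theta\<close>.\<close>

lemma Npt_lipschitz:
  assumes e: "e \<in> E" and \<psi>: "\<psi> \<in> strip \<rho>2"
    and w: "norm w \<le> R e / (K2 * e ^ m)" "norm w' \<le> R e / (K2 * e ^ m)"
    and D: "norm (w - w') \<le> D / (K2 * e ^ m)" "norm (d - d') \<le> 2 * D"
  shows "norm (Npt e \<psi> w d - Npt e \<psi> w' d') \<le> D / 2"
proof -
  note e0 = E(1)[OF e] and c = consts_pos and n = eta[OF e] and t = tau[OF e] and l = lam[OF e]
  have D0: "D \<ge> 0" using D(2) norm_ge_zero[of "d - d'"] by linarith
  let ?dd = "d - d'" and ?dw = "w - w'"
  let ?q = "Q e \<psi> (EB e \<psi> * w - pp e \<psi>) - Q e \<psi> (EB e \<psi> * w' - pp e \<psi>)"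
  have eq: "Npt e \<psi> w d - Npt e \<psi> w' d' =
     (of_real (e * theta e) * ?dd + of_real (2 * e\<^sup>2) * (DB e \<psi> * ?dd))
     - (of_real (e * lam e) * ((B e \<psi> + of_real e * DB e \<psi>) * ?dw) + of_real (e ^ 3) * (DB e \<psi> * DB e \<psi> * ?dw) + EBi e \<psi> * (of_real e * ?q))"
    unfolding Npt_def by (simp add: algebra_simps)
  have DBb: "norm (DB e \<psi>) \<le> CD * eta e ^ (m - 1)" by (rule DB_bound[OF e \<psi>])
  have n1: "eta e ^ (m - 1) \<le> 1" using pows(5)[OF e] n by linarith
  have DB1: "norm (DB e \<psi>) \<le> CD" using DBb mult_left_mono[OF n1, of CD] c by linarith
  have e2: "e\<^sup>2 \<le> tau e"
  proof -
    have "e * e \<le> e * 1" using e0 t(5) by (intro mult_left_mono) auto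
    then show ?thesis using pows(6)[OF e] unfolding power2_eq_square by linarith
  qed
  have T1: "norm (of_real (e * theta e) * ?dd) \<le> Ch * tau e * (2 * D)"
  proof -
    have "\<bar>h0 e\<bar> \<le> Ch" using h0_bound[OF e] mult_left_mono[OF n1, of Ch] c by linarith
    then have "\<bar>e * theta e\<bar> \<le> tau e * Ch"
      unfolding theta_def abs_mult mult.assoc[symmetric] using e2 e0 t
      by (intro mult_mono) (auto simp: power2_eq_square)
    then have "\<bar>e * theta e\<bar> * norm ?dd \<le> (tau e * Ch) * (2 * D)" using D(2) t c by (intro mult_mono) auto
    then show ?thesis unfolding norm_mult norm_of_real by (simp only: mult.commute[of Ch "tau e"])
  qed
  have T2: "norm (of_real (2 * e\<^sup>2) * (DB e \<psi> * ?dd)) \<le> 2 * CD * tau e * (2 * D)"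
  proof -
    have "(2 * e\<^sup>2) * (norm (DB e \<psi>) * norm ?dd) \<le> (2 * tau e) * (CD * (2 * D))"
      using e2 DB1 D(2) t c D0 by (intro mult_mono mult_nonneg_nonneg) auto
    then show ?thesis by (simp add: norm_mult norm_power mult_ac)
  qed
  have ee: "e ^ (m + 1) \<le> e ^ m * tau e" using mult_left_mono[OF pows(6)[OF e], of "e ^ m"] e0 by (simp add: mult.commute)
  let ?W = "D / (K2 * e ^ m)"
  have W0: "?W \<ge> 0" using D0 K2_pos e0 by simp
  have T3: "norm (of_real (e * lam e) * ((B e \<psi> + of_real e * DB e \<psi>) * ?dw)) \<le> (CB + CD) * (e ^ m * tau e) * ?W"
  proof -
    have "norm (of_real (e * lam e) * (B e \<psi> + of_real e * DB e \<psi>)) \<le> (CB + CD) * (e ^ m * tau e)"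
    proof -
      have b1: "e * norm (B e \<psi>) \<le> CB"
      proof -
        have "CB * eta e ^ m \<le> CB * 1" using n c by (intro mult_left_mono power_le_one) auto
        then show ?thesis using B_bound[OF e \<psi>] by linarith
      qed
      have b2: "e * (e * norm (DB e \<psi>)) \<le> 1 * (1 * CD)" using DB1 e0 t c by (intro mult_mono) auto
      have "norm (B e \<psi> + of_real e * DB e \<psi>) \<le> norm (B e \<psi>) + e * norm (DB e \<psi>)"
        using norm_triangle_ineq[of "B e \<psi>" "of_real e * DB e \<psi>"] e0 by (simp add: norm_mult)
      then have "e * norm (B e \<psi> + of_real e * DB e \<psi>) \<le> e * (norm (B e \<psi>) + e * norm (DB e \<psi>))" using e0 by (intro mult_left_mono) auto
      then have b3: "e * norm (B e \<psi> + of_real e * DB e \<psi>) \<le> CB + CD" using b1 b2 by (simp add: ring_distribs)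
      have "norm (of_real (e * lam e) * (B e \<psi> + of_real e * DB e \<psi>)) = lam e * (e * norm (B e \<psi> + of_real e * DB e \<psi>))"
        using e0 l by (simp add: norm_mult)
      also have "\<dots> \<le> (e ^ m * tau e) * (CB + CD)" using b3 ee e0 t by (intro mult_mono) (auto simp: lam_def)
      finally show ?thesis by (simp add: mult.commute)
    qed
    then have "norm (of_real (e * lam e) * (B e \<psi> + of_real e * DB e \<psi>)) * norm ?dw \<le> (CB + CD) * (e ^ m * tau e) * ?W"
      using D(1) c t e0 by (intro mult_mono) auto
    then show ?thesis by (simp only: norm_mult mult.assoc)
  qed
  have T4: "norm (of_real (e ^ 3) * (DB e \<psi> * DB e \<psi> * ?dw)) \<le> CD\<^sup>2 * (e ^ m * tau e) * ?W"
  proof -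
    have "norm (DB e \<psi>) * norm (DB e \<psi>) \<le> (CD * eta e ^ (m - 1)) * (CD * eta e ^ (m - 1))"
      using DBb c n by (intro mult_mono) auto
    also have "\<dots> = CD\<^sup>2 * ((eta e)\<^sup>2) ^ (m - 1)" by (simp add: power2_eq_square power_mult_distrib mult_ac)
    also have "\<dots> \<le> CD\<^sup>2 * e ^ (m - 1)" using pows(3)[OF e] by (intro mult_left_mono power_mono) auto
    finally have "e ^ 3 * (norm (DB e \<psi>) * norm (DB e \<psi>)) \<le> e ^ 3 * (CD\<^sup>2 * e ^ (m - 1))" using e0 by (intro mult_left_mono) auto
    also have "\<dots> = CD\<^sup>2 * e * e ^ (m + 1)"
    proof -
      obtain k where "m = Suc k" using m by (cases m) auto
      then show ?thesis by (simp add: power3_eq_cube)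
    qed
    also have "\<dots> \<le> CD\<^sup>2 * 1 * (e ^ m * tau e)" using ee e0 t by (intro mult_mono) auto
    finally have Z: "e ^ 3 * (norm (DB e \<psi>) * norm (DB e \<psi>)) \<le> CD\<^sup>2 * (e ^ m * tau e)" by simp
    have "e ^ 3 * (norm (DB e \<psi>) * norm (DB e \<psi>)) * norm ?dw \<le> CD\<^sup>2 * (e ^ m * tau e) * ?W"
      by (rule mult_mono[OF Z D(1)]) (use t e0 in auto)
    then show ?thesis using e0 by (simp add: norm_mult norm_power mult.assoc)
  qed
  have T5: "norm (EBi e \<psi> * (of_real e * ?q)) \<le> 9 * CQ * CV * (e ^ m * tau e) * ?W"
  proof -
    have "norm ?q \<le> LQ e * norm ((EB e \<psi> * w - pp e \<psi>) - (EB e \<psi> * w' - pp e \<psi>))"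
      by (rule Q_lipschitz[OF e \<psi> w_small[OF e \<psi> w(1)] w_small[OF e \<psi> w(2)]])
    also have "(EB e \<psi> * w - pp e \<psi>) - (EB e \<psi> * w' - pp e \<psi>) = EB e \<psi> * ?dw" by (simp add: algebra_simps)
    also have "LQ e * norm (EB e \<psi> * ?dw) \<le> LQ e * (3 * ?W)"
      unfolding norm_mult using EB_bound(1)[OF e \<psi>] D(1) V[OF e] c n
      by (intro mult_left_mono mult_mono) (auto simp: LQ_def)
    finally have "e * norm ?q \<le> e * (LQ e * (3 * ?W))" using e0 by (intro mult_left_mono) auto
    also have "\<dots> = (e * LQ e) * (3 * ?W)" by simp
    also have "\<dots> = CQ * CV * (e ^ m * (tau e)\<^sup>2) * (3 * ?W)" unfolding eLQ[OF e] ..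
    also have "\<dots> \<le> CQ * CV * (e ^ m * tau e) * (3 * ?W)"
    proof -
      have "(tau e)\<^sup>2 \<le> tau e" using t mult_left_mono[of "tau e" 1 "tau e"] by (simp add: power2_eq_square)
      then show ?thesis using e0 c W0 by (intro mult_right_mono mult_left_mono) auto
    qed
    finally have Z: "e * norm ?q \<le> CQ * CV * (e ^ m * tau e) * (3 * ?W)" .
    have "norm (EBi e \<psi> * (of_real e * ?q)) = norm (EBi e \<psi>) * (e * norm ?q)" using e0 by (simp add: norm_mult)
    also have "\<dots> \<le> 3 * (CQ * CV * (e ^ m * tau e) * (3 * ?W))"
      by (rule mult_mono[OF EB_bound(2)[OF e \<psi>] Z]) (use e0 in auto)
    also have "\<dots> = 9 * CQ * CV * (e ^ m * tau e) * ?W" by simp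
    finally show ?thesis .
  qed
  \<comment> \<open>The loss from \<open>theta\<close> cancels here, and a multiple of
    \<open>tau e * D\<close> is all that remains.\<close>
  have KW: "e ^ m * ?W = D / K2" using e0 K2_pos by simp
  have "norm (Npt e \<psi> w d - Npt e \<psi> w' d') \<le> norm (of_real (e * theta e) * ?dd) + norm (of_real (2 * e\<^sup>2) * (DB e \<psi> * ?dd))
     + (norm (of_real (e * lam e) * ((B e \<psi> + of_real e * DB e \<psi>) * ?dw)) + norm (of_real (e ^ 3) * (DB e \<psi> * DB e \<psi> * ?dw)) + norm (EBi e \<psi> * (of_real e * ?q)))"
    unfolding eq by (intro order_trans[OF norm_triangle_ineq4] add_mono norm_triangle_ineq order_trans[OF norm_triangle_ineq] order_refl)
  also have "\<dots> \<le> Ch * tau e * (2 * D) + 2 * CD * tau e * (2 * D) + ((CB + CD) * (e ^ m * tau e) * ?W + CD\<^sup>2 * (e ^ m * tau e) * ?W + 9 * CQ * CV * (e ^ m * tau e) * ?W)"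
    by (intro add_mono T1 T2 T3 T4 T5)
  also have "\<dots> = (2 * (Ch + 2 * CD)) * (tau e * D) + (CB + CD + CD\<^sup>2 + 9 * CQ * CV) * tau e * (e ^ m * ?W)"
    by (simp only: ring_distribs mult_ac add_ac)
  also have "\<dots> = CL * tau e * D" unfolding KW CL_def by (simp add: ring_distribs add_divide_distrib)
  also have "\<dots> \<le> (1 / 2) * D"
  proof (rule mult_right_mono[OF _ D0])
    show "CL * tau e \<le> 1 / 2" using small2(4) mult_left_mono[OF t(2), of CL] c by linarith
  qed
  finally show ?thesis by simp
qed

text \<open>At \<open>w = 0\<close> only \<open>src\<close> and \<open>Q\<close> at
  \<open>- pp\<close> survive. The latter is quadratically small since \<open>Q\<close> vanishes at
  \<open>0\<close>.\<close>

lemma Npt_zero: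
  assumes e: "e \<in> E" and \<psi>: "\<psi> \<in> strip \<rho>2"
  shows "norm (Npt e \<psi> 0 0) \<le> R e / 2"
proof -
  note e0 = E(1)[OF e] and c = consts_pos and n = eta[OF e] and t = tau[OF e] and V = V[OF e]
  have R0: "0 \<le> R e / (K2 * e ^ m)" using e0 n c K2_pos by (simp add: R_def)
  have "norm (EB e \<psi> * 0 - pp e \<psi>) \<le> V e" by (rule w_small[OF e \<psi>]) (use R0 in simp)
  then have "norm (Q e \<psi> (- pp e \<psi>) - Q e \<psi> 0) \<le> LQ e * norm (- pp e \<psi> - 0)"
    using V by (intro Q_lipschitz[OF e \<psi>]) auto
  also have "Q e \<psi> 0 = 0" by (simp add: Q_def P0_def)
  finally have "norm (Q e \<psi> (- pp e \<psi>)) \<le> LQ e * norm (pp e \<psi>)" by simp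
  also have "\<dots> \<le> LQ e * (Cp * e ^ m)" using pp_bound[OF e \<psi>] V c n by (intro mult_left_mono) (auto simp: LQ_def)
  finally have "e * norm (Q e \<psi> (- pp e \<psi>)) \<le> e * (LQ e * (Cp * e ^ m))" using e0 by (intro mult_left_mono) auto
  also have "\<dots> = (e * LQ e) * (Cp * e ^ m)" by simp
  also have "\<dots> = (CQ * CV * Cp) * (tau e)\<^sup>2 * (e ^ m * e ^ m)" unfolding eLQ[OF e] by (simp add: mult_ac)
  also have "\<dots> \<le> 1 * (e ^ (m + 1) * eta e)"
  proof (rule mult_mono)
    have "tau e * tau e \<le> tau e * 1" using t by (intro mult_left_mono) auto
    then have "(tau e)\<^sup>2 \<le> \<tau>0" using t(2) unfolding power2_eq_square by linarith
    then have "(CQ * CV * Cp) * (tau e)\<^sup>2 \<le> (CQ * CV * Cp) * \<tau>0"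
      using c by (intro mult_left_mono) auto
    then show "(CQ * CV * Cp) * (tau e)\<^sup>2 \<le> 1" using small2(5) by linarith
    obtain k where k: "m = Suc k" using m by (cases m) auto
    have "e ^ m * e ^ m = e ^ (m + 1) * e ^ (m - 1)" using k by (simp add: mult_ac)
    also have "\<dots> \<le> e ^ (m + 1) * eta e" using pows(4)[OF e] e0 by (intro mult_left_mono) auto
    finally show "e ^ m * e ^ m \<le> e ^ (m + 1) * eta e" .
  qed (use e0 in auto)
  finally have q: "e * norm (Q e \<psi> (- pp e \<psi>)) \<le> e ^ (m + 1) * eta e" by simp
  have "norm (src e \<psi> - of_real e * Q e \<psi> (- pp e \<psi>)) \<le> Cs * (e ^ (m + 1) * eta e) + e ^ (m + 1) * eta e"
  proof -
    have "norm (of_real e * Q e \<psi> (- pp e \<psi>)) = e * norm (Q e \<psi> (- pp e \<psi>))" using e0 by (simp add: norm_mult)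
    then show ?thesis
      using norm_triangle_ineq4[of "src e \<psi>" "of_real e * Q e \<psi> (- pp e \<psi>)"] src_bound[OF e \<psi>] q by linarith
  qed
  then have "norm (EBi e \<psi>) * norm (src e \<psi> - of_real e * Q e \<psi> (- pp e \<psi>)) \<le> 3 * (Cs * (e ^ (m + 1) * eta e) + e ^ (m + 1) * eta e)"
    using EB_bound(2)[OF e \<psi>] by (intro mult_mono) auto
  also have "\<dots> = R e / 2" by (simp add: R_def CR_def ring_distribs)
  finally show ?thesis by (simp add: Npt_def norm_mult)
qed

end

section \<open>Linearity of the inverses, their equations along an orbit, and the algebra of the
  ansatz\<close>

lemma resolv_cong:
  assumes "\<And>\<psi>. \<psi> \<in> strip \<rho> \<Longrightarrow> \<phi> \<psi> = \<phi>' \<psi>" "\<psi> \<in> strip \<rho>"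
  shows "resolv \<alpha> s \<phi> \<psi> = resolv \<alpha> s \<phi>' \<psi>"
proof -
  have "\<phi> (fst \<psi> - of_real (\<tau> / s), snd \<psi> - of_real (\<alpha> * \<tau> / s)) = \<phi>' (fst \<psi> - of_real (\<tau> / s), snd \<psi> - of_real (\<alpha> * \<tau> / s))" for \<tau>
    by (rule assms(1)[OF strip_shift[OF assms(2)]])
  then show ?thesis unfolding resolv_def by (simp only:)
qed

lemma Jop_diff:
  assumes "strip_analytic \<rho> \<phi>" "strip_analytic \<rho> \<phi>'" "\<psi> \<in> strip \<rho>"
  shows "Jop \<alpha> e (\<lambda>\<psi>. \<phi> \<psi> - \<phi>' \<psi>) \<psi> = Jop \<alpha> e \<phi> \<psi> - Jop \<alpha> e \<phi>' \<psi>"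
proof -
  obtain C where C: "\<And>\<psi>. \<psi> \<in> strip \<rho> \<Longrightarrow> norm (\<phi> \<psi>) \<le> C" using strip_analytic_bounded[OF assms(1)] by blast
  obtain C' where C': "\<And>\<psi>. \<psi> \<in> strip \<rho> \<Longrightarrow> norm (\<phi>' \<psi>) \<le> C'" using strip_analytic_bounded[OF assms(2)] by blast
  have "continuous_on (strip \<rho>) \<phi>" "continuous_on (strip \<rho>) \<phi>'" using assms by (auto simp: strip_analytic_def)
  from resolv_diff[OF this(1) C this(2) C' assms(3)] show ?thesis
    by (simp add: Jop_def left_diff_distrib diff_divide_distrib)
qed

lemma resolv_diff_an:
  assumes "strip_analytic \<rho> \<phi>" "strip_analytic \<rho> \<phi>'" "\<psi> \<in> strip \<rho>"
  shows "resolv \<alpha> s (\<lambda>\<psi>. \<phi> \<psi> - \<phi>' \<psi>) \<psi> = resolv \<alpha> s \<phi> \<psi> - resolv \<alpha> s \<phi>' \<psi>"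
proof -
  obtain C where C: "\<And>\<psi>. \<psi> \<in> strip \<rho> \<Longrightarrow> norm (\<phi> \<psi>) \<le> C" using strip_analytic_bounded[OF assms(1)] by blast
  obtain C' where C': "\<And>\<psi>. \<psi> \<in> strip \<rho> \<Longrightarrow> norm (\<phi>' \<psi>) \<le> C'" using strip_analytic_bounded[OF assms(2)] by blast
  have "continuous_on (strip \<rho>) \<phi>" "continuous_on (strip \<rho>) \<phi>'" using assms by (auto simp: strip_analytic_def)
  from resolv_diff[OF this(1) C this(2) C' assms(3)] show ?thesis .
qed

lemma Jop_ode:
  assumes "strip_analytic \<rho> \<phi>" "e > 0" "\<rho> \<ge> 0"
  shows "((\<lambda>t. Jop \<alpha> e \<phi> (of_real t, of_real (\<alpha> * t))) has_vector_derivative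
    (\<phi> (of_real t, of_real (\<alpha> * t)) - Jop \<alpha> e \<phi> (of_real t, of_real (\<alpha> * t))) / of_real e) (at t)"
proof -
  have "((\<lambda>t. resolv \<alpha> (1 / e) \<phi> (of_real t, of_real (\<alpha> * t)) * of_real (1 / e)) has_vector_derivative
    (\<phi> (of_real t, of_real (\<alpha> * t)) - of_real (1 / e) * resolv \<alpha> (1 / e) \<phi> (of_real t, of_real (\<alpha> * t))) * of_real (1 / e)) (at t)"
    by (rule has_vector_derivative_mult_left, rule resolv_ode[OF assms(1) _ assms(3)]) (use assms in simp)
  then show ?thesis by (simp add: Jop_def mult.commute)
qed

text \<open>The verification of the ansatz at one point of an orbit, separated from all analysis.
  \<open>JF\<close>, \<open>JP\<close>, \<open>Jh\<close> and \<open>y\<close> are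
  \<open>Jop\<close> of \<open>F\<close>, \<open>P0\<close>, \<open>ht\<close> and of the fixed
  point \<open>r\<close>; the large bracket is the second derivative of
  \<open>U - Pp + EB * w\<close>, the next one its first derivative.\<close>

lemma second_order_algebra:
  fixes e :: complex
  assumes e: "e \<noteq> 0" and EB: "EB * EBi = 1"
    and DU: "DU = e * JF - l * U" and DP: "DP = e * JP - l * Pp" and DB: "DB = Jh - l * B" and d: "d = y - e * h0 * w"
    and r: "r = e * (e * h0) * d - e * l * ((B + e * DB) * w) + 2 * e\<^sup>2 * (DB * d) - e ^ 3 * (DB * DB * w) + EBi * (src - e * Q)"
    and src: "src = l * (U + e * DU) - l * (Pp + e * DP) + e * (h * Pp)"
    and Q: "Q = PX - P0 - h * (EB * w - Pp)"
  shows "e * (((F - JF) - l * DU) - ((P0 - JP) - l * DP) +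
      ((EB * ((r - y) / e - e * h0 * d) + - (e * DB) * EB * d) +
       (- (e * DB) * EB * d + (- (e * DB) * (- (e * DB) * EB) + - (e * ((h - h0 - Jh) / e - l * DB)) * EB) * w)))
    + (DU - DP + (EB * d + - (e * DB) * EB * w)) + e * PX = e * F"
proof -
  define rr where "rr = (r - y) / e"
  define hh where "hh = (h - h0 - Jh) / e"
  have rr: "e * rr = r - y" and hh: "e * hh = h - h0 - Jh" using e by (auto simp: rr_def hh_def)
  have EBr: "EB * r = EB * (e * (e * h0) * d - e * l * ((B + e * DB) * w) + 2 * e\<^sup>2 * (DB * d) - e ^ 3 * (DB * DB * w)) + (src - e * Q)"
  proof -
    have "EB * r = EB * (e * (e * h0) * d - e * l * ((B + e * DB) * w) + 2 * e\<^sup>2 * (DB * d) - e ^ 3 * (DB * DB * w)) + (EB * EBi) * (src - e * Q)"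
      unfolding r by (simp add: algebra_simps)
    then show ?thesis unfolding EB by simp
  qed
  have Y: "y = d + e * h0 * w" using d by simp
  have "e * (((F - JF) - l * DU) - ((P0 - JP) - l * DP) +
      ((EB * (rr - e * h0 * d) + - (e * DB) * EB * d) +
       (- (e * DB) * EB * d + (- (e * DB) * (- (e * DB) * EB) + - (e * (hh - l * DB)) * EB) * w)))
    + (DU - DP + (EB * d + - (e * DB) * EB * w)) + e * PX
    = e * (F - JF) - e * l * DU - e * (P0 - JP) + e * l * DP + (EB * (e * rr) - e * e * h0 * EB * d - e * e * DB * EB * d)
      - e * e * DB * EB * d + e * (e * DB) * (e * DB) * EB * w - e * (e * hh) * EB * w + e * e * l * DB * EB * w
      + DU - DP + EB * d - e * DB * EB * w + e * PX"
    by (simp add: algebra_simps)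
  also have "EB * (e * rr) = EB * r - EB * d - e * h0 * EB * w"
    unfolding rr by (subst Y) (simp add: algebra_simps)
  also have "e * hh = h - h0 - DB - l * B" unfolding hh DB by simp
  also have "e * (F - JF) - e * l * DU - e * (P0 - JP) + e * l * DP + (EB * r - EB * d - e * h0 * EB * w - e * e * h0 * EB * d - e * e * DB * EB * d)
      - e * e * DB * EB * d + e * (e * DB) * (e * DB) * EB * w - e * (h - h0 - DB - l * B) * EB * w + e * e * l * DB * EB * w
      + DU - DP + EB * d - e * DB * EB * w + e * PX = e * F"
  proof -
    have J: "e * JF = DU + l * U" "e * JP = DP + l * Pp" using DU DP by simp_all
    show ?thesis
      unfolding EBr src Q power2_eq_square power3_eq_cube right_diff_distrib[of e F JF] right_diff_distrib[of e P0 JP] J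
      by (simp add: algebra_simps)
  qed
  finally show ?thesis unfolding rr_def hh_def .
qed

section \<open>Iteration to the fixed point and the resulting response\<close>

context response2
begin

text \<open>If \<open>(1 + e D) (D + theta) w = q\<close>, then \<open>w\<close> and \<open>D w\<close> are \<open>solw e q\<close> and \<open>sold e q\<close>.\<close>

definition "solw e q = resolv \<alpha> (theta e) (Jop \<alpha> e q)"
definition "sold e q \<psi> = Jop \<alpha> e q \<psi> - of_real (theta e) * solw e q \<psi>"
definition "N q e \<psi> = Npt e \<psi> (solw e (q e) \<psi>) (sold e (q e) \<psi>)"

text \<open>The loss of order \<open>e ^ (- m)\<close> hits only \<open>solw\<close>: in
  \<open>sold\<close> it is multiplied by \<open>theta\<close>, which cancels it.\<close>

lemma sol_bounds:
  assumes e: "e \<in> E" and q: "\<And>\<psi>. \<psi> \<in> strip \<rho>2 \<Longrightarrow> norm (q \<psi>) \<le> D" and \<psi>: "\<psi> \<in> strip \<rho>2"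
  shows "norm (solw e q \<psi>) \<le> D / (K2 * e ^ m)" "norm (sold e q \<psi>) \<le> 2 * D"
proof -
  have D: "D \<ge> 0" using q[OF \<psi>] norm_ge_zero order_trans by blast
  have J: "norm (Jop \<alpha> e q \<psi>) \<le> D" if "\<psi> \<in> strip \<rho>2" for \<psi> by (rule Jop_bound[OF E(1)[OF e] q that])
  have th: "0 < K2 * e ^ m" using K2_pos E(1)[OF e] by simp
  have w: "norm (solw e q \<psi>) \<le> D / \<bar>theta e\<bar>"
    unfolding solw_def by (rule resolv_bound[OF theta_nz[OF e] J \<psi>])
  also have "\<dots> \<le> D / (K2 * e ^ m)" by (rule frac_le) (use theta_lower[OF e] th D in auto)
  finally show "norm (solw e q \<psi>) \<le> D / (K2 * e ^ m)" .
  have "\<bar>theta e\<bar> * norm (solw e q \<psi>) \<le> \<bar>theta e\<bar> * (D / \<bar>theta e\<bar>)" using w by (intro mult_left_mono) auto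
  also have "\<dots> = D" using theta_nz[OF e] by simp
  finally show "norm (sold e q \<psi>) \<le> 2 * D"
    using norm_triangle_ineq4[of "Jop \<alpha> e q \<psi>" "of_real (theta e) * solw e q \<psi>"] J[OF \<psi>]
    by (simp add: sold_def norm_mult)
qed

lemma sol_diff:
  assumes e: "e \<in> E" and q: "strip_analytic \<rho>2 q" "strip_analytic \<rho>2 q'" and \<psi>: "\<psi> \<in> strip \<rho>2"
  shows "solw e q \<psi> - solw e q' \<psi> = solw e (\<lambda>\<psi>. q \<psi> - q' \<psi>) \<psi>"
    "sold e q \<psi> - sold e q' \<psi> = sold e (\<lambda>\<psi>. q \<psi> - q' \<psi>) \<psi>"
proof -
  have "solw e (\<lambda>\<psi>. q \<psi> - q' \<psi>) \<psi> = resolv \<alpha> (theta e) (\<lambda>\<psi>. Jop \<alpha> e q \<psi> - Jop \<alpha> e q' \<psi>) \<psi>"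
    unfolding solw_def by (rule resolv_cong[OF Jop_diff[OF q] \<psi>])
  also have "\<dots> = solw e q \<psi> - solw e q' \<psi>" unfolding solw_def
    by (rule resolv_diff_an[OF strip_analytic_Jop[OF q(1)] strip_analytic_Jop[OF q(2)] \<psi>]) (use E(1)[OF e] rho in auto)
  finally show 1: "solw e q \<psi> - solw e q' \<psi> = solw e (\<lambda>\<psi>. q \<psi> - q' \<psi>) \<psi>" by simp
  show "sold e q \<psi> - sold e q' \<psi> = sold e (\<lambda>\<psi>. q \<psi> - q' \<psi>) \<psi>"
    unfolding sold_def 1[symmetric] Jop_diff[OF q \<psi>] by (simp add: algebra_simps)
qed

lemma N_lipschitz:
  assumes e: "e \<in> E" and q: "strip_analytic \<rho>2 (q e)" "strip_analytic \<rho>2 (q' e)"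
    and b: "\<And>\<psi>. \<psi> \<in> strip \<rho>2 \<Longrightarrow> norm (q e \<psi>) \<le> R e" "\<And>\<psi>. \<psi> \<in> strip \<rho>2 \<Longrightarrow> norm (q' e \<psi>) \<le> R e"
    and D: "\<And>\<psi>. \<psi> \<in> strip \<rho>2 \<Longrightarrow> norm (q e \<psi> - q' e \<psi>) \<le> D" and \<psi>: "\<psi> \<in> strip \<rho>2"
  shows "norm (N q e \<psi> - N q' e \<psi>) \<le> D / 2"
proof -
  note b' = sol_bounds(1)[where q = "q e", OF e b(1) \<psi>] sol_bounds(1)[where q = "q' e", OF e b(2) \<psi>]
  note D' = sol_bounds[where q = "\<lambda>\<psi>. q e \<psi> - q' e \<psi>", OF e D \<psi>, folded sol_diff[OF e q \<psi>]]
  show ?thesis unfolding N_def by (rule Npt_lipschitz[OF e \<psi> b' D'])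
qed

lemma N_bound:
  assumes e: "e \<in> E" and b: "\<And>\<psi>. \<psi> \<in> strip \<rho>2 \<Longrightarrow> norm (q e \<psi>) \<le> R e" and \<psi>: "\<psi> \<in> strip \<rho>2"
  shows "norm (N q e \<psi>) \<le> R e"
proof -
  note sb = sol_bounds[where q = "q e", OF e b \<psi>]
  have R0: "0 \<le> R e / (K2 * e ^ m)" using sb(1) norm_ge_zero order_trans by blast
  have "norm (Npt e \<psi> (solw e (q e) \<psi>) (sold e (q e) \<psi>) - Npt e \<psi> 0 0) \<le> R e / 2"
    by (rule Npt_lipschitz[OF e \<psi> sb(1)]) (use R0 sb in auto)
  then show ?thesis using Npt_zero[OF e \<psi>] norm_triangle_ineq2[of "N q e \<psi>" "Npt e \<psi> 0 0"] by (simp add: N_def)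
qed

lemma solw_family:
  assumes "strip_family E \<rho>2 q"
  shows "strip_family E \<rho>2 (\<lambda>e \<psi>. solw e (q e) \<psi>)" "strip_family E \<rho>2 (\<lambda>e \<psi>. sold e (q e) \<psi>)"
proof -
  have J: "strip_family E \<rho>2 (\<lambda>e. Jop \<alpha> e (q e))" using J_family[OF assms rho(2)] .
  show 1: "strip_family E \<rho>2 (\<lambda>e \<psi>. solw e (q e) \<psi>)" unfolding solw_def
    by (rule strip_family_resolv[OF J continuous_theta theta_nz rho(2)])
  show "strip_family E \<rho>2 (\<lambda>e \<psi>. sold e (q e) \<psi>)" unfolding sold_def
    by (intro strip_family_diff strip_family_scale[where s = theta] J 1 continuous_theta)
qed

lemma Pv_family:
  assumes q: "strip_family E \<rho>2 q" and b: "\<And>e \<psi>. e \<in> E \<Longrightarrow> \<psi> \<in> strip \<rho>2 \<Longrightarrow> norm (q e \<psi>) \<le> R e"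
  shows "strip_family E \<rho>2 (\<lambda>e \<psi>. EB e \<psi> * solw e (q e) \<psi> - pp e \<psi>)"
    "strip_family E \<rho>2 (\<lambda>e \<psi>. P (y e \<psi> + (EB e \<psi> * solw e (q e) \<psi> - pp e \<psi>)))"
    "\<And>e \<psi>. e \<in> E \<Longrightarrow> \<psi> \<in> strip \<rho>2 \<Longrightarrow> norm (y e \<psi> + (EB e \<psi> * solw e (q e) \<psi> - pp e \<psi>)) \<le> A * eta e + V e"
proof -
  show 1: "strip_family E \<rho>2 (\<lambda>e \<psi>. EB e \<psi> * solw e (q e) \<psi> - pp e \<psi>)"
    by (intro strip_family_diff strip_family_mult EB_family solw_family q down(1)[OF pp_family])
  show 2: "norm (y e \<psi> + (EB e \<psi> * solw e (q e) \<psi> - pp e \<psi>)) \<le> A * eta e + V e" if a: "e \<in> E" "\<psi> \<in> strip \<rho>2" for e \<psi>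
    using norm_triangle_ineq[of "y e \<psi>" "EB e \<psi> * solw e (q e) \<psi> - pp e \<psi>"] y_bound[OF a(1) strip21(1)[OF a(2)]]
      w_small[OF a sol_bounds(1)[where q = "q e", OF a(1) b[OF a(1)] a(2)]] by simp
  show "strip_family E \<rho>2 (\<lambda>e \<psi>. P (y e \<psi> + (EB e \<psi> * solw e (q e) \<psi> - pp e \<psi>)))"
  proof (rule strip_family_compose[where H = P and U = "ball 0 r" and \<phi> = "\<lambda>e \<psi>. y e \<psi> + (EB e \<psi> * solw e (q e) \<psi> - pp e \<psi>)"])
    show "strip_family E \<rho>2 (\<lambda>e \<psi>. y e \<psi> + (EB e \<psi> * solw e (q e) \<psi> - pp e \<psi>))"
      by (intro strip_family_add 1 down(1)[OF y_family])
    fix e \<psi> assume "e \<in> E" "\<psi> \<in> strip \<rho>2"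
    then show "y e \<psi> + (EB e \<psi> * solw e (q e) \<psi> - pp e \<psi>) \<in> ball 0 r"
      using 2[of e \<psi>] V(3)[of e] by simp
  next
    fix x :: complex assume "x \<in> ball 0 r" "x \<in> \<real>"
    then show "P x \<in> \<real>" using P_real by (auto elim!: Reals_cases)
  qed (use P_hol rho in auto)
qed

lemma N_family:
  assumes q: "strip_family E \<rho>2 q" and b: "\<And>e \<psi>. e \<in> E \<Longrightarrow> \<psi> \<in> strip \<rho>2 \<Longrightarrow> norm (q e \<psi>) \<le> R e"
  shows "strip_family E \<rho>2 (N q)"
proof -
  note Pv = Pv_family[OF q b] and w = solw_family[OF q]
  have cs: "continuous_on E (\<lambda>e. e * theta e)" "continuous_on E (\<lambda>e. e * lam e)" "continuous_on E (\<lambda>e. 2 * e\<^sup>2)" "continuous_on E (\<lambda>e. e ^ 3)"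
    by (intro continuous_intros continuous_theta continuous_lam)+
  have B': "strip_family E \<rho>2 (\<lambda>e \<psi>. B e \<psi> + of_real e * DB e \<psi>)"
    by (intro strip_family_add strip_family_scale[where s = "\<lambda>e. e"] cont_id down(1)[OF B_family] down(1)[OF DB_family])
  have Qf: "strip_family E \<rho>2 (\<lambda>e \<psi>. Q e \<psi> (EB e \<psi> * solw e (q e) \<psi> - pp e \<psi>))"
    unfolding Q_def by (intro strip_family_diff strip_family_mult Pv(1,2) down(1)[OF P0_family] down(1)[OF h_family])
  show ?thesis unfolding N_def[abs_def] Npt_def
    by (intro strip_family_add strip_family_diff strip_family_mult[of _ _ EBi] strip_family_mult[of _ _ DB] strip_family_mult[of _ _ "\<lambda>e \<psi>. DB e \<psi> * DB e \<psi>"]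
      strip_family_mult[of _ _ "\<lambda>e \<psi>. B e \<psi> + of_real e * DB e \<psi>"]
      strip_family_scale[where s = "\<lambda>e. e * theta e"] strip_family_scale[where s = "\<lambda>e. e * lam e"] strip_family_scale[where s = "\<lambda>e. 2 * e\<^sup>2"]
      strip_family_scale[where s = "\<lambda>e. e ^ 3"] strip_family_scale[where s = "\<lambda>e. e"] cont_id cs B' Qf w EB_family src_family down(1)[OF DB_family])
qed

text \<open>The iteration runs on whole families rather than for each \<open>e\<close> separately;
  uniform convergence over \<open>E\<close> then hands joint continuity in parameter and point to
  the limit.\<close>

definition "it n = (N ^^ n) (\<lambda>e \<psi>. 0)"

lemma it_0: "it 0 e \<psi> = 0" by (simp add: it_def)
lemma it_Suc: "it (Suc n) = N (it n)" by (simp add: it_def)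

lemma R_le: "e \<in> E \<Longrightarrow> 0 \<le> R e" "e \<in> E \<Longrightarrow> R e \<le> CR"
proof -
  assume e: "e \<in> E"
  note e0 = E(1)[OF e] and n = eta[OF e] and t = tau[OF e] and c = consts_pos
  show "0 \<le> R e" using e0 n c by (simp add: R_def)
  have "e ^ (m + 1) * eta e \<le> 1 * 1" using e0 t n by (intro mult_mono power_le_one) auto
  then have "CR * (e ^ (m + 1) * eta e) \<le> CR * 1" using c by (intro mult_left_mono) auto
  then show "R e \<le> CR" by (simp add: R_def)
qed

lemma it_props: "strip_family E \<rho>2 (it n) \<and> (\<forall>e\<in>E. \<forall>\<psi>\<in>strip \<rho>2. norm (it n e \<psi>) \<le> R e)"
proof (induction n)
  case 0
  have "strip_family E \<rho>2 (\<lambda>e \<psi>. complex_of_real 0)" by (rule strip_family_const) simp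
  then show ?case using R_le by (simp add: it_def)
next
  case (Suc n)
  then show ?case unfolding it_Suc using N_family N_bound by blast
qed

lemma it_an: "e \<in> E \<Longrightarrow> strip_analytic \<rho>2 (it n e)" and it_bound: "e \<in> E \<Longrightarrow> \<psi> \<in> strip \<rho>2 \<Longrightarrow> norm (it n e \<psi>) \<le> R e"
  using it_props[of n] by (auto simp: strip_family_def)

lemma it_step: "e \<in> E \<Longrightarrow> \<psi> \<in> strip \<rho>2 \<Longrightarrow> norm (it (Suc n) e \<psi> - it n e \<psi>) \<le> R e * (1 / 2) ^ n"
proof (induction n arbitrary: \<psi>)
  case 0
  then show ?case using it_bound[of e \<psi> 1] by (simp add: it_0)
next
  case (Suc n)
  have "norm (N (it (Suc n)) e \<psi> - N (it n) e \<psi>) \<le> (R e * (1 / 2) ^ n) / 2"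
    using Suc by (intro N_lipschitz it_an it_bound) auto
  then show ?case by (simp add: it_Suc)
qed

definition "sol e \<psi> = (\<Sum>i. it (Suc i) e \<psi> - it i e \<psi>)"

lemma it_uniform: "uniform_limit (E \<times> strip \<rho>2) (\<lambda>n p. it n (fst p) (snd p)) (\<lambda>p. sol (fst p) (snd p)) sequentially"
proof -
  have "uniform_limit (E \<times> strip \<rho>2) (\<lambda>n p. \<Sum>i<n. it (Suc i) (fst p) (snd p) - it i (fst p) (snd p))
     (\<lambda>p. \<Sum>i. it (Suc i) (fst p) (snd p) - it i (fst p) (snd p)) sequentially"
  proof (rule Weierstrass_m_test)
    show "summable (\<lambda>n. CR * (1 / 2) ^ n)" by (intro summable_mult summable_geometric) simp
    fix n and p :: "real \<times> complex \<times> complex" assume "p \<in> E \<times> strip \<rho>2"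
    then have p: "fst p \<in> E" "snd p \<in> strip \<rho>2" by auto
    have "R (fst p) * (1 / 2) ^ n \<le> CR * (1 / 2) ^ n" using R_le(2)[OF p(1)] by (intro mult_right_mono) auto
    then show "norm (it (Suc n) (fst p) (snd p) - it n (fst p) (snd p)) \<le> CR * (1 / 2) ^ n"
      using it_step[OF p, of n] by linarith
  qed
  moreover have "(\<Sum>i<n. it (Suc i) e \<psi> - it i e \<psi>) = it n e \<psi>" for n e \<psi>
    using sum_lessThan_telescope[of "\<lambda>i. it i e \<psi>" n] by (simp add: it_0)
  ultimately show ?thesis by (simp add: sol_def)
qed

lemma sol_family: "strip_family E \<rho>2 sol"
  by (rule strip_family_uniform_limit[OF _ it_uniform rho(2)]) (use it_props in blast)

lemma it_lim: "e \<in> E \<Longrightarrow> \<psi> \<in> strip \<rho>2 \<Longrightarrow> (\<lambda>n. it n e \<psi>) \<longlonglongrightarrow> sol e \<psi>"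
  using tendsto_uniform_limitI[OF it_uniform, of "(e, \<psi>)"] by simp

lemma sol_bound: "e \<in> E \<Longrightarrow> \<psi> \<in> strip \<rho>2 \<Longrightarrow> norm (sol e \<psi>) \<le> R e"
  by (rule Lim_bounded[OF tendsto_norm[OF it_lim], of _ _ 0]) (use it_bound in auto)

text \<open>Uniform closeness of an iterate to \<open>sol\<close> is the hypothesis of
  \<open>N_lipschitz\<close>, so \<open>N\<close> of the iterates tends to \<open>N sol\<close>;
  being the shifted iteration, it also tends to \<open>sol\<close>.\<close>

lemma sol_fixed:
  assumes e: "e \<in> E" and \<psi>: "\<psi> \<in> strip \<rho>2"
  shows "N sol e \<psi> = sol e \<psi>"
proof -
  have "(\<lambda>n. N (it n) e \<psi>) \<longlonglongrightarrow> N sol e \<psi>"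
  proof (rule LIMSEQ_I)
    fix \<delta> :: real assume \<delta>: "\<delta> > 0"
    then obtain n0 where n0: "\<And>n p. n \<ge> n0 \<Longrightarrow> p \<in> E \<times> strip \<rho>2 \<Longrightarrow> dist (it n (fst p) (snd p)) (sol (fst p) (snd p)) < \<delta>"
      using uniform_limitD[OF it_uniform \<delta>] unfolding eventually_sequentially by blast
    show "\<exists>no. \<forall>n\<ge>no. norm (N (it n) e \<psi> - N sol e \<psi>) < \<delta>"
    proof (intro exI allI impI)
      fix n assume n: "n \<ge> n0"
      have "norm (N (it n) e \<psi> - N sol e \<psi>) \<le> \<delta> / 2"
      proof (rule N_lipschitz[where q = "it n" and q' = sol and D = \<delta>, OF e it_an[OF e] fam_an[OF sol_family e] it_bound[OF e] sol_bound[OF e] _ \<psi>])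
        fix \<psi> assume "\<psi> \<in> strip \<rho>2"
        then show "norm (it n e \<psi> - sol e \<psi>) \<le> \<delta>" using n0[OF n, of "(e, \<psi>)"] e by (simp add: dist_norm)
      qed
      then show "norm (N (it n) e \<psi> - N sol e \<psi>) < \<delta>" using \<delta> by simp
    qed
  qed
  moreover have "(\<lambda>n. N (it n) e \<psi>) \<longlonglongrightarrow> sol e \<psi>"
    using LIMSEQ_Suc[OF it_lim[OF e \<psi>]] by (simp add: it_Suc)
  ultimately show ?thesis using LIMSEQ_unique by blast
qed

definition "X e \<psi> = y e \<psi> + (EB e \<psi> * solw e (sol e) \<psi> - pp e \<psi>)"

lemma X_family: "strip_family E \<rho>2 X"
  unfolding X_def[abs_def] by (intro strip_family_add down(1)[OF y_family] Pv_family(1)[OF sol_family sol_bound])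

lemma X_bound: "e \<in> E \<Longrightarrow> \<psi> \<in> strip \<rho>2 \<Longrightarrow> norm (X e \<psi>) \<le> (A + 1) * eta e"
  using Pv_family(3)[OF sol_family sol_bound, of e \<psi>] V(2)[of e] by (simp add: X_def ring_distribs)

lemma X_less: "e \<in> E \<Longrightarrow> \<psi> \<in> strip \<rho>2 \<Longrightarrow> norm (X e \<psi>) < r"
  using Pv_family(3)[OF sol_family sol_bound, of e \<psi>] V(3)[of e] by (simp add: X_def)

abbreviation "orb t \<equiv> (complex_of_real t, complex_of_real (\<alpha> * t))"

lemma orb_strip: "0 \<le> \<rho> \<Longrightarrow> orb t \<in> strip \<rho>" by (simp add: strip_def)

lemma Top_ode:
  assumes e: "e \<in> E" and an: "strip_analytic \<rho> \<phi>" and \<rho>: "\<rho> \<ge> 0"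
  shows "((\<lambda>t. Top \<alpha> (lam e) e \<phi> (orb t)) has_vector_derivative
    (Jop \<alpha> e \<phi> (orb t) - of_real (lam e) * Top \<alpha> (lam e) e \<phi> (orb t))) (at t)"
  unfolding Top_def by (rule resolv_ode[OF strip_analytic_Jop[OF an E(1)[OF e] \<rho>] lam_nz[OF e] \<rho>])

lemma scaled_Top_ode:
  assumes e: "e \<in> E" and an: "strip_analytic \<rho> \<phi>" and \<rho>: "\<rho> \<ge> 0"
    and U: "\<And>\<psi>. U \<psi> = of_real e * Top \<alpha> (lam e) e \<phi> \<psi>"
    and U': "\<And>\<psi>. U' \<psi> = of_real e * Jop \<alpha> e \<phi> \<psi> - of_real (lam e) * U \<psi>"
  shows "((\<lambda>t. U (orb t)) has_vector_derivative U' (orb t)) (at t)"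
    "((\<lambda>t. U' (orb t)) has_vector_derivative (\<phi> (orb t) - Jop \<alpha> e \<phi> (orb t)) - of_real (lam e) * U' (orb t)) (at t)"
proof -
  have e0: "complex_of_real e \<noteq> 0" using E(1)[OF e] by simp
  have "((\<lambda>t. of_real e * Top \<alpha> (lam e) e \<phi> (orb t)) has_vector_derivative
     of_real e * (Jop \<alpha> e \<phi> (orb t) - of_real (lam e) * Top \<alpha> (lam e) e \<phi> (orb t))) (at t)"
    by (rule has_vector_derivative_mult_right[OF Top_ode[OF e an \<rho>]])
  then show 1: "((\<lambda>t. U (orb t)) has_vector_derivative U' (orb t)) (at t)"
    by (simp add: U U' algebra_simps)
  have "((\<lambda>t. of_real e * Jop \<alpha> e \<phi> (orb t) - of_real (lam e) * U (orb t)) has_vector_derivative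
     of_real e * ((\<phi> (orb t) - Jop \<alpha> e \<phi> (orb t)) / of_real e) - of_real (lam e) * U' (orb t)) (at t)"
    by (intro has_vector_derivative_diff has_vector_derivative_mult_right 1 Jop_ode[OF an E(1)[OF e] \<rho>])
  then show "((\<lambda>t. U' (orb t)) has_vector_derivative (\<phi> (orb t) - Jop \<alpha> e \<phi> (orb t)) - of_real (lam e) * U' (orb t)) (at t)"
    using e0 by (simp add: U')
qed

text \<open>On an orbit the flow derivative is the time derivative, and each ingredient has its
  derivative given by the equation of its resolvent. What remains is an identity between
  values.\<close>

lemma X_ode:
  assumes e: "e \<in> E"
  shows "\<exists>x1 x2. \<forall>t. ((\<lambda>t. X e (orb t)) has_vector_derivative x1 t) (at t) \<and> (x1 has_vector_derivative x2 t) (at t) \<and>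
    of_real e * x2 t + x1 t + of_real e * P (X e (orb t)) = of_real e * F (orb t)"
proof -
  note e0 = E(1)[OF e]
  let ?e = "complex_of_real e" and ?l = "complex_of_real (lam e)" and ?h = "complex_of_real (h0 e)"
  define w where "w \<psi> = solw e (sol e) \<psi>" for \<psi>
  define d where "d \<psi> = sold e (sol e) \<psi>" for \<psi>
  have san: "strip_analytic \<rho>2 (sol e)" by (rule fam_an[OF sol_family e])
  have u': "((\<lambda>t. u e (orb t)) has_vector_derivative Du e (orb t)) (at t)" for t
    by (rule scaled_Top_ode(1)[OF e F, where U = "u e" and U' = "Du e"]) (use \<xi> in \<open>simp_all add: u_def Du_def\<close>)
  have u'': "((\<lambda>t. Du e (orb t)) has_vector_derivative (F (orb t) - Jop \<alpha> e F (orb t)) - ?l * Du e (orb t)) (at t)" for t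
    by (rule scaled_Top_ode(2)[OF e F, where U = "u e" and U' = "Du e"]) (use \<xi> in \<open>simp_all add: u_def Du_def\<close>)
  note P0an = fam_an[OF P0_family e]
  have p': "((\<lambda>t. pp e (orb t)) has_vector_derivative Dp e (orb t)) (at t)" for t
    by (rule scaled_Top_ode(1)[OF e P0an rho(1), where U = "pp e" and U' = "Dp e"]) (simp_all add: pp_def Dp_def)
  have p'': "((\<lambda>t. Dp e (orb t)) has_vector_derivative (P0 e (orb t) - Jop \<alpha> e (P0 e) (orb t)) - ?l * Dp e (orb t)) (at t)" for t
    by (rule scaled_Top_ode(2)[OF e P0an rho(1), where U = "pp e" and U' = "Dp e"]) (simp_all add: pp_def Dp_def)
  have B': "((\<lambda>t. B e (orb t)) has_vector_derivative DB e (orb t)) (at t)" for t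
    unfolding B_def DB_def by (rule Top_ode[OF e fam_an[OF ht_family e] rho(1)])
  have DB': "((\<lambda>t. DB e (orb t)) has_vector_derivative (ht e (orb t) - Jop \<alpha> e (ht e) (orb t)) / ?e - ?l * DB e (orb t)) (at t)" for t
  proof -
    have "((\<lambda>t. Jop \<alpha> e (ht e) (orb t) - ?l * B e (orb t)) has_vector_derivative
      (ht e (orb t) - Jop \<alpha> e (ht e) (orb t)) / ?e - ?l * DB e (orb t)) (at t)"
      by (intro has_vector_derivative_diff has_vector_derivative_mult_right B' Jop_ode[OF fam_an[OF ht_family e] e0 rho(1)])
    then show ?thesis unfolding DB_def[of e] .
  qed
  have w': "((\<lambda>t. w (orb t)) has_vector_derivative d (orb t)) (at t)" for t
    unfolding w_def d_def sold_def solw_def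
    by (rule resolv_ode[OF strip_analytic_Jop[OF san e0 rho(2)] theta_nz[OF e] rho(2)])
  have d': "((\<lambda>t. d (orb t)) has_vector_derivative (sol e (orb t) - Jop \<alpha> e (sol e) (orb t)) / ?e - ?e * ?h * d (orb t)) (at t)" for t
  proof -
    have "((\<lambda>t. Jop \<alpha> e (sol e) (orb t) - of_real (theta e) * w (orb t)) has_vector_derivative
      (sol e (orb t) - Jop \<alpha> e (sol e) (orb t)) / ?e - of_real (theta e) * d (orb t)) (at t)"
      by (intro has_vector_derivative_diff has_vector_derivative_mult_right w' Jop_ode[OF san e0 rho(2)])
    then show ?thesis unfolding d_def sold_def w_def theta_def by simp
  qed
  have E': "((\<lambda>t. EB e (orb t)) has_vector_derivative - (?e * DB e (orb t)) * EB e (orb t)) (at t)" for t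
  proof -
    have "((\<lambda>t. - (?e * B e (orb t))) has_vector_derivative - (?e * DB e (orb t))) (at t)"
      by (intro has_vector_derivative_minus has_vector_derivative_mult_right B')
    moreover have "(exp has_field_derivative exp (- (?e * B e (orb t)))) (at (- (?e * B e (orb t))))" by (rule DERIV_exp)
    ultimately have "((exp \<circ> (\<lambda>t. - (?e * B e (orb t)))) has_vector_derivative - (?e * DB e (orb t)) * exp (- (?e * B e (orb t)))) (at t)"
      by (rule field_vector_diff_chain_at)
    then show ?thesis by (simp add: o_def EB_def)
  qed
  define x1 where "x1 t = Du e (orb t) - Dp e (orb t) + (EB e (orb t) * d (orb t) + - (?e * DB e (orb t)) * EB e (orb t) * w (orb t))" for t
  \<comment> \<open>Both candidates are spelled out exactly as the product rule delivers them, which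
    is also the form in \<open>second_order_algebra\<close>.\<close>
  define x2 where "x2 t = ((F (orb t) - Jop \<alpha> e F (orb t)) - ?l * Du e (orb t)) - ((P0 e (orb t) - Jop \<alpha> e (P0 e) (orb t)) - ?l * Dp e (orb t)) +
     ((EB e (orb t) * ((sol e (orb t) - Jop \<alpha> e (sol e) (orb t)) / ?e - ?e * ?h * d (orb t)) + - (?e * DB e (orb t)) * EB e (orb t) * d (orb t)) +
      (- (?e * DB e (orb t)) * EB e (orb t) * d (orb t) + (- (?e * DB e (orb t)) * (- (?e * DB e (orb t)) * EB e (orb t)) +
        - (?e * ((ht e (orb t) - Jop \<alpha> e (ht e) (orb t)) / ?e - ?l * DB e (orb t))) * EB e (orb t)) * w (orb t)))" for t
  have "((\<lambda>t. X e (orb t)) has_vector_derivative x1 t) (at t)" for t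
  proof -
    have "((\<lambda>t. (of_real (zeta e) + u e (orb t)) + (EB e (orb t) * w (orb t) - pp e (orb t))) has_vector_derivative
      ((0 + Du e (orb t)) + ((EB e (orb t) * d (orb t) + (- (?e * DB e (orb t)) * EB e (orb t)) * w (orb t)) - Dp e (orb t)))) (at t)"
      by (intro has_vector_derivative_add has_vector_derivative_diff has_vector_derivative_mult has_vector_derivative_const u' p' w' E')
    then show ?thesis by (simp add: X_def y_def w_def x1_def algebra_simps)
  qed
  moreover have "(x1 has_vector_derivative x2 t) (at t)" for t
    unfolding x1_def[abs_def] x2_def
    by (intro has_vector_derivative_add has_vector_derivative_diff has_vector_derivative_mult has_vector_derivative_minus has_vector_derivative_mult_right u'' p'' w' d' E' DB')
  moreover have "?e * x2 t + x1 t + ?e * P (X e (orb t)) = ?e * F (orb t)" for t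
  proof -
    let ?o = "orb t"
    have o: "?o \<in> strip \<rho>2" by (rule orb_strip[OF rho(2)])
    have eq: "sol e ?o = ?e * (?e * ?h) * d ?o - ?e * ?l * ((B e ?o + ?e * DB e ?o) * w ?o) + 2 * ?e\<^sup>2 * (DB e ?o * d ?o)
       - ?e ^ 3 * (DB e ?o * DB e ?o * w ?o) + EBi e ?o * (src e ?o - ?e * Q e ?o (EB e ?o * w ?o - pp e ?o))"
      using sol_fixed[OF e o] unfolding N_def Npt_def theta_def w_def[symmetric] d_def[symmetric] by simp
    have "EB e ?o * EBi e ?o = 1" by (simp add: EB_def EBi_def flip: exp_add)
    moreover have "?e \<noteq> 0" using e0 by simp
    moreover have "d ?o = Jop \<alpha> e (sol e) ?o - ?e * ?h * w ?o" by (simp add: d_def w_def sold_def theta_def)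
    moreover have "Q e ?o (EB e ?o * w ?o - pp e ?o) = P (X e ?o) - P0 e ?o - h e ?o * (EB e ?o * w ?o - pp e ?o)"
      by (simp add: Q_def X_def w_def)
    ultimately show ?thesis unfolding x1_def x2_def ht_def[of e ?o]
      by (intro second_order_algebra[OF _ _ Du_def Dp_def DB_def _ eq src_def])
  qed
  ultimately show ?thesis by blast
qed

end

section \<open>The admissible parameters\<close>

lemma common_small_factor:
  assumes "finite S" "b > (0 :: real)"
  obtains t :: real where "0 < t" "t \<le> 1" "\<And>a. a \<in> S \<Longrightarrow> a * t \<le> b"
proof
  let ?s = "1 + (\<Sum>a\<in>S. \<bar>a\<bar>)"
  let ?t = "min 1 (b / ?s)"
  have s: "?s > 0" by (simp add: add_pos_nonneg sum_nonneg)
  then show t: "0 < ?t" using assms by simp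
  show "?t \<le> 1" by simp
  fix a assume "a \<in> S"
  then have "\<bar>a\<bar> \<le> ?s" using member_le_sum[of a S abs] assms by auto
  then have "a \<le> ?s" by linarith
  then have "a * ?t \<le> ?s * ?t" using t by (intro mult_right_mono) auto
  also have "\<dots> \<le> ?s * (b / ?s)" using s by (intro mult_left_mono) auto
  finally show "a * ?t \<le> b" using s by simp
qed

text \<open>The only arithmetic information about \<open>\<alpha>\<close> and \<open>e\<close> that
  the fixed-point argument receives; continued fractions enter through
  \<open>I_set_small_divisors\<close> alone.\<close>

definition controlled_divisors :: "real \<Rightarrow> real \<Rightarrow> nat \<Rightarrow> real \<Rightarrow> real \<Rightarrow> bool" where
  "controlled_divisors \<alpha> d m C e \<longleftrightarrow>
     (\<exists>q\<ge>1. e * q \<le> C * root (m + 1) e ^ m \<and> exp (- d * q) \<le> e ^ (m + 1) \<and>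
        (\<forall>\<nu>. \<nu> \<noteq> (0, 0) \<longrightarrow> nrm1 \<nu> < q \<longrightarrow> 1 / (2 * q) \<le> \<bar>freq \<alpha> \<nu>\<bar>))"

definition solves_on_orbit ::
  "real \<Rightarrow> real \<Rightarrow> (complex \<Rightarrow> complex) \<Rightarrow> (complex \<times> complex \<Rightarrow> complex) \<Rightarrow> (complex \<times> complex \<Rightarrow> complex) \<Rightarrow> bool" where
  "solves_on_orbit \<alpha> e P F Y \<longleftrightarrow>
     (\<exists>x1 x2. \<forall>t. ((\<lambda>t. Y (of_real t, of_real (\<alpha> * t))) has_vector_derivative x1 t) (at t) \<and>
        (x1 has_vector_derivative x2 t) (at t) \<and>
        of_real e * x2 t + x1 t + of_real e * P (Y (of_real t, of_real (\<alpha> * t))) = of_real e * F (of_real t, of_real (\<alpha> * t)))"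

text \<open>The thresholds have to be known before \<open>E\<close>, since \<open>E\<close> will be
  cut out by them. Therefore the locales are first entered with the empty parameter set, just to
  have the constants at hand, and entered again with the actual \<open>E\<close>.\<close>

lemma response_solution:
  assumes base: "response \<alpha> \<xi> m P P1 P2 r K \<kappa> \<sigma> F Fb Cq 1 {} \<nu>0"
  obtains \<tau>0 C where "0 < \<tau>0" "\<tau>0 \<le> 1"
    "\<And>E. (\<And>e. e \<in> E \<Longrightarrow> 0 < e \<and> root (m + 1) e \<le> \<tau>0 \<and> controlled_divisors \<alpha> (\<xi> / 3) m Cq e) \<Longrightarrow>
      \<exists>X. strip_family E (\<xi> / 4) X \<and> (\<forall>e\<in>E. (\<forall>\<psi>\<in>strip (\<xi> / 4). norm (X e \<psi>) \<le> C * root (m + 1) e ^ m \<and> norm (X e \<psi>) < r) \<and>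
        solves_on_orbit \<alpha> e P F (X e))"
proof -
  interpret b: response \<alpha> \<xi> m P P1 P2 r K \<kappa> \<sigma> F Fb Cq 1 "{}" \<nu>0 by (rule base)
  have resp: "response \<alpha> \<xi> m P P1 P2 r K \<kappa> \<sigma> F Fb Cq \<tau> E \<nu>0"
    if "0 < \<tau>" "\<tau> \<le> 1" "\<And>e. e \<in> E \<Longrightarrow> 0 < e \<and> root (m + 1) e \<le> \<tau> \<and> controlled_divisors \<alpha> (\<xi> / 3) m Cq e" for \<tau> E
    by (rule response.intro[OF b.\<xi> b.m b.r b.K b.\<kappa> b.\<sigma> b.P_deriv b.P1_deriv b.P_bound b.P1_bound b.P2_bound b.P_real b.P1_real
        b.P1_lower b.P_sign b.F b.F_avg b.F_bound b.\<nu>0 b.Cq that(1,2)]) (use that(3) in \<open>auto simp: controlled_divisors_def\<close>)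
  obtain \<tau>1 where \<tau>1: "0 < \<tau>1" "\<tau>1 \<le> 1" "4 * b.Cu * \<tau>1 \<le> r / 2"
    using common_small_factor[of "{4 * b.Cu}" "r / 2"] b.r by auto
  \<comment> \<open>The remaining constants live in this locale and so require a first smallness
    \<open>\<tau>1\<close>, but their values depend neither on it nor on the parameter set.\<close>
  interpret b1: response1 \<alpha> \<xi> m P P1 P2 r K \<kappa> \<sigma> F Fb Cq \<tau>1 "{}" \<nu>0
    by (rule response1.intro[OF resp[OF \<tau>1(1,2)]], simp, unfold_locales) (use \<tau>1(3) b.r in linarith)
  obtain \<tau>0 where \<tau>0: "0 < \<tau>0" "\<tau>0 \<le> 1"
    and sm: "\<And>a. a \<in> {4 * b.Cu, b1.CB, b1.CV, b1.A + 1, b1.CL, b1.CQ * b1.CV * b1.Cp} \<Longrightarrow> a * \<tau>0 \<le> min (r / 2) (1 / 2)"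
    by (rule common_small_factor[of "{4 * b.Cu, b1.CB, b1.CV, b1.A + 1, b1.CL, b1.CQ * b1.CV * b1.Cp}" "min (r / 2) (1 / 2)"])
       (use b.r in auto)
  show ?thesis
  proof (rule that[OF \<tau>0, of "b1.A + 1"])
    fix E :: "real set"
    assume E: "\<And>e. e \<in> E \<Longrightarrow> 0 < e \<and> root (m + 1) e \<le> \<tau>0 \<and> controlled_divisors \<alpha> (\<xi> / 3) m Cq e"
    have r1: "response1 \<alpha> \<xi> m P P1 P2 r K \<kappa> \<sigma> F Fb Cq \<tau>0 E \<nu>0"
      by (rule response1.intro[OF resp[OF \<tau>0 E]], assumption, unfold_locales) (use sm[of "4 * b.Cu"] b.r in simp)
    interpret response2 \<alpha> \<xi> m P P1 P2 r K \<kappa> \<sigma> F Fb Cq \<tau>0 E \<nu>0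
      by (rule response2.intro[OF r1], unfold_locales)
         (use sm[of b1.CB] sm[of b1.CV] sm[of "b1.A + 1"] sm[of b1.CL] sm[of "b1.CQ * b1.CV * b1.Cp"] b.r in auto)
    show "\<exists>X. strip_family E (\<xi> / 4) X \<and> (\<forall>e\<in>E. (\<forall>\<psi>\<in>strip (\<xi> / 4). norm (X e \<psi>) \<le> (b1.A + 1) * root (m + 1) e ^ m \<and> norm (X e \<psi>) < r) \<and>
        solves_on_orbit \<alpha> e P F (X e))"
    proof (intro exI[of _ X] conjI ballI)
      fix e \<psi> assume a: "e \<in> E" "\<psi> \<in> strip (\<xi> / 4)"
      show "norm (X e \<psi>) \<le> (b1.A + 1) * root (m + 1) e ^ m" using X_bound[OF a] by (simp only: eta_def tau_def)
      show "norm (X e \<psi>) < r" by (rule X_less[OF a])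
    qed (fact X_family, unfold solves_on_orbit_def, rule X_ode)
  qed
qed

section \<open>The intervals \<open>I_n\<close>, the set \<open>J_N\<close> and the choice of
  \<open>N\<close>\<close>

lemma I_upper_eq: "I_upper \<alpha> m C n = 1 / (C * conv_denom \<alpha> n) ^ (m + 1)"
proof -
  have "- int m - 1 = - int (m + 1)" by simp
  then show ?thesis unfolding I_upper_def by (simp only: power_int_minus power_int_of_nat inverse_eq_divide)
qed

lemma conv_denom_at_top:
  assumes "\<alpha> \<notin> \<rat>"
  shows "filterlim (\<lambda>n. real_of_int (conv_denom \<alpha> n)) at_top sequentially"
proof (rule filterlim_at_top_mono[OF filterlim_real_sequentially], intro always_eventually allI)
  fix n show "real n \<le> real_of_int (conv_denom \<alpha> n)"
    using conv_denom_ge[OF assms, of n] by linarith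
qed

lemma I_upper_tendsto_0:
  assumes "\<alpha> \<notin> \<rat>" "C > 0"
  shows "I_upper \<alpha> m C \<longlonglongrightarrow> 0"
proof -
  have "filterlim (\<lambda>n. C * real_of_int (conv_denom \<alpha> n)) at_top sequentially"
    by (rule filterlim_tendsto_pos_mult_at_top[OF tendsto_const assms(2) conv_denom_at_top[OF assms(1)]])
  then have "filterlim (\<lambda>n. (C * real_of_int (conv_denom \<alpha> n)) ^ (m + 1)) at_infinity sequentially"
    by (intro filterlim_at_top_imp_at_infinity filterlim_pow_at_top) auto
  then show ?thesis unfolding I_upper_eq[abs_def] by (rule tendsto_divide_0[OF tendsto_const])
qed

text \<open>Exponentials beat powers along the denominators, which tend to infinity.\<close>

lemma I_lower_le_I_upper:
  assumes "\<alpha> \<notin> \<rat>" "C > 0" "C' > 0"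
  shows "eventually (\<lambda>n. I_lower \<alpha> C' n \<le> I_upper \<alpha> m C n) sequentially"
proof -
  let ?q = "\<lambda>n. real_of_int (conv_denom \<alpha> n)"
  have "filterlim (\<lambda>n. C' * ?q n) at_top sequentially"
    by (rule filterlim_tendsto_pos_mult_at_top[OF tendsto_const assms(3) conv_denom_at_top[OF assms(1)]])
  from filterlim_compose[OF tendsto_power_div_exp_0[of "m + 1"] this]
  have "(\<lambda>n. (C' * ?q n) ^ (m + 1) / exp (C' * ?q n)) \<longlonglongrightarrow> 0" .
  then have "eventually (\<lambda>n. (C' * ?q n) ^ (m + 1) / exp (C' * ?q n) < (C' / C) ^ (m + 1)) sequentially"
    using assms by (intro order_tendstoD) auto
  then show ?thesis
  proof eventually_elim
    case (elim n)
    have q: "?q n > 0" using conv_denom_ge_1[OF assms(1), of n] by linarith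
    have "(C' * ?q n) ^ (m + 1) < (C' / C) ^ (m + 1) * exp (C' * ?q n)"
      using elim by (simp add: divide_less_eq)
    moreover have "C' * ?q n = (C' / C) * (C * ?q n)" using assms by simp
    ultimately have "(C' / C) ^ (m + 1) * (C * ?q n) ^ (m + 1) < (C' / C) ^ (m + 1) * exp (C' * ?q n)"
      by (metis power_mult_distrib)
    then have "(C * ?q n) ^ (m + 1) < exp (C' * ?q n)"
      by (rule mult_left_less_imp_less) (use assms in simp)
    moreover have "(C * ?q n) ^ (m + 1) > 0" using assms q by simp
    ultimately have "1 / exp (C' * ?q n) \<le> 1 / (C * ?q n) ^ (m + 1)" by (intro divide_left_mono) auto
    then show ?case unfolding I_upper_eq I_lower_def by (simp add: exp_minus inverse_eq_divide)
  qed
qed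

text \<open>The closure adds at most the point \<open>0\<close>: the right ends tend to zero, so
  only finitely many intervals, each of them closed, reach above
  \<open>\<epsilon> / 2\<close>.\<close>

lemma J_set_cases:
  assumes "\<alpha> \<notin> \<rat>" "C > 0" "\<epsilon> \<in> J_set \<alpha> m N C C'"
  shows "\<epsilon> = 0 \<or> 0 < \<epsilon> \<and> (\<exists>n\<ge>N. \<epsilon> \<in> I_set \<alpha> m n C C')"
proof -
  let ?U = "\<Union>n\<in>{N..}. I_set \<alpha> m n C C'"
  have pos: "x > 0" if "x \<in> I_set \<alpha> m n C C'" for x n
    using that less_le_trans[OF exp_gt_zero] by (auto simp: I_set_def I_lower_def)
  then have "closure ?U \<subseteq> {0..}" by (intro closure_minimal) (auto intro: less_imp_le)
  then have "\<epsilon> \<ge> 0" using assms(3) by (auto simp: J_set_def)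
  moreover have "\<exists>n\<ge>N. \<epsilon> \<in> I_set \<alpha> m n C C'" if "\<epsilon> > 0"
  proof -
    have "eventually (\<lambda>n. I_upper \<alpha> m C n < \<epsilon> / 2) sequentially"
      by (rule order_tendstoD(2)[OF I_upper_tendsto_0[OF assms(1,2)]]) (use that in simp)
    then obtain M where M: "\<And>n. n \<ge> M \<Longrightarrow> I_upper \<alpha> m C n < \<epsilon> / 2" unfolding eventually_sequentially by blast
    have "?U \<subseteq> (\<Union>n\<in>{N..<M}. I_set \<alpha> m n C C') \<union> {..\<epsilon> / 2}"
    proof (intro subsetI, rule ccontr)
      fix x assume "x \<in> ?U" and x': "x \<notin> (\<Union>n\<in>{N..<M}. I_set \<alpha> m n C C') \<union> {..\<epsilon> / 2}"
      then obtain n where n: "N \<le> n" and x: "x \<in> I_set \<alpha> m n C C'" by auto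
      with x' have "n \<ge> M" by auto
      then show False using M[of n] x x' by (auto simp: I_set_def)
    qed
    moreover have "closed ((\<Union>n\<in>{N..<M}. I_set \<alpha> m n C C') \<union> {..\<epsilon> / 2})"
      by (intro closed_Un closed_UN) (auto simp: I_set_def)
    ultimately have "closure ?U \<subseteq> (\<Union>n\<in>{N..<M}. I_set \<alpha> m n C C') \<union> {..\<epsilon> / 2}" by (rule closure_minimal)
    then show ?thesis using assms(3) that by (force simp: J_set_def)
  qed
  ultimately show ?thesis by (cases "\<epsilon> = 0") auto
qed

text \<open>The witness is the denominator \<open>q_n\<close>. The upper end of the interval says
  \<open>root (m + 1) e * q \<le> 1 / C\<close>, the lower end raised to the power
  \<open>m + 1\<close> gives the exponential condition, and \<open>n \<ge> 1\<close> allows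
  \<open>small_divisor_lower\<close> with index \<open>n - 1\<close>.\<close>

lemma I_set_small_divisors:
  assumes \<alpha>: "\<alpha> \<notin> \<rat>" and C: "C > 0" and C': "C' > 0" "C' * real (m + 1) \<le> d" and n: "n \<ge> 1" and e: "e \<in> I_set \<alpha> m n C C'"
  shows "controlled_divisors \<alpha> d m (1 / C) e"
proof -
  define q where "q = real_of_int (conv_denom \<alpha> n)"
  define t where "t = root (m + 1) e"
  have q: "q \<ge> 1" using conv_denom_ge_1[OF \<alpha>, of n] by (simp add: q_def)
  have lo: "exp (- C' * q) \<le> e" and up: "e \<le> 1 / (C * q) ^ (m + 1)"
    using e by (auto simp: I_set_def I_lower_def I_upper_eq q_def)
  have e0: "e > 0" using lo less_le_trans[OF exp_gt_zero] by blast
  have t: "t > 0" "t ^ (m + 1) = e" using e0 unfolding t_def by (simp, intro real_root_pow_pos2) auto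
  have "t ^ (m + 1) \<le> (1 / (C * q)) ^ (m + 1)" unfolding t(2) using up by (simp add: power_divide)
  then have "t \<le> 1 / (C * q)" by (rule power_le_imp_le_base[of t m, unfolded Suc_eq_plus1]) (use C q in auto)
  then have tq: "t * q \<le> 1 / C" using C q by (simp add: field_simps)
  have "e * q = t ^ m * (t * q)" unfolding t(2)[symmetric] by simp
  also have "\<dots> \<le> t ^ m * (1 / C)" using tq t by (intro mult_left_mono) auto
  finally have "e * q \<le> (1 / C) * t ^ m" by simp
  moreover have "exp (- d * q) \<le> e ^ (m + 1)"
  proof -
    have "C' * real (m + 1) * q \<le> d * q" using C'(2) q by (intro mult_right_mono) auto
    then have "exp (- d * q) \<le> exp (real (m + 1) * (- C' * q))" by (simp add: mult_ac)
    also have "\<dots> = exp (- C' * q) ^ (m + 1)" by (rule exp_of_nat_mult)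
    also have "\<dots> \<le> e ^ (m + 1)" using lo by (intro power_mono) auto
    finally show ?thesis .
  qed
  moreover have "1 / (2 * q) \<le> \<bar>freq \<alpha> \<nu>\<bar>" if \<nu>: "\<nu> \<noteq> (0, 0)" "nrm1 \<nu> < q" for \<nu>
  proof -
    obtain a b where ab: "\<nu> = (a, b)" by (cases \<nu>)
    obtain k where k: "n = Suc k" using n by (cases n) auto
    have "\<bar>b\<bar> < conv_denom \<alpha> (Suc k)" using \<nu>(2) unfolding nrm1_def ab q_def k by simp
    from small_divisor_lower[OF \<alpha> this] show ?thesis using \<nu>(1) by (simp add: ab q_def k freq_def)
  qed
  ultimately show ?thesis using q unfolding t_def controlled_divisors_def by blast
qed

text \<open>Joint continuity over the compact period cell is uniform in the point; periodicity
  extends this to the unbounded strip.\<close>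

lemma strip_family_uniform:
  assumes X: "strip_family E \<rho> X" and e: "e \<in> E"
  shows "uniform_limit (strip \<rho>) X (X e) (at e within E)"
proof (rule uniform_limitI)
  fix \<delta> :: real assume \<delta>: "\<delta> > 0"
  have "continuous_on (E \<times> strip_cell \<rho>) (\<lambda>p. X (fst p) (snd p))"
    using X strip_cell_subset unfolding strip_family_def by (meson continuous_on_subset Sigma_mono order_refl)
  then obtain T where T: "e \<in> T" "open T"
    "\<forall>e'\<in>T \<inter> E. \<forall>\<psi>\<in>strip_cell \<rho>. dist (X (fst (e', \<psi>)) (snd (e', \<psi>))) (X (fst (e, \<psi>)) (snd (e, \<psi>))) \<le> \<delta> / 2"
    by (rule continuous_on_prod_compactE[OF _ compact_strip_cell e half_gt_zero[OF \<delta>]])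
  have "dist (X e' \<psi>) (X e \<psi>) < \<delta>" if e': "e' \<in> T" "e' \<in> E" and \<psi>: "\<psi> \<in> strip \<rho>" for e' \<psi>
  proof -
    obtain z w where zw: "\<psi> = (z, w)" by (cases \<psi>)
    obtain z' w' where c: "(z', w') \<in> strip_cell \<rho>" and
      eq: "\<And>\<phi> :: complex \<times> complex \<Rightarrow> complex. periodic2_on \<phi> (strip \<rho>) \<Longrightarrow> \<phi> (z, w) = \<phi> (z', w')"
      using periodic_reduce \<psi> zw by metis
    have "X e \<psi> = X e (z', w')" "X e' \<psi> = X e' (z', w')"
      using X e e' unfolding zw by (auto intro!: eq simp: strip_family_def strip_analytic_def)
    then show ?thesis using bspec[OF bspec[OF T(3)] c, of e'] e' \<delta> by simp
  qed
  then show "\<forall>\<^sub>F n in at e within E. \<forall>x\<in>strip \<rho>. dist (X n x) (X e x) < \<delta>"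
    unfolding eventually_at_topological using T(1,2) by blast
qed

lemma periodic2_on_subset: "periodic2_on F S \<Longrightarrow> T \<subseteq> S \<Longrightarrow> periodic2_on F T"
  unfolding periodic2_on_def by blast

lemma strip_family_analytic2:
  assumes "strip_family E \<rho> X" "e \<in> E" "\<xi>' < \<rho>" "\<rho> > 0"
  shows "analytic2_on (X e) (strip \<xi>')"
proof -
  have an: "strip_analytic \<rho> (X e)" using assms by (simp add: strip_family_def)
  obtain C where "\<And>\<psi>. \<psi> \<in> strip \<rho> \<Longrightarrow> norm (X e \<psi>) \<le> C" using strip_analytic_bounded[OF an] by blast
  from analytic2_on_strip[OF assms(4) an this assms(3)] show ?thesis .
qed

lemma forced_response_exists:
  assumes \<xi>: "\<xi> > 0" and ext: "has_analytic_extension f \<xi>" and A: "open A" "real_analytic_on g A" "c \<in> A"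
    and z: "zero_of_order g (torus_average f) c m" and m: "odd m" "m > 1" and Cq: "Cq > 0"
  obtains \<tau>0 C where "0 < \<tau>0"
    "\<And>E. (\<And>e. e \<in> E \<Longrightarrow> 0 < e \<and> root (m + 1) e \<le> \<tau>0 \<and> controlled_divisors \<alpha> (\<xi> / 3) m Cq e) \<Longrightarrow>
      \<exists>X. strip_family E (\<xi> / 4) X \<and> (\<forall>e\<in>E. (\<forall>\<psi>\<in>strip (\<xi> / 4). norm (X e \<psi>) \<le> C * root (m + 1) e ^ m) \<and>
        solves_eq A g f \<alpha> e (\<lambda>t. c + Re (X e (of_real t, of_real (\<alpha> * t)))))"
proof -
  obtain Fe where Fe: "analytic2_on Fe (strip \<xi>)" "periodic2_on Fe (strip \<xi>)"
    "\<And>x y. Fe (complex_of_real x, complex_of_real y) = complex_of_real (f (x, y))"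
    using ext unfolding has_analytic_extension_def by blast
  define f0 where "f0 = torus_average f"
  define F where "F \<psi> = Fe \<psi> - complex_of_real f0" for \<psi>
  have Fe_an: "strip_analytic \<xi> Fe" by (rule analytic2_on_imp_strip_analytic[OF Fe(1,2)]) (simp add: Fe(3))
  have "strip_family {0} \<xi> (\<lambda>e. F)"
    unfolding F_def[abs_def] by (intro strip_family_diff strip_family_fixed Fe_an strip_family_const continuous_on_const)
  then have F_an: "strip_analytic \<xi> F" by (simp add: strip_family_def)
  have \<xi>0: "\<xi> \<ge> 0" using \<xi> by simp
  have "tavg F = tavg Fe - of_real f0"
    using integrable_strip_analytic[OF Fe_an \<xi>0] by (simp add: tavg_def F_def torus.prob_space)
  then have F_avg: "tavg F = 0" using tavg_torus_average[OF Fe_an \<xi>0 Fe(3)] by (simp add: f0_def)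
  have F_real: "F (complex_of_real x, complex_of_real y) = complex_of_real (f (x, y) - f0)" for x y by (simp add: F_def Fe(3))
  obtain Fb where Fb: "\<And>\<psi>. \<psi> \<in> strip \<xi> \<Longrightarrow> norm (F \<psi>) \<le> Fb" using strip_analytic_bounded[OF F_an] by blast
  obtain r K \<kappa> \<sigma> P P1 P2 where r: "r > 0" and K: "K > 0" and \<kappa>: "\<kappa> > 0" and \<sigma>: "\<sigma> = 1 \<or> \<sigma> = -1"
    and cA: "\<And>x. \<bar>x\<bar> < r \<Longrightarrow> c + x \<in> A"
    and Pg: "\<And>x. \<bar>x\<bar> < r \<Longrightarrow> P (of_real x) = complex_of_real (g (c + x) - f0)"
    and P: "\<And>z. norm z < r \<Longrightarrow> (P has_field_derivative P1 z) (at z)"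
      "\<And>z. norm z < r \<Longrightarrow> (P1 has_field_derivative P2 z) (at z)"
      "\<And>z. norm z < r \<Longrightarrow> norm (P z) \<le> K * norm z ^ m"
      "\<And>z. norm z < r \<Longrightarrow> norm (P1 z) \<le> K * norm z ^ (m - 1)"
      "\<And>z. norm z < r \<Longrightarrow> norm (P2 z) \<le> K * norm z ^ (m - 2)"
      "\<And>x. \<bar>x\<bar> < r \<Longrightarrow> P1 (of_real x) \<in> \<real>"
      "\<And>x. \<bar>x\<bar> < r \<Longrightarrow> \<kappa> * \<bar>x\<bar> ^ (m - 1) \<le> \<sigma> * Re (P1 (of_real x))"
      "\<And>x. \<bar>x\<bar> < r \<Longrightarrow> 0 \<le> \<sigma> * x * Re (P (of_real x))"
    by (rule nonlinearity_bounds[OF A z[folded f0_def] m]) blast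
  have solves: "solves_eq A g f \<alpha> e (\<lambda>t. c + Re (Y (of_real t, of_real (\<alpha> * t))))"
    if Y: "strip_analytic (\<xi> / 4) Y" "\<And>\<psi>. \<psi> \<in> strip (\<xi> / 4) \<Longrightarrow> norm (Y \<psi>) < r"
      and ode: "solves_on_orbit \<alpha> e P F Y"
    for e Y
  proof -
   obtain x1 x2 where D: "\<And>t. ((\<lambda>t. Y (of_real t, of_real (\<alpha> * t))) has_vector_derivative x1 t) (at t)"
        "\<And>t. (x1 has_vector_derivative x2 t) (at t)"
        "\<And>t. of_real e * x2 t + x1 t + of_real e * P (Y (of_real t, of_real (\<alpha> * t))) = of_real e * F (of_real t, of_real (\<alpha> * t))"
     using ode unfolding solves_on_orbit_def by blast
   show ?thesis
    unfolding solves_eq_def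
  proof (intro exI allI conjI)
    fix t
    let ?o = "(complex_of_real t, complex_of_real (\<alpha> * t))"
    have "?o \<in> strip (\<xi> / 4)" using \<xi> by (simp add: strip_def)
    from Y(2)[OF this] have Yr: "norm (Y ?o) < r" .
    have "Y ?o \<in> \<real>" using Y(1) by (simp only: strip_analytic_def)
    then have YR: "Y ?o = of_real (Re (Y ?o))" by (simp only: of_real_Re)
    have a: "\<bar>Re (Y ?o)\<bar> < r" using Yr abs_Re_le_cmod le_less_trans by blast
    show "c + Re (Y ?o) \<in> A" by (rule cA[OF a])
    have "((\<lambda>t. Re (Y (of_real t, of_real (\<alpha> * t)))) has_vector_derivative Re (x1 t)) (at t)"
      by (rule bounded_linear.has_vector_derivative[OF bounded_linear_Re D(1)])
    then show "((\<lambda>t. c + Re (Y (of_real t, of_real (\<alpha> * t)))) has_real_derivative Re (x1 t)) (at t)"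
      unfolding has_real_derivative_iff_has_vector_derivative by (simp add: has_vector_derivative_add_const add.commute[of c])
    show "((\<lambda>t. Re (x1 t)) has_real_derivative Re (x2 t)) (at t)"
      unfolding has_real_derivative_iff_has_vector_derivative
      by (rule bounded_linear.has_vector_derivative[OF bounded_linear_Re D(2)])
    have "P (Y ?o) = of_real (g (c + Re (Y ?o)) - f0)" by (rule trans[OF arg_cong[OF YR, of P] Pg[OF a]])
    with D(3)[of t] F_real[of t "\<alpha> * t"]
    have "of_real e * x2 t + x1 t + of_real e * of_real (g (c + Re (Y ?o)) - f0) = of_real e * complex_of_real (f (t, \<alpha> * t) - f0)"
      by (simp only:)
    from arg_cong[OF this, of Re]
    have "e * Re (x2 t) + Re (x1 t) + e * (g (c + Re (Y ?o)) - f0) = e * (f (t, \<alpha> * t) - f0)" by simp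
    then show "e * Re (x2 t) + Re (x1 t) + e * g (c + Re (Y ?o)) = e * f (t, \<alpha> * t)" by (simp add: right_diff_distrib)
   qed
  qed
  show ?thesis
  proof (cases "\<exists>\<nu>. \<nu> \<noteq> (0, 0) \<and> fcoef F \<nu> \<noteq> 0")
    case True
    then obtain \<nu>0 where \<nu>0: "\<nu>0 \<noteq> (0, 0)" "fcoef F \<nu>0 \<noteq> 0" by blast
    have PR: "P (of_real x) \<in> \<real>" if "\<bar>x\<bar> < r" for x using Pg[OF that] by simp
    have "response \<alpha> \<xi> m P P1 P2 r K \<kappa> \<sigma> F Fb Cq 1 {} \<nu>0"
      by (rule response.intro[OF \<xi> m r K \<kappa> \<sigma> P(1-5) PR P(6-8) F_an F_avg Fb \<nu>0(2,1) Cq]) simp_all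
    then obtain \<tau>0 C where \<tau>0: "0 < \<tau>0" and H:
     "\<And>E. (\<And>e. e \<in> E \<Longrightarrow> 0 < e \<and> root (m + 1) e \<le> \<tau>0 \<and> controlled_divisors \<alpha> (\<xi> / 3) m Cq e) \<Longrightarrow>
      \<exists>X. strip_family E (\<xi> / 4) X \<and> (\<forall>e\<in>E. (\<forall>\<psi>\<in>strip (\<xi> / 4). norm (X e \<psi>) \<le> C * root (m + 1) e ^ m \<and> norm (X e \<psi>) < r) \<and>
        solves_on_orbit \<alpha> e P F (X e))"
      by (rule response_solution) blast
    show ?thesis
    proof (rule that[OF \<tau>0, of C])
      fix E :: "real set"
      assume E: "\<And>e. e \<in> E \<Longrightarrow> 0 < e \<and> root (m + 1) e \<le> \<tau>0 \<and> controlled_divisors \<alpha> (\<xi> / 3) m Cq e"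
      obtain X where X: "strip_family E (\<xi> / 4) X"
        and XE: "\<forall>e\<in>E. (\<forall>\<psi>\<in>strip (\<xi> / 4). norm (X e \<psi>) \<le> C * root (m + 1) e ^ m \<and> norm (X e \<psi>) < r) \<and> solves_on_orbit \<alpha> e P F (X e)"
        using H[of E] E by metis
      have "solves_eq A g f \<alpha> e (\<lambda>t. c + Re (X e (of_real t, of_real (\<alpha> * t))))" if e: "e \<in> E" for e
        by (rule solves) (use X bspec[OF XE e] e in \<open>simp_all add: strip_family_def\<close>)
      with X XE show "\<exists>X. strip_family E (\<xi> / 4) X \<and> (\<forall>e\<in>E. (\<forall>\<psi>\<in>strip (\<xi> / 4). norm (X e \<psi>) \<le> C * root (m + 1) e ^ m) \<and>
        solves_eq A g f \<alpha> e (\<lambda>t. c + Re (X e (of_real t, of_real (\<alpha> * t)))))"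
        by (intro exI[of _ X]) simp
    qed
  next
    \<comment> \<open>If all coefficients vanish, \<open>F\<close> is zero on the torus; the lower
      bound for \<open>h0\<close> breaks down, but \<open>X = 0\<close> solves the equation.\<close>
    case False
    have "fcoef F (0, 0) = 0" using fcoef_0[OF F_an \<xi>0] F_avg by simp
    with False have c0: "fcoef F \<nu> = 0" for \<nu> by metis
    have F0: "F (complex_of_real x, complex_of_real y) = 0" for x y
    proof -
      have "((\<lambda>\<nu>. fcoef F \<nu> * emode \<nu> (complex_of_real x, complex_of_real y)) has_sum F (complex_of_real x, complex_of_real y)) UNIV"
        by (rule fourier_series_2d[OF \<xi> F_an Fb]) (use \<xi> in auto)
      then show ?thesis by (rule has_sum_unique[OF _ has_sum_0]) (simp add: c0)
    qed
    have P0: "P 0 = 0" using P(3)[of 0] r m by (simp add: power_0_left)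
    have fam: "strip_family E (\<xi> / 4) (\<lambda>e \<psi>. 0)" for E
      using strip_family_const[of E "\<lambda>_. 0" "\<xi> / 4"] by simp
    have "solves_eq A g f \<alpha> e (\<lambda>t. c + Re 0)" for e
    proof -
      have an: "strip_analytic (\<xi> / 4) (\<lambda>_. 0)" using fam[of "{0}"] by (simp add: strip_family_def)
      show ?thesis
      proof (rule solves[OF an])
        show "solves_on_orbit \<alpha> e P F (\<lambda>_. 0)"
          unfolding solves_on_orbit_def F0 by (intro exI[of _ "\<lambda>_. 0"]) (simp add: P0)
      qed (use r in simp)
    qed
    then show ?thesis using fam by (intro that[of 1 0] exI[of _ "\<lambda>e \<psi>. 0"]) auto
  qed
qed

theorem theorem1:
  fixes \<alpha> \<xi> c C\<^sub>0 :: real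
    and A :: "real set"
    and g :: "real \<Rightarrow> real"
    and f :: "real \<times> real \<Rightarrow> real"
    and \<nn> :: nat
  assumes "\<alpha> \<notin> \<rat>"
    and "open A"
    and "real_analytic_on g A"
    and "periodic2_on f UNIV"
    and "analytic2_on f UNIV"
    and "\<xi> > 0"
    and "has_analytic_extension f \<xi>"
    and "c \<in> A"
    and "zero_of_order g (torus_average f) c \<nn>"
    and "odd \<nn>"
    and "\<nn> > 1"
    and "C\<^sub>0 = (real \<nn> + 1) / (4 * ((real \<nn>)\<^sup>2 + 2 * real \<nn> - 1)) * \<xi>"
  shows "\<forall>C\<^sub>1>0. \<exists>N::nat.
    (\<forall>n\<ge>N. I_lower \<alpha> C\<^sub>0 n \<le> I_upper \<alpha> \<nn> C\<^sub>1 n) \<and>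
    (\<exists>(X :: real \<Rightarrow> complex \<times> complex \<Rightarrow> complex) (x :: real \<Rightarrow> real \<Rightarrow> real).
      (\<forall>\<epsilon>\<in>J_set \<alpha> \<nn> N C\<^sub>1 C\<^sub>0.
         solves_eq A g f \<alpha> \<epsilon> (x \<epsilon>) \<and>
         (\<forall>t. complex_of_real (x \<epsilon> t) =
              complex_of_real c + X \<epsilon> (complex_of_real t, complex_of_real (\<alpha> * t)))) \<and>
      (\<forall>\<xi>'. 0 < \<xi>' \<and> \<xi>' < \<xi> / 4 \<longrightarrow>
         (\<forall>\<epsilon>\<in>J_set \<alpha> \<nn> N C\<^sub>1 C\<^sub>0.
            analytic2_on (X \<epsilon>) (strip \<xi>') \<and> periodic2_on (X \<epsilon>) (strip \<xi>') \<and>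
            uniform_limit (strip \<xi>') X (X \<epsilon>) (at \<epsilon> within J_set \<alpha> \<nn> N C\<^sub>1 C\<^sub>0)) \<and>
         uniform_limit (strip \<xi>') X (\<lambda>\<psi>. 0) (at 0 within J_set \<alpha> \<nn> N C\<^sub>1 C\<^sub>0)))"
proof (intro allI impI)
  note \<xi> = assms(6) and \<nn> = assms(10,11)
  fix C1 :: real assume C1: "C1 > 0"
  define M where "M = (real \<nn>)\<^sup>2 + 2 * real \<nn> - 1"
  have "3 * 3 \<le> real \<nn> * real \<nn>" and n3: "real \<nn> \<ge> 3"
  proof -
    have "\<nn> \<ge> 3" using \<nn> by (cases "\<nn> = 2") auto
    then show "real \<nn> \<ge> 3" by simp
    then show "3 * 3 \<le> real \<nn> * real \<nn>" by (intro mult_mono) auto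
  qed
  then have M: "M \<ge> 6" unfolding M_def power2_eq_square by linarith
  have C0: "C\<^sub>0 > 0" unfolding assms(12) M_def[symmetric] using M \<xi> by simp
  \<comment> \<open>Since \<open>(real \<nn> + 1)\<^sup>2 = M + 2\<close>, the factor is
    \<open>(M + 2) / (4 * M)\<close>, which is at most one third as soon as
    \<open>M \<ge> 6\<close>.\<close>
  have "C\<^sub>0 * real (\<nn> + 1) = (real \<nn> + 1)\<^sup>2 / (4 * M) * \<xi>"
    unfolding assms(12) M_def[symmetric] by (simp add: power2_eq_square field_simps)
  also have "(real \<nn> + 1)\<^sup>2 = M + 2" by (simp add: M_def power2_eq_square algebra_simps)
  also have "(M + 2) / (4 * M) * \<xi> \<le> (1 / 3) * \<xi>"
    using M \<xi> by (intro mult_right_mono) (auto simp: field_simps)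
  finally have C0\<xi>: "C\<^sub>0 * real (\<nn> + 1) \<le> \<xi> / 3" by simp
  have "1 / C1 > 0" using C1 by simp
  from forced_response_exists[OF \<xi> assms(7,2,3,8,9) \<nn> this, of \<alpha>]
  obtain \<tau>0 C where \<tau>0: "0 < \<tau>0" and H: "\<And>E. (\<And>e. e \<in> E \<Longrightarrow> 0 < e \<and> root (\<nn> + 1) e \<le> \<tau>0 \<and> controlled_divisors \<alpha> (\<xi> / 3) \<nn> (1 / C1) e) \<Longrightarrow>
      \<exists>X. strip_family E (\<xi> / 4) X \<and> (\<forall>e\<in>E. (\<forall>\<psi>\<in>strip (\<xi> / 4). norm (X e \<psi>) \<le> C * root (\<nn> + 1) e ^ \<nn>) \<and>
        solves_eq A g f \<alpha> e (\<lambda>t. c + Re (X e (of_real t, of_real (\<alpha> * t)))))"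
    by blast
  have "eventually (\<lambda>n. I_lower \<alpha> C\<^sub>0 n \<le> I_upper \<alpha> \<nn> C1 n \<and> I_upper \<alpha> \<nn> C1 n < \<tau>0 ^ (\<nn> + 1)) sequentially"
    by (intro eventually_conj I_lower_le_I_upper order_tendstoD(2)[OF I_upper_tendsto_0] assms(1) C1 C0 zero_less_power \<tau>0)
  then obtain N' where N': "\<And>n. n \<ge> N' \<Longrightarrow> I_lower \<alpha> C\<^sub>0 n \<le> I_upper \<alpha> \<nn> C1 n \<and> I_upper \<alpha> \<nn> C1 n < \<tau>0 ^ (\<nn> + 1)"
    unfolding eventually_sequentially by blast
  \<comment> \<open>At least one, because \<open>I_set_small_divisors\<close> refers to the
    preceding convergent.\<close>
  define N where "N = max 1 N'"
  define J where "J = J_set \<alpha> \<nn> N C1 C\<^sub>0"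
  define E where "E = J \<inter> {0<..}"
  have JE: "\<epsilon> = 0 \<or> \<epsilon> \<in> E" if "\<epsilon> \<in> J" for \<epsilon>
    using J_set_cases[OF assms(1) C1] that unfolding J_def E_def by blast
  have "\<exists>X. strip_family E (\<xi> / 4) X \<and> (\<forall>e\<in>E. (\<forall>\<psi>\<in>strip (\<xi> / 4). norm (X e \<psi>) \<le> C * root (\<nn> + 1) e ^ \<nn>) \<and>
        solves_eq A g f \<alpha> e (\<lambda>t. c + Re (X e (of_real t, of_real (\<alpha> * t)))))"
  proof (rule H)
    fix e assume e: "e \<in> E"
    then obtain n where n: "n \<ge> N" "e \<in> I_set \<alpha> \<nn> n C1 C\<^sub>0"
      using J_set_cases[OF assms(1) C1, of e \<nn> N C\<^sub>0] unfolding E_def J_def by auto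
    have e0: "e > 0" using e by (simp add: E_def)
    have n1: "n \<ge> 1" "n \<ge> N'" using n(1) by (auto simp: N_def)
    have "e \<le> \<tau>0 ^ (\<nn> + 1)" using n(2) N'[OF n1(2)] by (auto simp: I_set_def)
    then have "root (\<nn> + 1) e \<le> root (\<nn> + 1) (\<tau>0 ^ (\<nn> + 1))" by (intro real_root_le_mono) auto
    also have "\<dots> = \<tau>0" using \<tau>0 by (intro real_root_power_cancel) auto
    finally show "0 < e \<and> root (\<nn> + 1) e \<le> \<tau>0 \<and> controlled_divisors \<alpha> (\<xi> / 3) \<nn> (1 / C1) e"
      using I_set_small_divisors[OF assms(1) C1 C0 C0\<xi> n1(1) n(2)] e0 by blast
  qed
  then obtain X where X: "strip_family E (\<xi> / 4) X"
    and X_bound: "\<And>e \<psi>. e \<in> E \<Longrightarrow> \<psi> \<in> strip (\<xi> / 4) \<Longrightarrow> norm (X e \<psi>) \<le> C * root (\<nn> + 1) e ^ \<nn>"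
    and X_sol: "\<And>e. e \<in> E \<Longrightarrow> solves_eq A g f \<alpha> e (\<lambda>t. c + Re (X e (of_real t, of_real (\<alpha> * t))))"
    by blast
  \<comment> \<open>Extension by zero supplies the value at \<open>0\<close>, and keeps analyticity
    and periodicity valid for every parameter.\<close>
  define Y where "Y e = (if e \<in> E then X e else (\<lambda>\<psi>. 0))" for e
  define x where "x e t = c + Re (Y e (of_real t, of_real (\<alpha> * t)))" for e t
  have \<xi>4: "\<xi> / 4 > 0" using \<xi> by simp
  have Y: "strip_family E (\<xi> / 4) Y"
    by (rule strip_family_cong[OF X]) (use \<xi>4 in \<open>auto simp: Y_def\<close>)
  have Y0: "Y 0 = (\<lambda>\<psi>. 0)" by (simp add: Y_def E_def)
  have Y_an: "strip_analytic (\<xi> / 4) (Y e)" for e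
  proof (cases "e \<in> E")
    case False
    have "strip_family {0} (\<xi> / 4) (\<lambda>e \<psi>. complex_of_real 0)" by (rule strip_family_const) simp
    then show ?thesis using False by (simp add: Y_def strip_family_def)
  qed (use Y in \<open>simp add: strip_family_def\<close>)
  have zero: "uniform_limit (strip (\<xi> / 4)) Y (\<lambda>\<psi>. 0) (at 0 within J)"
  proof (rule uniform_limitI)
    fix \<delta> :: real assume \<delta>: "\<delta> > 0"
    have "((\<lambda>e. C * root (\<nn> + 1) e ^ \<nn>) \<longlongrightarrow> C * root (\<nn> + 1) 0 ^ \<nn>) (at 0 within J)"
      by (intro tendsto_intros)
    then have "eventually (\<lambda>e. C * root (\<nn> + 1) e ^ \<nn> < \<delta>) (at 0 within J)"
      by (rule order_tendstoD(2)) (use \<nn> \<delta> in \<open>simp add: power_0_left\<close>)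
    then show "\<forall>\<^sub>F e in at 0 within J. \<forall>\<psi>\<in>strip (\<xi> / 4). dist (Y e \<psi>) 0 < \<delta>"
    proof eventually_elim
      case (elim e)
      then show ?case using X_bound[of e] \<delta> by (force simp: Y_def)
    qed
  qed
  have lim: "uniform_limit (strip (\<xi> / 4)) Y (Y e) (at e within J)" if "e \<in> J" for e
  proof (cases "e = 0")
    case False
    with JE[OF that] have e: "e \<in> E" by blast
    \<comment> \<open>Away from \<open>0\<close> the sets \<open>J\<close> and \<open>E\<close>
      agree locally, so uniform continuity on \<open>E\<close> suffices there; the point
      \<open>0\<close> is settled by the bound on \<open>X\<close>.\<close>
    have "at e within J = at e within E"
      by (rule at_within_nhd[of e "{0<..}"]) (use e in \<open>auto simp: E_def\<close>)
    then show ?thesis using strip_family_uniform[OF Y e] by simp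
  qed (use zero Y0 in simp)
  have sub: "strip \<xi>' \<subseteq> strip (\<xi> / 4)" if "\<xi>' < \<xi> / 4" for \<xi>' using strip_mono[of \<xi>' "\<xi> / 4"] that by simp
  have "solves_eq A g f \<alpha> \<epsilon> (x \<epsilon>)" if "\<epsilon> \<in> J" for \<epsilon>
  proof (cases "\<epsilon> = 0")
    \<comment> \<open>For \<open>\<epsilon> = 0\<close> the equation reads \<open>x' = 0\<close>,
      and the constant \<open>c\<close> solves it.\<close>
    case True
    show ?thesis unfolding solves_eq_def True
      by (intro exI[of _ "\<lambda>_. 0"]) (simp add: x_def[abs_def] Y0 assms(8))
  next
    case False
    with JE[OF that] have "\<epsilon> \<in> E" by blast
    with X_sol[OF this] show ?thesis by (simp add: x_def[abs_def] Y_def)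
  qed
  moreover have "complex_of_real (x \<epsilon> t) = complex_of_real c + Y \<epsilon> (complex_of_real t, complex_of_real (\<alpha> * t))" for \<epsilon> t
  proof -
    have "Y \<epsilon> (complex_of_real t, complex_of_real (\<alpha> * t)) \<in> \<real>" using Y_an by (simp only: strip_analytic_def)
    then show ?thesis unfolding x_def of_real_add by (simp only: of_real_Re)
  qed
  moreover have "analytic2_on (Y \<epsilon>) (strip \<xi>')" if "\<xi>' < \<xi> / 4" for \<epsilon> \<xi>'
  proof -
    have "strip_family {0::real} (\<xi> / 4) (\<lambda>_. Y \<epsilon>)" by (rule strip_family_fixed[OF Y_an])
    from strip_family_analytic2[OF this _ that \<xi>4] show ?thesis by simp
  qed
  moreover have "periodic2_on (Y \<epsilon>) (strip \<xi>')" if "\<xi>' < \<xi> / 4" for \<epsilon> \<xi>'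
    by (rule periodic2_on_subset[OF _ sub[OF that]]) (use Y_an[of \<epsilon>] in \<open>simp only: strip_analytic_def\<close>)
  moreover have "\<forall>n\<ge>N. I_lower \<alpha> C\<^sub>0 n \<le> I_upper \<alpha> \<nn> C1 n" using N' by (simp add: N_def)
  ultimately show "\<exists>N::nat.
    (\<forall>n\<ge>N. I_lower \<alpha> C\<^sub>0 n \<le> I_upper \<alpha> \<nn> C1 n) \<and>
    (\<exists>(X :: real \<Rightarrow> complex \<times> complex \<Rightarrow> complex) (x :: real \<Rightarrow> real \<Rightarrow> real).
      (\<forall>\<epsilon>\<in>J_set \<alpha> \<nn> N C1 C\<^sub>0.
         solves_eq A g f \<alpha> \<epsilon> (x \<epsilon>) \<and>
         (\<forall>t. complex_of_real (x \<epsilon> t) =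
              complex_of_real c + X \<epsilon> (complex_of_real t, complex_of_real (\<alpha> * t)))) \<and>
      (\<forall>\<xi>'. 0 < \<xi>' \<and> \<xi>' < \<xi> / 4 \<longrightarrow>
         (\<forall>\<epsilon>\<in>J_set \<alpha> \<nn> N C1 C\<^sub>0.
            analytic2_on (X \<epsilon>) (strip \<xi>') \<and> periodic2_on (X \<epsilon>) (strip \<xi>') \<and>
            uniform_limit (strip \<xi>') X (X \<epsilon>) (at \<epsilon> within J_set \<alpha> \<nn> N C1 C\<^sub>0)) \<and>
         uniform_limit (strip \<xi>') X (\<lambda>\<psi>. 0) (at 0 within J_set \<alpha> \<nn> N C1 C\<^sub>0)))"
    unfolding J_def[symmetric]
    by (intro exI[of _ N] exI[of _ Y] exI[of _ x] conjI allI impI ballI)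
       (simp_all only: J_def[symmetric] uniform_limit_on_subset[OF lim sub] uniform_limit_on_subset[OF zero sub])
qed

end
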